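(* Let $V$ be a double-well potential on the circle satisfying the standing assumptions on $V$, let $\xi_0\in\mathbb R$, and let $\mathfrak L_h=(hD_s+\xi_0)^2+V(s)$ on $L^2(\mathbb S^1)$, with first two eigenvalues $\lambda_1(h)\le\lambda_2(h)$ (counted with multiplicity). Assume in addition that $V$ is even, and set $$\kappa=\sqrt{\frac{V''(0)}{2}},\qquad S=\int_0^\pi\sqrt{V(\sigma)}\,d\sigma,\qquad A=\exp\left(-\int_{0}^{\pi/2}\frac{\partial_\sigma\sqrt V-\kappa}{\sqrt V}\,d\sigma\right).$$ Then, as $h\to0$, $$\lambda_2(h)-\lambda_1(h)=8h^{1/2}A\sqrt{V\left(\tfrac{\pi}{2}\right)}\sqrt{\frac{\kappa}{\pi}}\left|\cos\left(\frac{\xi_0\pi}{h}\right)\right|e^{-S/h}+h^{3/2}\,\mathcal O\big(e^{-S/h}\big).$$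
   Context: The circle $\mathbb S^1$ is parametrized by $s\mapsto e^{is}$ and functions on $\mathbb S^1$ are identified with $2\pi$-periodic functions of $s\in\mathbb R$. $D_s=-i\,\frac{d}{ds}$. The operator $\mathfrak L_h=(hD_s+\xi_0)^2+V(s)$, $h>0$, is the self-adjoint operator on $L^2(\mathbb S^1)$ with domain $H^2(\mathbb S^1)$. Standing assumptions on $V$: $V$ is a smooth real-valued function on $\mathbb S^1$ which admits exactly two minima, at $s=0$ and $s=\pi$ (mod $2\pi$); they are non-degenerate, $V(0)=V(\pi)=0$ (so $V>0$ elsewhere), and $V(\pi-s)=V(s)$ for all $s$. *)

theory Defs
  imports
    "HOL-Analysis.Analysis"
    "HOL-Library.Landau_Symbols"
    "HOL-Library.Extended_Nat"
    "HOL-Library.Periodic_Fun"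
begin

text \<open>
  Functions on the circle are \<open>2 * pi\<close>-periodic functions of a real variable. Elements of
  $L^2(S^1)$ are handled through representatives, so equality in $L^2(S^1)$ is equality almost
  everywhere.
\<close>

abbreviation circle_periodic :: "(real \<Rightarrow> 'a) \<Rightarrow> bool" where
  "circle_periodic f \<equiv> periodic_fun_simple f (2 * pi)"

definition smooth_real :: "(real \<Rightarrow> real) \<Rightarrow> bool" where
  "smooth_real f \<longleftrightarrow> (\<forall>n x. ((deriv ^^ n) f) differentiable (at x))"

definition L2_circle :: "(real \<Rightarrow> complex) set" where
  "L2_circle = {u. circle_periodic u \<and> u \<in> borel_measurable borel \<and>
     set_integrable lborel {0..2*pi} (\<lambda>s. (cmod (u s))\<^sup>2)}"

text \<open>
  Derivatives in the sense of distributions on the circle. Real-valued test functions suffice,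
  since the identity is complex linear in the test function.
\<close>

definition has_weak_deriv :: "(real \<Rightarrow> complex) \<Rightarrow> (real \<Rightarrow> complex) \<Rightarrow> bool" where
  "has_weak_deriv u v \<longleftrightarrow>
     (\<forall>\<phi>. smooth_real \<phi> \<and> circle_periodic \<phi> \<longrightarrow>
        (LINT s:{0..2*pi}|lborel. u s * of_real (deriv \<phi> s)) =
        - (LINT s:{0..2*pi}|lborel. v s * of_real (\<phi> s)))"

definition H2_circle :: "(real \<Rightarrow> complex) set" where
  "H2_circle = {u \<in> L2_circle. \<exists>v\<in>L2_circle. \<exists>w\<in>L2_circle.
     has_weak_deriv u v \<and> has_weak_deriv v w}"

text \<open>
  A representative of the weak derivative; it is unique up to null sets whenever it exists, and
  is only used where it exists.
\<close>

definition weak_deriv :: "(real \<Rightarrow> complex) \<Rightarrow> real \<Rightarrow> complex" where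
  "weak_deriv u = (SOME v. v \<in> L2_circle \<and> has_weak_deriv u v)"

definition D\<^sub>s :: "(real \<Rightarrow> complex) \<Rightarrow> real \<Rightarrow> complex" where
  "D\<^sub>s u = (\<lambda>s. - \<i> * weak_deriv u s)"

definition magnetic_momentum ::
    "real \<Rightarrow> real \<Rightarrow> (real \<Rightarrow> complex) \<Rightarrow> real \<Rightarrow> complex" where
  "magnetic_momentum \<xi>\<^sub>0 h u = (\<lambda>s. of_real h * D\<^sub>s u s + of_real \<xi>\<^sub>0 * u s)"

text \<open>The operator is to be read with domain \<^const>\<open>H2_circle\<close>.\<close>

definition magnetic_schrodinger ::
    "(real \<Rightarrow> real) \<Rightarrow> real \<Rightarrow> real \<Rightarrow> (real \<Rightarrow> complex) \<Rightarrow> real \<Rightarrow> complex" where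
  "magnetic_schrodinger V \<xi>\<^sub>0 h u =
     (\<lambda>s. magnetic_momentum \<xi>\<^sub>0 h (magnetic_momentum \<xi>\<^sub>0 h u) s + of_real (V s) * u s)"

text \<open>Linear independence of \<open>u 0, \<dots>, u (k - 1)\<close> over the complex numbers in $L^2(S^1)$.\<close>

definition L2_independent :: "nat \<Rightarrow> (nat \<Rightarrow> real \<Rightarrow> complex) \<Rightarrow> bool" where
  "L2_independent k u \<longleftrightarrow>
     (\<forall>c :: nat \<Rightarrow> complex. (AE s in lborel. (\<Sum>i<k. c i * u i s) = 0) \<longrightarrow> (\<forall>i<k. c i = 0))"

text \<open>
  Only real spectral parameters are considered below, the operators of interest being
  self-adjoint.
\<close>

definition eigenspace ::
    "(real \<Rightarrow> complex) set \<Rightarrow> ((real \<Rightarrow> complex) \<Rightarrow> real \<Rightarrow> complex) \<Rightarrow> real \<Rightarrow>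
     (real \<Rightarrow> complex) set" where
  "eigenspace Dom T \<mu> = {u \<in> Dom. AE s in lborel. T u s = of_real \<mu> * u s}"

text \<open>
  The dimension of the eigenspace as a subspace of $L^2(S^1)$; it is \<open>0\<close> exactly when \<open>\<mu>\<close> is not
  an eigenvalue.
\<close>

definition multiplicity_at ::
    "(real \<Rightarrow> complex) set \<Rightarrow> ((real \<Rightarrow> complex) \<Rightarrow> real \<Rightarrow> complex) \<Rightarrow> real \<Rightarrow> enat" where
  "multiplicity_at Dom T \<mu> =
     Sup {enat k | k. \<exists>u. (\<forall>i<k. u i \<in> eigenspace Dom T \<mu>) \<and> L2_independent k u}"

text \<open>
  The \<open>k\<close>-th eigenvalue (\<open>k \<ge> 1\<close>), in increasing order and counted with multiplicity: the least
  \<open>\<mu>\<close> such that the eigenvalues in \<open>{..\<mu>}\<close> have total multiplicity at least \<open>k\<close>.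
\<close>

definition nth_eigenvalue ::
    "(real \<Rightarrow> complex) set \<Rightarrow> ((real \<Rightarrow> complex) \<Rightarrow> real \<Rightarrow> complex) \<Rightarrow> nat \<Rightarrow> real" where
  "nth_eigenvalue Dom T k =
     (LEAST \<mu>. \<exists>F. finite F \<and> F \<subseteq> {..\<mu>} \<and> enat k \<le> (\<Sum>\<nu>\<in>F. multiplicity_at Dom T \<nu>))"

definition magnetic_eigenvalue :: "(real \<Rightarrow> real) \<Rightarrow> real \<Rightarrow> nat \<Rightarrow> real \<Rightarrow> real" where
  "magnetic_eigenvalue V \<xi>\<^sub>0 k h = nth_eigenvalue H2_circle (magnetic_schrodinger V \<xi>\<^sub>0 h) k"

text \<open>Minima are global minima over the circle.\<close>

definition double_well_potential :: "(real \<Rightarrow> real) \<Rightarrow> bool" where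
  "double_well_potential V \<longleftrightarrow>
     smooth_real V \<and> circle_periodic V \<and>
     {s \<in> {0..<2*pi}. \<forall>t. V s \<le> V t} = {0, pi} \<and>
     deriv (deriv V) 0 \<noteq> 0 \<and> deriv (deriv V) pi \<noteq> 0 \<and>
     V 0 = 0 \<and> V pi = 0 \<and>
     (\<forall>s. V (pi - s) = V s)"

end

theory Submission
  imports Defs "HOL-Probability.Distributions"
begin

text \<open>
  Multiplication by \<open>exp (i \<xi>\<^sub>0 s / h)\<close> removes the magnetic term: a \<open>2 * pi\<close>-periodic eigenfunction for the
  eigenvalue \<open>l\<close> becomes a solution of \<open>h\<^sup>2 f'' = (V - l) f\<close> that is multiplied by
  \<open>exp (2 * pi * i * \<xi>\<^sub>0 / h)\<close> along one turn. The reflections about \<open>0\<close> and about \<open>pi / 2\<close> make \<open>V\<close>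
  even and \<open>pi\<close>-periodic, so the monodromy along one turn is the square of the monodromy along half a
  turn, and the latter has trace \<open>2 * disc l\<close> with \<open>disc l = a b' + a' b\<close> evaluated at \<open>T = pi / 2\<close>; here
  \<open>a\<close> and \<open>b\<close> are the even and the odd solution with data \<open>(1, 0)\<close> and \<open>(0, 1)\<close> at \<open>0\<close>. Hence \<open>l\<close> is
  an eigenvalue if and only if \<open>disc l = c\<close> or \<open>disc l = - c\<close> with \<open>c = \<bar>cos (\<xi>\<^sub>0 * pi / h)\<bar>\<close>
  (\<open>multiplicity_off\<close>, \<open>multiplicity_on\<close>, \<open>multiplicity_double\<close>).

  Near the bottom of the well the even solution is close to the WKB function \<open>exp Y\<close>, where
  \<open>Y = - \<Phi> / h + B + h D\<close>, \<open>\<Phi>' = sqrt V\<close>, and \<open>B\<close>, \<open>D\<close> solve the first two transport equations. It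
  belongs to the approximate eigenvalue \<open>l0 = h * \<kappa> - h\<^sup>2 * n 0\<close> up to an error of order \<open>h\<^sup>3\<close>. Writing
  solutions as \<open>exp Y\<close> times an unknown turns Hill's equation into a first-order system with the weight
  \<open>P = exp (2 * Y)\<close> and a perturbation of order \<open>h\<close> (\<open>reduction\<close>), which is controlled by elementary
  integral estimates. They show that the discriminant exceeds \<open>1\<close> below a window of width of order
  \<open>h\<^sup>3\<close> about \<open>l0\<close>, is injective in the window while it lies in \<open>[-1, 1]\<close>, and is less than \<open>-1\<close> at its
  upper end. So the first two eigenvalues \<open>l1\<close>, \<open>l2\<close> are the solutions of \<open>disc l1 = c\<close> and
  \<open>disc l2 = - c\<close> in the window (\<open>first_two_eigenvalues\<close>).

  The difference \<open>l2 - l1\<close> is exponentially small, far below the accuracy with which either eigenvalue is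
  known, and is therefore computed from an exact formula. Green's identity for \<open>a\<close> at \<open>l1\<close>
  and at \<open>l2\<close>, combined with the values of the discriminant and the Wronskian, gives
  \<open>(l2 - l1) / h\<^sup>2 * J = c / (b' b)\<close> at \<open>T\<close>, with \<open>b'\<close> taken at \<open>l1\<close>, \<open>b\<close> at \<open>l2\<close>, and \<open>J\<close> the
  integral of the product of the two even solutions over \<open>[0, T]\<close> up to a small correction
  (\<open>gap_identity\<close>). Each factor is now needed only with relative error of order \<open>h\<close>. With
  \<open>\<beta> = sqrt (V T)\<close>, Laplace's method gives \<open>J \<sim> sqrt (pi * h / \<kappa>) / 2\<close>, \<open>exp (Y T) * b \<sim> h / (2 * \<beta>)\<close>
  and \<open>exp (Y T) * b' \<sim> 1 / 2\<close> (\<open>laplace_origin\<close>, \<open>laplace_end\<close>), and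
  \<open>exp (2 * Y T) \<sim> exp (- 2 * \<Phi> T / h) * exp (2 * B T)\<close>. Finally \<open>2 * \<Phi> T = S\<close> by
  symmetry and \<open>exp (2 * B T) = A\<close> by the first transport equation.
\<close>

section \<open>Smooth functions and division by powers of the variable\<close>

text \<open>
  Derivatives are given by existence, so that closure under products, quotients and parameter
  integrals follows by induction without formulas for iterated derivatives.
\<close>

primrec Ck_on :: "nat \<Rightarrow> real set \<Rightarrow> (real \<Rightarrow> real) \<Rightarrow> bool" where
  "Ck_on 0 U f = continuous_on U f"
| "Ck_on (Suc n) U f = (\<exists>f'. (\<forall>x\<in>U. (f has_real_derivative f' x) (at x)) \<and> Ck_on n U f')"

definition smooth_on_set :: "real set \<Rightarrow> (real \<Rightarrow> real) \<Rightarrow> bool" where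
  "smooth_on_set U f \<longleftrightarrow> (\<forall>n. Ck_on n U f)"

lemma Ck_on_cong:
  assumes "open U" "\<And>x. x \<in> U \<Longrightarrow> f x = g x" "Ck_on n U f"
  shows "Ck_on n U g"
proof (cases n)
  case 0
  then show ?thesis using assms by (simp cong: continuous_on_cong)
next
  case (Suc m)
  then obtain f' where f': "\<forall>x\<in>U. (f has_real_derivative f' x) (at x)" "Ck_on m U f'"
    using assms by auto
  have "(g has_real_derivative f' x) (at x)" if "x \<in> U" for x
    using has_field_derivative_transform_within_open[of f "f' x" x U g] f' assms that by auto
  then show ?thesis using f' Suc by auto
qed

lemma Ck_on_Suc_imp: "Ck_on (Suc n) U f \<Longrightarrow> Ck_on n U f"
proof (induction n arbitrary: f)
  case 0
  then show ?case
    by (auto intro!: continuous_at_imp_continuous_on intro: DERIV_isCont)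
next
  case (Suc n)
  then obtain f' where f': "\<forall>x\<in>U. (f has_real_derivative f' x) (at x)" "Ck_on (Suc n) U f'"
    unfolding Ck_on.simps(2)[of "Suc n"] by blast
  show ?case unfolding Ck_on.simps(2)[of n] using f'(1) Suc.IH[OF f'(2)] by blast
qed

lemma Ck_on_imp_continuous: "Ck_on n U f \<Longrightarrow> continuous_on U f"
proof (induction n)
  case (Suc n)
  show ?case by (rule Suc.IH[OF Ck_on_Suc_imp[OF Suc.prems]])
qed simp

lemma Ck_on_SucI:
  "(\<And>x. x \<in> U \<Longrightarrow> (f has_real_derivative f' x) (at x)) \<Longrightarrow> Ck_on n U f' \<Longrightarrow> Ck_on (Suc n) U f"
  unfolding Ck_on.simps by blast

lemma Ck_on_const: "Ck_on n U (\<lambda>x. c)"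
proof (induction n arbitrary: c)
  case (Suc n)
  show ?case by (rule Ck_on_SucI[where f' = "\<lambda>x. 0"]) (auto simp: Suc)
qed simp

lemma Ck_on_ident: "Ck_on n U (\<lambda>x. x)"
proof (cases n)
  case (Suc m)
  show ?thesis unfolding Suc by (rule Ck_on_SucI[where f' = "\<lambda>x. 1"]) (auto intro: Ck_on_const)
qed simp

lemma Ck_on_add: "Ck_on n U f \<Longrightarrow> Ck_on n U g \<Longrightarrow> Ck_on n U (\<lambda>x. f x + g x)"
proof (induction n arbitrary: f g)
  case (Suc n)
  then obtain f' g' where "\<forall>x\<in>U. (f has_real_derivative f' x) (at x)" "Ck_on n U f'"
    "\<forall>x\<in>U. (g has_real_derivative g' x) (at x)" "Ck_on n U g'" by auto
  then show ?case
    by (intro Ck_on_SucI[where f' = "\<lambda>x. f' x + g' x"] Suc.IH DERIV_add) auto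
qed (simp add: continuous_on_add)

lemma Ck_on_mult: "Ck_on n U f \<Longrightarrow> Ck_on n U g \<Longrightarrow> Ck_on n U (\<lambda>x. f x * g x)"
proof (induction n arbitrary: f g)
  case (Suc n)
  note S = Suc
  from Suc obtain f' g' where *: "\<forall>x\<in>U. (f has_real_derivative f' x) (at x)" "Ck_on n U f'"
    "\<forall>x\<in>U. (g has_real_derivative g' x) (at x)" "Ck_on n U g'" by auto
  have "Ck_on n U f" "Ck_on n U g" using S(2,3) by (blast intro: Ck_on_Suc_imp)+
  then have "Ck_on n U (\<lambda>x. f' x * g x + g' x * f x)"
    using * by (intro Ck_on_add Suc.IH) auto
  then show ?case using *
    by (intro Ck_on_SucI[where f' = "\<lambda>x. f' x * g x + g' x * f x"] DERIV_mult) auto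
qed (simp add: continuous_on_mult)

lemma Ck_on_inverse:
  "Ck_on n U f \<Longrightarrow> (\<And>x. x \<in> U \<Longrightarrow> f x \<noteq> 0) \<Longrightarrow> Ck_on n U (\<lambda>x. inverse (f x))"
proof (induction n)
  case (Suc n)
  then obtain f' where *: "\<forall>x\<in>U. (f has_real_derivative f' x) (at x)" "Ck_on n U f'" by auto
  have "Ck_on n U (\<lambda>x. inverse (f x))" using Suc Ck_on_Suc_imp by blast
  then have "Ck_on n U (\<lambda>x. (-1) * (f' x * (inverse (f x) * inverse (f x))))"
    using * by (intro Ck_on_mult Ck_on_const) auto
  moreover have "((\<lambda>x. inverse (f x)) has_real_derivative
      (-1) * (f' x * (inverse (f x) * inverse (f x)))) (at x)" if "x \<in> U" for x
    using * Suc.prems(2)[OF that] that by (auto intro!: derivative_eq_intros)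
  ultimately show ?case by (rule Ck_on_SucI[rotated])
qed (simp add: continuous_on_inverse)

lemma Ck_on_sqrt:
  "Ck_on n U f \<Longrightarrow> (\<And>x. x \<in> U \<Longrightarrow> f x > 0) \<Longrightarrow> Ck_on n U (\<lambda>x. sqrt (f x))"
proof (induction n)
  case (Suc n)
  then obtain f' where *: "\<forall>x\<in>U. (f has_real_derivative f' x) (at x)" "Ck_on n U f'" by auto
  have "Ck_on n U (\<lambda>x. sqrt (f x))" using Suc Ck_on_Suc_imp by blast
  then have "Ck_on n U (\<lambda>x. (1/2) * (f' x * inverse (sqrt (f x))))"
    using * Suc.prems(2) by (intro Ck_on_mult Ck_on_const Ck_on_inverse) force+
  moreover have "((\<lambda>x. sqrt (f x)) has_real_derivative (1/2) * (f' x * inverse (sqrt (f x)))) (at x)"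
    if "x \<in> U" for x
    using * Suc.prems(2)[OF that] that
    by (auto intro!: derivative_eq_intros simp: divide_simps)
  ultimately show ?case by (rule Ck_on_SucI[rotated])
qed (simp add: continuous_on_real_sqrt)

lemma smooth_on_set_deriv:
  assumes "smooth_on_set U f" "open U"
  obtains f' where "smooth_on_set U f'" "\<And>x. x \<in> U \<Longrightarrow> (f has_real_derivative f' x) (at x)"
proof -
  have "Ck_on (Suc 0) U f" using assms by (simp add: smooth_on_set_def del: Ck_on.simps)
  then obtain f' where f': "\<And>x. x \<in> U \<Longrightarrow> (f has_real_derivative f' x) (at x)" by auto
  have "Ck_on n U f'" for n
  proof -
    have "Ck_on (Suc n) U f" using assms by (simp add: smooth_on_set_def del: Ck_on.simps)
    then obtain d where d: "\<forall>x\<in>U. (f has_real_derivative d x) (at x)" "Ck_on n U d" by auto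
    then have "d x = f' x" if "x \<in> U" for x
      using DERIV_unique[of f "d x" x "f' x"] f' that by blast
    then show ?thesis using Ck_on_cong[OF assms(2) _ d(2)] by blast
  qed
  then show ?thesis using that f' unfolding smooth_on_set_def by blast
qed

lemma smooth_real_imp_Ck: "smooth_real f \<Longrightarrow> Ck_on n UNIV f"
proof (induction n arbitrary: f)
  case 0
  have "f differentiable (at x)" for x
    using 0 unfolding smooth_real_def by (metis funpow_0)
  then show ?case
    by (simp add: continuous_at_imp_continuous_on differentiable_imp_continuous_within)
next
  case (Suc n)
  have "smooth_real (deriv f)"
    using Suc.prems unfolding smooth_real_def by (metis funpow_Suc_right comp_apply)
  then have "Ck_on n UNIV (deriv f)" by (rule Suc.IH)
  moreover have "f differentiable (at x)" for x
    using Suc.prems unfolding smooth_real_def by (metis funpow_0)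
  ultimately show ?case
    by (auto simp: DERIV_deriv_iff_real_differentiable intro!: exI[of _ "deriv f"])
qed

lemma Ck_imp_smooth_real:
  assumes "\<And>n. Ck_on n UNIV f"
  shows "smooth_real f"
proof -
  have D: "f differentiable (at x)" "Ck_on n UNIV (deriv f)" if ck: "\<And>n. Ck_on n UNIV f" for f n x
  proof -
    obtain f' where f': "\<forall>x. (f has_real_derivative f' x) (at x)" "Ck_on n UNIV f'"
      using ck[of "Suc n"] by auto
    then show "f differentiable (at x)" by (auto simp: real_differentiable_def)
    have "deriv f = f'" using f' by (auto simp: DERIV_imp_deriv)
    then show "Ck_on n UNIV (deriv f)" using f' by simp
  qed
  have "Ck_on n UNIV ((deriv ^^ k) f)" for k n
  proof (induction k arbitrary: n)
    case 0 then show ?case using assms by simp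
  next
    case (Suc k) then show ?case using D(2)[of "(deriv ^^ k) f"] by simp
  qed
  then show ?thesis unfolding smooth_real_def using D(1) by blast
qed

text \<open>
  Each differentiation under the integral sign produces another factor \<open>t\<close>; the power \<open>t ^ j\<close> makes the
  induction on \<open>n\<close> possible.
\<close>

lemma Ck_on_integral_scaled:
  fixes c :: real
  assumes "Ck_on n {-c<..<c} F"
  shows "Ck_on n {-c<..<c} (\<lambda>x. integral {0..1} (\<lambda>t. t ^ j * F (t * x)))"
proof -
  let ?U = "{-c<..<c}"
  have in_U: "t * x \<in> ?U" if "x \<in> ?U" "t \<in> {0..1}" for x t :: real
  proof -
    have "\<bar>t * x\<bar> \<le> 1 * \<bar>x\<bar>" using that unfolding abs_mult by (intro mult_right_mono) auto
    then show ?thesis using that by auto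
  qed
  have cont: "continuous_on (?U \<times> {0..1}) (\<lambda>(x,t). t ^ j * G (t * x))"
    if "continuous_on ?U G" for G j
    unfolding split_beta
    by (intro continuous_intros continuous_on_compose2[OF that]) (use in_U in auto)
  show ?thesis using assms
  proof (induction n arbitrary: F j)
    case 0
    then show ?case
      using integral_continuous_on_param[of ?U 0 1 "\<lambda>x t. t ^ j * F (t * x)"] cont by simp
  next
    case (Suc n)
    then obtain F' where F': "\<And>x. x \<in> ?U \<Longrightarrow> (F has_real_derivative F' x) (at x)" "Ck_on n ?U F'"
      unfolding Ck_on.simps by blast
    have cF: "continuous_on ?U F"
      using F'(1) by (intro DERIV_continuous_on) (auto intro: has_field_derivative_at_within)
    have cF': "continuous_on ?U F'"
      by (rule Ck_on_imp_continuous[OF F'(2)])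
    have "((\<lambda>x. integral {0..1} (\<lambda>t. t ^ j * F (t * x))) has_real_derivative
         integral {0..1} (\<lambda>t. t ^ (Suc j) * F' (t * x))) (at x)" if x: "x \<in> ?U" for x
    proof -
      have "((\<lambda>x. integral (cbox 0 1) (\<lambda>t. t ^ j * F (t * x))) has_real_derivative
         integral (cbox 0 1) (\<lambda>t. t ^ (Suc j) * F' (t * x))) (at x within ?U)"
      proof (rule leibniz_rule_field_derivative)
        fix x t :: real assume "x \<in> ?U" "t \<in> cbox 0 1"
        then have "t * x \<in> ?U" using in_U by auto
        then have "((\<lambda>x. F (t * x)) has_real_derivative F' (t * x) * t) (at x within ?U)"
          by (intro DERIV_chain'[where g = F and f = "\<lambda>x. t * x"] F'(1) DERIV_cmult_Id)
        from DERIV_cmult[OF this, of "t ^ j"]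
        show "((\<lambda>x. t ^ j * F (t * x)) has_real_derivative t ^ Suc j * F' (t * x)) (at x within ?U)"
          by (simp add: mult_ac)
      next
        fix x assume "x \<in> ?U"
        then have "continuous_on {0..1} (\<lambda>t. t ^ j * F (t * x))"
          by (intro continuous_intros continuous_on_compose2[OF cF]) (use in_U in auto)
        then show "(\<lambda>t. t ^ j * F (t * x)) integrable_on cbox 0 1"
          by (simp add: integrable_continuous_real)
      qed (use cont[OF cF', of "Suc j"] x in auto)
      then show ?thesis using x by (simp add: at_within_open[of x ?U])
    qed
    then show ?case by (rule Ck_on_SucI[OF _ Suc.IH[OF F'(2), of "Suc j"]])
  qed
qed

text \<open>
  Hadamard's lemma: \<open>F x\<close> is the integral of \<open>x * F' (t * x)\<close> over \<open>t\<close> in \<open>[0, 1]\<close>.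
\<close>

lemma hadamard_factor:
  assumes F: "smooth_on_set {-c<..<c} F" and "F 0 = 0"
  obtains G where "smooth_on_set {-c<..<c} G" "\<And>x. x \<in> {-c<..<c} \<Longrightarrow> F x = x * G x"
proof -
  let ?U = "{-c<..<c}"
  obtain F' where F': "smooth_on_set ?U F'" "\<And>x. x \<in> ?U \<Longrightarrow> (F has_real_derivative F' x) (at x)"
    using smooth_on_set_deriv[OF F] by (metis open_greaterThanLessThan)
  let ?G = "\<lambda>x. integral {0..1} (\<lambda>t. t ^ 0 * F' (t * x))"
  have "smooth_on_set ?U ?G"
    using F' Ck_on_integral_scaled[of _ c F' 0] by (simp add: smooth_on_set_def)
  moreover have "F x = x * ?G x" if x: "x \<in> ?U" for x
  proof -
    have in_U: "t * x \<in> ?U" if "t \<in> {0..1}" for t :: real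
    proof -
      have "\<bar>t * x\<bar> \<le> 1 * \<bar>x\<bar>" using that unfolding abs_mult by (intro mult_right_mono) auto
      then show ?thesis using x by auto
    qed
    have "((\<lambda>t. F' (t * x) * x) has_integral F (1 * x) - F (0 * x)) {0..1}"
    proof (rule fundamental_theorem_of_calculus)
      fix t :: real assume "t \<in> {0..1}"
      then have "((\<lambda>t. F (t * x)) has_real_derivative F' (t * x) * x) (at t within {0..1})"
        using in_U by (intro DERIV_chain'[where g = F and f = "\<lambda>t. t * x"] F'(2) DERIV_cmult_right[of "\<lambda>x. x" 1, simplified]) auto
      then show "((\<lambda>t. F (t * x)) has_vector_derivative F' (t * x) * x) (at t within {0..1})"
        by (simp add: has_real_derivative_iff_has_vector_derivative)
    qed simp
    from integral_unique[OF this] have "integral {0..1} (\<lambda>t. F' (t * x)) * x = F x"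
      using assms(2) by simp
    then show ?thesis by (simp add: mult.commute)
  qed
  ultimately show ?thesis by (rule that)
qed

lemma even_deriv_zero:
  assumes "(F has_real_derivative d) (at 0)" "c > 0" "\<And>x. \<bar>x\<bar> < c \<Longrightarrow> F (- x) = F x"
  shows "d = 0"
proof -
  have "((\<lambda>x. F (- x)) has_real_derivative - d) (at 0)"
    using DERIV_mirror[of F d 0] assms(1) by simp
  moreover have "((\<lambda>x. F (- x)) has_real_derivative d) (at 0)"
    by (rule has_field_derivative_transform_within_open[of F d 0 "{-c<..<c}"]) (use assms in auto)
  ultimately have "- d = d" by (rule DERIV_unique)
  then show ?thesis by simp
qed

text \<open>
  The first Hadamard quotient of an even function takes the value \<open>F' 0 = 0\<close> at \<open>0\<close>, so it can be divided by
  \<open>x\<close> once more.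
\<close>

lemma even_hadamard_factor:
  assumes F: "smooth_on_set {-c<..<c} F" and "c > 0" "F 0 = 0"
    and ev: "\<And>x. \<bar>x\<bar> < c \<Longrightarrow> F (- x) = F x"
  obtains G where "smooth_on_set {-c<..<c} G" "\<And>x. x \<in> {-c<..<c} \<Longrightarrow> F x = x\<^sup>2 * G x"
    "\<And>x. \<bar>x\<bar> < c \<Longrightarrow> G (- x) = G x"
proof -
  let ?U = "{-c<..<c}"
  obtain G1 where G1: "smooth_on_set ?U G1" "\<And>x. x \<in> ?U \<Longrightarrow> F x = x * G1 x"
    using hadamard_factor[OF F \<open>F 0 = 0\<close>] by blast
  obtain G1' where G1': "\<And>x. x \<in> ?U \<Longrightarrow> (G1 has_real_derivative G1' x) (at x)"
    using smooth_on_set_deriv[OF G1(1)] by (metis open_greaterThanLessThan)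
  have "((\<lambda>x. x * G1 x) has_real_derivative G1 0) (at 0)"
    using G1'[of 0] \<open>c > 0\<close> by (auto intro!: derivative_eq_intros)
  then have "(F has_real_derivative G1 0) (at 0)"
    by (rule has_field_derivative_transform_within_open[of "\<lambda>x. x * G1 x" _ 0 ?U F])
      (use G1(2) \<open>c > 0\<close> in auto)
  then have "G1 0 = 0" using even_deriv_zero[of F "G1 0" c] \<open>c > 0\<close> ev by blast
  then obtain G where G: "smooth_on_set ?U G" "\<And>x. x \<in> ?U \<Longrightarrow> G1 x = x * G x"
    using hadamard_factor[OF G1(1)] by blast
  have FG: "F x = x\<^sup>2 * G x" if "x \<in> ?U" for x
    using G(2)[OF that] G1(2)[OF that] by (simp add: power2_eq_square)
  show ?thesis
  proof (rule that[OF G(1) FG])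
    fix x :: real assume x: "\<bar>x\<bar> < c"
    then have "x\<^sup>2 * G (- x) = x\<^sup>2 * G x"
      using FG[of x] FG[of "- x"] ev[OF x] by (auto simp: abs_less_iff)
    then show "G (- x) = G x" by (cases "x = 0") auto
  qed
qed

lemma smooth_on_set_const: "smooth_on_set U (\<lambda>x. c)"
  by (simp add: smooth_on_set_def Ck_on_const)

lemma smooth_on_set_ident: "smooth_on_set U (\<lambda>x. x)"
  by (simp add: smooth_on_set_def Ck_on_ident)

lemma smooth_on_set_add:
  "smooth_on_set U f \<Longrightarrow> smooth_on_set U g \<Longrightarrow> smooth_on_set U (\<lambda>x. f x + g x)"
  by (simp add: smooth_on_set_def Ck_on_add)

lemma smooth_on_set_mult:
  "smooth_on_set U f \<Longrightarrow> smooth_on_set U g \<Longrightarrow> smooth_on_set U (\<lambda>x. f x * g x)"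
  by (simp add: smooth_on_set_def Ck_on_mult)

lemma smooth_on_set_inverse:
  "smooth_on_set U f \<Longrightarrow> (\<And>x. x \<in> U \<Longrightarrow> f x \<noteq> 0) \<Longrightarrow> smooth_on_set U (\<lambda>x. inverse (f x))"
  by (simp add: smooth_on_set_def Ck_on_inverse)

lemma smooth_on_set_sqrt:
  "smooth_on_set U f \<Longrightarrow> (\<And>x. x \<in> U \<Longrightarrow> f x > 0) \<Longrightarrow> smooth_on_set U (\<lambda>x. sqrt (f x))"
  by (simp add: smooth_on_set_def Ck_on_sqrt)

lemma smooth_on_set_continuous:
  assumes "smooth_on_set U f"
  shows "continuous_on U f"
proof -
  have "Ck_on 0 U f" using assms unfolding smooth_on_set_def by simp
  then show ?thesis by simp
qed

section \<open>The WKB coefficients of a double well\<close>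

lemma even_imp_odd_deriv:
  assumes "\<And>x. \<bar>x\<bar> < c \<Longrightarrow> (F has_real_derivative F' x) (at x)"
    and "\<And>x. \<bar>x\<bar> < c \<Longrightarrow> F (- x) = F x" "\<bar>x\<bar> < c"
  shows "F' (- x) = - F' x"
proof -
  have "(F has_real_derivative F' (- x)) (at (- x))" using assms by simp
  then have "((\<lambda>x. F (- x)) has_real_derivative - F' (- x)) (at x)"
    using DERIV_mirror[of F "F' (- x)" x] by simp
  moreover have "((\<lambda>x. F (- x)) has_real_derivative F' x) (at x)"
    by (rule has_field_derivative_transform_within_open[of F _ x "{-c<..<c}"])
      (use assms in auto)
  ultimately have "- F' (- x) = F' x" by (rule DERIV_unique)
  then show ?thesis by simp
qed

lemma double_well_nonneg: "double_well_potential V \<Longrightarrow> 0 \<le> V t"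
proof -
  assume V: "double_well_potential V"
  then have "0 \<in> {s \<in> {0..<2*pi}. \<forall>t. V s \<le> V t}" unfolding double_well_potential_def by blast
  then have "V 0 \<le> V t" by blast
  then show ?thesis using V unfolding double_well_potential_def by simp
qed

lemma double_well_pos:
  assumes V: "double_well_potential V" and ev: "\<And>s. V (- s) = V s"
    and s: "0 < \<bar>s\<bar>" "\<bar>s\<bar> < pi"
  shows "0 < V s"
proof -
  have "\<bar>s\<bar> \<notin> {s \<in> {0..<2*pi}. \<forall>t. V s \<le> V t}"
    using V s unfolding double_well_potential_def by (metis insert_iff less_irrefl singletonD)
  then obtain t where "\<not> V \<bar>s\<bar> \<le> V t" using s by auto
  then have "0 < V \<bar>s\<bar>" using double_well_nonneg[OF V, of t] by simp
  moreover have "V \<bar>s\<bar> = V s" using ev[of s] by (cases "s < 0") auto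
  ultimately show ?thesis by simp
qed

text \<open>
  The translation by \<open>pi\<close> is the composition of the reflections about \<open>0\<close> and \<open>pi / 2\<close>.
\<close>

lemma double_well_periodic_pi:
  assumes V: "double_well_potential V" and ev: "\<And>s. V (- s) = V s"
  shows "V (s + pi) = V s"
proof -
  have "V (pi - (- s)) = V (- s)" using V unfolding double_well_potential_def by blast
  then show ?thesis by (simp add: ev add.commute)
qed

text \<open>
  Away from \<open>0\<close> the quotient is positive because the potential vanishes only at the two wells; at \<open>0\<close> it is
  nonnegative by continuity and nonzero by non-degeneracy.
\<close>

lemma double_well_factor:
  assumes V: "double_well_potential V" and ev: "\<And>s. V (- s) = V s"
  obtains k where "smooth_on_set {-pi<..<pi} k" "\<And>x. x \<in> {-pi<..<pi} \<Longrightarrow> V x = x\<^sup>2 * k x"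
    "\<And>x. x \<in> {-pi<..<pi} \<Longrightarrow> k x > 0" "\<And>x. \<bar>x\<bar> < pi \<Longrightarrow> k (- x) = k x"
    "k 0 = deriv (deriv V) 0 / 2"
proof -
  let ?U = "{-pi<..<pi}"
  have sm: "smooth_real V" and V0: "V 0 = 0" and V2: "deriv (deriv V) 0 \<noteq> 0"
    using V unfolding double_well_potential_def by blast+
  have "Ck_on n ?U V" for n
  proof -
    have "Ck_on n UNIV V" using smooth_real_imp_Ck[OF sm] .
    then show ?thesis
    proof (induction n arbitrary: V)
      case 0 then show ?case using continuous_on_subset by auto
    next
      case (Suc n)
      then obtain f' where f': "\<forall>x\<in>UNIV. (V has_real_derivative f' x) (at x)" "Ck_on n UNIV f'"
        unfolding Ck_on.simps by blast
      show ?case by (rule Ck_on_SucI[OF _ Suc.IH[OF f'(2)]]) (use f'(1) in auto)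
    qed
  qed
  then have "smooth_on_set ?U V" by (simp add: smooth_on_set_def)
  then obtain k where k: "smooth_on_set ?U k" "\<And>x. x \<in> ?U \<Longrightarrow> V x = x\<^sup>2 * k x"
    "\<And>x. \<bar>x\<bar> < pi \<Longrightarrow> k (- x) = k x"
    using even_hadamard_factor[OF _ pi_gt_zero V0 ev] by blast
  obtain k1 where k1: "smooth_on_set ?U k1" "\<And>x. x \<in> ?U \<Longrightarrow> (k has_real_derivative k1 x) (at x)"
    using smooth_on_set_deriv[OF k(1)] by (metis open_greaterThanLessThan)
  obtain k2 where k2: "\<And>x. x \<in> ?U \<Longrightarrow> (k1 has_real_derivative k2 x) (at x)"
    using smooth_on_set_deriv[OF k1(1)] by (metis open_greaterThanLessThan)
  have d1: "deriv V x = 2 * x * k x + x\<^sup>2 * k1 x" if x: "x \<in> ?U" for x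
  proof -
    have "((\<lambda>x. x\<^sup>2 * k x) has_real_derivative 2 * x * k x + x\<^sup>2 * k1 x) (at x)"
      using k1(2)[OF x] by (auto intro!: derivative_eq_intros)
    then have "(V has_real_derivative 2 * x * k x + x\<^sup>2 * k1 x) (at x)"
      by (rule has_field_derivative_transform_within_open[of _ _ x ?U]) (use k(2) x in auto)
    then show ?thesis by (rule DERIV_imp_deriv)
  qed
  have "((\<lambda>x. 2 * x * k x + x\<^sup>2 * k1 x) has_real_derivative 2 * k 0) (at 0)"
    using k1(2)[of 0] k2[of 0] by (auto intro!: derivative_eq_intros)
  then have "(deriv V has_real_derivative 2 * k 0) (at 0)"
    by (rule has_field_derivative_transform_within_open[of _ _ 0 ?U]) (use d1 in auto)
  then have k0: "deriv (deriv V) 0 = 2 * k 0" by (rule DERIV_imp_deriv)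
  have pos: "k x > 0" if "x \<in> ?U" "x \<noteq> 0" for x
    using double_well_pos[OF V ev, of x] k(2)[of x] that
    by (auto simp: zero_less_mult_iff)
  have "0 \<le> k 0"
  proof (rule ccontr)
    assume "\<not> 0 \<le> k 0"
    moreover have "isCont k 0" using k1(2)[of 0] DERIV_isCont by auto
    ultimately have "eventually (\<lambda>x. k x < 0) (at 0)"
      by (intro order_tendstoD(2)[of k "k 0"]) (auto simp: isCont_def)
    moreover have "eventually (\<lambda>x. x \<in> ?U - {0}) (at 0)"
      by (rule eventually_at_in_open) auto
    ultimately have "eventually (\<lambda>x. False) (at (0::real))"
      by eventually_elim (use pos in force)
    then show False by simp
  qed
  then have "k x > 0" if "x \<in> ?U" for x using pos[OF that] k0 V2 by (cases "x = 0") auto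
  then show ?thesis using that[of k] k k0 by auto
qed

text \<open>
  With \<open>Y' x = x * (- g x / h + n x + h * p x)\<close>, the function \<open>exp Y\<close> solves
  \<open>h\<^sup>2 u'' = (V - (h * \<kappa> - h\<^sup>2 * n 0)) u\<close> up to order \<open>h\<^sup>3\<close>: the order \<open>0\<close> is \<open>V x = x\<^sup>2 * (g x)\<^sup>2\<close>,
  and the orders \<open>1\<close> and \<open>2\<close> are the last two identities, the transport equations. Both are solved by
  division by \<open>x\<^sup>2 * g x\<close>, which is possible because \<open>g - \<kappa>\<close> and \<open>n - n 0\<close> are even and vanish at \<open>0\<close>.
\<close>

lemma wkb_functions:
  assumes V: "double_well_potential V" and ev: "\<And>s. V (- s) = V s"
    and \<kappa>: "\<kappa> = sqrt (deriv (deriv V) 0 / 2)"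
  obtains g g' m n n' p p' where
    "\<And>x. x \<in> {-pi<..<pi} \<Longrightarrow> (g has_real_derivative g' x) (at x)"
    "\<And>x. x \<in> {-pi<..<pi} \<Longrightarrow> (n has_real_derivative n' x) (at x)"
    "\<And>x. x \<in> {-pi<..<pi} \<Longrightarrow> (p has_real_derivative p' x) (at x)"
    "continuous_on {-pi<..<pi} g'" "continuous_on {-pi<..<pi} p'" "continuous_on {-pi<..<pi} m"
    "\<And>x. x \<in> {-pi<..<pi} \<Longrightarrow> V x = x\<^sup>2 * (g x)\<^sup>2"
    "\<And>x. x \<in> {-pi<..<pi} \<Longrightarrow> g x > 0"
    "\<And>x. x \<in> {-pi<..<pi} \<Longrightarrow> g x = \<kappa> + x\<^sup>2 * m x"
    "\<And>x. x \<in> {-pi<..<pi} \<Longrightarrow> g x + x * g' x - \<kappa> = - 2 * x\<^sup>2 * g x * n x"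
    "\<And>x. x \<in> {-pi<..<pi} \<Longrightarrow> n x + x * n' x + x\<^sup>2 * (n x)\<^sup>2 - n 0 = 2 * x\<^sup>2 * g x * p x"
proof -
  let ?U = "{-pi<..<pi}"
  note smi = smooth_on_set_const smooth_on_set_ident smooth_on_set_add smooth_on_set_mult
  have op: "open ?U" by simp
  obtain k where k: "smooth_on_set ?U k" "\<And>x. x \<in> ?U \<Longrightarrow> V x = x\<^sup>2 * k x"
    "\<And>x. x \<in> ?U \<Longrightarrow> k x > 0" "\<And>x. \<bar>x\<bar> < pi \<Longrightarrow> k (- x) = k x"
    "k 0 = deriv (deriv V) 0 / 2"
    using double_well_factor[OF V ev] by blast
  define g where "g = (\<lambda>x. sqrt (k x))"
  have g: "smooth_on_set ?U g" unfolding g_def by (rule smooth_on_set_sqrt[OF k(1) k(3)])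
  have gpos: "g x > 0" if "x \<in> ?U" for x using k(3)[OF that] by (simp add: g_def)
  have g0: "g 0 = \<kappa>" by (simp add: g_def \<kappa> k(5))
  have g_even: "g (- x) = g x" if "\<bar>x\<bar> < pi" for x using k(4)[OF that] by (simp add: g_def)
  have gV: "V x = x\<^sup>2 * (g x)\<^sup>2" if "x \<in> ?U" for x
    using k(2,3)[OF that] by (simp add: g_def)
  obtain g' where g': "smooth_on_set ?U g'" "\<And>x. x \<in> ?U \<Longrightarrow> (g has_real_derivative g' x) (at x)"
    using smooth_on_set_deriv[OF g op] by blast
  have "smooth_on_set ?U (\<lambda>x. g x + (- \<kappa>))" by (intro smi g)
  then obtain m where m: "smooth_on_set ?U m" "\<And>x. x \<in> ?U \<Longrightarrow> g x + (- \<kappa>) = x\<^sup>2 * m x"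
    "\<And>x. \<bar>x\<bar> < pi \<Longrightarrow> m (- x) = m x"
    using even_hadamard_factor[of pi "\<lambda>x. g x + (- \<kappa>)"] g_even g0 by auto
  obtain m' where m': "smooth_on_set ?U m'" "\<And>x. x \<in> ?U \<Longrightarrow> (m has_real_derivative m' x) (at x)"
    using smooth_on_set_deriv[OF m(1) op] by blast
  have m'_odd: "m' (- x) = - m' x" if "\<bar>x\<bar> < pi" for x
    by (rule even_imp_odd_deriv[of pi m m' x]) (use m'(2) m(3) that in \<open>auto simp: abs_less_iff\<close>)
  have gm: "g x = \<kappa> + x\<^sup>2 * m x" if "x \<in> ?U" for x using m(2)[OF that] by simp
  have g'm: "g' x = 2 * x * m x + x\<^sup>2 * m' x" if x: "x \<in> ?U" for x
  proof -
    have "((\<lambda>x. \<kappa> + x\<^sup>2 * m x) has_real_derivative 2 * x * m x + x\<^sup>2 * m' x) (at x)"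
      using m'(2)[OF x] by (auto intro!: derivative_eq_intros)
    then have "(g has_real_derivative 2 * x * m x + x\<^sup>2 * m' x) (at x)"
      by (rule has_field_derivative_transform_within_open[of _ _ x ?U]) (use gm[symmetric] x in auto)
    then show ?thesis using g'(2)[OF x] DERIV_unique by blast
  qed
  \<comment> \<open>Solves the first transport equation, since \<open>g + x * g' - \<kappa> = x\<^sup>2 * (3 * m + x * m')\<close>.\<close>
  define n where "n = (\<lambda>x. (- 1 / 2) * ((3 * m x + x * m' x) * inverse (g x)))"
  have gne: "g x \<noteq> 0" if "x \<in> ?U" for x using gpos[OF that] by simp
  have n: "smooth_on_set ?U n" unfolding n_def
    by (intro smi smooth_on_set_inverse g m m') (use gne in auto)
  have n_even: "n (- x) = n x" if "\<bar>x\<bar> < pi" for x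
    using m(3)[OF that] m'_odd[OF that] g_even[OF that] by (simp add: n_def)
  obtain n' where n': "smooth_on_set ?U n'" "\<And>x. x \<in> ?U \<Longrightarrow> (n has_real_derivative n' x) (at x)"
    using smooth_on_set_deriv[OF n op] by blast
  have sn: "smooth_on_set ?U (\<lambda>x. n x + (- n 0))" by (intro smi n)
  have en: "n (- x) + (- n 0) = n x + (- n 0)" if "\<bar>x\<bar> < pi" for x using n_even[OF that] by simp
  have zn: "n 0 + (- n 0) = 0" by simp
  obtain r where r: "smooth_on_set ?U r" "\<And>x. x \<in> ?U \<Longrightarrow> n x + (- n 0) = x\<^sup>2 * r x"
    "\<And>x. \<bar>x\<bar> < pi \<Longrightarrow> r (- x) = r x"
    by (rule even_hadamard_factor[OF sn pi_gt_zero zn en], assumption) (rule that)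
  obtain r' where r': "smooth_on_set ?U r'" "\<And>x. x \<in> ?U \<Longrightarrow> (r has_real_derivative r' x) (at x)"
    using smooth_on_set_deriv[OF r(1) op] by blast
  have nr: "n x = n 0 + x\<^sup>2 * r x" if "x \<in> ?U" for x using r(2)[OF that] by simp
  have n'r: "n' x = 2 * x * r x + x\<^sup>2 * r' x" if x: "x \<in> ?U" for x
  proof -
    have "((\<lambda>x. n 0 + x\<^sup>2 * r x) has_real_derivative 2 * x * r x + x\<^sup>2 * r' x) (at x)"
      using r'(2)[OF x] by (auto intro!: derivative_eq_intros)
    then have "(n has_real_derivative 2 * x * r x + x\<^sup>2 * r' x) (at x)"
      by (rule has_field_derivative_transform_within_open[of _ _ x ?U]) (use nr[symmetric] x in auto)
    then show ?thesis using n'(2)[OF x] DERIV_unique by blast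
  qed
  \<comment> \<open>Solves the second one, since \<open>n + x * n' - n 0 = x\<^sup>2 * (3 * r + x * r')\<close>.\<close>
  define p where "p = (\<lambda>x. (1 / 2) * ((3 * r x + (x * r' x + n x * n x)) * inverse (g x)))"
  have p: "smooth_on_set ?U p" unfolding p_def
    by (intro smi smooth_on_set_inverse g r r' n) (use gne in auto)
  obtain p' where p': "smooth_on_set ?U p'" "\<And>x. x \<in> ?U \<Longrightarrow> (p has_real_derivative p' x) (at x)"
    using smooth_on_set_deriv[OF p op] by blast
  have I1: "g x + x * g' x - \<kappa> = - 2 * x\<^sup>2 * g x * n x" if x: "x \<in> ?U" for x
  proof -
    have "- 2 * x\<^sup>2 * g x * n x = x\<^sup>2 * (3 * m x + x * m' x)"
      using gne[OF x] by (simp add: n_def)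
    then show ?thesis using g'm[OF x] gm[OF x] by (simp add: algebra_simps power2_eq_square)
  qed
  have I2: "n x + x * n' x + x\<^sup>2 * (n x)\<^sup>2 - n 0 = 2 * x\<^sup>2 * g x * p x" if x: "x \<in> ?U" for x
  proof -
    have "2 * x\<^sup>2 * g x * p x = x\<^sup>2 * (3 * r x + (x * r' x + n x * n x))"
      using gne[OF x] by (simp add: p_def)
    then show ?thesis using n'r[OF x] nr[OF x] by (simp add: algebra_simps power2_eq_square)
  qed
  show ?thesis
    by (rule that[OF g'(2) n'(2) p'(2) _ _ _ gV gpos gm I1 I2])
      (simp_all add: smooth_on_set_continuous g' p' m)
qed

section \<open>Second-order linear equations\<close>

lemma increment_bound:
  fixes f F :: "real \<Rightarrow> real"
  assumes "a \<le> b"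
    and "\<And>x. x \<in> {a..b} \<Longrightarrow> (f has_real_derivative f' x) (at x within {a..b})"
    and "\<And>x. x \<in> {a..b} \<Longrightarrow> (F has_real_derivative F' x) (at x within {a..b})"
    and "\<And>x. x \<in> {a..b} \<Longrightarrow> \<bar>f' x\<bar> \<le> F' x"
  shows "\<bar>f b - f a\<bar> \<le> F b - F a"
proof (cases "a < b")
  case True
  have "norm (f b - f a) \<le> F b - F a"
  proof (rule differentiable_bound_general[OF True])
    show "continuous_on {a..b} f" by (rule DERIV_continuous_on[OF assms(2)])
    show "continuous_on {a..b} F" by (rule DERIV_continuous_on[OF assms(3)])
  next
    fix x assume x: "a < x" "x < b"
    then have at: "at x within {a..b} = at x" by (simp add: at_within_Icc_at)
    show "(f has_vector_derivative f' x) (at x)"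
      using assms(2)[of x] x by (simp add: at has_real_derivative_iff_has_vector_derivative)
    show "(F has_vector_derivative F' x) (at x)"
      using assms(3)[of x] x by (simp add: at has_real_derivative_iff_has_vector_derivative)
    show "norm (f' x) \<le> F' x" using assms(4)[of x] x by simp
  qed
  then show ?thesis by simp
next
  case False
  then show ?thesis using assms(1) by simp
qed

lemma real_antiderivative:
  fixes f :: "real \<Rightarrow> real"
  assumes "continuous_on UNIV f"
  obtains F where "F 0 = 0" "\<And>x. (F has_real_derivative f x) (at x)"
proof -
  define F where "F = (\<lambda>x. LBINT t=ereal 0..ereal x. f t)"
  have "(F has_real_derivative f x) (at x)" for x
  proof -
    let ?r = "\<bar>x\<bar> + 1"
    have *: "((\<lambda>u. LBINT y=ereal 0..ereal u. f y) has_vector_derivative f x) (at x within {- ?r..?r})"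
      by (rule interval_integral_FTC2[OF _ _ continuous_on_subset[OF assms]]) auto
    have "at x within {- ?r..?r} = at x" by (rule at_within_Icc_at) auto
    with * show ?thesis unfolding F_def has_real_derivative_iff_has_vector_derivative by simp
  qed
  moreover have "F 0 = 0" unfolding F_def by (rule interval_integral_endpoints_same)
  ultimately show ?thesis using that by blast
qed

text \<open>
  The equation \<open>u'' = q u\<close>, as a system so that statements can refer to the derivative \<open>u'\<close>.
\<close>

definition ode_solution :: "(real \<Rightarrow> real) \<Rightarrow> (real \<Rightarrow> real) \<Rightarrow> (real \<Rightarrow> real) \<Rightarrow> bool" where
  "ode_solution q u u' \<longleftrightarrow> (\<forall>s. (u has_real_derivative u' s) (at s) \<and>
     (u' has_real_derivative q s * u s) (at s))"

text \<open>
  The inductive step for the bounds on Picard iterates.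
\<close>

lemma power_growth_step:
  fixes u :: "real \<Rightarrow> real"
  assumes d: "\<And>s. (u has_real_derivative v s) (at s)" and "u 0 = 0" "0 \<le> M" "0 \<le> C"
    and v: "\<And>s. \<bar>s\<bar> \<le> L \<Longrightarrow> \<bar>v s\<bar> \<le> M * (C * (M * \<bar>s\<bar>) ^ n / fact n)"
    and "\<bar>s\<bar> \<le> L"
  shows "\<bar>u s\<bar> \<le> C * (M * \<bar>s\<bar>) ^ Suc n / fact (Suc n)"
proof -
  define P where "P = (\<lambda>x. C * (M * x) ^ Suc n / fact (Suc n))"
  have P: "(P has_real_derivative M * (C * (M * x) ^ n / fact n)) (at x)" for x
  proof -
    have "(P has_real_derivative C * (real (Suc n) * (M * x) ^ n * M) / fact (Suc n)) (at x)"
      unfolding P_def by (rule derivative_eq_intros refl | simp)+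
    also have "C * (real (Suc n) * (M * x) ^ n * M) / fact (Suc n)
        = real (Suc n) * (M * (C * (M * x) ^ n)) / (real (Suc n) * fact n)"
      by (simp only: fact_Suc of_nat_mult of_nat_fact) (simp add: mult_ac)
    also have "\<dots> = M * (C * (M * x) ^ n / fact n)"
      by (subst mult_divide_mult_cancel_left) auto
    finally show ?thesis .
  qed
  have P0: "P 0 = 0" by (simp add: P_def)
  have pos: "\<bar>w s\<bar> \<le> P s"
    if w: "\<And>s. (w has_real_derivative z s) (at s)" "w 0 = 0"
      "\<And>s. \<bar>s\<bar> \<le> L \<Longrightarrow> \<bar>z s\<bar> \<le> M * (C * (M * \<bar>s\<bar>) ^ n / fact n)" and s: "0 \<le> s" "s \<le> L"
    for w z s
  proof -
    have "\<bar>w s - w 0\<bar> \<le> P s - P 0"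
    proof (rule increment_bound[OF s(1)])
      show "(w has_real_derivative z x) (at x within {0..s})" for x
        using w(1) has_field_derivative_at_within by blast
      show "(P has_real_derivative M * (C * (M * x) ^ n / fact n)) (at x within {0..s})" for x
        using P has_field_derivative_at_within by blast
      show "\<bar>z x\<bar> \<le> M * (C * (M * x) ^ n / fact n)" if "x \<in> {0..s}" for x
        using w(3)[of x] that s by auto
    qed
    then show ?thesis using w(2) P0 by simp
  qed
  show ?thesis
  proof (cases "0 \<le> s")
    case True
    then show ?thesis using pos[of u v s] assms by (simp add: P_def)
  next
    case False
    have "((\<lambda>x. u (- x)) has_real_derivative - v (- x)) (at x)" for x
      using DERIV_mirror[of u "v (- x)" x] d[of "- x"] by simp
    from pos[of "\<lambda>x. u (- x)" "\<lambda>x. - v (- x)" "- s", OF this] show ?thesis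
      using assms False v[of "- x" for x] by (auto simp: P_def abs_le_iff)
  qed
qed

text \<open>
  Picard iteration. On \<open>[- L, L]\<close> the \<open>n\<close>-th increment and its derivative are bounded by terms of an
  exponential series, so the series can be differentiated term by term.
\<close>

lemma ode_solution_exists:
  assumes q: "continuous_on UNIV q"
  obtains u u' where "ode_solution q u u'" "u 0 = x0" "u' 0 = y0"
proof -
  \<comment> \<open>The primitive vanishing at \<open>0\<close>; all iterates after the first then vanish at \<open>0\<close>.\<close>
  define AD where "AD = (\<lambda>f::real\<Rightarrow>real. SOME F. F 0 = 0 \<and> (\<forall>x. (F has_real_derivative f x) (at x)))"
  have AD: "AD f 0 = 0" "(AD f has_real_derivative f x) (at x)" if "continuous_on UNIV f" for f x
  proof -
    have "\<exists>F. F 0 = 0 \<and> (\<forall>x. (F has_real_derivative f x) (at x))"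
      using real_antiderivative[OF that] by blast
    then have "AD f 0 = 0 \<and> (\<forall>x. (AD f has_real_derivative f x) (at x))"
      unfolding AD_def by (rule someI_ex)
    then show "AD f 0 = 0" "(AD f has_real_derivative f x) (at x)" by auto
  qed
  define W where "W = rec_nat ((\<lambda>s. x0, \<lambda>s. y0))
     (\<lambda>n uw. (AD (snd uw), AD (\<lambda>s. q s * fst uw s)))"
  define U where "U = (\<lambda>n. fst (W n))"
  define Z where "Z = (\<lambda>n. snd (W n))"
  have U0: "U 0 = (\<lambda>s. x0)" "Z 0 = (\<lambda>s. y0)" by (auto simp: U_def Z_def W_def)
  have US: "U (Suc n) = AD (Z n)" "Z (Suc n) = AD (\<lambda>s. q s * U n s)" for n
    by (auto simp: U_def Z_def W_def)
  have cont: "continuous_on UNIV (U n) \<and> continuous_on UNIV (Z n)" for n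
  proof (induction n)
    case (Suc n)
    then have "continuous_on UNIV (\<lambda>s. q s * U n s)" using q by (intro continuous_on_mult) auto
    with Suc show ?case unfolding US
      by (meson AD(2) DERIV_isCont continuous_at_imp_continuous_on)
  qed (simp add: U0)
  have dU: "(U (Suc n) has_real_derivative Z n s) (at s)" "U (Suc n) 0 = 0" for n s
    using AD cont by (auto simp: US)
  have dZ: "(Z (Suc n) has_real_derivative q s * U n s) (at s)" "Z (Suc n) 0 = 0" for n s
  proof -
    have "continuous_on UNIV (\<lambda>s. q s * U n s)" using q cont by (intro continuous_on_mult) auto
    from AD[OF this] show "(Z (Suc n) has_real_derivative q s * U n s) (at s)" "Z (Suc n) 0 = 0"
      unfolding US by auto
  qed
  define C where "C = max \<bar>x0\<bar> \<bar>y0\<bar>"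
  have bound: "\<exists>M\<ge>1. (\<forall>s. \<bar>s\<bar> \<le> L \<longrightarrow> \<bar>q s\<bar> \<le> M) \<and>
      (\<forall>n s. \<bar>s\<bar> \<le> L \<longrightarrow> \<bar>U n s\<bar> \<le> C * (M * L) ^ n / fact n \<and> \<bar>Z n s\<bar> \<le> C * (M * L) ^ n / fact n)"
    if "L \<ge> 0" for L
  proof -
    have "bounded (q ` {-L..L})"
      by (intro compact_imp_bounded compact_continuous_image continuous_on_subset[OF q]) auto
    then obtain M0 where "\<forall>x \<in> q ` {-L..L}. norm x \<le> M0" unfolding bounded_iff by blast
    then have M0: "\<And>s. \<bar>s\<bar> \<le> L \<Longrightarrow> \<bar>q s\<bar> \<le> M0" by (auto simp: abs_le_iff)
    define M where "M = max 1 M0"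
    have M: "M \<ge> 1" "\<And>s. \<bar>s\<bar> \<le> L \<Longrightarrow> \<bar>q s\<bar> \<le> M" using M0 by (auto simp: M_def le_max_iff_disj)
    have C: "C \<ge> 0" by (simp add: C_def)
    have b: "\<forall>s. \<bar>s\<bar> \<le> L \<longrightarrow> \<bar>U n s\<bar> \<le> C * (M * \<bar>s\<bar>) ^ n / fact n \<and> \<bar>Z n s\<bar> \<le> C * (M * \<bar>s\<bar>) ^ n / fact n" for n
    proof (induction n)
      case 0 show ?case by (simp add: U0 C_def)
    next
      case (Suc n)
      have r: "0 \<le> C * (M * \<bar>s\<bar>) ^ n / fact n" for s using M C by simp
      have 1: "\<bar>Z n s\<bar> \<le> M * (C * (M * \<bar>s\<bar>) ^ n / fact n)" if "\<bar>s\<bar> \<le> L" for s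
        using mult_mono[OF M(1), of "\<bar>Z n s\<bar>" "C * (M * \<bar>s\<bar>) ^ n / fact n"] Suc that M r by auto
      have 2: "\<bar>q s * U n s\<bar> \<le> M * (C * (M * \<bar>s\<bar>) ^ n / fact n)" if "\<bar>s\<bar> \<le> L" for s
        unfolding abs_mult using Suc that M r by (intro mult_mono) auto
      have M0: "0 \<le> M" using M by simp
      show ?case
        using power_growth_step[OF dU(1) dU(2) M0 C 1] power_growth_step[OF dZ(1) dZ(2) M0 C 2]
        by blast
    qed
    have "C * (M * \<bar>s\<bar>) ^ n / fact n \<le> C * (M * L) ^ n / fact n" if "\<bar>s\<bar> \<le> L" for n s
      using that M C by (intro divide_right_mono mult_left_mono power_mono) auto
    then show ?thesis using M b by (meson order_trans)
  qed
  define u where "u = (\<lambda>s. \<Sum>n. U n s)"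
  define w where "w = (\<lambda>s. \<Sum>n. Z n s)"
  define dUU where "dUU = (\<lambda>n s. case n of 0 \<Rightarrow> 0 | Suc m \<Rightarrow> Z m s)"
  define dZZ where "dZZ = (\<lambda>n s. case n of 0 \<Rightarrow> 0 | Suc m \<Rightarrow> q s * U m s)"
  have dUU: "(U n has_real_derivative dUU n s) (at s)" for n s
    using dU by (cases n) (auto simp: dUU_def U0)
  have dZZ: "(Z n has_real_derivative dZZ n s) (at s)" for n s
    using dZ by (cases n) (auto simp: dZZ_def U0)
  have D: "(u has_real_derivative w s) (at s) \<and> (w has_real_derivative q s * u s) (at s)" for s
  proof -
    define L where "L = \<bar>s\<bar> + 1"
    obtain M where M: "M \<ge> 1" "\<And>s. \<bar>s\<bar> \<le> L \<Longrightarrow> \<bar>q s\<bar> \<le> M"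
      and b: "\<And>n s. \<bar>s\<bar> \<le> L \<Longrightarrow> \<bar>U n s\<bar> \<le> C * (M * L) ^ n / fact n"
        "\<And>n s. \<bar>s\<bar> \<le> L \<Longrightarrow> \<bar>Z n s\<bar> \<le> C * (M * L) ^ n / fact n"
      using bound[of L] by (auto simp: L_def)
    have sumb: "summable (\<lambda>n. C * (M * L) ^ n / fact n)"
      using summable_mult[OF summable_exp[of "M * L"], of C] by (simp add: field_simps)
    define B where "B = (\<lambda>n. case n of 0 \<Rightarrow> 0 | Suc m \<Rightarrow> M * (C * (M * L) ^ m / fact m))"
    have sumB: "summable B"
    proof (subst summable_Suc_iff[symmetric])
      have "(\<lambda>n. B (Suc n)) = (\<lambda>n. M * (C * (M * L) ^ n / fact n))" by (simp add: B_def)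
      then show "summable (\<lambda>n. B (Suc n))" using summable_mult[OF sumb, of M] by simp
    qed
    have b0: "0 \<le> C * (M * L) ^ m / fact m" for m using M by (simp add: C_def L_def)
    have BU: "\<And>n x. x \<in> {-L..L} \<Longrightarrow> norm (dUU n x) \<le> B n"
    proof -
      fix n x assume that: "x \<in> {-L..L}"
      show "norm (dUU n x) \<le> B n"
      proof (cases n)
      case (Suc m)
      have "\<bar>Z m x\<bar> \<le> 1 * (C * (M * L) ^ m / fact m)" using b(2)[of x m] that by (auto simp: abs_le_iff)
      also have "\<dots> \<le> M * (C * (M * L) ^ m / fact m)" by (rule mult_right_mono[OF M(1) b0])
      finally show ?thesis by (simp add: Suc dUU_def B_def)
    qed (simp add: dUU_def B_def)
    qed
    have BZ: "\<And>n x. x \<in> {-L..L} \<Longrightarrow> norm (dZZ n x) \<le> B n"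
    proof -
      fix n x assume that: "x \<in> {-L..L}"
      show "norm (dZZ n x) \<le> B n"
      proof (cases n)
      case (Suc m)
      have x: "\<bar>x\<bar> \<le> L" using that by (auto simp: abs_le_iff)
      have "\<bar>q x\<bar> * \<bar>U m x\<bar> \<le> M * (C * (M * L) ^ m / fact m)"
        by (intro mult_mono M(2) b(1) x) (use M in auto)
      then show ?thesis by (simp add: Suc dZZ_def B_def abs_mult)
    qed (simp add: dZZ_def B_def)
    qed
    have ucBU: "uniformly_convergent_on {-L..L} (\<lambda>n x. \<Sum>i<n. dUU i x)"
      by (rule Weierstrass_m_test'[OF _ sumB]) (rule BU)
    have ucBZ: "uniformly_convergent_on {-L..L} (\<lambda>n x. \<Sum>i<n. dZZ i x)"
      by (rule Weierstrass_m_test'[OF _ sumB]) (rule BZ)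
    have int: "s \<in> interior {-L..L}" "0 \<in> {-L..L}" "s \<in> {-L..L}" by (auto simp: L_def)
    have sU: "summable (\<lambda>n. U n x)" and sZ: "summable (\<lambda>n. Z n x)" if "\<bar>x\<bar> \<le> L" for x
      using summable_comparison_test'[OF sumb, of 0 "\<lambda>n. U n x"]
        summable_comparison_test'[OF sumb, of 0 "\<lambda>n. Z n x"] b that by auto
    have sUs: "summable (\<lambda>n. U n s)" "summable (\<lambda>n. Z n s)" "summable (\<lambda>n. U n 0)" "summable (\<lambda>n. Z n 0)"
      using sU[of s] sZ[of s] sU[of 0] sZ[of 0] by (auto simp: L_def)
    have du: "(u has_real_derivative (\<Sum>n. dUU n s)) (at s)"
      unfolding u_def
      by (rule has_field_derivative_series'(2)[where S="{-L..L}" and ?x0.0=0])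
        (use sUs int ucBU in
          \<open>auto intro: has_field_derivative_at_within[OF dUU]\<close>)
    have dw: "(w has_real_derivative (\<Sum>n. dZZ n s)) (at s)"
      unfolding w_def
      by (rule has_field_derivative_series'(2)[where S="{-L..L}" and ?x0.0=0])
        (use sUs int ucBZ in
          \<open>auto intro: has_field_derivative_at_within[OF dZZ]\<close>)
    have "(\<lambda>n. dUU (Suc n) s) sums w s" unfolding w_def using sUs by (simp add: dUU_def summable_sums)
    then have "(\<Sum>n. dUU n s) = w s" by (subst (asm) sums_Suc_iff) (simp add: sums_iff dUU_def)
    moreover have "(\<lambda>n. dZZ (Suc n) s) sums (q s * u s)"
      unfolding u_def using sUs by (simp add: dZZ_def summable_sums sums_mult)
    then have "(\<Sum>n. dZZ n s) = q s * u s" by (subst (asm) sums_Suc_iff) (simp add: sums_iff dZZ_def)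
    ultimately show ?thesis using du dw by simp
  qed
  have at0: "u 0 = x0" "w 0 = y0"
  proof -
    have "U n 0 = 0" "Z n 0 = 0" if "n \<noteq> 0" for n using that dU(2) dZ(2) by (cases n; simp)+
    then show "u 0 = x0" "w 0 = y0"
      unfolding u_def w_def using suminf_finite[of "{0}" "\<lambda>n. U n 0"] suminf_finite[of "{0}" "\<lambda>n. Z n 0"]
      by (auto simp: U0)
  qed
  show ?thesis by (rule that[of u w, OF _ at0]) (simp add: ode_solution_def D)
qed

text \<open>
  Gronwall's argument for the energy \<open>w\<^sup>2 + w'\<^sup>2\<close>. Without source it gives uniqueness; with a source it
  controls the dependence of solutions on the spectral parameter.
\<close>

lemma energy_estimate:
  fixes w w' :: "real \<Rightarrow> real"
  assumes d: "\<And>s. s \<in> {0..T} \<Longrightarrow> (w has_real_derivative w' s) (at s)"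
    and d': "\<And>s. s \<in> {0..T} \<Longrightarrow> (w' has_real_derivative q s * w s + r s) (at s)"
    and "w 0 = 0" "w' 0 = 0" and q: "\<And>s. s \<in> {0..T} \<Longrightarrow> \<bar>q s\<bar> \<le> Q"
    and r: "\<And>s. s \<in> {0..T} \<Longrightarrow> \<bar>r s\<bar> \<le> \<epsilon>" and T: "0 \<le> T"
  shows "(w T)\<^sup>2 + (w' T)\<^sup>2 \<le> \<epsilon>\<^sup>2 * T * exp ((2 + Q) * T)"
proof -
  let ?k = "2 + Q"
  define E where "E = (\<lambda>s. ((w s)\<^sup>2 + (w' s)\<^sup>2) * exp (- ?k * s) - \<epsilon>\<^sup>2 * s)"
  have "E T \<le> E 0"
  proof (rule DERIV_nonpos_imp_nonincreasing[OF T])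
    fix x assume x: "0 \<le> x" "x \<le> T"
    then have xI: "x \<in> {0..T}" by simp
    let ?D = "2 * w x * w' x + 2 * w' x * (q x * w x + r x)"
    have "(E has_real_derivative (?D - ?k * ((w x)\<^sup>2 + (w' x)\<^sup>2)) * exp (- ?k * x) - \<epsilon>\<^sup>2) (at x)"
      unfolding E_def using d[OF xI] d'[OF xI]
      by (auto intro!: derivative_eq_intros simp: algebra_simps)
    moreover have "(?D - ?k * ((w x)\<^sup>2 + (w' x)\<^sup>2)) * exp (- ?k * x) \<le> \<epsilon>\<^sup>2"
    proof -
      have 1: "2 * w x * w' x \<le> (w x)\<^sup>2 + (w' x)\<^sup>2"
        using sum_squares_bound[of "w x" "w' x"] by simp
      have "2 * w' x * (q x * w x) \<le> \<bar>q x\<bar> * (2 * \<bar>w x\<bar> * \<bar>w' x\<bar>)"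
        using abs_ge_self[of "2 * w' x * (q x * w x)"] by (simp add: abs_mult mult_ac)
      also have "\<dots> \<le> Q * ((w x)\<^sup>2 + (w' x)\<^sup>2)"
        using sum_squares_bound[of "\<bar>w x\<bar>" "\<bar>w' x\<bar>"] q[OF xI] by (intro mult_mono) auto
      finally have 2: "2 * w' x * (q x * w x) \<le> Q * ((w x)\<^sup>2 + (w' x)\<^sup>2)" .
      have "2 * w' x * r x \<le> (w' x)\<^sup>2 + (r x)\<^sup>2" using sum_squares_bound[of "w' x" "r x"] by simp
      moreover have "(r x)\<^sup>2 \<le> \<epsilon>\<^sup>2" using r[OF xI] by (metis abs_ge_zero power2_abs power_mono)
      moreover have "0 \<le> (w x)\<^sup>2" by simp
      moreover have "?D - ?k * ((w x)\<^sup>2 + (w' x)\<^sup>2) = 2 * w x * w' x + 2 * w' x * (q x * w x)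
          + 2 * w' x * r x - 2 * ((w x)\<^sup>2 + (w' x)\<^sup>2) - Q * ((w x)\<^sup>2 + (w' x)\<^sup>2)"
        by (simp add: algebra_simps)
      ultimately have *: "?D - ?k * ((w x)\<^sup>2 + (w' x)\<^sup>2) \<le> \<epsilon>\<^sup>2"
        using 1 2 by argo
      have Qp: "0 \<le> Q" using q[OF xI] by linarith
      then have "0 \<le> ?k * x" using x by (intro mult_nonneg_nonneg) auto
      then have "exp (- ?k * x) \<le> 1" by (simp only: exp_le_one_iff mult_minus_left neg_le_0_iff_le)
      then have "\<epsilon>\<^sup>2 * exp (- ?k * x) \<le> \<epsilon>\<^sup>2" by (simp add: mult_left_le)
      moreover have "(?D - ?k * ((w x)\<^sup>2 + (w' x)\<^sup>2)) * exp (- ?k * x) \<le> \<epsilon>\<^sup>2 * exp (- ?k * x)"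
        using * by (intro mult_right_mono) auto
      ultimately show ?thesis by linarith
    qed
    ultimately show "\<exists>y. DERIV E x :> y \<and> y \<le> 0" by (intro exI conjI) auto
  qed
  then have "((w T)\<^sup>2 + (w' T)\<^sup>2) * exp (- ?k * T) \<le> \<epsilon>\<^sup>2 * T"
    using assms(3,4) by (simp add: E_def)
  then have "((w T)\<^sup>2 + (w' T)\<^sup>2) * exp (- ?k * T) * exp (?k * T) \<le> \<epsilon>\<^sup>2 * T * exp (?k * T)"
    by (rule mult_right_mono) simp
  moreover have "exp (- ?k * T) * exp (?k * T) = 1"
    by (simp add: exp_add[symmetric] algebra_simps)
  ultimately show ?thesis by (simp only: mult.assoc mult_1_right)
qed

lemma ode_solution_mirror:
  assumes "ode_solution q u u'"
  shows "ode_solution (\<lambda>s. q (- s)) (\<lambda>s. u (- s)) (\<lambda>s. - u' (- s))"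
  unfolding ode_solution_def
proof (intro allI conjI)
  fix s
  have "(u has_real_derivative u' (- s)) (at (- s))" "(u' has_real_derivative q (- s) * u (- s)) (at (- s))"
    using assms unfolding ode_solution_def by auto
  then show "((\<lambda>s. u (- s)) has_real_derivative - u' (- s)) (at s)"
    "((\<lambda>s. - u' (- s)) has_real_derivative q (- s) * u (- s)) (at s)"
    using DERIV_mirror[of u "u' (- s)" s] DERIV_minus[of "\<lambda>s. u' (- s)" "- (q (- s) * u (- s))" s]
      DERIV_mirror[of u' "q (- s) * u (- s)" s] by auto
qed

lemma ode_solution_shift:
  assumes "ode_solution q u u'"
  shows "ode_solution (\<lambda>s. q (s + c)) (\<lambda>s. u (s + c)) (\<lambda>s. u' (s + c))"
  using assms unfolding ode_solution_def
  by (auto simp: DERIV_shift[symmetric])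

lemma ode_solution_lin:
  assumes "ode_solution q u u'" "ode_solution q v v'"
  shows "ode_solution q (\<lambda>s. x * u s + y * v s) (\<lambda>s. x * u' s + y * v' s)"
  using assms unfolding ode_solution_def
  by (auto intro!: derivative_eq_intros simp: algebra_simps)

lemma ode_solution_zero:
  assumes u: "ode_solution q u u'" and q: "continuous_on UNIV q" and "u 0 = 0" "u' 0 = 0"
  shows "u s = 0 \<and> u' s = 0"
proof -
  have pos: "w s = 0 \<and> w' s = 0"
    if w: "ode_solution k w w'" "continuous_on UNIV k" "w 0 = 0" "w' 0 = 0" "0 \<le> s" for k w w' s
  proof -
    have "bounded (k ` {0..s})"
      by (intro compact_imp_bounded compact_continuous_image continuous_on_subset[OF w(2)]) auto
    then obtain Q where "\<forall>x \<in> k ` {0..s}. norm x \<le> Q" unfolding bounded_iff by blast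
    then have Q: "\<And>t. t \<in> {0..s} \<Longrightarrow> \<bar>k t\<bar> \<le> Q" by simp
    have "(w s)\<^sup>2 + (w' s)\<^sup>2 \<le> 0\<^sup>2 * s * exp ((2 + Q) * s)"
      by (rule energy_estimate[where q = k and r = "\<lambda>_. 0"])
        (use w Q in \<open>auto simp: ode_solution_def\<close>)
    then show ?thesis by (simp add: sum_power2_le_zero_iff)
  qed
  show ?thesis
  proof (cases "0 \<le> s")
    case True then show ?thesis using pos[OF u q assms(3,4)] by simp
  next
    case False
    have "continuous_on UNIV (\<lambda>s. q (- s))"
      by (rule continuous_on_compose2[OF q]) (auto intro: continuous_intros)
    from pos[OF ode_solution_mirror[OF u] this, of "- s"] show ?thesis using assms False by simp
  qed
qed

lemma ode_solution_unique:
  assumes "ode_solution q u u'" "ode_solution q v v'" "continuous_on UNIV q" "u 0 = v 0" "u' 0 = v' 0"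
  shows "u = v" "u' = v'"
proof -
  have "ode_solution q (\<lambda>s. 1 * u s + (-1) * v s) (\<lambda>s. 1 * u' s + (-1) * v' s)"
    by (rule ode_solution_lin[OF assms(1,2)])
  from ode_solution_zero[OF this assms(3)] have "u s = v s \<and> u' s = v' s" for s
    using assms(4,5) by simp
  then show "u = v" "u' = v'" by auto
qed

section \<open>Hill's equation with an even potential\<close>

definition fund_sol :: "(real \<Rightarrow> real) \<Rightarrow> real \<Rightarrow> real \<Rightarrow> (real \<Rightarrow> real) \<times> (real \<Rightarrow> real)" where
  "fund_sol q x y = (SOME u. ode_solution q (fst u) (snd u) \<and> fst u 0 = x \<and> snd u 0 = y)"

text \<open>
  For even \<open>q\<close> these fundamental solutions are the even and the odd solution (\<open>parity\<close> below).
\<close>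

definition "ev_sol q = fst (fund_sol q 1 0)"
definition "ev_der q = snd (fund_sol q 1 0)"
definition "od_sol q = fst (fund_sol q 0 1)"
definition "od_der q = snd (fund_sol q 0 1)"

lemma fund_sol:
  assumes "continuous_on UNIV q"
  shows "ode_solution q (fst (fund_sol q x y)) (snd (fund_sol q x y))"
    "fst (fund_sol q x y) 0 = x" "snd (fund_sol q x y) 0 = y"
proof -
  obtain u u' where "ode_solution q u u'" "u 0 = x" "u' 0 = y"
    using ode_solution_exists[OF assms] by blast
  then have "\<exists>p. ode_solution q (fst p) (snd p) \<and> fst p 0 = x \<and> snd p 0 = y"
    by (intro exI[of _ "(u, u')"]) simp
  then have "ode_solution q (fst (fund_sol q x y)) (snd (fund_sol q x y)) \<and>
      fst (fund_sol q x y) 0 = x \<and> snd (fund_sol q x y) 0 = y"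
    unfolding fund_sol_def by (rule someI_ex)
  then show "ode_solution q (fst (fund_sol q x y)) (snd (fund_sol q x y))"
    "fst (fund_sol q x y) 0 = x" "snd (fund_sol q x y) 0 = y" by auto
qed

lemma ev_od_ode:
  assumes "continuous_on UNIV q"
  shows "ode_solution q (ev_sol q) (ev_der q)" "ode_solution q (od_sol q) (od_der q)"
    "ev_sol q 0 = 1" "ev_der q 0 = 0" "od_sol q 0 = 0" "od_der q 0 = 1"
  using fund_sol[OF assms] by (simp_all add: ev_sol_def ev_der_def od_sol_def od_der_def)

lemma ode_solution_D:
  assumes "ode_solution q u u'"
  shows "(u has_real_derivative u' s) (at s)" "(u' has_real_derivative q s * u s) (at s)"
  using assms unfolding ode_solution_def by auto

lemma wronskian_ev_od:
  assumes "continuous_on UNIV q"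
  shows "ev_sol q s * od_der q s - ev_der q s * od_sol q s = 1"
proof -
  note e = ev_od_ode[OF assms]
  let ?W = "\<lambda>s. ev_sol q s * od_der q s - ev_der q s * od_sol q s"
  have "(?W has_real_derivative 0) (at t)" for t
    using ode_solution_D[OF e(1), of t] ode_solution_D[OF e(2), of t]
    by (auto intro!: derivative_eq_intros simp: algebra_simps)
  then have "?W s = ?W 0" by (intro DERIV_isconst_all) auto
  then show ?thesis using e by simp
qed

locale hill =
  fixes q :: "real \<Rightarrow> real"
  assumes cont: "continuous_on UNIV q" and even: "\<And>s. q (- s) = q s"
    and periodic: "\<And>s. q (s + pi) = q s"
begin

abbreviation "a \<equiv> ev_sol q"
abbreviation "a' \<equiv> ev_der q"
abbreviation "b \<equiv> od_sol q"
abbreviation "b' \<equiv> od_der q"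

text \<open>
  The entries of the matrix of translation by \<open>pi\<close> in the basis \<open>a\<close>, \<open>b\<close>, written with values at
  \<open>pi / 2\<close> (\<open>half_period_values\<close>). Both diagonal entries equal \<open>mA\<close>, half the trace.
\<close>

definition "mA = a (pi/2) * b' (pi/2) + a' (pi/2) * b (pi/2)"
definition "mB = 2 * b (pi/2) * b' (pi/2)"
definition "mC = 2 * a (pi/2) * a' (pi/2)"

lemmas ab = ev_od_ode[OF cont]

lemma parity:
  "a (- s) = a s" "a' (- s) = - a' s" "b (- s) = - b s" "b' (- s) = b' s"
proof -
  have qq: "(\<lambda>s. q (- s)) = q" by (simp add: even)
  have 1: "ode_solution q (\<lambda>s. a (- s)) (\<lambda>s. - a' (- s))"
    using ode_solution_mirror[OF ab(1)] qq by simp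
  have 2: "(\<lambda>s. a (- s)) = a" "(\<lambda>s. - a' (- s)) = a'"
    by (rule ode_solution_unique[OF 1 ab(1) cont]; simp add: ab)+
  have 3: "ode_solution q (\<lambda>s. b (- s)) (\<lambda>s. - b' (- s))"
    using ode_solution_mirror[OF ab(2)] qq by simp
  have 4: "ode_solution q (\<lambda>s. (-1) * b s + 0 * b s) (\<lambda>s. (-1) * b' s + 0 * b' s)"
    by (rule ode_solution_lin[OF ab(2) ab(2)])
  have 5: "(\<lambda>s. b (- s)) = (\<lambda>s. (-1) * b s + 0 * b s)" "(\<lambda>s. - b' (- s)) = (\<lambda>s. (-1) * b' s + 0 * b' s)"
    by (rule ode_solution_unique[OF 3 4 cont]; simp add: ab)+
  show "a (- s) = a s" using fun_cong[OF 2(1), of s] by simp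
  show "a' (- s) = - a' s" using fun_cong[OF 2(2), of s] by simp
  show "b (- s) = - b s" using fun_cong[OF 5(1), of s] by simp
  show "b' (- s) = b' s" using fun_cong[OF 5(2), of s] by simp
qed

lemma solution_expansion:
  assumes "ode_solution q u u'"
  shows "u s = u 0 * a s + u' 0 * b s" "u' s = u 0 * a' s + u' 0 * b' s"
proof -
  have 1: "ode_solution q (\<lambda>s. u 0 * a s + u' 0 * b s) (\<lambda>s. u 0 * a' s + u' 0 * b' s)"
    by (rule ode_solution_lin[OF ab(1,2)])
  have "u = (\<lambda>s. u 0 * a s + u' 0 * b s)" "u' = (\<lambda>s. u 0 * a' s + u' 0 * b' s)"
    by (rule ode_solution_unique[OF assms 1 cont]; simp add: ab)+
  from fun_cong[OF this(1), of s] fun_cong[OF this(2), of s]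
  show "u s = u 0 * a s + u' 0 * b s" "u' s = u 0 * a' s + u' 0 * b' s" by auto
qed

lemma shift_solution:
  assumes "ode_solution q u u'"
  shows "ode_solution q (\<lambda>s. u (s + pi)) (\<lambda>s. u' (s + pi))"
proof -
  have "(\<lambda>s. q (s + pi)) = q" by (simp add: periodic)
  then show ?thesis using ode_solution_shift[OF assms, of pi] by simp
qed

text \<open>
  Expanding the translate of \<open>a\<close> or \<open>b\<close> by \<open>pi\<close> in the basis and evaluating it at \<open>- pi / 2\<close> gives, by
  parity, a linear system for the values at \<open>pi\<close> whose determinant is the Wronskian.
\<close>

lemma half_period_values: "a pi = mA" "a' pi = mC" "b pi = mB" "b' pi = mA"
proof -
  let ?T = "pi/2"
  have h: "- ?T + pi = ?T" by simp
  note W = wronskian_ev_od[OF cont, of ?T]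
  have A1: "a ?T = a pi * a ?T - a' pi * b ?T" and A2: "a' ?T = - a pi * a' ?T + a' pi * b' ?T"
    using solution_expansion[OF shift_solution[OF ab(1)], of "- ?T"] unfolding h parity by simp_all
  have B1: "b ?T = b pi * a ?T - b' pi * b ?T" and B2: "b' ?T = - b pi * a' ?T + b' pi * b' ?T"
    using solution_expansion[OF shift_solution[OF ab(2)], of "- ?T"] unfolding h parity by simp_all
  have "mA = (a pi * a ?T - a' pi * b ?T) * b' ?T + (- a pi * a' ?T + a' pi * b' ?T) * b ?T"
    unfolding mA_def using A1 A2 by simp
  also have "\<dots> = a pi * (a ?T * b' ?T - a' ?T * b ?T)" by (simp add: algebra_simps)
  finally show "a pi = mA" using W by simp
  have "mC = (a pi * a ?T - a' pi * b ?T) * a' ?T + (- a pi * a' ?T + a' pi * b' ?T) * a ?T"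
    unfolding mC_def using A1 A2 by simp
  also have "\<dots> = a' pi * (a ?T * b' ?T - a' ?T * b ?T)" by (simp add: algebra_simps)
  finally show "a' pi = mC" using W by simp
  have "mB = (b pi * a ?T - b' pi * b ?T) * b' ?T + (- b pi * a' ?T + b' pi * b' ?T) * b ?T"
    unfolding mB_def using B1 B2 by simp
  also have "\<dots> = b pi * (a ?T * b' ?T - a' ?T * b ?T)" by (simp add: algebra_simps)
  finally show "b pi = mB" using W by simp
  have "mA = a' ?T * (b pi * a ?T - b' pi * b ?T) + a ?T * (- b pi * a' ?T + b' pi * b' ?T)"
    unfolding mA_def using B1 B2 by simp
  also have "\<dots> = b' pi * (a ?T * b' ?T - a' ?T * b ?T)" by (simp add: algebra_simps)
  finally show "b' pi = mA" using W by simp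
qed

lemma monodromy_det: "mA\<^sup>2 - mB * mC = 1"
  using wronskian_ev_od[OF cont, of pi] unfolding half_period_values
  by (simp add: power2_eq_square mult.commute)

lemma monodromy_half:
  "a (s + pi) = mA * a s + mC * b s" "b (s + pi) = mB * a s + mA * b s"
  using solution_expansion(1)[OF shift_solution[OF ab(1)], of s]
    solution_expansion(1)[OF shift_solution[OF ab(2)], of s]
  by (simp_all add: half_period_values)

lemma monodromy_full:
  "a (s + 2 * pi) = (2 * mA\<^sup>2 - 1) * a s + 2 * mA * mC * b s"
  "b (s + 2 * pi) = 2 * mA * mB * a s + (2 * mA\<^sup>2 - 1) * b s"
proof -
  have e: "s + 2 * pi = (s + pi) + pi" by simp
  show "a (s + 2 * pi) = (2 * mA\<^sup>2 - 1) * a s + 2 * mA * mC * b s"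
    unfolding e monodromy_half using monodromy_det by algebra
  show "b (s + 2 * pi) = 2 * mA * mB * a s + (2 * mA\<^sup>2 - 1) * b s"
    unfolding e monodromy_half using monodromy_det by algebra
qed

end

text \<open>
  The difference of the solutions for \<open>l\<close> and \<open>l0\<close> solves the equation for \<open>l\<close> with a source
  proportional to \<open>l - l0\<close>, so the energy estimate bounds it by a multiple of \<open>\<bar>l - l0\<bar>\<close>.
\<close>

lemma fund_sol_isCont:
  fixes V :: "real \<Rightarrow> real" and h T x y l0 :: real
  defines "q \<equiv> \<lambda>l s. (V s - l) / h\<^sup>2"
  assumes V: "continuous_on UNIV V" and T: "0 \<le> T"
  shows "isCont (\<lambda>l. fst (fund_sol (q l) x y) T) l0" "isCont (\<lambda>l. snd (fund_sol (q l) x y) T) l0"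
proof -
  let ?u = "\<lambda>l. fst (fund_sol (q l) x y)" and ?v = "\<lambda>l. snd (fund_sol (q l) x y)"
  have cq: "continuous_on UNIV (q l)" for l
    unfolding q_def divide_inverse by (intro continuous_intros V)
  have ode: "ode_solution (q l) (?u l) (?v l)" "?u l 0 = x" "?v l 0 = y" for l
    using fund_sol[OF cq] by auto
  note D = ode_solution_D[OF ode(1)]
  have cu: "continuous_on UNIV (?u l0)"
    using D(1) by (auto intro!: continuous_at_imp_continuous_on intro: DERIV_isCont)
  have "bounded (V ` {0..T})" "bounded (?u l0 ` {0..T})"
    by (intro compact_imp_bounded compact_continuous_image continuous_on_subset[OF V]
        continuous_on_subset[OF cu]; simp)+
  then obtain Q U where "\<forall>t \<in> V ` {0..T}. norm t \<le> Q" "\<forall>t \<in> ?u l0 ` {0..T}. norm t \<le> U"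
    unfolding bounded_iff by blast
  then have Q: "\<And>t. t \<in> {0..T} \<Longrightarrow> \<bar>V t\<bar> \<le> Q" and U: "\<And>t. t \<in> {0..T} \<Longrightarrow> \<bar>?u l0 t\<bar> \<le> U" by auto
  define R where "R = (Q + \<bar>l0\<bar> + 1) / h\<^sup>2"
  define K where "K = (U / h\<^sup>2)\<^sup>2 * T * exp ((2 + R) * T)"
  have K: "(?u l T - ?u l0 T)\<^sup>2 + (?v l T - ?v l0 T)\<^sup>2 \<le> K * (l - l0)\<^sup>2" if l: "\<bar>l - l0\<bar> < 1" for l
  proof -
    let ?w = "\<lambda>t. ?u l t - ?u l0 t" and ?w' = "\<lambda>t. ?v l t - ?v l0 t"
    have "(?w T)\<^sup>2 + (?w' T)\<^sup>2 \<le> (\<bar>l - l0\<bar> * U / h\<^sup>2)\<^sup>2 * T * exp ((2 + R) * T)"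
    proof (rule energy_estimate[where q = "q l" and r = "\<lambda>t. (l0 - l) / h\<^sup>2 * ?u l0 t"])
      fix t
      show "(?w has_real_derivative ?w' t) (at t)"
        by (intro DERIV_diff D)
      have "(?w' has_real_derivative q l t * ?u l t - q l0 t * ?u l0 t) (at t)"
        by (intro DERIV_diff D)
      then show "(?w' has_real_derivative q l t * ?w t + (l0 - l) / h\<^sup>2 * ?u l0 t) (at t)"
        by (simp add: q_def algebra_simps diff_divide_distrib)
      assume t: "t \<in> {0..T}"
      have "\<bar>V t - l\<bar> \<le> Q + \<bar>l0\<bar> + 1" using Q[OF t] l by linarith
      then show "\<bar>q l t\<bar> \<le> R" unfolding q_def R_def abs_divide by (simp add: divide_right_mono)
      have "\<bar>l0 - l\<bar> / h\<^sup>2 * \<bar>?u l0 t\<bar> \<le> \<bar>l - l0\<bar> / h\<^sup>2 * U"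
        using U[OF t] by (intro mult_mono) (auto simp: abs_minus_commute)
      then show "\<bar>(l0 - l) / h\<^sup>2 * ?u l0 t\<bar> \<le> \<bar>l - l0\<bar> * U / h\<^sup>2" by (simp add: abs_mult)
    qed (simp_all add: ode T)
    also have "\<dots> = K * (l - l0)\<^sup>2" by (simp add: K_def power_mult_distrib power_divide)
    finally show ?thesis .
  qed
  have near: "\<forall>\<^sub>F l in nhds l0. \<bar>l - l0\<bar> < 1"
    using eventually_nhds_ball[of 1 l0] by (auto simp: dist_real_def abs_minus_commute elim: eventually_mono)
  have lim: "((\<lambda>l. sqrt (K * (l - l0)\<^sup>2)) \<longlongrightarrow> 0) (at l0)"
    by (auto intro!: tendsto_eq_intros)
  have gen: "isCont f l0" if "\<And>l. \<bar>l - l0\<bar> < 1 \<Longrightarrow> (f l - f l0)\<^sup>2 \<le> K * (l - l0)\<^sup>2" for f :: "real \<Rightarrow> real"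
  proof -
    have "((\<lambda>l. f l - f l0) \<longlongrightarrow> 0) (at l0)"
    proof (rule Lim_null_comparison[OF _ lim])
      have "\<forall>\<^sub>F l in at l0. \<bar>l - l0\<bar> < 1" using near by (simp add: eventually_at_filter eventually_mono)
      then show "\<forall>\<^sub>F l in at l0. norm (f l - f l0) \<le> sqrt (K * (l - l0)\<^sup>2)"
        by eventually_elim (use that real_le_rsqrt in force)
    qed
    then show ?thesis by (simp add: isCont_def LIM_zero_iff)
  qed
  show "isCont (\<lambda>l. ?u l T) l0" by (rule gen) (smt (verit) K zero_le_power2)
  show "isCont (\<lambda>l. ?v l T) l0" by (rule gen) (smt (verit) K zero_le_power2)
qed

section \<open>The fundamental lemma on the circle\<close>

abbreviation circ :: "real set" where "circ \<equiv> {0..2*pi}"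

lemma set_integrable_mult_bounded:
  fixes f g :: "real \<Rightarrow> 'a::{real_normed_field, second_countable_topology, banach}"
  assumes f: "set_integrable lborel I f" and g: "g \<in> borel_measurable borel"
    and K: "\<And>s. s \<in> I \<Longrightarrow> norm (g s) \<le> K"
  shows "set_integrable lborel I (\<lambda>s. f s * g s)"
  unfolding set_integrable_def
proof (rule Bochner_Integration.integrable_bound)
  show "integrable lborel (\<lambda>s. K *\<^sub>R (indicator I s *\<^sub>R f s))"
    using f unfolding set_integrable_def by (rule integrable_scaleR_right)
  have "(\<lambda>s. indicator I s *\<^sub>R f s) \<in> borel_measurable lborel"
    using f unfolding set_integrable_def by (rule borel_measurable_integrable)
  then have "(\<lambda>s. (indicator I s *\<^sub>R f s) * g s) \<in> borel_measurable lborel"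
    using g by (intro borel_measurable_times) auto
  then show "(\<lambda>s. indicator I s *\<^sub>R (f s * g s)) \<in> borel_measurable lborel"
    by simp
  have "norm (indicator I s *\<^sub>R (f s * g s)) \<le> norm (K *\<^sub>R (indicator I s *\<^sub>R f s))" for s
  proof (cases "s \<in> I")
    case True
    have "norm (f s) * norm (g s) \<le> norm (f s) * \<bar>K\<bar>"
      using K[OF True] by (intro mult_left_mono) auto
    then show ?thesis using True by (simp add: norm_mult mult.commute)
  qed simp
  then show "AE s in lborel. norm (indicator I s *\<^sub>R (f s * g s)) \<le> norm (K *\<^sub>R (indicator I s *\<^sub>R f s))"
    by simp
qed

lemma set_integrable_mult_continuous:
  fixes f g :: "real \<Rightarrow> 'a::{real_normed_field, second_countable_topology, banach}"
  assumes f: "set_integrable lborel {c..d} f" and g: "continuous_on UNIV g"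
  shows "set_integrable lborel {c..d} (\<lambda>s. f s * g s)"
proof -
  have "bounded (g ` {c..d})"
    by (intro compact_imp_bounded compact_continuous_image continuous_on_subset[OF g]) auto
  then obtain K where "\<forall>x\<in>g ` {c..d}. norm x \<le> K" unfolding bounded_iff by blast
  then show ?thesis
    by (intro set_integrable_mult_bounded[OF f borel_measurable_continuous_onI[OF g], of K]) auto
qed

lemma smooth_real_D:
  assumes "smooth_real \<phi>"
  shows "(\<phi> has_real_derivative deriv \<phi> s) (at s)" "continuous_on UNIV \<phi>" "continuous_on UNIV (deriv \<phi>)"
proof -
  have c: "Ck_on 1 UNIV \<phi>" using smooth_real_imp_Ck[OF assms] .
  then obtain d where d: "\<And>x. (\<phi> has_real_derivative d x) (at x)" "continuous_on UNIV d" by auto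
  then have "deriv \<phi> = d" by (auto simp: DERIV_imp_deriv)
  then show "(\<phi> has_real_derivative deriv \<phi> s) (at s)" "continuous_on UNIV (deriv \<phi>)" using d by auto
  show "continuous_on UNIV \<phi>" by (rule Ck_on_imp_continuous[OF c])
qed

text \<open>
  The line is covered by countably many translates of one period.
\<close>

lemma AE_periodic:
  assumes P: "\<And>s k. P (s + of_int k * (2 * pi)) \<Longrightarrow> P s"
    and ae: "AE s in lborel. s \<in> circ \<longrightarrow> P s"
  shows "AE s in lborel. P s"
proof -
  have "AE s in lborel. \<forall>k::int. of_int k * (2 * pi) + s \<in> circ \<longrightarrow> P (of_int k * (2 * pi) + s)"
  proof (subst AE_all_countable, intro allI)
    fix k :: int
    let ?t = "of_int k * (2 * pi)"
    have "AE s in distr lborel borel ((+) ?t). s \<in> circ \<longrightarrow> P s"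
      unfolding lborel_distr_plus by (rule ae)
    then show "AE s in lborel. ?t + s \<in> circ \<longrightarrow> P (?t + s)"
      by (rule AE_distrD[rotated]) simp
  qed
  then show ?thesis
  proof eventually_elim
    case (elim s)
    define k where "k = - \<lfloor>s / (2 * pi)\<rfloor>"
    have "of_int \<lfloor>s / (2 * pi)\<rfloor> * (2 * pi) \<le> s" "s < (of_int \<lfloor>s / (2 * pi)\<rfloor> + 1) * (2 * pi)"
      by (simp_all add: pos_le_divide_eq[symmetric] pos_divide_less_eq[symmetric] floor_correct)
    then have "of_int k * (2 * pi) + s \<in> circ" by (auto simp: k_def algebra_simps)
    then have "P (s + of_int k * (2 * pi))" using elim[rule_format, of k] by (simp add: add.commute)
    then show ?case by (rule P)
  qed
qed

lemma Ck_on_sin_cos: "Ck_on n UNIV sin \<and> Ck_on n UNIV cos"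
proof (induction n)
  case (Suc n)
  have "Ck_on (Suc n) UNIV sin" by (rule Ck_on_SucI[of _ _ cos]) (use Suc in auto)
  moreover have "Ck_on n UNIV (\<lambda>x. (-1) * sin x)"
    using Suc by (intro Ck_on_mult Ck_on_const) auto
  then have "Ck_on (Suc n) UNIV cos"
    by (intro Ck_on_SucI[of _ cos "\<lambda>x. (-1) * sin x"]) (auto intro!: derivative_eq_intros)
  ultimately show ?case by simp
qed (simp add: continuous_on_sin continuous_on_cos)

lemma circle_periodicI: "(\<And>s. f (s + 2 * pi) = f s) \<Longrightarrow> circle_periodic f"
  by unfold_locales assumption

lemma cis_periodic: "cis (s + 2 * pi) = cis s"
proof -
  have "cis (s + 2 * pi) = cis s * cis (2 * pi)" by (rule cis_mult[symmetric])
  then show ?thesis unfolding cis_2pi mult_1_right .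
qed

text \<open>
  Polynomials in the point \<open>cis t\<close> of the circle are trigonometric polynomials; they serve as test
  functions because Stone-Weierstrass makes them dense.
\<close>

lemma polynomial_cis_test:
  assumes "real_polynomial_function (g :: complex \<Rightarrow> real)"
  shows "smooth_real (\<lambda>t. g (cis t))" "circle_periodic (\<lambda>t. g (cis t))"
proof -
  have "Ck_on n UNIV (\<lambda>t. g (cis t))" for n using assms
  proof (induction g)
    case (linear f)
    interpret f: bounded_linear f by fact
    have "f (cis t) = cos t * f 1 + sin t * f \<i>" for t
    proof -
      have "cis t = cos t *\<^sub>R 1 + sin t *\<^sub>R \<i>" by (rule complex_eqI) simp_all
      then show ?thesis by (simp only: f.add f.scaleR real_scaleR_def)
    qed
    then have e: "(\<lambda>t. f (cis t)) = (\<lambda>t. cos t * f 1 + sin t * f \<i>)" by auto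
    show ?case unfolding e using Ck_on_sin_cos[of n]
      by (intro Ck_on_add Ck_on_mult Ck_on_const) auto
  next
    case (const c) show ?case by (rule Ck_on_const)
  next
    case (add f g) show ?case by (rule Ck_on_add[OF add.IH])
  next
    case (mult f g) show ?case by (rule Ck_on_mult[OF mult.IH])
  qed
  then show "smooth_real (\<lambda>t. g (cis t))" by (rule Ck_imp_smooth_real)
  show "circle_periodic (\<lambda>t. g (cis t))" by (rule circle_periodicI) (simp add: cis_periodic)
qed

context
  fixes z :: "real \<Rightarrow> real"
  assumes zi: "set_integrable lborel circ z"
    and test: "\<And>\<phi>. smooth_real \<phi> \<Longrightarrow> circle_periodic \<phi> \<Longrightarrow> (LINT s:circ|lborel. z s * \<phi> s) = 0"
begin

text \<open>
  Uniform approximation by polynomials extends the orthogonality from test functions to continuous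
  functions.
\<close>

lemma integral_against_continuous_zero:
  assumes F: "continuous_on (sphere 0 1) (F :: complex \<Rightarrow> real)" and Fm: "F \<in> borel_measurable borel"
  shows "(LINT s:circ|lborel. z s * F (cis s)) = 0"
proof -
  have mcis: "cis \<in> borel_measurable borel"
    by (intro borel_measurable_continuous_onI continuous_intros)
  have mF: "(\<lambda>s. F (cis s)) \<in> borel_measurable borel"
    using measurable_compose[OF mcis Fm] by simp
  obtain K where "\<forall>x\<in>F ` sphere 0 1. norm x \<le> K"
    using compact_imp_bounded[OF compact_continuous_image[OF F compact_sphere]]
    unfolding bounded_iff by blast
  then have K: "\<And>w. w \<in> sphere 0 1 \<Longrightarrow> \<bar>F w\<bar> \<le> K" by simp
  have i1: "set_integrable lborel circ (\<lambda>s. z s * F (cis s))"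
    by (rule set_integrable_mult_bounded[OF zi mF, of K]) (simp add: K)
  define N where "N = (LINT s:circ|lborel. \<bar>z s\<bar>)"
  have N: "0 \<le> N" unfolding N_def set_lebesgue_integral_def by (intro integral_nonneg_AE) auto
  have "\<bar>LINT s:circ|lborel. z s * F (cis s)\<bar> \<le> e * N" if e: "e > 0" for e
  proof -
    obtain g where g: "polynomial_function g" "\<And>w. w \<in> sphere 0 1 \<Longrightarrow> norm (F w - g w) < e"
      using Stone_Weierstrass_polynomial_function[OF compact_sphere F e] by blast
    have rg: "real_polynomial_function g" using g(1) by (simp add: real_polynomial_function_eq)
    note t = polynomial_cis_test[OF rg]
    note cg = smooth_real_D(2)[OF t(1)]
    have i2: "set_integrable lborel circ (\<lambda>s. z s * g (cis s))"
      by (rule set_integrable_mult_continuous[OF zi cg])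
    have i3: "set_integrable lborel circ (\<lambda>s. z s * (F (cis s) - g (cis s)))"
      using set_integral_diff(1)[OF i1 i2] by (simp add: right_diff_distrib)
    have "(LINT s:circ|lborel. z s * F (cis s)) = (LINT s:circ|lborel. z s * (F (cis s) - g (cis s)))"
      using set_integral_diff(2)[OF i1 i2] test[OF t] by (simp add: right_diff_distrib)
    also have "\<bar>\<dots>\<bar> \<le> (LINT s:circ|lborel. \<bar>z s * (F (cis s) - g (cis s))\<bar>)"
      using set_integral_norm_bound[OF i3] by simp
    also have "\<dots> \<le> (LINT s:circ|lborel. e * \<bar>z s\<bar>)"
    proof (rule set_integral_mono)
      show "set_integrable lborel circ (\<lambda>s. \<bar>z s * (F (cis s) - g (cis s))\<bar>)"
        using set_integrable_abs[OF i3] .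
      show "set_integrable lborel circ (\<lambda>s. e * \<bar>z s\<bar>)"
        using set_integrable_abs[OF zi] by simp
      show "\<bar>z s * (F (cis s) - g (cis s))\<bar> \<le> e * \<bar>z s\<bar>" for s
        using g(2)[of "cis s"] by (simp add: abs_mult mult.commute[of e] mult_left_mono less_imp_le)
    qed
    also have "\<dots> = e * N" by (simp add: N_def)
    finally show ?thesis .
  qed
  then have *: "\<bar>LINT s:circ|lborel. z s * F (cis s)\<bar> \<le> e * N" if "e > 0" for e using that by blast
  have "\<bar>LINT s:circ|lborel. z s * F (cis s)\<bar> \<le> 0 + d" if d: "d > 0" for d
  proof -
    have "d / (N + 1) * N \<le> d" using d N by (simp add: field_simps)
    then show ?thesis using *[of "d / (N + 1)"] d N by simp
  qed
  then have "\<bar>LINT s:circ|lborel. z s * F (cis s)\<bar> \<le> 0" by (rule field_le_epsilon)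
  then show ?thesis by simp
qed

text \<open>
  The indicator of an open set is the pointwise limit of the continuous functions
  \<open>min 1 (k * infdist w (- U))\<close>.
\<close>

lemma integral_on_open_zero:
  assumes O: "open (U :: complex set)" "U \<noteq> UNIV"
  shows "(LINT s:circ|lborel. z s * indicator U (cis s)) = 0"
proof -
  define F where "F = (\<lambda>k w. min 1 (real k * infdist w (- U)))"
  have cF: "continuous_on UNIV (F k)" for k
    unfolding F_def by (intro continuous_intros)
  have zero: "(LINT s:circ|lborel. z s * F k (cis s)) = 0" for k
    by (rule integral_against_continuous_zero)
      (auto intro: continuous_on_subset[OF cF] borel_measurable_continuous_onI cF)
  have mcis: "cis \<in> borel_measurable borel"
    by (intro borel_measurable_continuous_onI continuous_intros)
  have mz: "(\<lambda>s. indicator circ s * z s) \<in> borel_measurable lborel"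
    using borel_measurable_integrable[OF zi[unfolded set_integrable_def]] by simp
  have "(\<lambda>k. LINT s|lborel. (indicator circ s * z s) * F k (cis s)) \<longlonglongrightarrow>
      (LINT s|lborel. (indicator circ s * z s) * indicator U (cis s))"
  proof (rule integral_dominated_convergence[where w = "\<lambda>s. norm (indicator circ s * z s)"])
    show "(\<lambda>s. indicator circ s * z s * indicator U (cis s)) \<in> borel_measurable lborel"
      by (rule borel_measurable_times[OF mz]) (use measurable_compose[OF mcis, of "indicator U :: complex \<Rightarrow> real"] O in simp)
    show "(\<lambda>s. indicator circ s * z s * F k (cis s)) \<in> borel_measurable lborel" for k
      by (rule borel_measurable_times[OF mz]) (use measurable_compose[OF mcis borel_measurable_continuous_onI[OF cF[of k]]] in simp)
    show "integrable lborel (\<lambda>s. norm (indicator circ s * z s))"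
      using zi by (intro integrable_norm) (simp add: set_integrable_def)
    have "(\<lambda>k. F k w) \<longlonglongrightarrow> indicator U w" for w
    proof (cases "w \<in> U")
      case True
      then have "0 < infdist w (- U)"
        using O by (intro infdist_pos_not_in_closed) auto
      then obtain N where N: "1 < real N * infdist w (- U)" using reals_Archimedean3 by blast
      have "\<forall>\<^sub>F k in sequentially. F k w = 1"
        using eventually_ge_at_top[of N]
      proof eventually_elim
        case (elim k)
        have "real N * infdist w (- U) \<le> real k * infdist w (- U)"
          using elim infdist_nonneg by (intro mult_right_mono) auto
        then show ?case using N by (simp add: F_def)
      qed
      then show ?thesis using True by (simp add: tendsto_eventually)
    next
      case False
      then show ?thesis by (simp add: F_def)
    qed
    then show "AE s in lborel. (\<lambda>k. indicator circ s * z s * F k (cis s)) \<longlonglongrightarrow> indicator circ s * z s * indicator U (cis s)"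
      by (intro AE_I2 tendsto_mult tendsto_const)
    have "\<bar>F k w\<bar> \<le> 1" for k w by (simp add: F_def infdist_nonneg)
    then show "AE s in lborel. norm (indicator circ s * z s * F k (cis s)) \<le> norm (indicator circ s * z s)" for k
      by (intro AE_I2) (simp add: abs_mult mult_left_le)
  qed
  moreover have "(LINT s|lborel. (indicator circ s * z s) * F k (cis s)) = 0" for k
    using zero[of k] by (simp add: set_lebesgue_integral_def mult.assoc)
  ultimately have "(\<lambda>k. 0) \<longlonglongrightarrow> (LINT s|lborel. (indicator circ s * z s) * indicator U (cis s))"
    by (simp only:)
  then have "(LINT s|lborel. (indicator circ s * z s) * indicator U (cis s)) = 0"
    by (rule LIMSEQ_unique) (rule tendsto_const)
  then show ?thesis by (simp add: set_lebesgue_integral_def mult.assoc)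
qed

text \<open>
  Up to its end points, the arc over \<open>{x<..}\<close> is the preimage of a ray under the continuous branch
  of the argument, hence open.
\<close>

lemma integral_tail_zero: "(LINT s|lborel. indicator circ s * z s * indicator {x<..} s) = 0"
proof -
  define U where "U = {w \<in> - \<real>\<^sub>\<ge>\<^sub>0. Arg2pi w \<in> {x<..}}"
  have "open U" unfolding U_def
    using continuous_open_preimage[of "- \<real>\<^sub>\<ge>\<^sub>0" Arg2pi "{x<..}"]
      continuous_at_imp_continuous_on[of "- \<real>\<^sub>\<ge>\<^sub>0" Arg2pi] continuous_at_Arg2pi
    by (simp add: vimage_def Int_def open_Compl)
  moreover have "0 \<notin> U" by (simp add: U_def)
  ultimately have 0: "(LINT s:circ|lborel. z s * indicator U (cis s)) = 0"
    by (intro integral_on_open_zero) auto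
  have "AE s in lborel. s \<noteq> 0" "AE s in lborel. s \<noteq> 2 * pi" by (rule AE_lborel_singleton)+
  then have "AE s in lborel. indicator circ s * z s * indicator {x<..} s = indicator circ s *\<^sub>R (z s * indicator U (cis s))"
  proof eventually_elim
    case (elim s)
    show ?case
    proof (cases "s \<in> circ")
      case True
      then have s: "0 < s" "s < 2 * pi" using elim by auto
      have arg: "Arg2pi (cis s) = s"
        using s by (intro Arg2pi_unique[of 1]) (auto simp: cis_conv_exp)
      have "cis s \<notin> \<real>\<^sub>\<ge>\<^sub>0"
      proof
        assume "cis s \<in> \<real>\<^sub>\<ge>\<^sub>0"
        then have "cis s \<in> \<real> \<and> 0 \<le> Re (cis s)"
          by (simp add: complex_nonneg_Reals_iff complex_is_Real_iff)
        then have "Arg2pi (cis s) = 0" by (simp only: Arg2pi_eq_0 simp_thms)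
        then show False using arg s by simp
      qed
      then have "cis s \<in> U \<longleftrightarrow> s \<in> {x<..}" using arg s by (auto simp: U_def)
      then show ?thesis by (auto simp: indicator_def)
    qed simp
  qed
  then have "(LINT s|lborel. indicator circ s * z s * indicator {x<..} s)
      = (LINT s|lborel. indicator circ s *\<^sub>R (z s * indicator U (cis s)))"
  proof (rule integral_cong_AE[rotated 2])
    have mz: "(\<lambda>s. indicator circ s * z s) \<in> borel_measurable lborel"
      using borel_measurable_integrable[OF zi[unfolded set_integrable_def]] by simp
    then show "(\<lambda>s. indicator circ s * z s * indicator {x<..} s) \<in> borel_measurable lborel"
      by (rule borel_measurable_times) simp
    have mcis: "cis \<in> borel_measurable borel"
      by (intro borel_measurable_continuous_onI continuous_intros)
    have "(\<lambda>s. indicator circ s * z s * indicator U (cis s)) \<in> borel_measurable lborel"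
      by (rule borel_measurable_times[OF mz]) (use measurable_compose[OF mcis, of "indicator U :: complex \<Rightarrow> real"] \<open>open U\<close> in simp)
    then show "(\<lambda>s. indicator circ s *\<^sub>R (z s * indicator U (cis s))) \<in> borel_measurable lborel"
      by (simp add: mult.assoc)
  qed
  then show ?thesis using 0 by (simp add: set_lebesgue_integral_def)
qed

text \<open>
  The measures with densities the positive and the negative part of \<open>z\<close> agree on all half-lines, hence
  everywhere.
\<close>

lemma fundamental_lemma_real: "AE s in lborel. s \<in> circ \<longrightarrow> z s = 0"
proof -
  let ?z = "\<lambda>s. indicator circ s * z s"
  have int: "integrable lborel ?z" using zi by (simp add: set_integrable_def)
  have mz: "?z \<in> borel_measurable lborel" using int by simp
  let ?M = "density lborel (\<lambda>s. ennreal (max 0 (?z s)))"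
  let ?N = "density lborel (\<lambda>s. ennreal (max 0 (- ?z s)))"
  have ip: "integrable lborel (\<lambda>s. max 0 (?z s) * indicator {x<..} s)"
       and im: "integrable lborel (\<lambda>s. max 0 (- ?z s) * indicator {x<..} s)" for x
    by (intro integrable_real_mult_indicator integrable_max int integrable_minus[OF int]; simp)+
  have e1: "emeasure ?M {x<..} = ennreal (LINT s|lborel. max 0 (?z s) * indicator {x<..} s)" for x
  proof -
    have "emeasure ?M {x<..} = (\<integral>\<^sup>+s. ennreal (max 0 (?z s)) * indicator {x<..} s \<partial>lborel)"
      using mz by (intro emeasure_density) auto
    also have "\<dots> = (\<integral>\<^sup>+s. ennreal (max 0 (?z s) * indicator {x<..} s) \<partial>lborel)"
      by (intro nn_integral_cong) (auto simp: indicator_def)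
    also have "\<dots> = ennreal (LINT s|lborel. max 0 (?z s) * indicator {x<..} s)"
      by (intro nn_integral_eq_integral ip) auto
    finally show ?thesis .
  qed
  have e2: "emeasure ?N {x<..} = ennreal (LINT s|lborel. max 0 (- ?z s) * indicator {x<..} s)" for x
  proof -
    have "emeasure ?N {x<..} = (\<integral>\<^sup>+s. ennreal (max 0 (- ?z s)) * indicator {x<..} s \<partial>lborel)"
      using mz by (intro emeasure_density) auto
    also have "\<dots> = (\<integral>\<^sup>+s. ennreal (max 0 (- ?z s) * indicator {x<..} s) \<partial>lborel)"
      by (intro nn_integral_cong) (auto simp: indicator_def)
    also have "\<dots> = ennreal (LINT s|lborel. max 0 (- ?z s) * indicator {x<..} s)"
      by (intro nn_integral_eq_integral im) auto
    finally show ?thesis .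
  qed
  have eq: "(LINT s|lborel. max 0 (?z s) * indicator {x<..} s) = (LINT s|lborel. max 0 (- ?z s) * indicator {x<..} s)" for x
  proof -
    have "(LINT s|lborel. max 0 (?z s) * indicator {x<..} s) - (LINT s|lborel. max 0 (- ?z s) * indicator {x<..} s)
       = (LINT s|lborel. max 0 (?z s) * indicator {x<..} s - max 0 (- ?z s) * indicator {x<..} s)"
      by (rule Bochner_Integration.integral_diff[OF ip im, symmetric])
    also have "\<dots> = (LINT s|lborel. ?z s * indicator {x<..} s)"
      by (intro Bochner_Integration.integral_cong) (auto simp: max_def indicator_def)
    also have "\<dots> = 0" by (rule integral_tail_zero)
    finally show ?thesis by simp
  qed
  have "?M = ?N"
    by (rule measure_eqI_lessThan) (simp_all add: e1 e2 eq)
  then have "AE s in lborel. ennreal (max 0 (?z s)) = ennreal (max 0 (- ?z s))"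
    using mz by (intro sigma_finite_measure.density_unique[OF lborel.sigma_finite_measure_axioms]) auto
  then show ?thesis
  proof eventually_elim
    case (elim s)
    then have "max 0 (?z s) = max 0 (- ?z s)" by (subst (asm) ennreal_inj) auto
    then have "?z s = 0" by linarith
    then show ?case by (simp add: indicator_def)
  qed
qed

end

lemma antiderivative_test_function:
  assumes sm: "smooth_real \<phi>" and per: "circle_periodic \<phi>" and mean: "(LINT s:circ|lborel. \<phi> s) = 0"
  obtains \<Phi> where "smooth_real \<Phi>" "circle_periodic \<Phi>" "\<And>s. deriv \<Phi> s = \<phi> s"
proof -
  have c: "continuous_on UNIV \<phi>" using smooth_real_D(2)[OF sm] .
  obtain \<Phi> where "\<Phi> 0 = 0" and \<Phi>: "\<And>x. (\<Phi> has_real_derivative \<phi> x) (at x)"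
    by (rule real_antiderivative[OF c]) (rule that)
  have "Ck_on n UNIV \<Phi>" for n
    using Ck_on_Suc_imp[OF Ck_on_SucI[of UNIV \<Phi> \<phi> n, OF \<Phi> smooth_real_imp_Ck[OF sm]]] .
  then have "smooth_real \<Phi>" by (rule Ck_imp_smooth_real)
  have p: "\<phi> (s + 2 * pi) = \<phi> s" for s
    using per by (rule periodic_fun_simple.plus_period)
  have "((\<lambda>s. \<Phi> (s + 2 * pi) - \<Phi> s) has_real_derivative 0) (at s)" for s
  proof -
    have "((\<lambda>s. \<Phi> (s + 2 * pi)) has_real_derivative \<phi> s) (at s)"
      using DERIV_shift[THEN iffD1, OF \<Phi>[of "s + 2 * pi"]] unfolding p .
    from DERIV_diff[OF this \<Phi>[of s]] show ?thesis by simp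
  qed
  then have k: "\<Phi> (s + 2 * pi) - \<Phi> s = \<Phi> (0 + 2 * pi) - \<Phi> 0" for s
    using DERIV_isconst_all[of "\<lambda>s. \<Phi> (s + 2 * pi) - \<Phi> s"] by blast
  have "(LINT s:circ|lborel. \<phi> s) = \<Phi> (2 * pi) - \<Phi> 0"
    unfolding set_lebesgue_integral_def
    by (rule integral_FTC_Icc)
      (use \<Phi> c in \<open>auto simp: has_real_derivative_iff_has_vector_derivative[symmetric]
        intro: has_field_derivative_at_within continuous_on_subset\<close>)
  then have "\<Phi> (s + 2 * pi) = \<Phi> s" for s using k[of s] mean by simp
  then have "circle_periodic \<Phi>" by (rule circle_periodicI)
  then show ?thesis using that[of \<Phi>] \<open>smooth_real \<Phi>\<close> \<Phi> by (simp add: DERIV_imp_deriv)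
qed

section \<open>Weak derivatives on the circle\<close>

lemma set_integrable_complex_parts:
  assumes "set_integrable lborel A (f :: real \<Rightarrow> complex)"
  shows "set_integrable lborel A (\<lambda>s. Re (f s))" "set_integrable lborel A (\<lambda>s. Im (f s))"
    "(LINT s:A|lborel. Re (f s)) = Re (LINT s:A|lborel. f s)"
    "(LINT s:A|lborel. Im (f s)) = Im (LINT s:A|lborel. f s)"
proof -
  have i: "integrable lborel (\<lambda>s. indicator A s *\<^sub>R f s)"
    using assms by (simp add: set_integrable_def)
  have e: "Re (indicator A s *\<^sub>R f s) = indicator A s *\<^sub>R Re (f s)"
    "Im (indicator A s *\<^sub>R f s) = indicator A s *\<^sub>R Im (f s)" for s by simp_all
  show "set_integrable lborel A (\<lambda>s. Re (f s))"
    using integrable_bounded_linear[OF bounded_linear_Re i] unfolding set_integrable_def e .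
  show "set_integrable lborel A (\<lambda>s. Im (f s))"
    using integrable_bounded_linear[OF bounded_linear_Im i] unfolding set_integrable_def e .
  show "(LINT s:A|lborel. Re (f s)) = Re (LINT s:A|lborel. f s)"
    using integral_bounded_linear[OF bounded_linear_Re i] unfolding set_lebesgue_integral_def e .
  show "(LINT s:A|lborel. Im (f s)) = Im (LINT s:A|lborel. f s)"
    using integral_bounded_linear[OF bounded_linear_Im i] unfolding set_lebesgue_integral_def e .
qed

lemma continuous_of_real: "continuous_on S f \<Longrightarrow> continuous_on S (\<lambda>s. complex_of_real (f s))"
  by (rule continuous_on_of_real)

lemma fundamental_lemma_complex:
  assumes zi: "set_integrable lborel circ (z :: real \<Rightarrow> complex)"
    and test: "\<And>\<phi>. smooth_real \<phi> \<Longrightarrow> circle_periodic \<phi> \<Longrightarrow> (LINT s:circ|lborel. z s * of_real (\<phi> s)) = 0"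
  shows "AE s in lborel. s \<in> circ \<longrightarrow> z s = 0"
proof -
  have t: "(LINT s:circ|lborel. Re (z s) * \<phi> s) = 0 \<and> (LINT s:circ|lborel. Im (z s) * \<phi> s) = 0"
    if "smooth_real \<phi>" "circle_periodic \<phi>" for \<phi>
  proof -
    have i: "set_integrable lborel circ (\<lambda>s. z s * of_real (\<phi> s))"
      by (rule set_integrable_mult_continuous[OF zi continuous_of_real[OF smooth_real_D(2)[OF that(1)]]])
    show ?thesis using set_integrable_complex_parts(3,4)[OF i] test[OF that] by simp
  qed
  have "AE s in lborel. s \<in> circ \<longrightarrow> Re (z s) = 0"
    by (rule fundamental_lemma_real[OF set_integrable_complex_parts(1)[OF zi]]) (use t in blast)
  moreover have "AE s in lborel. s \<in> circ \<longrightarrow> Im (z s) = 0"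
    by (rule fundamental_lemma_real[OF set_integrable_complex_parts(2)[OF zi]]) (use t in blast)
  ultimately show ?thesis by eventually_elim (simp add: complex_eq_iff)
qed

lemma LINT_circ_const: "(LINT s:circ|lborel. (c :: 'a::{banach, second_countable_topology})) = (2 * pi) *\<^sub>R c"
  by (simp add: set_lebesgue_integral_def)

lemma set_integrable_circ_continuous:
  fixes g :: "real \<Rightarrow> 'a::{banach, second_countable_topology}"
  assumes "continuous_on circ g"
  shows "set_integrable lborel circ g"
  unfolding set_integrable_def by (rule borel_integrable_compact[OF _ assms]) simp

text \<open>
  A test function minus its mean is the derivative of a test function, so \<open>z\<close> minus its mean is
  orthogonal to all test functions.
\<close>

lemma du_bois_reymond:
  assumes zi: "set_integrable lborel circ (z :: real \<Rightarrow> complex)"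
    and test: "\<And>\<phi>. smooth_real \<phi> \<Longrightarrow> circle_periodic \<phi> \<Longrightarrow> (LINT s:circ|lborel. z s * of_real (deriv \<phi> s)) = 0"
  obtains C where "AE s in lborel. s \<in> circ \<longrightarrow> z s = C"
proof -
  define C where "C = (LINT s:circ|lborel. z s) / of_real (2 * pi)"
  have "AE s in lborel. s \<in> circ \<longrightarrow> z s - C = 0"
  proof (rule fundamental_lemma_complex)
    have ci: "set_integrable lborel circ (\<lambda>s. C)"
      by (rule set_integrable_circ_continuous) (rule continuous_on_const)
    show "set_integrable lborel circ (\<lambda>s. z s - C)" by (rule set_integral_diff(1)[OF zi ci])
    fix \<phi> assume \<phi>: "smooth_real \<phi>" "circle_periodic \<phi>"
    note c\<phi> = smooth_real_D(2)[OF \<phi>(1)]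
    have ip: "set_integrable lborel circ \<phi>"
      by (rule set_integrable_circ_continuous[OF continuous_on_subset[OF c\<phi>]]) simp
    define m where "m = (LINT s:circ|lborel. \<phi> s) / (2 * pi)"
    have im: "set_integrable lborel circ (\<lambda>s. m)"
      by (rule set_integrable_circ_continuous) (rule continuous_on_const)
    have "Ck_on n UNIV (\<lambda>s. \<phi> s + (- m))" for n
      by (rule Ck_on_add[OF smooth_real_imp_Ck[OF \<phi>(1)] Ck_on_const])
    then have s1: "smooth_real (\<lambda>s. \<phi> s + (- m))" by (rule Ck_imp_smooth_real)
    have s2: "circle_periodic (\<lambda>s. \<phi> s + (- m))"
      by (rule circle_periodicI) (simp add: periodic_fun_simple.plus_period[OF \<phi>(2)])
    have s3: "(LINT s:circ|lborel. \<phi> s + (- m)) = 0"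
      using set_integral_diff(2)[OF ip im] LINT_circ_const[of m] by (simp add: m_def)
    obtain \<Phi> where \<Phi>: "smooth_real \<Phi>" "circle_periodic \<Phi>" "\<And>s. deriv \<Phi> s = \<phi> s + (- m)"
      by (rule antiderivative_test_function[OF s1 s2 s3]) (rule that)
    have iz: "set_integrable lborel circ (\<lambda>s. z s * of_real (\<phi> s))"
      by (rule set_integrable_mult_continuous[OF zi continuous_of_real[OF c\<phi>]])
    have izm: "set_integrable lborel circ (\<lambda>s. z s * of_real m)"
      by (rule set_integrable_mult_continuous[OF zi]) (rule continuous_on_const)
    have "0 = (LINT s:circ|lborel. z s * of_real (\<phi> s) - z s * of_real m)"
      using test[OF \<Phi>(1,2)] unfolding \<Phi>(3) by (simp add: algebra_simps)
    also have "\<dots> = (LINT s:circ|lborel. z s * of_real (\<phi> s)) - (LINT s:circ|lborel. z s * of_real m)"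
      by (rule set_integral_diff(2)[OF iz izm])
    finally have 1: "(LINT s:circ|lborel. z s * of_real (\<phi> s)) = (LINT s:circ|lborel. z s) * of_real m"
      by simp
    have icp: "set_integrable lborel circ (\<lambda>s. C * of_real (\<phi> s))"
      by (rule set_integrable_mult_continuous[OF ci continuous_of_real[OF c\<phi>]])
    have "(LINT s:circ|lborel. (z s - C) * of_real (\<phi> s))
        = (LINT s:circ|lborel. z s * of_real (\<phi> s) - C * of_real (\<phi> s))"
      by (simp add: left_diff_distrib)
    also have "\<dots> = (LINT s:circ|lborel. z s * of_real (\<phi> s)) - (LINT s:circ|lborel. C * of_real (\<phi> s))"
      by (rule set_integral_diff(2)[OF iz icp])
    also have "(LINT s:circ|lborel. C * of_real (\<phi> s)) = C * of_real (LINT s:circ|lborel. \<phi> s)"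
      by (simp add: set_lebesgue_integral_def scaleR_conv_of_real mult.left_commute[of _ C] flip: of_real_mult)
    also have "(LINT s:circ|lborel. \<phi> s) = 2 * pi * m" by (simp add: m_def)
    finally show "(LINT s:circ|lborel. (z s - C) * of_real (\<phi> s)) = 0"
      unfolding 1 by (simp add: C_def field_simps)
  qed
  then have "AE s in lborel. s \<in> circ \<longrightarrow> z s = C" by simp
  then show ?thesis by (rule that)
qed

lemma L2_circleD:
  assumes "u \<in> L2_circle"
  shows "\<And>s. u (s + 2 * pi) = u s" "u \<in> borel_measurable borel"
    "set_integrable lborel circ (\<lambda>s. (cmod (u s))\<^sup>2)" "set_integrable lborel circ u"
    "\<And>s k. u (s + of_int k * (2 * pi)) = u s"
proof -
  have p: "circle_periodic u" and m: "u \<in> borel_measurable borel"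
    and i: "set_integrable lborel circ (\<lambda>s. (cmod (u s))\<^sup>2)"
    using assms unfolding L2_circle_def by auto
  show "u (s + 2 * pi) = u s" for s by (rule periodic_fun_simple.plus_period[OF p])
  interpret periodic_fun_simple u "2 * pi" by (rule p)
  show "u (s + of_int k * (2 * pi)) = u s" for s k by (rule plus_of_int)
  show "u \<in> borel_measurable borel" "set_integrable lborel circ (\<lambda>s. (cmod (u s))\<^sup>2)" by fact+
  have i1: "set_integrable lborel circ (\<lambda>s. 1 + (cmod (u s))\<^sup>2)"
    by (rule set_integral_add(1)[OF set_integrable_circ_continuous i]) (rule continuous_on_const)
  have m2: "(\<lambda>s. indicator circ s *\<^sub>R u s) \<in> borel_measurable lborel" using m by simp
  show "set_integrable lborel circ u" unfolding set_integrable_def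
  proof (rule Bochner_Integration.integrable_bound[OF i1[unfolded set_integrable_def] m2], rule AE_I2)
    fix s :: real
    have "0 \<le> (cmod (u s) - 1)\<^sup>2" by simp
    then have "2 * cmod (u s) \<le> 1 + (cmod (u s))\<^sup>2" by (simp add: power2_eq_square algebra_simps)
    then have "cmod (u s) \<le> \<bar>1 + (cmod (u s))\<^sup>2\<bar>" using norm_ge_zero[of "u s"] by linarith
    then show "norm (indicator circ s *\<^sub>R u s) \<le> norm (indicator circ s *\<^sub>R (1 + (cmod (u s))\<^sup>2))"
      by (simp add: indicator_def)
  qed
qed

text \<open>
  Fubini's theorem on the triangle \<open>t \<le> s\<close>.
\<close>

lemma indefinite_integral_by_parts:
  fixes v :: "real \<Rightarrow> complex"
  assumes v: "set_integrable lborel circ v" and vm: "v \<in> borel_measurable borel" and \<phi>: "smooth_real \<phi>"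
  shows "(LINT s:circ|lborel. (LINT t:{0..s}|lborel. v t) * of_real (deriv \<phi> s))
    = of_real (\<phi> (2 * pi)) * (LINT t:circ|lborel. v t) - (LINT t:circ|lborel. v t * of_real (\<phi> t))"
proof -
  note c\<phi>' = smooth_real_D(3)[OF \<phi>]
  have m\<phi>'[measurable]: "deriv \<phi> \<in> borel_measurable borel" by (rule borel_measurable_continuous_onI[OF c\<phi>'])
  note vm[measurable]
  have "bounded (deriv \<phi> ` circ)"
    by (intro compact_imp_bounded compact_continuous_image continuous_on_subset[OF c\<phi>']) auto
  then obtain K where "\<forall>x\<in>deriv \<phi> ` circ. norm x \<le> K" unfolding bounded_iff by blast
  then have K: "\<And>s. s \<in> circ \<Longrightarrow> \<bar>deriv \<phi> s\<bar> \<le> K" by simp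
  have K0: "0 \<le> K" using K[of 0] by simp
  define f :: "real \<Rightarrow> real \<Rightarrow> complex" where
    "f = (\<lambda>t s. (indicator circ t * indicator circ s * (if t \<le> s then 1 else 0)) *\<^sub>R (v t * of_real (deriv \<phi> s)))"
  have fm: "case_prod f \<in> borel_measurable (lborel \<Otimes>\<^sub>M lborel)"
    unfolding f_def split_beta by measurable
  have fb: "norm (f t s) \<le> indicator circ s * (K * norm (indicator circ t *\<^sub>R v t))" for t s
  proof (cases "t \<in> circ \<and> s \<in> circ \<and> t \<le> s")
    case True
    have "cmod (v t) * \<bar>deriv \<phi> s\<bar> \<le> cmod (v t) * K" using K[of s] True by (intro mult_left_mono) auto
    then show ?thesis using True by (simp add: f_def norm_mult mult.commute[of K])
  next
    case False
    then have "f t s = 0" by (auto simp: f_def indicator_def)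
    then show ?thesis using K0 by simp
  qed
  have ib: "integrable lborel (\<lambda>s. indicator circ s * (K * norm (indicator circ t *\<^sub>R v t)))" for t
    by (intro integrable_mult_left) simp
  have its: "integrable lborel (\<lambda>s. f t s)" for t
  proof (rule Bochner_Integration.integrable_bound[OF ib[of t]])
    show "f t \<in> borel_measurable lborel" unfolding f_def by measurable
    show "AE s in lborel. norm (f t s) \<le> norm (indicator circ s * (K * norm (indicator circ t *\<^sub>R v t)))"
      using fb[of t] K0 by (intro AE_I2) (simp add: abs_mult)
  qed
  have F: "integrable (lborel \<Otimes>\<^sub>M lborel) (case_prod f)"
  proof (rule lborel_pair.Fubini_integrable[OF fm])
    show "AE t in lborel. integrable lborel (\<lambda>s. case_prod f (t, s))" using its by simp
    have iv: "integrable lborel (\<lambda>t. 2 * pi * (K * norm (indicator circ t *\<^sub>R v t)))"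
      using v unfolding set_integrable_def by (intro integrable_mult_right integrable_norm)
    show "integrable lborel (\<lambda>t. LINT s|lborel. norm (case_prod f (t, s)))"
    proof (rule Bochner_Integration.integrable_bound[OF iv])
      show "(\<lambda>t. LINT s|lborel. norm (case_prod f (t, s))) \<in> borel_measurable lborel"
        using fm by (intro lborel.borel_measurable_lebesgue_integral) simp
      have "(LINT s|lborel. norm (f t s)) \<le> 2 * pi * (K * norm (indicator circ t *\<^sub>R v t))" for t
      proof -
        have "(LINT s|lborel. norm (f t s)) \<le> (LINT s|lborel. indicator circ s * (K * norm (indicator circ t *\<^sub>R v t)))"
          by (rule integral_mono[OF integrable_norm[OF its] ib fb])
        then show ?thesis by simp
      qed
      moreover have "0 \<le> (LINT s|lborel. norm (f t s))" for t by (intro integral_nonneg_AE) auto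
      ultimately show "AE t in lborel. norm (LINT s|lborel. norm (case_prod f (t, s)))
           \<le> norm (2 * pi * (K * norm (indicator circ t *\<^sub>R v t)))"
        using K0 by (intro AE_I2) (simp add: abs_mult)
    qed
  qed
  have "(LINT s|lborel. LINT t|lborel. f t s) = (LINT t|lborel. LINT s|lborel. f t s)"
    by (rule lborel_pair.Fubini_integral[OF F])
  moreover have "(LINT t|lborel. f t s) = indicator circ s *\<^sub>R ((LINT t:{0..s}|lborel. v t) * of_real (deriv \<phi> s))" for s
  proof -
    define c where "c = indicator circ s *\<^sub>R complex_of_real (deriv \<phi> s)"
    have "f t s = c * (indicator {0..s} t *\<^sub>R v t)" for t
      by (auto simp: f_def indicator_def c_def)
    then have "(LINT t|lborel. f t s) = c * (LINT t|lborel. indicator {0..s} t *\<^sub>R v t)"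
      by (simp only: integral_mult_right_zero)
    then show ?thesis by (simp add: set_lebesgue_integral_def c_def mult.commute)
  qed
  moreover have "(LINT s|lborel. f t s) = indicator circ t *\<^sub>R (of_real (\<phi> (2 * pi)) * v t - v t * of_real (\<phi> t))" for t
  proof (cases "t \<in> circ")
    case True
    have "(LINT s|lborel. indicator {t..2*pi} s *\<^sub>R deriv \<phi> s) = \<phi> (2 * pi) - \<phi> t"
    proof (rule integral_FTC_Icc)
      show "t \<le> 2 * pi" using True by simp
      show "(\<phi> has_vector_derivative deriv \<phi> x) (at x within {t..2*pi})" for x
        using has_field_derivative_at_within[OF smooth_real_D(1)[OF \<phi>]]
        unfolding has_real_derivative_iff_has_vector_derivative .
      show "continuous_on {t..2*pi} (deriv \<phi>)" by (rule continuous_on_subset[OF c\<phi>']) simp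
    qed
    moreover have "f t s = v t * of_real (indicator {t..2*pi} s *\<^sub>R deriv \<phi> s)" for s
      using True by (auto simp: f_def indicator_def)
    ultimately have "(LINT s|lborel. f t s) = v t * of_real (\<phi> (2 * pi) - \<phi> t)"
      by (simp only: integral_mult_right_zero integral_complex_of_real)
    then show ?thesis using True by (simp add: algebra_simps)
  next
    case False
    then show ?thesis by (simp add: f_def)
  qed
  ultimately have *: "(LINT s:circ|lborel. (LINT t:{0..s}|lborel. v t) * of_real (deriv \<phi> s))
     = (LINT t:circ|lborel. of_real (\<phi> (2 * pi)) * v t - v t * of_real (\<phi> t))"
    by (simp add: set_lebesgue_integral_def)
  have i1: "set_integrable lborel circ (\<lambda>t. of_real (\<phi> (2 * pi)) * v t)"
    using v by simp
  have i2: "set_integrable lborel circ (\<lambda>t. v t * of_real (\<phi> t))"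
    by (rule set_integrable_mult_continuous[OF v continuous_of_real[OF smooth_real_D(2)[OF \<phi>]]])
  show ?thesis unfolding * using set_integral_diff(2)[OF i1 i2] by simp
qed

lemma integral_cong_AE_lborel:
  fixes f g :: "real \<Rightarrow> complex"
  assumes "AE x in lborel. x \<in> S \<longrightarrow> f x = g x"
  shows "integral S f = integral S g"
proof -
  obtain N where N: "{x \<in> space lborel. \<not> (x \<in> S \<longrightarrow> f x = g x)} \<subseteq> N" "N \<in> null_sets lborel"
    using assms by (rule AE_E) (auto simp: null_sets_def)
  have "negligible N"
    using N(2) by (simp add: negligible_iff_null_sets null_sets_completionI)
  then show ?thesis by (rule integral_spike) (use N(1) in auto)
qed

lemma has_weak_derivD:
  assumes "has_weak_deriv u v" "smooth_real \<phi>" "circle_periodic \<phi>"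
  shows "(LINT s:circ|lborel. u s * of_real (deriv \<phi> s)) = - (LINT s:circ|lborel. v s * of_real (\<phi> s))"
  by (rule assms(1)[unfolded has_weak_deriv_def, rule_format, OF conjI[OF assms(2,3)]])

lemma smooth_real_const: "smooth_real (\<lambda>s. c)"
  by (rule Ck_imp_smooth_real) (rule Ck_on_const)

text \<open>
  The difference between \<open>u\<close> and the primitive of \<open>v\<close> has weak derivative \<open>0\<close>. Testing with the
  constant function shows that \<open>v\<close> has mean \<open>0\<close>, so the primitive is periodic.
\<close>

lemma weak_deriv_representation:
  assumes u: "u \<in> L2_circle" and v: "v \<in> L2_circle" and w: "has_weak_deriv u v"
  obtains C where "AE s in lborel. s \<in> circ \<longrightarrow> u s = C + integral {0..s} v" "integral circ v = 0"
proof -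
  note vD = L2_circleD[OF v] note uD = L2_circleD[OF u]
  have test: "(LINT s:circ|lborel. u s * of_real (deriv \<phi> s)) = - (LINT s:circ|lborel. v s * of_real (\<phi> s))"
    if "smooth_real \<phi>" "circle_periodic \<phi>" for \<phi> by (rule has_weak_derivD[OF w that])
  have "circle_periodic (\<lambda>s. 1 :: real)" by (rule circle_periodicI) simp
  from test[OF smooth_real_const this] have v0: "(LINT s:circ|lborel. v s) = 0" by simp
  have vs: "set_integrable lborel {0..s} v" if "s \<in> circ" for s
    by (rule set_integrable_subset[OF vD(4)]) (use that in auto)
  have IV: "(LINT t:{0..s}|lborel. v t) = integral {0..s} v" if "s \<in> circ" for s
    using set_borel_integral_eq_integral(2)[OF vs[OF that]] .
  have cI: "continuous_on circ (\<lambda>s. integral {0..s} v)"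
    by (rule indefinite_integral_continuous_1[OF set_borel_integral_eq_integral(1)[OF vD(4)]])
  have iI: "set_integrable lborel circ (\<lambda>s. integral {0..s} v)"
    by (rule set_integrable_circ_continuous[OF cI])
  have d: "set_integrable lborel circ (\<lambda>s. u s - integral {0..s} v)"
    by (rule set_integral_diff(1)[OF uD(4) iI])
  have "\<exists>C. AE s in lborel. s \<in> circ \<longrightarrow> u s - integral {0..s} v = C"
  proof (rule du_bois_reymond[OF d])
    fix \<phi> assume \<phi>: "smooth_real \<phi>" "circle_periodic \<phi>"
    have c\<phi>: "continuous_on UNIV (\<lambda>s. complex_of_real (deriv \<phi> s))"
      by (rule continuous_of_real[OF smooth_real_D(3)[OF \<phi>(1)]])
    have i1: "set_integrable lborel circ (\<lambda>s. u s * of_real (deriv \<phi> s))"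
      by (rule set_integrable_mult_continuous[OF uD(4) c\<phi>])
    have i2: "set_integrable lborel circ (\<lambda>s. integral {0..s} v * of_real (deriv \<phi> s))"
      by (rule set_integrable_mult_continuous[OF iI c\<phi>])
    have "(LINT s:circ|lborel. (u s - integral {0..s} v) * of_real (deriv \<phi> s))
       = (LINT s:circ|lborel. u s * of_real (deriv \<phi> s)) - (LINT s:circ|lborel. integral {0..s} v * of_real (deriv \<phi> s))"
      using set_integral_diff(2)[OF i1 i2] by (simp add: left_diff_distrib)
    also have "(LINT s:circ|lborel. integral {0..s} v * of_real (deriv \<phi> s))
       = (LINT s:circ|lborel. (LINT t:{0..s}|lborel. v t) * of_real (deriv \<phi> s))"
      by (rule set_lebesgue_integral_cong) (auto simp: IV)
    also have "\<dots> = - (LINT t:circ|lborel. v t * of_real (\<phi> t))"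
      using indefinite_integral_by_parts[OF vD(4) vD(2) \<phi>(1)] v0 by simp
    finally show "(LINT s:circ|lborel. (u s - integral {0..s} v) * of_real (deriv \<phi> s)) = 0"
      using test[OF \<phi>] by simp
  qed blast
  then obtain C where "AE s in lborel. s \<in> circ \<longrightarrow> u s - integral {0..s} v = C" by blast
  then have "AE s in lborel. s \<in> circ \<longrightarrow> u s = C + integral {0..s} v"
    by eventually_elim (simp add: diff_eq_eq)
  moreover have "integral circ v = 0" using v0 IV[of "2 * pi"] by simp
  ultimately show ?thesis by (rule that)
qed

lemma weak_deriv_unique:
  assumes "v \<in> L2_circle" "v2 \<in> L2_circle" "has_weak_deriv u v" "has_weak_deriv u v2"
  shows "AE s in lborel. v s = v2 s"
proof (rule AE_periodic)
  note D1 = L2_circleD[OF assms(1)] note D2 = L2_circleD[OF assms(2)]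
  show "v s = v2 s" if "v (s + of_int k * (2 * pi)) = v2 (s + of_int k * (2 * pi))" for s k
    using that unfolding D1(5) D2(5) .
  have "AE s in lborel. s \<in> circ \<longrightarrow> v s - v2 s = 0"
  proof (rule fundamental_lemma_complex)
    show "set_integrable lborel circ (\<lambda>s. v s - v2 s)" by (rule set_integral_diff(1)[OF D1(4) D2(4)])
    fix \<phi> assume \<phi>: "smooth_real \<phi>" "circle_periodic \<phi>"
    note c\<phi> = continuous_of_real[OF smooth_real_D(2)[OF \<phi>(1)]]
    have "(LINT s:circ|lborel. v s * of_real (\<phi> s)) = (LINT s:circ|lborel. v2 s * of_real (\<phi> s))"
      using has_weak_derivD[OF assms(3) \<phi>] has_weak_derivD[OF assms(4) \<phi>] by simp
    then show "(LINT s:circ|lborel. (v s - v2 s) * of_real (\<phi> s)) = 0"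
      using set_integral_diff(2)[OF set_integrable_mult_continuous[OF D1(4) c\<phi>]
          set_integrable_mult_continuous[OF D2(4) c\<phi>]] by (simp add: left_diff_distrib)
  qed
  then show "AE s in lborel. s \<in> circ \<longrightarrow> v s = v2 s" by simp
qed

lemma weak_deriv_AE:
  assumes "v \<in> L2_circle" "has_weak_deriv u v"
  shows "AE s in lborel. weak_deriv u s = v s" "weak_deriv u \<in> L2_circle" "has_weak_deriv u (weak_deriv u)"
proof -
  have "\<exists>v. v \<in> L2_circle \<and> has_weak_deriv u v" using assms by blast
  then have *: "weak_deriv u \<in> L2_circle \<and> has_weak_deriv u (weak_deriv u)"
    unfolding weak_deriv_def by (rule someI_ex)
  then show "weak_deriv u \<in> L2_circle" "has_weak_deriv u (weak_deriv u)" by auto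
  show "AE s in lborel. weak_deriv u s = v s"
    by (rule weak_deriv_unique) (use * assms in auto)
qed

lemma L2_circle_lin:
  assumes u: "u \<in> L2_circle" and v: "v \<in> L2_circle"
  shows "(\<lambda>s. \<alpha> * u s + \<beta> * v s) \<in> L2_circle"
proof -
  note uD = L2_circleD[OF u] note vD = L2_circleD[OF v]
  have m: "(\<lambda>s. \<alpha> * u s + \<beta> * v s) \<in> borel_measurable borel" using uD(2) vD(2) by simp
  have b: "set_integrable lborel circ (\<lambda>s. 2 * (cmod \<alpha>)\<^sup>2 * (cmod (u s))\<^sup>2 + 2 * (cmod \<beta>)\<^sup>2 * (cmod (v s))\<^sup>2)"
    using uD(3) vD(3) by (intro set_integral_add(1)) auto
  have "set_integrable lborel circ (\<lambda>s. (cmod (\<alpha> * u s + \<beta> * v s))\<^sup>2)"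
    unfolding set_integrable_def
  proof (rule Bochner_Integration.integrable_bound[OF b[unfolded set_integrable_def]], safe intro!: AE_I2)
    show "(\<lambda>s. indicator circ s *\<^sub>R (cmod (\<alpha> * u s + \<beta> * v s))\<^sup>2) \<in> borel_measurable lborel"
      using m by simp
    fix s :: real
    have "(cmod (\<alpha> * u s + \<beta> * v s))\<^sup>2 \<le> (cmod (\<alpha> * u s) + cmod (\<beta> * v s))\<^sup>2"
      by (intro power_mono norm_triangle_ineq) simp
    also have "\<dots> \<le> 2 * (cmod (\<alpha> * u s))\<^sup>2 + 2 * (cmod (\<beta> * v s))\<^sup>2"
      using sum_squares_bound[of "cmod (\<alpha> * u s)" "cmod (\<beta> * v s)"] by (simp add: power2_sum)
    finally have "(cmod (\<alpha> * u s + \<beta> * v s))\<^sup>2 \<le> 2 * (cmod \<alpha>)\<^sup>2 * (cmod (u s))\<^sup>2 + 2 * (cmod \<beta>)\<^sup>2 * (cmod (v s))\<^sup>2"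
      by (simp add: norm_mult power_mult_distrib)
    then show "norm (indicator circ s *\<^sub>R (cmod (\<alpha> * u s + \<beta> * v s))\<^sup>2)
       \<le> norm (indicator circ s *\<^sub>R (2 * (cmod \<alpha>)\<^sup>2 * (cmod (u s))\<^sup>2 + 2 * (cmod \<beta>)\<^sup>2 * (cmod (v s))\<^sup>2))"
      by (simp add: indicator_def)
  qed
  moreover have "circle_periodic (\<lambda>s. \<alpha> * u s + \<beta> * v s)"
    by (rule circle_periodicI) (simp add: uD(1) vD(1))
  ultimately show ?thesis using m unfolding L2_circle_def by simp
qed

lemma has_weak_deriv_lin:
  assumes L: "u \<in> L2_circle" "u' \<in> L2_circle" "v \<in> L2_circle" "v' \<in> L2_circle"
    and w: "has_weak_deriv u u'" "has_weak_deriv v v'"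
  shows "has_weak_deriv (\<lambda>s. \<alpha> * u s + \<beta> * v s) (\<lambda>s. \<alpha> * u' s + \<beta> * v' s)"
  unfolding has_weak_deriv_def
proof (intro allI impI, elim conjE)
  fix \<phi> assume \<phi>: "smooth_real \<phi>" "circle_periodic \<phi>"
  have lin: "(LINT s:circ|lborel. (\<alpha> * f s + \<beta> * g s) * of_real (\<psi> s)) =
      \<alpha> * (LINT s:circ|lborel. f s * of_real (\<psi> s)) + \<beta> * (LINT s:circ|lborel. g s * of_real (\<psi> s))"
    if "f \<in> L2_circle" "g \<in> L2_circle" "continuous_on UNIV \<psi>" for f g and \<psi> :: "real \<Rightarrow> real"
  proof -
    have i: "set_integrable lborel circ (\<lambda>s. f s * of_real (\<psi> s))" "set_integrable lborel circ (\<lambda>s. g s * of_real (\<psi> s))"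
      by (rule set_integrable_mult_continuous[OF L2_circleD(4) continuous_of_real]; fact)+
    have "(LINT s:circ|lborel. (\<alpha> * f s + \<beta> * g s) * of_real (\<psi> s)) =
      (LINT s:circ|lborel. \<alpha> * (f s * of_real (\<psi> s)) + \<beta> * (g s * of_real (\<psi> s)))"
      by (simp add: distrib_right mult.assoc)
    also have "\<dots> = (LINT s:circ|lborel. \<alpha> * (f s * of_real (\<psi> s))) + (LINT s:circ|lborel. \<beta> * (g s * of_real (\<psi> s)))"
      by (rule set_integral_add(2)) (use i in auto)
    finally show ?thesis by simp
  qed
  show "(LINT s:circ|lborel. (\<alpha> * u s + \<beta> * v s) * of_real (deriv \<phi> s)) =
      - (LINT s:circ|lborel. (\<alpha> * u' s + \<beta> * v' s) * of_real (\<phi> s))"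
    unfolding lin[OF L(1,3) smooth_real_D(3)[OF \<phi>(1)]] lin[OF L(2,4) smooth_real_D(2)[OF \<phi>(1)]]
    using has_weak_derivD[OF w(1) \<phi>] has_weak_derivD[OF w(2) \<phi>] by simp
qed

lemma has_weak_deriv_cong_AE:
  assumes "u \<in> borel_measurable borel" "u2 \<in> borel_measurable borel" "AE s in lborel. u s = u2 s"
    "has_weak_deriv u v"
  shows "has_weak_deriv u2 v"
  unfolding has_weak_deriv_def
proof (intro allI impI, elim conjE)
  fix \<phi> assume \<phi>: "smooth_real \<phi>" "circle_periodic \<phi>"
  have m: "deriv \<phi> \<in> borel_measurable borel"
    by (rule borel_measurable_continuous_onI[OF smooth_real_D(3)[OF \<phi>(1)]])
  have "(LINT s:circ|lborel. u s * of_real (deriv \<phi> s)) = (LINT s:circ|lborel. u2 s * of_real (deriv \<phi> s))"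
    by (rule set_lebesgue_integral_cong_AE) (use assms m in \<open>auto elim: eventually_mono\<close>)
  then show "(LINT s:circ|lborel. u2 s * of_real (deriv \<phi> s)) = - (LINT s:circ|lborel. v s * of_real (\<phi> s))"
    using has_weak_derivD[OF assms(4) \<phi>] by simp
qed

text \<open>
  The operator is defined through a chosen representative of the weak derivative; almost everywhere it
  does not depend on this choice.
\<close>

lemma magnetic_schrodinger_AE:
  assumes L: "u \<in> L2_circle" "v \<in> L2_circle" "w \<in> L2_circle"
    and d: "has_weak_deriv u v" "has_weak_deriv v w"
  shows "AE s in lborel. magnetic_schrodinger V \<xi> h u s =
     - of_real (h\<^sup>2) * w s - 2 * \<i> * of_real (h * \<xi>) * v s + of_real (\<xi>\<^sup>2) * u s + of_real (V s) * u s"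
proof -
  note W = weak_deriv_AE[OF L(2) d(1)]
  let ?m = "magnetic_momentum \<xi> h u"
  have m: "?m = (\<lambda>s. (- \<i> * of_real h) * weak_deriv u s + of_real \<xi> * u s)"
    by (auto simp: magnetic_momentum_def D\<^sub>s_def)
  let ?m1 = "\<lambda>s. (- \<i> * of_real h) * v s + of_real \<xi> * u s"
  let ?m' = "\<lambda>s. (- \<i> * of_real h) * w s + of_real \<xi> * v s"
  have L': "?m \<in> L2_circle" "?m1 \<in> L2_circle" "?m' \<in> L2_circle"
    unfolding m by (intro L2_circle_lin L W)+
  have "has_weak_deriv ?m1 ?m'" by (rule has_weak_deriv_lin[OF L(2,3,1,2) d(2,1)])
  moreover have "AE s in lborel. ?m1 s = ?m s" using W(1) unfolding m by eventually_elim simp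
  ultimately have "has_weak_deriv ?m ?m'"
    using has_weak_deriv_cong_AE[OF L2_circleD(2)[OF L'(2)] L2_circleD(2)[OF L'(1)]] by blast
  from weak_deriv_AE(1)[OF L'(3) this] W(1) show ?thesis
  proof eventually_elim
    case (elim s)
    have "magnetic_schrodinger V \<xi> h u s = of_real h * (- \<i> * weak_deriv ?m s) + of_real \<xi> * ?m s + of_real (V s) * u s"
      by (simp add: magnetic_schrodinger_def magnetic_momentum_def[of \<xi> h "magnetic_momentum \<xi> h u"] D\<^sub>s_def)
    also have "?m s = (- \<i> * of_real h) * v s + of_real \<xi> * u s" unfolding m using elim by simp
    finally show ?case unfolding elim(1)
      by (simp add: algebra_simps power2_eq_square)
  qed
qed

section \<open>Eigenfunctions as Bloch waves\<close>

text \<open>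
  Regularity: the equation expresses \<open>w\<close> by \<open>u\<close> and \<open>v\<close>, whose continuous representatives are
  primitives, so two integrations give a classical solution.
\<close>

lemma weak_solution_classical:
  assumes L: "u \<in> L2_circle" "v \<in> L2_circle" "w \<in> L2_circle"
    and d: "has_weak_deriv u v" "has_weak_deriv v w"
    and p: "continuous_on UNIV (p :: real \<Rightarrow> complex)"
    and eq: "AE s in lborel. s \<in> circ \<longrightarrow> w s = p s * u s + c * v s"
  obtains U U' where
    "\<And>s. s \<in> circ \<Longrightarrow> (U has_vector_derivative U' s) (at s within circ)"
    "\<And>s. s \<in> circ \<Longrightarrow> (U' has_vector_derivative (p s * U s + c * U' s)) (at s within circ)"
    "U (2 * pi) = U 0" "U' (2 * pi) = U' 0" "AE s in lborel. s \<in> circ \<longrightarrow> u s = U s"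
proof -
  obtain C1 where C1: "AE s in lborel. s \<in> circ \<longrightarrow> u s = C1 + integral {0..s} v" "integral circ v = 0"
    by (rule weak_deriv_representation[OF L(1,2) d(1)]) (rule that)
  obtain C2 where C2: "AE s in lborel. s \<in> circ \<longrightarrow> v s = C2 + integral {0..s} w" "integral circ w = 0"
    by (rule weak_deriv_representation[OF L(2,3) d(2)]) (rule that)
  define U where "U = (\<lambda>s. C1 + integral {0..s} v)"
  define U' where "U' = (\<lambda>s. C2 + integral {0..s} w)"
  define G where "G = (\<lambda>s. p s * U s + c * U' s)"
  have io: "v integrable_on circ" "w integrable_on circ"
    using set_borel_integral_eq_integral(1)[OF L2_circleD(4)[OF L(2)]]
      set_borel_integral_eq_integral(1)[OF L2_circleD(4)[OF L(3)]] .
  have cU: "continuous_on circ U" "continuous_on circ U'"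
    unfolding U_def U'_def by (intro continuous_on_add continuous_on_const indefinite_integral_continuous_1 io)+
  have cG: "continuous_on circ G" unfolding G_def
    by (intro continuous_on_add continuous_on_mult continuous_on_const cU continuous_on_subset[OF p]) simp
  have U2: "U s = C1 + integral {0..s} U'" if "s \<in> circ" for s
  proof -
    have "AE t in lborel. t \<in> {0..s} \<longrightarrow> v t = U' t"
      using C2(1) by eventually_elim (use that in \<open>simp add: U'_def\<close>)
    then show ?thesis unfolding U_def using integral_cong_AE_lborel by simp
  qed
  have U'2: "U' s = C2 + integral {0..s} G" if "s \<in> circ" for s
  proof -
    have "AE t in lborel. t \<in> {0..s} \<longrightarrow> w t = G t"
      using C1(1) C2(1) eq by eventually_elim (use that in \<open>simp add: U'_def U_def G_def\<close>)
    then show ?thesis unfolding U'_def using integral_cong_AE_lborel by simp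
  qed
  have dU: "(U has_vector_derivative U' s) (at s within circ)" if s: "s \<in> circ" for s
  proof -
    have "((\<lambda>s. integral {0..s} U') has_vector_derivative U' s) (at s within circ)"
      by (rule integral_has_vector_derivative[OF cU(2) s])
    from has_vector_derivative_add[OF has_vector_derivative_const this, of C1]
    have "((\<lambda>s. C1 + integral {0..s} U') has_vector_derivative U' s) (at s within circ)" by simp
    then show ?thesis by (rule has_vector_derivative_transform[OF s, rotated]) (rule U2)
  qed
  have dU': "(U' has_vector_derivative G s) (at s within circ)" if s: "s \<in> circ" for s
  proof -
    have "((\<lambda>s. integral {0..s} G) has_vector_derivative G s) (at s within circ)"
      by (rule integral_has_vector_derivative[OF cG s])
    from has_vector_derivative_add[OF has_vector_derivative_const this, of C2]
    have "((\<lambda>s. C2 + integral {0..s} G) has_vector_derivative G s) (at s within circ)" by simp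
    then show ?thesis by (rule has_vector_derivative_transform[OF s, rotated]) (rule U'2)
  qed
  show ?thesis
  proof (rule that[OF dU dU'[unfolded G_def]])
    show "U (2 * pi) = U 0" "U' (2 * pi) = U' 0" using C1(2) C2(2) by (simp_all add: U_def U'_def)
    show "AE s in lborel. s \<in> circ \<longrightarrow> u s = U s" using C1(1) by (simp add: U_def)
  qed
qed

lemma vector_derivative_zero_circ:
  fixes W :: "real \<Rightarrow> complex"
  assumes "\<And>t. t \<in> circ \<Longrightarrow> (W has_vector_derivative 0) (at t within circ)" "s \<in> circ"
  shows "W s = W 0"
proof (rule has_vector_derivative_zero_constant[of circ W])
  show "convex circ" by simp
  show "(W has_vector_derivative 0) (at t within circ)" if "t \<in> circ" for t by (rule assms(1)[OF that])
  fix c assume "\<And>x. x \<in> circ \<Longrightarrow> W x = c"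
  from this[of s] this[of 0] assms(2) show ?thesis by simp
qed

lemma hvd_continuous_on:
  fixes W :: "real \<Rightarrow> complex"
  assumes "\<And>s. (W has_vector_derivative W' s) (at s)"
  shows "continuous_on UNIV W"
  by (rule continuous_at_imp_continuous_on) (use has_vector_derivative_continuous[OF assms] in blast)

context hill
begin

lemma monodromy_der:
  "a' (s + 2 * pi) = (2 * mA\<^sup>2 - 1) * a' s + 2 * mA * mC * b' s"
  "b' (s + 2 * pi) = 2 * mA * mB * a' s + (2 * mA\<^sup>2 - 1) * b' s"
proof -
  have h: "a' (s + pi) = mA * a' s + mC * b' s" "b' (s + pi) = mB * a' s + mA * b' s" for s
    using solution_expansion(2)[OF shift_solution[OF ab(1)], of s]
      solution_expansion(2)[OF shift_solution[OF ab(2)], of s]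
    by (simp_all add: half_period_values)
  have e: "s + 2 * pi = (s + pi) + pi" by simp
  show "a' (s + 2 * pi) = (2 * mA\<^sup>2 - 1) * a' s + 2 * mA * mC * b' s"
    unfolding e h using monodromy_det by algebra
  show "b' (s + 2 * pi) = 2 * mA * mB * a' s + (2 * mA\<^sup>2 - 1) * b' s"
    unfolding e h using monodromy_det by algebra
qed

lemma ab_vector:
  "((\<lambda>s. complex_of_real (a s)) has_vector_derivative of_real (a' s)) (at s within S)"
  "((\<lambda>s. complex_of_real (a' s)) has_vector_derivative of_real (q s * a s)) (at s within S)"
  "((\<lambda>s. complex_of_real (b s)) has_vector_derivative of_real (b' s)) (at s within S)"
  "((\<lambda>s. complex_of_real (b' s)) has_vector_derivative of_real (q s * b s)) (at s within S)"
  by (rule has_vector_derivative_of_real[OF has_field_derivative_at_within],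
      rule ode_solution_D[OF ab(1)] ode_solution_D[OF ab(2)])+

text \<open>
  The coefficients of \<open>f\<close> in the basis \<open>a\<close>, \<open>b\<close> are Wronskians and hence constant.
\<close>

lemma complex_ode_representation:
  fixes f f1 :: "real \<Rightarrow> complex"
  assumes f: "\<And>s. s \<in> circ \<Longrightarrow> (f has_vector_derivative f1 s) (at s within circ)"
    and f1: "\<And>s. s \<in> circ \<Longrightarrow> (f1 has_vector_derivative of_real (q s) * f s) (at s within circ)"
    and s: "s \<in> circ"
  shows "f s = f 0 * of_real (a s) + f1 0 * of_real (b s)"
    "f1 s = f 0 * of_real (a' s) + f1 0 * of_real (b' s)"
proof -
  let ?W1 = "\<lambda>s. f s * of_real (b' s) - f1 s * of_real (b s)"
  let ?W2 = "\<lambda>s. f1 s * of_real (a s) - f s * of_real (a' s)"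
  have "(?W1 has_vector_derivative 0) (at t within circ)" if t: "t \<in> circ" for t
    using has_vector_derivative_diff[OF has_vector_derivative_mult[OF f[OF t] ab_vector(4)]
        has_vector_derivative_mult[OF f1[OF t] ab_vector(3)]]
    by (simp add: algebra_simps)
  from vector_derivative_zero_circ[OF this s] have W1: "?W1 s = f 0" using ab by simp
  have "(?W2 has_vector_derivative 0) (at t within circ)" if t: "t \<in> circ" for t
    using has_vector_derivative_diff[OF has_vector_derivative_mult[OF f1[OF t] ab_vector(1)]
        has_vector_derivative_mult[OF f[OF t] ab_vector(2)]]
    by (simp add: algebra_simps)
  from vector_derivative_zero_circ[OF this s] have W2: "?W2 s = f1 0" using ab by simp
  have "complex_of_real (a s * b' s - a' s * b s) = 1"
    unfolding wronskian_ev_od[OF cont, of s] by simp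
  then have W: "complex_of_real (a s) * of_real (b' s) - of_real (a' s) * of_real (b s) = 1" by simp
  show "f s = f 0 * of_real (a s) + f1 0 * of_real (b s)"
    unfolding W1[symmetric] W2[symmetric] using W by algebra
  show "f1 s = f 0 * of_real (a' s) + f1 0 * of_real (b' s)"
    unfolding W1[symmetric] W2[symmetric] using W by algebra
qed

end

lemma classical_weak_deriv:
  fixes W W' :: "real \<Rightarrow> complex"
  assumes W: "\<And>s. (W has_vector_derivative W' s) (at s)" and c: "continuous_on UNIV W'"
    and per: "W (2 * pi) = W 0"
  shows "has_weak_deriv W W'"
  unfolding has_weak_deriv_def
proof (intro allI impI, elim conjE)
  fix \<phi> assume \<phi>: "smooth_real \<phi>" "circle_periodic \<phi>"
  have cW: "continuous_on UNIV W"
    by (rule hvd_continuous_on[OF W])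
  note c\<phi> = continuous_of_real[OF smooth_real_D(2)[OF \<phi>(1)]] continuous_of_real[OF smooth_real_D(3)[OF \<phi>(1)]]
  have i1: "set_integrable lborel circ (\<lambda>s. W s * of_real (deriv \<phi> s))"
    by (rule set_integrable_circ_continuous) (intro continuous_on_mult continuous_on_subset[OF cW] continuous_on_subset[OF c\<phi>(2)]; simp)
  have i2: "set_integrable lborel circ (\<lambda>s. W' s * of_real (\<phi> s))"
    by (rule set_integrable_circ_continuous) (intro continuous_on_mult continuous_on_subset[OF c] continuous_on_subset[OF c\<phi>(1)]; simp)
  have p0: "\<phi> (2 * pi) = \<phi> 0" using periodic_fun_simple.plus_period[OF \<phi>(2), of 0] by simp
  have "(LINT s:circ|lborel. W s * of_real (deriv \<phi> s) + W' s * of_real (\<phi> s)) = W (2 * pi) * of_real (\<phi> (2 * pi)) - W 0 * of_real (\<phi> 0)"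
    unfolding set_lebesgue_integral_def
  proof (rule integral_FTC_Icc)
    show "((\<lambda>s. W s * of_real (\<phi> s)) has_vector_derivative W x * of_real (deriv \<phi> x) + W' x * of_real (\<phi> x)) (at x within circ)" for x
      by (rule has_vector_derivative_mult[OF has_vector_derivative_at_within[OF W] has_vector_derivative_of_real[OF has_field_derivative_at_within[OF smooth_real_D(1)[OF \<phi>(1)]]]])
    show "continuous_on circ (\<lambda>x. W x * of_real (deriv \<phi> x) + W' x * of_real (\<phi> x))"
      by (intro continuous_on_add continuous_on_mult continuous_on_subset[OF cW] continuous_on_subset[OF c] continuous_on_subset[OF c\<phi>(1)] continuous_on_subset[OF c\<phi>(2)]; simp)
  qed simp
  then show "(LINT s:circ|lborel. W s * of_real (deriv \<phi> s)) = - (LINT s:circ|lborel. W' s * of_real (\<phi> s))"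
    using set_integral_add(2)[OF i1 i2] per p0 by (simp add: eq_neg_iff_add_eq_0)
qed

lemma L2_circle_continuous:
  assumes "continuous_on UNIV W" "\<And>s. W (s + 2 * pi) = W s"
  shows "W \<in> L2_circle"
proof -
  have "set_integrable lborel circ (\<lambda>s. (cmod (W s))\<^sup>2)"
    by (rule set_integrable_circ_continuous)
      (intro continuous_on_power continuous_on_norm continuous_on_subset[OF assms(1)], simp)
  then show ?thesis using assms circle_periodicI[of W] borel_measurable_continuous_onI[OF assms(1)]
    unfolding L2_circle_def by blast
qed

lemma AE_continuous_zero:
  fixes F :: "real \<Rightarrow> complex"
  assumes "continuous_on UNIV F" "AE s in lborel. F s = 0"
  shows "F s = 0"
proof (rule ccontr)
  assume ne: "F s \<noteq> 0"
  have op: "open {s. F s \<noteq> 0}"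
    by (rule open_Collect_neq[OF assms(1) continuous_on_const])
  obtain N where N: "{x \<in> space lborel. \<not> F x = 0} \<subseteq> N" "N \<in> null_sets lborel"
    using assms(2) by (rule AE_E) (auto simp: null_sets_def)
  have "negligible N" using N(2) by (simp add: negligible_iff_null_sets null_sets_completionI)
  then have "negligible {s. F s \<noteq> 0}" by (rule negligible_subset) (use N(1) in auto)
  then show False using open_not_negligible[OF op] ne by blast
qed

lemma has_vector_derivative_cis_linear:
  "((\<lambda>s. cis (k * s)) has_vector_derivative \<i> * of_real k * cis (k * s)) (at s within S)"
proof -
  have "((\<lambda>z. exp (\<i> * of_real k * z)) has_field_derivative \<i> * of_real k * exp (\<i> * of_real k * of_real s)) (at (of_real s))"
    by (auto intro!: derivative_eq_intros)
  from has_vector_derivative_real_field[OF this] show ?thesis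
    by (simp add: cis_conv_exp mult.assoc)
qed

text \<open>
  The algebra of conjugation by \<open>exp (i K s)\<close> for \<open>\<xi> = h K\<close>: the first and third identities pass from
  the magnetic equation to Hill's equation, the other two back.
\<close>

lemma magnetic_algebra:
  fixes H K Q L u v e :: complex
  shows "- 2 * \<i> * (H * (H * K)) * v + (H * K)\<^sup>2 * u + (H\<^sup>2 * Q) * u
      = H\<^sup>2 * ((K\<^sup>2 + Q) * u + (- 2 * \<i> * K) * v)"
    "- (H\<^sup>2) * (e * (Q * u - 2 * \<i> * K * v - K\<^sup>2 * u)) - 2 * \<i> * (H * (H * K)) * (e * (v - \<i> * K * u))
      + (H * K)\<^sup>2 * (e * u) + (H\<^sup>2 * Q + L) * (e * u) = L * (e * u)"
    "e * ((K\<^sup>2 + Q) * u + (- 2 * \<i> * K) * v + \<i> * K * v) + \<i> * K * e * (v + \<i> * K * u) = Q * (e * u)"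
    "e * (Q * u - \<i> * K * v) + (- \<i> * K) * e * (v - \<i> * K * u) = e * (Q * u - 2 * \<i> * K * v - K\<^sup>2 * u)"
  by (simp_all add: algebra_simps power2_eq_square)

locale magnetic_hill = hill "\<lambda>s. (V s - l) / h\<^sup>2" for V l h +
  fixes \<xi> :: real
  assumes h: "h > 0" and cV: "continuous_on UNIV V"
begin

abbreviation "q \<equiv> \<lambda>s. (V s - l) / h\<^sup>2"
definition "k = \<xi> / h"
definition "z = cis (k * (2 * pi))"

text \<open>
  The initial data \<open>(x, y)\<close> of solutions of Hill's equation that are multiplied by \<open>z\<close> along one turn.
\<close>

definition bloch_kernel :: "complex \<Rightarrow> complex \<Rightarrow> bool" where
  "bloch_kernel x y \<longleftrightarrow>
     of_real (2 * mA\<^sup>2 - 1) * x + of_real (2 * mA * mB) * y = z * x \<and>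
     of_real (2 * mA * mC) * x + of_real (2 * mA\<^sup>2 - 1) * y = z * y"

definition bloch :: "complex \<Rightarrow> complex \<Rightarrow> real \<Rightarrow> complex" where
  "bloch x y s = cis (- k * s) * (x * of_real (a s) + y * of_real (b s))"

abbreviation "E \<equiv> eigenspace H2_circle (magnetic_schrodinger V \<xi> h) l"

lemma z_ne: "z \<noteq> 0" by (simp add: z_def)

lemma cis_shift: "cis (- k * (s + 2 * pi)) * z = cis (- k * s)"
  by (simp add: z_def cis_mult algebra_simps)

lemma bloch_factor_shift:
  assumes "bloch_kernel x y"
  shows "x * of_real (a (s + 2 * pi)) + y * of_real (b (s + 2 * pi)) = z * (x * of_real (a s) + y * of_real (b s))"
    "x * of_real (a' (s + 2 * pi)) + y * of_real (b' (s + 2 * pi)) = z * (x * of_real (a' s) + y * of_real (b' s))"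
proof -
  have K: "of_real (2 * mA\<^sup>2 - 1) * x + of_real (2 * mA * mB) * y = z * x"
    "of_real (2 * mA * mC) * x + of_real (2 * mA\<^sup>2 - 1) * y = z * y"
    using assms unfolding bloch_kernel_def by auto
  have e: "x * of_real (p * c + r * d) + y * of_real (t * c + p * d) =
     (of_real p * x + of_real t * y) * of_real c + (of_real r * x + of_real p * y) * of_real d"
    for p c r d t :: real by (simp add: algebra_simps)
  show "x * of_real (a (s + 2 * pi)) + y * of_real (b (s + 2 * pi)) = z * (x * of_real (a s) + y * of_real (b s))"
    unfolding monodromy_full e K by (simp add: algebra_simps)
  show "x * of_real (a' (s + 2 * pi)) + y * of_real (b' (s + 2 * pi)) = z * (x * of_real (a' s) + y * of_real (b' s))"
    unfolding monodromy_der e K by (simp add: algebra_simps)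
qed

lemma bloch_periodic:
  assumes "bloch_kernel x y"
  shows "bloch x y (s + 2 * pi) = bloch x y s"
  unfolding bloch_def bloch_factor_shift[OF assms]
  by (simp only: mult.assoc[symmetric] cis_shift)

text \<open>
  After regularisation and conjugation by \<open>cis (k * s)\<close>, an eigenfunction is a solution of Hill's equation,
  and periodicity becomes the condition that one turn multiplies it by \<open>z\<close>.
\<close>

lemma eigenfunction_is_bloch:
  assumes u: "u \<in> E"
  obtains x y where "bloch_kernel x y" "AE s in lborel. u s = bloch x y s"
proof -
  have uH: "u \<in> H2_circle" and uE: "AE s in lborel. magnetic_schrodinger V \<xi> h u s = of_real l * u s"
    using u unfolding eigenspace_def by auto
  obtain v w where L: "u \<in> L2_circle" "v \<in> L2_circle" "w \<in> L2_circle" and d: "has_weak_deriv u v" "has_weak_deriv v w"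
    using uH unfolding H2_circle_def by blast
  have \<xi>: "h * \<xi> = h * (h * k)" "\<xi>\<^sup>2 = (h * k)\<^sup>2" using h by (simp_all add: k_def)
  define p where "p = (\<lambda>s. complex_of_real (k\<^sup>2 + q s))"
  define c where "c = - 2 * \<i> * complex_of_real k"
  have hne: "complex_of_real (h\<^sup>2) \<noteq> 0" using h by simp
  have eq: "AE s in lborel. s \<in> circ \<longrightarrow> w s = p s * u s + c * v s"
    using uE magnetic_schrodinger_AE[OF L d, of V \<xi> h]
  proof eventually_elim
    case (elim s)
    have hq: "complex_of_real (h\<^sup>2) * of_real (q s) = of_real (V s) - of_real l"
    proof -
      have "h\<^sup>2 * q s = V s - l" using h by simp
      then have "complex_of_real (h\<^sup>2 * q s) = of_real (V s - l)" by (simp only:)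
      then show ?thesis unfolding of_real_mult of_real_diff .
    qed
    have "of_real (h\<^sup>2) * w s = - 2 * \<i> * of_real (h * \<xi>) * v s + of_real (\<xi>\<^sup>2) * u s + (of_real (V s) - of_real l) * u s"
      using elim by (simp add: algebra_simps)
    also have "\<dots> = of_real (h\<^sup>2) * (p s * u s + c * v s)"
      unfolding hq[symmetric] \<xi> p_def c_def of_real_mult of_real_power of_real_add
      by (rule magnetic_algebra(1))
    finally show ?case using hne by simp
  qed
  have cp: "continuous_on UNIV p" unfolding p_def
    by (intro continuous_of_real continuous_on_add continuous_on_const cont)
  obtain U U' where U: "\<And>s. s \<in> circ \<Longrightarrow> (U has_vector_derivative U' s) (at s within circ)"
    and U': "\<And>s. s \<in> circ \<Longrightarrow> (U' has_vector_derivative (p s * U s + c * U' s)) (at s within circ)"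
    and per: "U (2 * pi) = U 0" "U' (2 * pi) = U' 0" and ae: "AE s in lborel. s \<in> circ \<longrightarrow> u s = U s"
    by (rule weak_solution_classical[OF L d cp eq]) (rule that)
  define f where "f = (\<lambda>s. cis (k * s) * U s)"
  define f1 where "f1 = (\<lambda>s. cis (k * s) * (U' s + \<i> * of_real k * U s))"
  have df: "(f has_vector_derivative f1 s) (at s within circ)" if s: "s \<in> circ" for s
    using has_vector_derivative_mult[OF has_vector_derivative_cis_linear U[OF s], of k]
    unfolding f_def f1_def by (simp add: algebra_simps)
  have df1: "(f1 has_vector_derivative of_real (q s) * f s) (at s within circ)" if s: "s \<in> circ" for s
  proof -
    have 1: "((\<lambda>s. \<i> * of_real k * U s) has_vector_derivative \<i> * of_real k * U' s) (at s within circ)"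
      by (rule has_vector_derivative_mult_right[OF U[OF s]])
    have "(f1 has_vector_derivative cis (k * s) * (p s * U s + c * U' s + \<i> * of_real k * U' s)
        + \<i> * of_real k * cis (k * s) * (U' s + \<i> * of_real k * U s)) (at s within circ)"
      unfolding f1_def
      by (rule has_vector_derivative_mult[OF has_vector_derivative_cis_linear has_vector_derivative_add[OF U'[OF s] 1]])
    moreover have "cis (k * s) * (p s * U s + c * U' s + \<i> * of_real k * U' s)
        + \<i> * of_real k * cis (k * s) * (U' s + \<i> * of_real k * U s) = of_real (q s) * f s"
      unfolding p_def c_def f_def of_real_power of_real_add by (rule magnetic_algebra(3))
    ultimately show ?thesis by (simp only:)
  qed
  have rep: "f t = f 0 * of_real (a t) + f1 0 * of_real (b t)"
    "f1 t = f 0 * of_real (a' t) + f1 0 * of_real (b' t)" if t: "t \<in> circ" for t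
    by (rule complex_ode_representation[OF df df1 t]; assumption)+
  have pi2: "2 * pi \<in> circ" by simp
  have z2: "z = cis (k * (2 * pi))" by (simp add: z_def)
  have end1: "f (2 * pi) = z * f 0" "f1 (2 * pi) = z * f1 0"
    unfolding f_def f1_def z2 per by simp_all
  have per_ab: "a (2 * pi) = 2 * mA\<^sup>2 - 1" "b (2 * pi) = 2 * mA * mB" "a' (2 * pi) = 2 * mA * mC" "b' (2 * pi) = 2 * mA\<^sup>2 - 1"
    using monodromy_full[of 0] monodromy_der[of 0] ab by simp_all
  have K: "bloch_kernel (f 0) (f1 0)"
    unfolding bloch_kernel_def end1[symmetric] rep(1)[OF pi2] rep(2)[OF pi2] per_ab by (simp only: mult.commute simp_thms)
  have "AE s in lborel. u s = bloch (f 0) (f1 0) s"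
  proof (rule AE_periodic)
    interpret B: periodic_fun_simple "bloch (f 0) (f1 0)" "2 * pi"
      by unfold_locales (rule bloch_periodic[OF K])
    show "u s = bloch (f 0) (f1 0) s"
      if "u (s + of_int n * (2 * pi)) = bloch (f 0) (f1 0) (s + of_int n * (2 * pi))" for s n
      using that unfolding L2_circleD(5)[OF L(1)] B.plus_of_int .
    show "AE s in lborel. s \<in> circ \<longrightarrow> u s = bloch (f 0) (f1 0) s"
      using ae
    proof eventually_elim
      case (elim s)
      show ?case
      proof
        assume s: "s \<in> circ"
        have "bloch (f 0) (f1 0) s = cis (- k * s) * f s" unfolding bloch_def rep(1)[OF s] ..
        also have "\<dots> = U s" by (simp add: f_def mult.assoc[symmetric] cis_mult)
        finally show "u s = bloch (f 0) (f1 0) s" using elim s by simp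
      qed
    qed
  qed
  with K show ?thesis by (rule that)
qed

text \<open>
  Conversely, a Bloch wave is smooth enough for its weak derivatives to be the classical ones.
\<close>

lemma bloch_in_eigenspace:
  assumes K: "bloch_kernel x y"
  shows "bloch x y \<in> E"
proof -
  define f where "f = (\<lambda>s. x * complex_of_real (a s) + y * of_real (b s))"
  define f1 where "f1 = (\<lambda>s. x * complex_of_real (a' s) + y * of_real (b' s))"
  define e where "e = (\<lambda>s. cis ((- k) * s))"
  have de: "(e has_vector_derivative (- \<i> * of_real k) * e s) (at s)" for s
    unfolding e_def using has_vector_derivative_cis_linear[of "- k" s UNIV] by simp
  have df: "(f has_vector_derivative f1 s) (at s)" for s
    unfolding f_def f1_def
    by (rule has_vector_derivative_add[OF has_vector_derivative_mult_right[OF ab_vector(1)]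
          has_vector_derivative_mult_right[OF ab_vector(3)]])
  have df1: "(f1 has_vector_derivative of_real (q s) * f s) (at s)" for s
  proof -
    have "(f1 has_vector_derivative (x * of_real (q s * a s) + y * of_real (q s * b s))) (at s)"
      unfolding f1_def
      by (rule has_vector_derivative_add[OF has_vector_derivative_mult_right[OF ab_vector(2)]
          has_vector_derivative_mult_right[OF ab_vector(4)]])
    moreover have "x * (A * B) + y * (A * C) = A * (x * B + y * C)" for A B C :: complex
      by (simp add: algebra_simps)
    ultimately show ?thesis unfolding f_def of_real_mult by (simp only:)
  qed
  define W1 where "W1 = (\<lambda>s. e s * (f1 s - \<i> * of_real k * f s))"
  define W2 where "W2 = (\<lambda>s. e s * (of_real (q s) * f s - 2 * \<i> * of_real k * f1 s - of_real (k\<^sup>2) * f s))"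
  have W: "bloch x y = (\<lambda>s. e s * f s)" by (auto simp: bloch_def e_def f_def)
  have dW: "((\<lambda>s. e s * f s) has_vector_derivative W1 s) (at s)" for s
    using has_vector_derivative_mult[OF de df] unfolding W1_def by (simp add: algebra_simps)
  have dW1: "(W1 has_vector_derivative W2 s) (at s)" for s
  proof -
    have "(W1 has_vector_derivative e s * (of_real (q s) * f s - \<i> * of_real k * f1 s) + (- \<i> * of_real k) * e s * (f1 s - \<i> * of_real k * f s)) (at s)"
      unfolding W1_def
      by (rule has_vector_derivative_mult[OF de has_vector_derivative_diff[OF df1 has_vector_derivative_mult_right[OF df]]])
    then show ?thesis unfolding W2_def of_real_power magnetic_algebra(4) .
  qed
  have ce: "continuous_on UNIV e" "continuous_on UNIV f" "continuous_on UNIV f1" "continuous_on UNIV W1"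
    by (rule hvd_continuous_on[OF de] hvd_continuous_on[OF df] hvd_continuous_on[OF df1] hvd_continuous_on[OF dW1])+
  have cW2: "continuous_on UNIV W2" unfolding W2_def
    by (intro continuous_on_mult continuous_on_diff continuous_on_const ce continuous_of_real cont)
  have es: "e (s + 2 * pi) * z = e s" for s unfolding e_def by (rule cis_shift)
  have fs: "f (s + 2 * pi) = z * f s" "f1 (s + 2 * pi) = z * f1 s" for s
    unfolding f_def f1_def by (rule bloch_factor_shift[OF K])+
  have qs: "q (s + 2 * pi) = q s" for s
  proof -
    have "q (s + 2 * pi) = q ((s + pi) + pi)" by (simp add: add.assoc)
    then show ?thesis unfolding periodic .
  qed
  have p0: "e (s + 2 * pi) * f (s + 2 * pi) = e s * f s" for s
    unfolding fs es[of s, symmetric] by (simp add: mult_ac)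
  have p1: "W1 (s + 2 * pi) = W1 s" for s
    unfolding W1_def fs es[of s, symmetric] by (simp add: algebra_simps)
  have p2: "W2 (s + 2 * pi) = W2 s" for s
  proof -
    have "A * (Q * (z * F) - B * (z * G) - C * (z * F)) = (A * z) * (Q * F - B * G - C * F)"
      for A B C F G Q :: complex by (simp add: algebra_simps)
    then show ?thesis unfolding W2_def fs qs es[of s, symmetric] .
  qed
  have L: "(\<lambda>s. e s * f s) \<in> L2_circle" "W1 \<in> L2_circle" "W2 \<in> L2_circle"
    by (rule L2_circle_continuous; intro continuous_on_mult ce cW2 p0 p1 p2)+
  have d: "has_weak_deriv (\<lambda>s. e s * f s) W1" "has_weak_deriv W1 W2"
    by (rule classical_weak_deriv[OF dW ce(4)], use p0[of 0] in simp)
       (rule classical_weak_deriv[OF dW1 cW2], use p1[of 0] in simp)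
  have H: "(\<lambda>s. e s * f s) \<in> H2_circle" using L d unfolding H2_circle_def by blast
  have \<xi>: "h * \<xi> = h * (h * k)" "\<xi>\<^sup>2 = (h * k)\<^sup>2" using h by (simp_all add: k_def)
  have "AE s in lborel. magnetic_schrodinger V \<xi> h (\<lambda>s. e s * f s) s = of_real l * (e s * f s)"
    using magnetic_schrodinger_AE[OF L d, of V \<xi> h]
  proof eventually_elim
    case (elim s)
    have "h\<^sup>2 * q s = V s - l" using h by simp
    then have "complex_of_real (h\<^sup>2 * q s) = of_real (V s - l)" by (simp only:)
    then have "complex_of_real (h\<^sup>2) * of_real (q s) = of_real (V s) - of_real l"
      unfolding of_real_mult of_real_diff .
    then have hq: "of_real (V s) = complex_of_real (h\<^sup>2) * of_real (q s) + of_real l"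
      by (simp only: diff_add_cancel)
    show ?case unfolding elim W1_def W2_def hq \<xi> of_real_mult of_real_power
      by (rule magnetic_algebra(2))
  qed
  then show ?thesis using H unfolding eigenspace_def W by blast
qed

lemma bloch_AE_zero:
  assumes "AE s in lborel. bloch x y s = 0"
  shows "x = 0 \<and> y = 0"
proof -
  have ca: "continuous_on UNIV (\<lambda>s. complex_of_real (a s))" "continuous_on UNIV (\<lambda>s. complex_of_real (b s))"
    by (rule hvd_continuous_on[OF ab_vector(1)] hvd_continuous_on[OF ab_vector(3)])+
  have cF: "continuous_on UNIV (\<lambda>s. x * complex_of_real (a s) + y * of_real (b s))"
    by (intro continuous_on_add continuous_on_mult continuous_on_const ca)
  have "AE s in lborel. x * complex_of_real (a s) + y * of_real (b s) = 0"
    using assms by eventually_elim (simp add: bloch_def)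
  note z = AE_continuous_zero[OF cF this]
  have x: "x = 0" using z[of 0] ab by simp
  have "y = 0"
  proof (rule ccontr)
    assume "y \<noteq> 0"
    then have b0: "b = (\<lambda>s. 0)" using z x by auto
    have "(b has_real_derivative b' 0) (at 0)" by (rule ode_solution_D[OF ab(2)])
    moreover have "(b has_real_derivative 0) (at 0)" unfolding b0 by simp
    ultimately have "b' 0 = 0" by (rule DERIV_unique)
    then show False using ab by simp
  qed
  with x show ?thesis ..
qed

end

section \<open>Multiplicities and the lowest eigenvalues\<close>

lemma kernel_det:
  fixes \<alpha> \<beta> \<gamma> x y :: complex
  assumes "\<alpha> * x + \<beta> * y = 0" "\<gamma> * x + \<alpha> * y = 0" "x \<noteq> 0 \<or> y \<noteq> 0"
  shows "\<alpha>\<^sup>2 = \<beta> * \<gamma>"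
proof -
  have "(\<alpha>\<^sup>2 - \<beta> * \<gamma>) * x = 0" "(\<alpha>\<^sup>2 - \<beta> * \<gamma>) * y = 0"
    using assms(1,2) by algebra+
  then show ?thesis using assms(3) by auto
qed

lemma L2_independentD:
  assumes "L2_independent n u" "AE s in lborel. (\<Sum>i<n. c i * u i s) = 0" "i < n"
  shows "c i = 0"
  using assms unfolding L2_independent_def by blast

lemma multiplicity_ge:
  assumes "\<forall>i<n. u i \<in> eigenspace Dom T \<mu>" "L2_independent n u"
  shows "enat n \<le> multiplicity_at Dom T \<mu>"
  unfolding multiplicity_at_def by (rule Sup_upper) (use assms in blast)

lemma multiplicity_le:
  assumes "\<And>k u. \<forall>i<k. u i \<in> eigenspace Dom T \<mu> \<Longrightarrow> L2_independent k u \<Longrightarrow> k \<le> n"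
  shows "multiplicity_at Dom T \<mu> \<le> enat n"
  unfolding multiplicity_at_def by (rule Sup_least) (use assms in auto)

context magnetic_hill
begin

abbreviation "M \<equiv> multiplicity_at H2_circle (magnetic_schrodinger V \<xi> h) l"

text \<open>
  The characteristic equation of a monodromy with determinant \<open>1\<close> and eigenvalue \<open>z\<close>; its trace is
  \<open>2 * cos (2 * k * pi)\<close>.
\<close>

lemma z_quadratic: "z\<^sup>2 - 2 * z * of_real (2 * (cos (k * pi))\<^sup>2 - 1) + 1 = 0"
proof -
  have e: "z = cis (k * pi) ^ 2" unfolding z_def by (simp add: cis_mult power2_eq_square mult_ac)
  have "cis (k * pi) * cis (- (k * pi)) = 1" by (simp add: cis_mult)
  moreover have "cis (k * pi) + cis (- (k * pi)) = 2 * of_real (cos (k * pi))"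
    by (rule complex_eqI) simp_all
  ultimately have "cis (k * pi) ^ 2 - 2 * of_real (cos (k * pi)) * cis (k * pi) + 1 = 0" by algebra
  then show ?thesis unfolding e of_real_diff of_real_mult of_real_power of_real_numeral of_real_1 by algebra
qed

lemma bloch_lin: "bloch (c * x + d * x') (c * y + d * y') s = c * bloch x y s + d * bloch x' y' s"
  by (simp add: bloch_def algebra_simps)

lemma multiplicity_pos:
  assumes "bloch_kernel x y" "x \<noteq> 0 \<or> y \<noteq> 0"
  shows "1 \<le> M"
proof -
  have "enat 1 \<le> M"
  proof (rule multiplicity_ge[where u = "\<lambda>_. bloch x y"])
    show "\<forall>i<1. bloch x y \<in> E" using bloch_in_eigenspace[OF assms(1)] by blast
    show "L2_independent 1 (\<lambda>_. bloch x y)"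
      unfolding L2_independent_def
    proof (intro allI impI)
      fix c :: "nat \<Rightarrow> complex" and i :: nat
      assume "AE s in lborel. (\<Sum>i<1. c i * bloch x y s) = 0" and i: "i < 1"
      then have "AE s in lborel. bloch (c 0 * x + 0 * 0) (c 0 * y + 0 * 0) s = 0"
        unfolding bloch_lin by simp
      from bloch_AE_zero[OF this] assms(2) i show "c i = 0" by auto
    qed
  qed
  then show ?thesis by (simp add: one_enat_def)
qed

lemma multiplicity_zero:
  assumes "\<And>x y. bloch_kernel x y \<Longrightarrow> x = 0 \<and> y = 0"
  shows "M = 0"
proof -
  have "M \<le> enat 0"
  proof (rule multiplicity_le)
    fix n u assume u: "\<forall>i<n. u i \<in> E" and ind: "L2_independent n u"
    show "n \<le> 0"
    proof (rule ccontr)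
      assume n: "\<not> n \<le> 0"
      then have "u 0 \<in> E" using u by simp
      then obtain x y where K: "bloch_kernel x y" and ae: "AE s in lborel. u 0 s = bloch x y s"
        by (rule eigenfunction_is_bloch) (rule that)
      have u0: "AE s in lborel. u 0 s = 0" using ae
        by eventually_elim (use assms[OF K] in \<open>simp add: bloch_def\<close>)
      let ?c = "\<lambda>i::nat. if i = 0 then 1 else (0::complex)"
      have "AE s in lborel. (\<Sum>i<n. ?c i * u i s) = 0" using u0
      proof eventually_elim
        case (elim s)
        have "(\<Sum>i<n. ?c i * u i s) = (\<Sum>i<n. 0)"
          by (rule sum.cong) (use elim in auto)
        then show ?case by simp
      qed
      from L2_independentD[OF ind this, of 0] n show False by simp
    qed
  qed
  then show ?thesis by (simp add: zero_enat_def[symmetric])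
qed

text \<open>
  The kernel equation \<open>(2 * mA\<^sup>2 - 1 - z) * x + 2 * mA * mB * y = 0\<close> is then nontrivial, so any two
  kernel vectors are proportional.
\<close>

lemma multiplicity_le_one:
  assumes AB: "mA \<noteq> 0" "mB \<noteq> 0"
  shows "M \<le> 1"
proof -
  have ABne: "complex_of_real (2 * mA * mB) \<noteq> 0" using AB by simp
  have "M \<le> enat 1"
  proof (rule multiplicity_le)
    fix n u assume u: "\<forall>i<n. u i \<in> E" and ind: "L2_independent n u"
    show "n \<le> 1"
    proof (rule ccontr)
      assume n: "\<not> n \<le> 1"
      then have "u 0 \<in> E" "u 1 \<in> E" using u by auto
      obtain x y where K: "bloch_kernel x y" and ae: "AE s in lborel. u 0 s = bloch x y s"
        by (rule eigenfunction_is_bloch[OF \<open>u 0 \<in> E\<close>]) (rule that)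
      obtain x' y' where K': "bloch_kernel x' y'" and ae': "AE s in lborel. u 1 s = bloch x' y' s"
        by (rule eigenfunction_is_bloch[OF \<open>u 1 \<in> E\<close>]) (rule that)
      have "of_real (2 * mA * mB) * (x' * y - x * y') = 0"
        using K K' unfolding bloch_kernel_def by algebra
      then have xy: "x' * y = x * y'" using ABne by simp
      \<comment> \<open>A linear relation between the two vectors, transferred to the eigenfunctions.\<close>
      obtain c d where cd: "c * x + d * x' = 0" "c * y + d * y' = 0" "c \<noteq> 0 \<or> d \<noteq> 0"
      proof (cases "x = 0 \<and> x' = 0")
        case True
        then have "of_real (2 * mA * mB) * y = 0" "of_real (2 * mA * mB) * y' = 0"
          using K K' unfolding bloch_kernel_def by simp_all
        then have "y = 0" "y' = 0" using ABne by simp_all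
        then show ?thesis using that[of 1 1] True by simp
      next
        case False
        then show ?thesis using that[of x' "- x"] xy by (auto simp: mult.commute)
      qed
      let ?c = "\<lambda>i::nat. if i = 0 then c else if i = 1 then d else (0::complex)"
      have "AE s in lborel. (\<Sum>i<n. ?c i * u i s) = 0" using ae ae'
      proof eventually_elim
        case (elim s)
        have "(\<Sum>i<n. ?c i * u i s) = (\<Sum>i\<in>{0,1}. ?c i * u i s)"
          by (rule sum.mono_neutral_right) (use n in auto)
        also have "\<dots> = c * bloch x y s + d * bloch x' y' s" using elim by simp
        also have "\<dots> = 0" unfolding bloch_lin[symmetric] cd by (simp add: bloch_def)
        finally show ?case .
      qed
      from L2_independentD[OF ind this, of 0] L2_independentD[OF ind this, of 1] n
      show False using cd(3) by simp
    qed
  qed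
  then show ?thesis by (simp add: one_enat_def)
qed

text \<open>
  Here the monodromy is \<open>- 1\<close> and \<open>z = - 1\<close>, so every solution of Hill's equation is a Bloch wave.
\<close>

lemma multiplicity_two:
  assumes "mA = 0" "cos (k * pi) = 0"
  shows "2 \<le> M"
proof -
  have "z\<^sup>2 + 2 * z + 1 = 0" using z_quadratic assms(2) by simp
  then have "(z + 1)\<^sup>2 = 0" by algebra
  then have z: "z = -1" by (simp add: add_eq_0_iff2)
  have K: "bloch_kernel x y" for x y unfolding bloch_kernel_def z assms(1) by simp
  let ?u = "\<lambda>i::nat. if i = 0 then bloch 1 0 else bloch 0 1"
  have "enat 2 \<le> M"
  proof (rule multiplicity_ge[where u = ?u])
    show "\<forall>i<2. ?u i \<in> E" using bloch_in_eigenspace[OF K] by simp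
    show "L2_independent 2 ?u"
      unfolding L2_independent_def
    proof (intro allI impI)
      fix c :: "nat \<Rightarrow> complex" and i :: nat
      assume ae: "AE s in lborel. (\<Sum>i<2. c i * ?u i s) = 0" and i: "i < 2"
      have "(\<Sum>i<2. c i * ?u i s) = bloch (c 0 * 1 + c 1 * 0) (c 0 * 0 + c 1 * 1) s" for s
        unfolding bloch_lin by (simp add: numeral_2_eq_2)
      then have "AE s in lborel. bloch (c 0 * 1 + c 1 * 0) (c 0 * 0 + c 1 * 1) s = 0"
        using ae by simp
      from bloch_AE_zero[OF this] i show "c i = 0" by (auto simp: less_2_cases_iff)
    qed
  qed
  then show ?thesis by (simp only: numeral_eq_enat)
qed

text \<open>
  The number \<open>z\<close> is an eigenvalue of the monodromy only if the trace \<open>2 * (2 * mA\<^sup>2 - 1)\<close> equals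
  \<open>z + 1 / z = 2 * (2 * (cos (k * pi))\<^sup>2 - 1)\<close>.
\<close>

lemma multiplicity_zero_off_band:
  assumes "mA\<^sup>2 \<noteq> (cos (k * pi))\<^sup>2"
  shows "M = 0"
proof (rule multiplicity_zero, rule ccontr)
  fix x y assume K: "bloch_kernel x y" and ne: "\<not> (x = 0 \<and> y = 0)"
  let ?al = "complex_of_real (2 * mA\<^sup>2 - 1) - z"
  have "?al * x + of_real (2 * mA * mB) * y = 0" "of_real (2 * mA * mC) * x + ?al * y = 0"
    using K unfolding bloch_kernel_def by (simp_all add: algebra_simps)
  then have "?al\<^sup>2 = of_real (2 * mA * mB) * of_real (2 * mA * mC)"
    by (rule kernel_det) (use ne in auto)
  also have "\<dots> = of_real (4 * mA\<^sup>2 * (mA\<^sup>2 - 1))"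
  proof -
    have "2 * mA * mB * (2 * mA * mC) = 4 * mA\<^sup>2 * (mA\<^sup>2 - 1)" using monodromy_det by algebra
    then show ?thesis unfolding of_real_mult[symmetric] by simp
  qed
  finally have "z\<^sup>2 - 2 * z * of_real (2 * mA\<^sup>2 - 1) + 1 = 0"
    unfolding of_real_diff of_real_mult of_real_power of_real_numeral of_real_1 by algebra
  with z_quadratic have "2 * z * (of_real (2 * mA\<^sup>2 - 1) - of_real (2 * (cos (k * pi))\<^sup>2 - 1)) = 0" by algebra
  then have "complex_of_real (2 * mA\<^sup>2 - 1) = of_real (2 * (cos (k * pi))\<^sup>2 - 1)"
    using z_ne by simp
  then have "2 * mA\<^sup>2 - 1 = 2 * (cos (k * pi))\<^sup>2 - 1" by (simp only: of_real_eq_iff)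
  then show False using assms by simp
qed

lemma multiplicity_one_on_band:
  assumes "mA\<^sup>2 = (cos (k * pi))\<^sup>2" "mA \<noteq> 0" "mB \<noteq> 0"
  shows "M = 1"
proof -
  have zq: "z\<^sup>2 - 2 * z * of_real (2 * mA\<^sup>2 - 1) + 1 = 0" using z_quadratic unfolding assms(1) .
  have BC: "mB * mC = mA\<^sup>2 - 1" using monodromy_det by simp
  have "of_real (2 * mA * mC) * of_real (2 * mA * mB) = complex_of_real (4 * mA\<^sup>2 * (mA\<^sup>2 - 1))"
  proof -
    have "2 * mA * mC * (2 * mA * mB) = 4 * mA\<^sup>2 * (mA\<^sup>2 - 1)" using BC by algebra
    then show ?thesis unfolding of_real_mult[symmetric] by simp
  qed
  then have BC': "of_real (2 * mA * mC) * of_real (2 * mA * mB) = 4 * (complex_of_real mA)\<^sup>2 * ((of_real mA)\<^sup>2 - 1)" by simp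
  have "bloch_kernel (of_real (2 * mA * mB)) (z - of_real (2 * mA\<^sup>2 - 1))"
    unfolding bloch_kernel_def
  proof
    show "of_real (2 * mA\<^sup>2 - 1) * of_real (2 * mA * mB) + of_real (2 * mA * mB) * (z - of_real (2 * mA\<^sup>2 - 1)) = z * of_real (2 * mA * mB)"
      by (simp add: algebra_simps)
    show "of_real (2 * mA * mC) * of_real (2 * mA * mB) + of_real (2 * mA\<^sup>2 - 1) * (z - of_real (2 * mA\<^sup>2 - 1)) = z * (z - of_real (2 * mA\<^sup>2 - 1))"
      using zq unfolding BC' of_real_diff[of "2 * mA\<^sup>2"] of_real_mult[of 2] of_real_power of_real_numeral of_real_1 by algebra
  qed
  moreover have "complex_of_real (2 * mA * mB) \<noteq> 0" using assms by simp
  ultimately have "1 \<le> M" using multiplicity_pos by blast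
  with multiplicity_le_one[OF assms(2,3)] show ?thesis by (rule antisym)
qed

end

lemma nth_eigenvalue_lowest:
  assumes k: "0 < k" and m: "enat k \<le> multiplicity_at Dom T l"
    and lt: "\<And>\<nu>. \<nu> < l \<Longrightarrow> multiplicity_at Dom T \<nu> = 0"
  shows "nth_eigenvalue Dom T k = l"
  unfolding nth_eigenvalue_def
proof (rule Least_equality)
  show "\<exists>F. finite F \<and> F \<subseteq> {..l} \<and> enat k \<le> (\<Sum>\<nu>\<in>F. multiplicity_at Dom T \<nu>)"
    using m by (intro exI[of _ "{l}"]) simp
  fix \<mu> assume "\<exists>F. finite F \<and> F \<subseteq> {..\<mu>} \<and> enat k \<le> (\<Sum>\<nu>\<in>F. multiplicity_at Dom T \<nu>)"
  then obtain F where F: "finite F" "F \<subseteq> {..\<mu>}" "enat k \<le> (\<Sum>\<nu>\<in>F. multiplicity_at Dom T \<nu>)" by blast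
  show "l \<le> \<mu>"
  proof (rule ccontr)
    assume "\<not> l \<le> \<mu>"
    then have S: "(\<Sum>\<nu>\<in>F. multiplicity_at Dom T \<nu>) = 0"
      by (intro sum.neutral ballI lt) (use F in auto)
    show False using F(3) k unfolding S by (simp add: zero_enat_def)
  qed
qed

lemma nth_eigenvalue_second_simple:
  assumes l: "l1 < l2" and m1: "multiplicity_at Dom T l1 = 1" and m2: "1 \<le> multiplicity_at Dom T l2"
    and lt: "\<And>\<nu>. \<nu> < l2 \<Longrightarrow> \<nu> \<noteq> l1 \<Longrightarrow> multiplicity_at Dom T \<nu> = 0"
  shows "nth_eigenvalue Dom T 2 = l2"
  unfolding nth_eigenvalue_def
proof (rule Least_equality)
  have "(1::enat) + 1 \<le> multiplicity_at Dom T l1 + multiplicity_at Dom T l2"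
    using m1 m2 by (intro add_mono) auto
  moreover have "(1::enat) + 1 = enat 2" by (simp add: one_enat_def)
  ultimately have "enat 2 \<le> multiplicity_at Dom T l1 + multiplicity_at Dom T l2" by (simp only:)
  then show "\<exists>F. finite F \<and> F \<subseteq> {..l2} \<and> enat 2 \<le> (\<Sum>\<nu>\<in>F. multiplicity_at Dom T \<nu>)"
    using l by (intro exI[of _ "{l1, l2}"]) simp
  fix \<mu> assume "\<exists>F. finite F \<and> F \<subseteq> {..\<mu>} \<and> enat 2 \<le> (\<Sum>\<nu>\<in>F. multiplicity_at Dom T \<nu>)"
  then obtain F where F: "finite F" "F \<subseteq> {..\<mu>}" "enat 2 \<le> (\<Sum>\<nu>\<in>F. multiplicity_at Dom T \<nu>)" by blast
  show "l2 \<le> \<mu>"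
  proof (rule ccontr)
    assume "\<not> l2 \<le> \<mu>"
    then have "(\<Sum>\<nu>\<in>F. multiplicity_at Dom T \<nu>) = (\<Sum>\<nu>\<in>F. if \<nu> = l1 then 1 else 0)"
      by (intro sum.cong refl) (use F lt m1 in auto)
    also have "\<dots> \<le> 1" using F(1) by simp
    finally have "enat 2 \<le> 1" using F(3) by (rule order_trans[rotated])
    then show False by (simp add: one_enat_def)
  qed
qed

section \<open>Perturbation of a weighted first-order system\<close>

lemma within_mono:
  fixes f F :: "real \<Rightarrow> real"
  assumes "a \<le> b"
    and "\<And>x. x \<in> {a..b} \<Longrightarrow> (f has_real_derivative f' x) (at x within {a..b})"
    and "\<And>x. x \<in> {a..b} \<Longrightarrow> (F has_real_derivative F' x) (at x within {a..b})"
    and "\<And>x. x \<in> {a..b} \<Longrightarrow> f' x \<le> F' x"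
  shows "f b - f a \<le> F b - F a"
proof -
  have "\<bar>(\<lambda>x. 0::real) b - (\<lambda>x. 0) a\<bar> \<le> (F b - f b) - (F a - f a)"
    by (rule increment_bound[where f' = "\<lambda>x. 0" and F' = "\<lambda>x. F' x - f' x", OF assms(1)])
      (use assms(4) in \<open>auto intro!: DERIV_diff assms(2,3)\<close>)
  then show ?thesis by simp
qed

lemma within_nondecr:
  fixes F :: "real \<Rightarrow> real"
  assumes "a \<le> b"
    and "\<And>x. x \<in> {a..b} \<Longrightarrow> (F has_real_derivative F' x) (at x within {a..b})"
    and "\<And>x. x \<in> {a..b} \<Longrightarrow> 0 \<le> F' x"
  shows "F a \<le> F b"
  using within_mono[of a b "\<lambda>_. 0" "\<lambda>_. 0" F F', OF assms(1) _ assms(2,3)] by simp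

lemma within_nonincr:
  fixes F :: "real \<Rightarrow> real"
  assumes "a \<le> b"
    and "\<And>x. x \<in> {a..b} \<Longrightarrow> (F has_real_derivative F' x) (at x within {a..b})"
    and "\<And>x. x \<in> {a..b} \<Longrightarrow> F' x \<le> 0"
  shows "F b \<le> F a"
  using within_mono[of a b F F' "\<lambda>_. 0" "\<lambda>_. 0", OF assms(1) assms(2) _ assms(3)] by simp

lemma attains_max_abs:
  fixes f :: "real \<Rightarrow> real"
  assumes "continuous_on {0..T} f" "0 \<le> T"
  obtains t where "t \<in> {0..T}" "\<And>s. s \<in> {0..T} \<Longrightarrow> \<bar>f s\<bar> \<le> \<bar>f t\<bar>"
proof -
  have "\<exists>x\<in>{0..T}. \<forall>y\<in>{0..T}. \<bar>f y\<bar> \<le> \<bar>f x\<bar>"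
    by (rule continuous_attains_sup) (use assms in \<open>auto intro: continuous_on_rabs\<close>)
  then show ?thesis using that by blast
qed

text \<open>
  A weight that decreases up to the factor \<open>C\<close>; it stands for \<open>exp (2 * Y)\<close>.
\<close>

locale weight =
  fixes T C :: real and P :: "real \<Rightarrow> real"
  assumes T: "0 < T" and cP: "continuous_on {0..T} P" and Ppos: "\<And>s. s \<in> {0..T} \<Longrightarrow> 0 < P s"
    and decr: "\<And>s t. 0 \<le> t \<Longrightarrow> t \<le> s \<Longrightarrow> s \<le> T \<Longrightarrow> P s \<le> C * P t"
begin

definition "G s = integral {0..s} (\<lambda>t. 1 / P t)"
definition "N s = integral {0..s} P"

text \<open>
  If \<open>P = exp (2 * Y)\<close> and \<open>u'' = (Y'' + Y'\<^sup>2 - \<rho>) * u\<close>, then \<open>f = exp (- Y) * u\<close> and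
  \<open>X = exp Y * (u' - Y' * u)\<close> satisfy this system. For \<open>\<rho> = 0\<close> its solutions are spanned by
  \<open>(1, 0)\<close> and \<open>(G, 1)\<close>.
\<close>

definition solves :: "(real \<Rightarrow> real) \<Rightarrow> (real \<Rightarrow> real) \<Rightarrow> (real \<Rightarrow> real) \<Rightarrow> bool" where
  "solves \<rho> f X \<longleftrightarrow> (\<forall>s\<in>{0..T}. (f has_real_derivative X s / P s) (at s within {0..T}) \<and>
     (X has_real_derivative - \<rho> s * P s * f s) (at s within {0..T}))"

lemma solvesD:
  assumes "solves \<rho> f X" "s \<in> {0..T}" "S \<subseteq> {0..T}"
  shows "(f has_real_derivative X s / P s) (at s within S)"
    "(X has_real_derivative - \<rho> s * P s * f s) (at s within S)"
  using assms DERIV_subset unfolding solves_def by blast+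

lemma DG: "s \<in> {0..T} \<Longrightarrow> S \<subseteq> {0..T} \<Longrightarrow> (G has_real_derivative 1 / P s) (at s within S)"
  unfolding G_def[abs_def]
  by (rule DERIV_subset[of _ _ _ "{0..T}"], rule integral_has_real_derivative)
    (use Ppos in \<open>force intro!: continuous_on_divide continuous_on_const cP\<close>)+

lemma DN: "s \<in> {0..T} \<Longrightarrow> S \<subseteq> {0..T} \<Longrightarrow> (N has_real_derivative P s) (at s within S)"
  unfolding N_def[abs_def]
  by (rule DERIV_subset[of _ _ _ "{0..T}"], rule integral_has_real_derivative) (use cP in auto)

lemma G0: "G 0 = 0" and N0: "N 0 = 0" by (simp_all add: G_def N_def)

lemma C_ge_1: "1 \<le> C" using decr[of 0 0] Ppos[of 0] T by simp

lemma G_mono: "0 \<le> t \<Longrightarrow> t \<le> s \<Longrightarrow> s \<le> T \<Longrightarrow> G t \<le> G s"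
  using within_mono[of t s "\<lambda>_. 0" "\<lambda>_. 0" G "\<lambda>s. 1 / P s"] DG[of _ "{t..s}"] Ppos
  by (force simp: less_imp_le)

lemma G_nonneg: "s \<in> {0..T} \<Longrightarrow> 0 \<le> G s" using G_mono[of 0 s] G0 by simp

lemma P_times_G_le: "s \<in> {0..T} \<Longrightarrow> P s * G s \<le> C * s"
proof -
  assume s: "s \<in> {0..T}"
  have "G s - G 0 \<le> (C / P s) * s - (C / P s) * 0"
  proof (rule within_mono)
    show "0 \<le> s" using s by simp
    show "(G has_real_derivative 1 / P x) (at x within {0..s})" if "x \<in> {0..s}" for x
      by (rule DG) (use that s in auto)
    show "((\<lambda>s'. C / P s * s') has_real_derivative C / P s) (at x within {0..s})" for x
      by (rule DERIV_cmult_Id)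
    show "1 / P x \<le> C / P s" if "x \<in> {0..s}" for x
      using decr[of x s] Ppos[of x] Ppos[of s] that s by (simp add: field_simps)
  qed
  then show ?thesis using G0 Ppos[OF s] by (simp add: field_simps)
qed

lemma solves_continuous:
  assumes "solves \<rho> f X"
  shows "continuous_on {0..T} f" "continuous_on {0..T} X"
  by (rule DERIV_continuous_on[OF solvesD(1)[OF assms _ order_refl]], assumption)
     (rule DERIV_continuous_on[OF solvesD(2)[OF assms _ order_refl]], assumption)

text \<open>
  Bootstrap: with \<open>M = max \<bar>X - 1\<bar>\<close>, the first equation gives \<open>\<bar>f\<bar> \<le> (1 + M) * G\<close>, and because
  \<open>P * G \<le> C * s\<close> the second gives \<open>M \<le> \<epsilon> * C * T\<^sup>2 * (1 + M)\<close>.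
\<close>

lemma growing_solution:
  assumes so: "solves \<rho> f X" and f0: "f 0 = 0" and X0: "X 0 = 1"
    and \<rho>: "\<And>s. s \<in> {0..T} \<Longrightarrow> \<bar>\<rho> s\<bar> \<le> \<epsilon>" and th: "\<epsilon> * C * T\<^sup>2 \<le> 1/2"
    and s: "s \<in> {0..T}"
  shows "\<bar>X s - 1\<bar> \<le> 2 * (\<epsilon> * C * T\<^sup>2)" "\<bar>f s - G s\<bar> \<le> 2 * (\<epsilon> * C * T\<^sup>2) * G s"
proof -
  let ?th = "\<epsilon> * C * T\<^sup>2"
  have e0: "0 \<le> \<epsilon>" using \<rho>[of 0] T by simp
  have th0: "0 \<le> ?th" using e0 C_ge_1 by simp
  have "continuous_on {0..T} (\<lambda>s. X s - 1)"
    by (intro continuous_on_diff continuous_on_const solves_continuous[OF so])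
  then obtain t where t: "t \<in> {0..T}" and M: "\<And>s. s \<in> {0..T} \<Longrightarrow> \<bar>X s - 1\<bar> \<le> \<bar>X t - 1\<bar>"
    by (rule attains_max_abs) (use T in auto)
  define M where "M = \<bar>X t - 1\<bar>"
  have M0: "0 \<le> M" by (simp add: M_def)
  have fb: "\<bar>f s\<bar> \<le> (1 + M) * G s" if s: "s \<in> {0..T}" for s
  proof -
    have "\<bar>f s - f 0\<bar> \<le> (1 + M) * G s - (1 + M) * G 0"
    proof (rule increment_bound)
      show "0 \<le> s" using s by simp
      fix x assume x: "x \<in> {0..s}"
      then have xT: "x \<in> {0..T}" "{0..s} \<subseteq> {0..T}" using s by auto
      show "(f has_real_derivative X x / P x) (at x within {0..s})" by (rule solvesD[OF so xT])
      show "((\<lambda>s. (1 + M) * G s) has_real_derivative (1 + M) * (1 / P x)) (at x within {0..s})"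
        by (rule DERIV_cmult[OF DG[OF xT]])
      have "\<bar>X x\<bar> \<le> 1 + M" using M[OF xT(1)] unfolding M_def by linarith
      then show "\<bar>X x / P x\<bar> \<le> (1 + M) * (1 / P x)" using Ppos[OF xT(1)]
        by (simp add: abs_divide divide_right_mono)
    qed
    then show ?thesis using f0 G0 by simp
  qed
  have Xb: "\<bar>X s - 1\<bar> \<le> ?th * (1 + M)" if s: "s \<in> {0..T}" for s
  proof -
    have "\<bar>X s - X 0\<bar> \<le> (\<epsilon> * (1 + M) * (C * T)) * s - (\<epsilon> * (1 + M) * (C * T)) * 0"
    proof (rule increment_bound)
      show "0 \<le> s" using s by simp
      fix x assume x: "x \<in> {0..s}"
      then have xT: "x \<in> {0..T}" "{0..s} \<subseteq> {0..T}" using s by auto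
      show "(X has_real_derivative - \<rho> x * P x * f x) (at x within {0..s})" by (rule solvesD[OF so xT])
      show "((\<lambda>s. \<epsilon> * (1 + M) * (C * T) * s) has_real_derivative \<epsilon> * (1 + M) * (C * T)) (at x within {0..s})"
        by (rule DERIV_cmult_Id)
      have "C * x \<le> C * T" using C_ge_1 xT(1) by (intro mult_left_mono) auto
      then have "P x * G x \<le> C * T" using P_times_G_le[OF xT(1)] by linarith
      then have PG': "(1 + M) * (P x * G x) \<le> (1 + M) * (C * T)" using M0 by (intro mult_left_mono) auto
      have "\<bar>- \<rho> x * P x * f x\<bar> = \<bar>\<rho> x\<bar> * (P x * \<bar>f x\<bar>)" using Ppos[OF xT(1)] by (simp add: abs_mult)
      also have "\<dots> \<le> \<epsilon> * (P x * ((1 + M) * G x))"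
        using \<rho>[OF xT(1)] fb[OF xT(1)] Ppos[OF xT(1)] e0 by (intro mult_mono mult_left_mono) auto
      also have "\<dots> \<le> \<epsilon> * ((1 + M) * (C * T))" using PG' e0 by (intro mult_left_mono) (auto simp: mult_ac)
      finally show "\<bar>- \<rho> x * P x * f x\<bar> \<le> \<epsilon> * (1 + M) * (C * T)" by (simp add: mult.assoc)
    qed
    also have "\<dots> \<le> (\<epsilon> * (1 + M) * (C * T)) * T" using s e0 M0 C_ge_1 T by (simp add: mult_left_mono)
    finally show ?thesis using X0 by (simp add: power2_eq_square mult_ac)
  qed
  have "M \<le> ?th * (1 + M)" using Xb[OF t] by (simp add: M_def)
  also have "?th * M \<le> 1/2 * M" using th M0 by (intro mult_right_mono) auto
  then have "?th * (1 + M) \<le> ?th + M / 2" by (simp add: distrib_left)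
  finally have M2: "M \<le> 2 * ?th" by linarith
  have X2: "\<bar>X s - 1\<bar> \<le> 2 * ?th" if "s \<in> {0..T}" for s using M[OF that] M2 unfolding M_def by linarith
  show "\<bar>X s - 1\<bar> \<le> 2 * ?th" by (rule X2[OF s])
  have "\<bar>(f s - G s) - (f 0 - G 0)\<bar> \<le> 2 * ?th * G s - 2 * ?th * G 0"
  proof (rule increment_bound)
    show "0 \<le> s" using s by simp
    fix x assume x: "x \<in> {0..s}"
    then have xT: "x \<in> {0..T}" "{0..s} \<subseteq> {0..T}" using s by auto
    show "((\<lambda>s. f s - G s) has_real_derivative X x / P x - 1 / P x) (at x within {0..s})"
      by (rule DERIV_diff[OF solvesD(1)[OF so xT] DG[OF xT]])
    show "((\<lambda>s. 2 * ?th * G s) has_real_derivative 2 * ?th * (1 / P x)) (at x within {0..s})"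
      by (rule DERIV_cmult[OF DG[OF xT]])
    show "\<bar>X x / P x - 1 / P x\<bar> \<le> 2 * ?th * (1 / P x)"
      using X2[OF xT(1)] Ppos[OF xT(1)]
      by (simp add: diff_divide_distrib[symmetric] abs_divide divide_right_mono)
  qed
  then show "\<bar>f s - G s\<bar> \<le> 2 * ?th * G s" using f0 G0 by simp
qed

text \<open>
  For \<open>\<rho> \<le> 0\<close> the product \<open>f * X\<close> is nondecreasing, hence nonnegative, and it controls the derivatives
  of both squares.
\<close>

lemma squares_nondecreasing:
  assumes so: "solves \<rho> f X" and \<rho>: "\<And>s. s \<in> {0..T} \<Longrightarrow> \<rho> s \<le> 0" and z: "f 0 * X 0 = 0"
    and s: "s \<in> {0..T}"
  shows "(f 0)\<^sup>2 \<le> (f s)\<^sup>2" "(X 0)\<^sup>2 \<le> (X s)\<^sup>2"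
proof -
  have fX: "0 \<le> f s * X s" if s: "s \<in> {0..T}" for s
  proof -
    have "f 0 * X 0 \<le> f s * X s"
    proof (rule within_nondecr[where F = "\<lambda>s. f s * X s"])
      show "0 \<le> s" using s by simp
      fix x assume x: "x \<in> {0..s}"
      then have xT: "x \<in> {0..T}" "{0..s} \<subseteq> {0..T}" using s by auto
      show "((\<lambda>s. f s * X s) has_real_derivative X x / P x * X x + (- \<rho> x * P x * f x) * f x) (at x within {0..s})"
        by (rule DERIV_mult[OF solvesD[OF so xT]])
      have "0 \<le> X x * X x / P x" using Ppos[OF xT(1)] by simp
      moreover have "0 \<le> - \<rho> x * P x" using Ppos[OF xT(1)] \<rho>[OF xT(1)]
        by (intro mult_nonneg_nonneg) auto
      then have "0 \<le> (- \<rho> x * P x) * (f x * f x)" by (rule mult_nonneg_nonneg) (rule zero_le_square)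
      ultimately show "0 \<le> X x / P x * X x + (- \<rho> x * P x * f x) * f x" by (simp add: mult.assoc)
    qed
    then show ?thesis using z by simp
  qed
  have "f 0 * f 0 \<le> f s * f s"
  proof (rule within_nondecr[where F = "\<lambda>s. f s * f s"])
    show "0 \<le> s" using s by simp
    fix x assume x: "x \<in> {0..s}"
    then have xT: "x \<in> {0..T}" "{0..s} \<subseteq> {0..T}" using s by auto
    show "((\<lambda>s. f s * f s) has_real_derivative X x / P x * f x + X x / P x * f x) (at x within {0..s})"
      by (rule DERIV_mult[OF solvesD(1)[OF so xT] solvesD(1)[OF so xT]])
    have "0 \<le> f x * X x / P x" using fX[OF xT(1)] Ppos[OF xT(1)] by simp
    then show "0 \<le> X x / P x * f x + X x / P x * f x" by (simp add: mult.commute)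
  qed
  then show "(f 0)\<^sup>2 \<le> (f s)\<^sup>2" by (simp add: power2_eq_square)
  have "X 0 * X 0 \<le> X s * X s"
  proof (rule within_nondecr[where F = "\<lambda>s. X s * X s"])
    show "0 \<le> s" using s by simp
    fix x assume x: "x \<in> {0..s}"
    then have xT: "x \<in> {0..T}" "{0..s} \<subseteq> {0..T}" using s by auto
    show "((\<lambda>s. X s * X s) has_real_derivative (- \<rho> x * P x * f x) * X x + (- \<rho> x * P x * f x) * X x) (at x within {0..s})"
      by (rule DERIV_mult[OF solvesD(2)[OF so xT] solvesD(2)[OF so xT]])
    have "0 \<le> - \<rho> x * P x" using Ppos[OF xT(1)] \<rho>[OF xT(1)]
      by (intro mult_nonneg_nonneg) auto
    then have "0 \<le> (- \<rho> x * P x) * (f x * X x)" using fX[OF xT(1)] by (rule mult_nonneg_nonneg)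
    then show "0 \<le> (- \<rho> x * P x * f x) * X x + (- \<rho> x * P x * f x) * X x" by (simp add: mult_ac)
  qed
  then show "(X 0)\<^sup>2 \<le> (X s)\<^sup>2" by (simp add: power2_eq_square)
qed

lemma ge_one_of_square_ge_one:
  fixes u :: "real \<Rightarrow> real"
  assumes c: "continuous_on {0..T} u" and u0: "u 0 = 1" and sq: "\<And>s. s \<in> {0..T} \<Longrightarrow> 1 \<le> (u s)\<^sup>2"
    and s: "s \<in> {0..T}"
  shows "1 \<le> u s"
proof (rule ccontr)
  assume "\<not> 1 \<le> u s"
  moreover have "1 \<le> \<bar>u s\<bar>" using sq[OF s] abs_le_square_iff[of 1 "u s"] by simp
  ultimately have "u s \<le> 0" by linarith
  have "\<exists>x\<ge>0. x \<le> s \<and> u x = 0"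
    by (rule IVT2') (use \<open>u s \<le> 0\<close> u0 s in \<open>auto intro: continuous_on_subset[OF c]\<close>)
  then obtain x where "0 \<le> x" "x \<le> s" "u x = 0" by blast
  then have "x \<in> {0..T}" "u x = 0" using s by auto
  then show False using sq[of x] by simp
qed

lemma growing_solution_sign:
  assumes so: "solves \<rho> f X" and f0: "f 0 = 0" and X0: "X 0 = 1"
    and \<rho>: "\<And>s. s \<in> {0..T} \<Longrightarrow> \<rho> s \<le> 0" and s: "s \<in> {0..T}"
  shows "1 \<le> X s" "G s \<le> f s"
proof -
  have X1: "1 \<le> X s" if "s \<in> {0..T}" for s
    by (rule ge_one_of_square_ge_one[OF solves_continuous(2)[OF so] X0 _ that])
      (use squares_nondecreasing(2)[OF so \<rho>] f0 X0 in force)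
  show "1 \<le> X s" by (rule X1[OF s])
  have "G s - G 0 \<le> f s - f 0"
  proof (rule within_mono)
    show "0 \<le> s" using s by simp
    fix x assume x: "x \<in> {0..s}"
    then have xT: "x \<in> {0..T}" "{0..s} \<subseteq> {0..T}" using s by auto
    show "(G has_real_derivative 1 / P x) (at x within {0..s})" by (rule DG[OF xT])
    show "(f has_real_derivative X x / P x) (at x within {0..s})" by (rule solvesD[OF so xT])
    show "1 / P x \<le> X x / P x" using X1[OF xT(1)] Ppos[OF xT(1)] by (simp add: divide_right_mono)
  qed
  then show "G s \<le> f s" using G0 f0 by simp
qed

text \<open>
  The system keeps \<open>f \<ge> 1\<close>, so \<open>X\<close> increases at least like \<open>\<epsilon> * N\<close>.
\<close>

lemma even_solution_sign:
  assumes so: "solves \<rho> f X" and f0: "f 0 = 1" and X0: "X 0 = 0"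
    and \<rho>: "\<And>s. s \<in> {0..T} \<Longrightarrow> \<rho> s \<le> - \<epsilon>" and e: "0 \<le> \<epsilon>"
  shows "\<epsilon> * N T \<le> X T" "f T \<le> 1 + X T * G T"
proof -
  have T0: "T \<in> {0..T}" using T by simp
  have r0: "\<rho> s \<le> 0" if "s \<in> {0..T}" for s using \<rho>[OF that] e by linarith
  have f1: "1 \<le> f s" if "s \<in> {0..T}" for s
    by (rule ge_one_of_square_ge_one[OF solves_continuous(1)[OF so] f0 _ that])
      (use squares_nondecreasing(1)[OF so r0] f0 X0 in force)
  have X': "\<epsilon> * P x \<le> - \<rho> x * P x * f x" if x: "x \<in> {0..T}" for x
  proof -
    have 1: "\<epsilon> * P x \<le> - \<rho> x * P x"
      using \<rho>[OF x] Ppos[OF x] by (intro mult_right_mono) auto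
    have "0 \<le> \<epsilon> * P x" using e Ppos[OF x] by simp
    then have "\<epsilon> * P x * 1 \<le> (- \<rho> x * P x) * f x"
      using 1 f1[OF x] by (intro mult_mono[OF 1]) auto
    then show ?thesis by simp
  qed
  have "\<epsilon> * N T - \<epsilon> * N 0 \<le> X T - X 0"
    by (rule within_mono[OF less_imp_le[OF T] DERIV_cmult[OF DN] solvesD(2)[OF so] X']) auto
  then show "\<epsilon> * N T \<le> X T" using N0 X0 by simp
  have Xmono: "X x \<le> X T" if x: "x \<in> {0..T}" for x
    proof (rule within_nondecr[where F = X and a = x and b = T])
      show "x \<le> T" using x by simp
      fix t assume t: "t \<in> {x..T}"
      then have tT: "t \<in> {0..T}" "{x..T} \<subseteq> {0..T}" using x by auto
      show "(X has_real_derivative - \<rho> t * P t * f t) (at t within {x..T})" by (rule solvesD[OF so tT])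
      show "0 \<le> - \<rho> t * P t * f t" using X'[OF tT(1)] Ppos[OF tT(1)] e mult_nonneg_nonneg[of \<epsilon> "P t"] by linarith
    qed
  have "f T - f 0 \<le> X T * G T - X T * G 0"
  proof (rule within_mono[OF less_imp_le[OF T] solvesD(1)[OF so] DERIV_cmult[OF DG]])
    show "X x / P x \<le> X T * (1 / P x)" if "x \<in> {0..T}" for x
      using Xmono[OF that] Ppos[OF that] by (simp add: divide_right_mono)
  qed auto
  then show "f T \<le> 1 + X T * G T" using f0 G0 by simp
qed

text \<open>
  For nonnegative \<open>\<rho>\<close> a positive \<open>f\<close> would be nonincreasing, so \<open>X m \<le> - \<epsilon> * f m * N m\<close>; the resulting
  loss \<open>\<bar>X m\<bar> * (G T - G m)\<close> of \<open>f\<close> on \<open>[m, T]\<close> exceeds \<open>f m\<close>.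
\<close>

lemma even_solution_oscillates:
  assumes so: "solves \<rho> f X" and X0: "X 0 = 0"
    and \<rho>: "\<And>s. s \<in> {0..T} \<Longrightarrow> \<epsilon> \<le> \<rho> s" and e: "0 \<le> \<epsilon>"
    and m: "0 < m" "m < T" and big: "1 < \<epsilon> * N m * (G T - G m)"
    and pos: "\<And>s. 0 \<le> s \<Longrightarrow> s < T \<Longrightarrow> 0 < f s" and fT: "0 \<le> f T"
  shows False
proof -
  have f0: "0 \<le> f s" if "s \<in> {0..T}" for s using pos[of s] fT that by (cases "s = T") auto
  have X': "- \<rho> x * P x * f x \<le> 0" if x: "x \<in> {0..T}" for x
    using \<rho>[OF x] e Ppos[OF x] f0[OF x] by (simp add: mult_nonneg_nonneg)
  have Xdec: "X t \<le> X s" if "0 \<le> s" "s \<le> t" "t \<le> T" for s t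
  proof -
    show ?thesis
    proof (rule within_nonincr[OF that(2)])
      fix x assume x: "x \<in> {s..t}"
      then have xT: "x \<in> {0..T}" "{s..t} \<subseteq> {0..T}" using that by auto
      show "(X has_real_derivative - \<rho> x * P x * f x) (at x within {s..t})" by (rule solvesD[OF so xT])
      show "- \<rho> x * P x * f x \<le> 0" by (rule X'[OF xT(1)])
    qed
  qed
  have Xneg: "X s \<le> 0" if "s \<in> {0..T}" for s using Xdec[of 0 s] X0 that by simp
  have fdec: "f t \<le> f s" if "0 \<le> s" "s \<le> t" "t \<le> T" for s t
  proof -
    show ?thesis
    proof (rule within_nonincr[OF that(2)])
      fix x assume x: "x \<in> {s..t}"
      then have xT: "x \<in> {0..T}" "{s..t} \<subseteq> {0..T}" using that by auto
      show "(f has_real_derivative X x / P x) (at x within {s..t})" by (rule solvesD[OF so xT])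
      show "X x / P x \<le> 0" using Xneg[OF xT(1)] Ppos[OF xT(1)] by (simp add: divide_nonpos_pos)
    qed
  qed
  have "X m - X 0 \<le> (- \<epsilon> * f m) * N m - (- \<epsilon> * f m) * N 0"
  proof (rule within_mono)
    show "0 \<le> m" using m by simp
    fix x assume x: "x \<in> {0..m}"
    then have xT: "x \<in> {0..T}" "{0..m} \<subseteq> {0..T}" using m by auto
    show "(X has_real_derivative - \<rho> x * P x * f x) (at x within {0..m})" by (rule solvesD[OF so xT])
    show "((\<lambda>s. - \<epsilon> * f m * N s) has_real_derivative - \<epsilon> * f m * P x) (at x within {0..m})"
      by (rule DERIV_cmult[OF DN[OF xT]])
    have "\<epsilon> * f m \<le> \<rho> x * f x"
      using \<rho>[OF xT(1)] e fdec[of x m] f0[of m] x m by (intro mult_mono) auto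
    from mult_right_mono[OF this, of "P x"] show "- \<rho> x * P x * f x \<le> - \<epsilon> * f m * P x"
      using Ppos[OF xT(1)] by (simp add: mult_ac)
  qed
  then have Xm: "X m \<le> - (\<epsilon> * f m * N m)" using X0 N0 by simp
  have "f T - f m \<le> X m * G T - X m * G m"
  proof (rule within_mono)
    show "m \<le> T" using m by simp
    fix x assume x: "x \<in> {m..T}"
    then have xT: "x \<in> {0..T}" "{m..T} \<subseteq> {0..T}" using m by auto
    show "(f has_real_derivative X x / P x) (at x within {m..T})" by (rule solvesD[OF so xT])
    show "((\<lambda>s. X m * G s) has_real_derivative X m * (1 / P x)) (at x within {m..T})"
      by (rule DERIV_cmult[OF DG[OF xT]])
    show "X x / P x \<le> X m * (1 / P x)"
      using Xdec[of m x] x m Ppos[OF xT(1)] by (simp add: divide_right_mono)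
  qed
  then have 1: "f T \<le> f m + X m * (G T - G m)" by (simp add: right_diff_distrib)
  have "0 \<le> G T - G m" using G_mono[of m T] m by simp
  from mult_right_mono[OF Xm this] have "X m * (G T - G m) \<le> - (f m * (\<epsilon> * N m * (G T - G m)))"
    by (simp add: mult_ac)
  moreover have fm: "0 < f m" using pos m by simp
  then have "f m * 1 < f m * (\<epsilon> * N m * (G T - G m))" using big by (intro mult_strict_left_mono) auto
  ultimately have "f T < 0" using 1 by linarith
  then show False using fT by simp
qed

text \<open>
  A solution with small \<open>X T\<close> stays close to the constant solution. The equation for \<open>X\<close> is integrated from
  the right end, because \<open>P \<le> C * P s\<close> on \<open>[s, T]\<close> bounds \<open>X s\<close> by \<open>\<zeta>\<close> plus a multiple of \<open>P s\<close>; the rest is a bootstrap on \<open>max \<bar>f\<bar>\<close>.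
\<close>

lemma band_solution:
  assumes so: "solves \<rho> f X" and f0: "f 0 = 1" and XT: "\<bar>X T\<bar> \<le> \<zeta>"
    and \<rho>: "\<And>s. s \<in> {0..T} \<Longrightarrow> \<bar>\<rho> s\<bar> \<le> \<epsilon>" and th: "\<epsilon> * C * T\<^sup>2 \<le> 1/2"
    and s: "s \<in> {0..T}"
  shows "\<bar>f s\<bar> \<le> 2 * (1 + \<zeta> * G T)"
    "\<bar>f s - 1\<bar> \<le> \<zeta> * G s + 2 * (\<epsilon> * C * T\<^sup>2) * (1 + \<zeta> * G T)"
proof -
  let ?th = "\<epsilon> * C * T\<^sup>2"
  have e0: "0 \<le> \<epsilon>" using \<rho>[of 0] T by simp
  have th0: "0 \<le> ?th" using e0 C_ge_1 by simp
  have z0: "0 \<le> \<zeta>" using XT by simp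
  obtain t where t: "t \<in> {0..T}" and M: "\<And>s. s \<in> {0..T} \<Longrightarrow> \<bar>f s\<bar> \<le> \<bar>f t\<bar>"
    by (rule attains_max_abs[OF solves_continuous(1)[OF so]]) (use T in auto)
  define M where "M = \<bar>f t\<bar>"
  have M0: "0 \<le> M" by (simp add: M_def)
  have Xb: "\<bar>X s\<bar> \<le> \<zeta> + \<epsilon> * M * C * T * P s" if s: "s \<in> {0..T}" for s
  proof -
    have "\<bar>X T - X s\<bar> \<le> (\<epsilon> * M * (C * P s)) * T - (\<epsilon> * M * (C * P s)) * s"
    proof (rule increment_bound)
      show "s \<le> T" using s by simp
      fix x assume x: "x \<in> {s..T}"
      then have xT: "x \<in> {0..T}" "{s..T} \<subseteq> {0..T}" using s by auto
      show "(X has_real_derivative - \<rho> x * P x * f x) (at x within {s..T})" by (rule solvesD[OF so xT])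
      show "((*) (\<epsilon> * M * (C * P s)) has_real_derivative \<epsilon> * M * (C * P s)) (at x within {s..T})"
        by (rule DERIV_cmult_Id)
      have "\<bar>- \<rho> x * P x * f x\<bar> = \<bar>\<rho> x\<bar> * (P x * \<bar>f x\<bar>)" using Ppos[OF xT(1)] by (simp add: abs_mult)
      also have "\<dots> \<le> \<epsilon> * ((C * P s) * M)"
        using \<rho>[OF xT(1)] M[OF xT(1)] decr[of s x] Ppos[OF xT(1)] e0 x s
        by (intro mult_mono) (auto simp: M_def intro!: mult_nonneg_nonneg)
      finally show "\<bar>- \<rho> x * P x * f x\<bar> \<le> \<epsilon> * M * (C * P s)" by (simp add: mult_ac)
    qed
    also have "\<dots> \<le> (\<epsilon> * M * (C * P s)) * T"
      using s e0 M0 C_ge_1 Ppos[OF s] by (simp add: mult_nonneg_nonneg)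
    finally show ?thesis using XT by (simp add: mult_ac)
  qed
  have fb: "\<bar>f s - 1\<bar> \<le> \<zeta> * G s + ?th * M" if s: "s \<in> {0..T}" for s
  proof -
    have "\<bar>f s - f 0\<bar> \<le> (\<zeta> * G s + \<epsilon> * M * C * T * s) - (\<zeta> * G 0 + \<epsilon> * M * C * T * 0)"
    proof (rule increment_bound)
      show "0 \<le> s" using s by simp
      fix x assume x: "x \<in> {0..s}"
      then have xT: "x \<in> {0..T}" "{0..s} \<subseteq> {0..T}" using s by auto
      show "(f has_real_derivative X x / P x) (at x within {0..s})" by (rule solvesD[OF so xT])
      show "((\<lambda>s. \<zeta> * G s + \<epsilon> * M * C * T * s) has_real_derivative \<zeta> * (1 / P x) + \<epsilon> * M * C * T) (at x within {0..s})"
        by (rule DERIV_add[OF DERIV_cmult[OF DG[OF xT]] DERIV_cmult_Id])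
      have "\<bar>X x / P x\<bar> \<le> (\<zeta> + \<epsilon> * M * C * T * P x) / P x"
        unfolding abs_divide using Xb[OF xT(1)] Ppos[OF xT(1)] by (simp add: divide_right_mono)
      then show "\<bar>X x / P x\<bar> \<le> \<zeta> * (1 / P x) + \<epsilon> * M * C * T"
        using Ppos[OF xT(1)] by (simp add: add_divide_distrib)
    qed
    also have "\<epsilon> * M * C * T * s \<le> \<epsilon> * M * C * T * T"
      using s e0 M0 C_ge_1 T by (intro mult_left_mono) auto
    finally show ?thesis using f0 G0 by (simp add: power2_eq_square mult_ac)
  qed
  have "\<zeta> * G t \<le> \<zeta> * G T" using G_mono[of t T] t z0 by (intro mult_left_mono) auto
  moreover have "?th * M \<le> 1/2 * M" using th M0 by (intro mult_right_mono) auto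
  ultimately have "M \<le> 1 + \<zeta> * G T + M / 2" using fb[OF t] unfolding M_def by linarith
  then have "M \<le> 2 + 2 * (\<zeta> * G T)" by linarith
  then have M2: "M \<le> 2 * (1 + \<zeta> * G T)" by (simp only: distrib_left mult_1_right)
  show "\<bar>f s\<bar> \<le> 2 * (1 + \<zeta> * G T)" using M[OF s] M2 unfolding M_def by linarith
  have "?th * M \<le> ?th * (2 * (1 + \<zeta> * G T))" using M2 th0 by (rule mult_left_mono)
  then have "?th * M \<le> 2 * ?th * (1 + \<zeta> * G T)" by (simp only: mult.assoc mult.left_commute)
  then show "\<bar>f s - 1\<bar> \<le> \<zeta> * G s + 2 * ?th * (1 + \<zeta> * G T)" using fb[OF s] by linarith
qed

end

section \<open>Laplace asymptotics of the WKB weight\<close>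

lemma exp_difference_bound:
  fixes a b m d :: real
  assumes "a \<le> m" "b \<le> m" "\<bar>a - b\<bar> \<le> d"
  shows "\<bar>exp a - exp b\<bar> \<le> d * exp m"
proof -
  have w: "exp v - exp u \<le> d * exp m" if "u \<le> v" "v \<le> m" "v - u \<le> d" for u v :: real
  proof -
    have "exp v * (1 + (u - v)) \<le> exp v * exp (u - v)"
      using exp_ge_add_one_self[of "u - v"] by (intro mult_left_mono) auto
    also have "exp v * exp (u - v) = exp u" by (simp add: exp_add[symmetric])
    finally have "exp v - exp u \<le> (v - u) * exp v" by (simp add: algebra_simps)
    also have "\<dots> \<le> d * exp m" using that by (intro mult_mono) auto
    finally show ?thesis .
  qed
  show ?thesis
  proof (cases "a \<le> b")
    case True
    then have "exp a \<le> exp b" by simp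
    then show ?thesis using w[of a b] assms True by simp
  next
    case False
    then have "exp b \<le> exp a" by simp
    then show ?thesis using w[of b a] assms False by simp
  qed
qed

lemma exp_minus_le_inverse: "0 < z \<Longrightarrow> exp (- z) \<le> 1 / (z :: real)"
proof -
  assume z: "0 < z"
  have "z \<le> exp z" using exp_ge_add_one_self[of z] by linarith
  then show ?thesis unfolding exp_minus inverse_eq_divide using z by (intro divide_left_mono) auto
qed

text \<open>
  Half of the exponential decay absorbs the polynomial and leaves a factor \<open>h\<close>.
\<close>

lemma poly_exp_bound:
  fixes A B c h x :: real
  assumes "0 \<le> A" "0 \<le> B" "0 < c" "0 < h" "0 \<le> x"
  shows "(A * x\<^sup>2 / h + B * x) * exp (- c * x / h) \<le> (16 * A / c\<^sup>2 + 2 * B / c) * h * exp (- c * x / (2 * h))"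
proof -
  define z where "z = c * x / (4 * h)"
  have z0: "0 \<le> z" using assms by (simp add: z_def)
  have x: "x = 4 * h * z / c" using assms by (simp add: z_def)
  have z1: "z \<le> exp z" using exp_ge_add_one_self[of z] by linarith
  have z2: "2 * z \<le> exp (2 * z)" using exp_ge_add_one_self[of "2 * z"] by linarith
  have zz: "z\<^sup>2 \<le> exp (2 * z)"
    using mult_mono[OF z1 z1] z0 by (simp add: power2_eq_square exp_add[symmetric])
  have e: "exp (- c * x / h) = exp (- 4 * z)" "exp (- c * x / (2 * h)) = exp (2 * z) * exp (- 4 * z)"
    using assms by (simp_all add: z_def exp_add[symmetric] field_simps)
  have "A * x\<^sup>2 / h + B * x = (16 * A / c\<^sup>2) * h * z\<^sup>2 + (2 * B / c) * h * (2 * z)"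
    using assms by (simp add: x power2_eq_square field_simps)
  also have "\<dots> \<le> (16 * A / c\<^sup>2) * h * exp (2 * z) + (2 * B / c) * h * exp (2 * z)"
    using zz z2 assms by (intro add_mono mult_left_mono) auto
  also have "\<dots> = (16 * A / c\<^sup>2 + 2 * B / c) * h * exp (2 * z)" by (simp add: algebra_simps)
  finally show ?thesis unfolding e by (simp add: mult.assoc[symmetric])
qed

lemma gaussian_half_line:
  fixes k :: real
  assumes "k > 0"
  shows "(\<lambda>x. exp (- k * x\<^sup>2)) integrable_on {0..}" "integral {0..} (\<lambda>x. exp (- k * x\<^sup>2)) = sqrt (pi / k) / 2"
proof -
  have "has_bochner_integral lborel (\<lambda>x::real. indicator {0..} x *\<^sub>R exp (- x\<^sup>2)) (sqrt pi / 2)"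
    by (rule gaussian_moment_0)
  then have "has_bochner_integral lborel (\<lambda>x. indicator {0..} (0 + sqrt k * x) *\<^sub>R exp (- (0 + sqrt k * x)\<^sup>2)) ((sqrt pi / 2) /\<^sub>R \<bar>sqrt k\<bar>)"
    by (subst (asm) lborel_has_bochner_integral_real_affine_iff[of "sqrt k" _ _ 0]) (use assms in auto)
  moreover have "indicator {0..} (0 + sqrt k * x) *\<^sub>R exp (- (0 + sqrt k * x)\<^sup>2) = indicator {0..} x *\<^sub>R exp (- k * x\<^sup>2)" for x
    using assms by (auto simp: indicator_def power_mult_distrib zero_le_mult_iff)
  moreover have "(sqrt pi / 2) /\<^sub>R \<bar>sqrt k\<bar> = sqrt (pi / k) / 2"
    using assms by (simp add: real_sqrt_divide field_simps)
  ultimately have *: "has_bochner_integral lborel (\<lambda>x. indicator {0..} x *\<^sub>R exp (- k * x\<^sup>2)) (sqrt (pi / k) / 2)"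
    by simp
  then have s: "set_integrable lborel {0..} (\<lambda>x. exp (- k * x\<^sup>2))"
    unfolding set_integrable_def by (rule integrable.intros)
  show "(\<lambda>x. exp (- k * x\<^sup>2)) integrable_on {0..}"
    by (rule set_borel_integral_eq_integral(1)[OF s])
  show "integral {0..} (\<lambda>x. exp (- k * x\<^sup>2)) = sqrt (pi / k) / 2"
    using set_borel_integral_eq_integral(2)[OF s] has_bochner_integral_integral_eq[OF *]
    by (simp add: set_lebesgue_integral_def)
qed

text \<open>
  Beyond \<open>T\<close> one has \<open>exp (- k * x\<^sup>2) \<le> exp (- k * T\<^sup>2 / 2) * exp (- k * x\<^sup>2 / 2)\<close>.
\<close>

lemma gaussian_truncated:
  fixes k T :: real
  assumes k: "k > 0" and T: "T > 0"
  shows "integral {0..T} (\<lambda>x. exp (- k * x\<^sup>2)) \<le> sqrt (pi / k) / 2"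
    "sqrt (pi / k) / 2 - exp (- k * T\<^sup>2 / 2) * (sqrt (2 * pi / k) / 2) \<le> integral {0..T} (\<lambda>x. exp (- k * x\<^sup>2))"
proof -
  let ?f = "\<lambda>x::real. exp (- k * x\<^sup>2)"
  have iT: "?f integrable_on {0..T}"
    by (intro integrable_continuous_real continuous_intros)
  show "integral {0..T} ?f \<le> sqrt (pi / k) / 2"
    unfolding gaussian_half_line(2)[OF k, symmetric]
    by (rule integral_subset_le[OF _ iT gaussian_half_line(1)[OF k]]) auto
  have k2: "k / 2 > 0" using k by simp
  have h1: "((\<lambda>x. if x \<in> {0..T} then ?f x else 0) has_integral integral {0..T} ?f) {0..}"
    by (subst has_integral_restrict) (use iT in \<open>auto intro: integrable_integral\<close>)
  have h2: "((\<lambda>x. exp (- (k / 2) * x\<^sup>2)) has_integral sqrt (pi / (k / 2)) / 2) {0..}"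
    using integrable_integral[OF gaussian_half_line(1)[OF k2]] unfolding gaussian_half_line(2)[OF k2] .
  have h3: "((\<lambda>x. (if x \<in> {0..T} then ?f x else 0) + exp (- k * T\<^sup>2 / 2) * exp (- (k / 2) * x\<^sup>2))
      has_integral integral {0..T} ?f + exp (- k * T\<^sup>2 / 2) * (sqrt (pi / (k / 2)) / 2)) {0..}"
    by (rule has_integral_add[OF h1 has_integral_mult_right[OF h2]])
  have h4: "(?f has_integral sqrt (pi / k) / 2) {0..}"
    using integrable_integral[OF gaussian_half_line(1)[OF k]] unfolding gaussian_half_line(2)[OF k] .
  have "sqrt (pi / k) / 2 \<le> integral {0..T} ?f + exp (- k * T\<^sup>2 / 2) * (sqrt (pi / (k / 2)) / 2)"
  proof (rule has_integral_le[OF h4 h3])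
    fix x :: real assume x: "x \<in> {0..}"
    show "?f x \<le> (if x \<in> {0..T} then ?f x else 0) + exp (- k * T\<^sup>2 / 2) * exp (- (k / 2) * x\<^sup>2)"
    proof (cases "x \<in> {0..T}")
      case True then show ?thesis by simp
    next
      case False
      then have "T\<^sup>2 \<le> x\<^sup>2" using x T by (intro power_mono) auto
      then have "k * T\<^sup>2 \<le> k * x\<^sup>2" using k by simp
      then show ?thesis using False by (simp add: exp_add[symmetric] field_simps)
    qed
  qed
  then show "sqrt (pi / k) / 2 - exp (- k * T\<^sup>2 / 2) * (sqrt (2 * pi / k) / 2) \<le> integral {0..T} ?f"
    by (simp add: mult.commute)
qed

text \<open>
  Linear steps of the estimates below, in atomic variables: in place they would involve
  nonlinear subterms.
\<close>

lemma abs_estimates: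
  fixes A H d k l b P q Yd :: real
  shows "\<bar>H\<bar> \<le> \<bar>d\<bar> \<Longrightarrow> \<bar>d\<bar> \<le> k \<Longrightarrow> k \<le> l \<Longrightarrow> H \<le> l"
    and "\<bar>A\<bar> \<le> k / 2 \<Longrightarrow> \<bar>H\<bar> \<le> \<bar>d\<bar> \<Longrightarrow> \<bar>d\<bar> \<le> k / 2 \<Longrightarrow> \<bar>A + H\<bar> \<le> k"
    and "\<bar>P - b\<bar> \<le> q / 2 \<Longrightarrow> \<bar>Yd + P\<bar> \<le> k \<Longrightarrow> k \<le> l \<Longrightarrow> \<bar>2 * Yd - - 2 * b\<bar> \<le> q + 2 * l"
    and "A \<le> b \<Longrightarrow> Yd \<le> - b + k \<Longrightarrow> k \<le> l \<Longrightarrow> 2 * Yd \<le> - 2 * A + 2 * l"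
  by linarith+

text \<open>
  The exponent \<open>Y = - \<Phi> / h + B + h * D\<close> of the WKB function on the interval from the well to the
  midpoint \<open>T\<close> between the wells. The constant \<open>K\<close> bounds all remainders; \<open>g_near\<close> and \<open>g_end\<close> are the
  Taylor estimates used at the two ends of the interval.
\<close>

locale wkb_data =
  fixes T K gm \<kappa> :: real and g n p :: "real \<Rightarrow> real"
  assumes T: "0 < T" and gm: "0 < gm" and K: "0 \<le> K"
    and cont: "continuous_on {0..T} g" "continuous_on {0..T} n" "continuous_on {0..T} p"
    and g_ge: "\<And>s. s \<in> {0..T} \<Longrightarrow> gm \<le> g s" and g0: "g 0 = \<kappa>"
    and g_near: "\<And>s. s \<in> {0..T} \<Longrightarrow> \<bar>g s - \<kappa>\<bar> \<le> K * s\<^sup>2"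
    and g_end: "\<And>s. s \<in> {0..T} \<Longrightarrow> \<bar>s * g s - T * g T\<bar> \<le> K * (T - s)"
    and n_le: "\<And>s. s \<in> {0..T} \<Longrightarrow> \<bar>n s\<bar> \<le> K" and p_le: "\<And>s. s \<in> {0..T} \<Longrightarrow> \<bar>p s\<bar> \<le> K"
begin

definition "\<Phi> s = integral {0..s} (\<lambda>t. t * g t)"
definition "B s = integral {0..s} (\<lambda>t. t * n t)"
definition "D s = integral {0..s} (\<lambda>t. t * p t)"
definition "Y h s = - \<Phi> s / h + B s + h * D s"
definition "y h s = s * (- g s / h + n s + h * p s)"

lemma D\<Phi>: "s \<in> {0..T} \<Longrightarrow> S \<subseteq> {0..T} \<Longrightarrow> (\<Phi> has_real_derivative s * g s) (at s within S)"
  unfolding \<Phi>_def[abs_def]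
  by (rule DERIV_subset[of _ _ _ "{0..T}"], rule integral_has_real_derivative)
    (use cont in \<open>auto intro!: continuous_on_mult continuous_on_id\<close>)

lemma DB: "s \<in> {0..T} \<Longrightarrow> S \<subseteq> {0..T} \<Longrightarrow> (B has_real_derivative s * n s) (at s within S)"
  unfolding B_def[abs_def]
  by (rule DERIV_subset[of _ _ _ "{0..T}"], rule integral_has_real_derivative)
    (use cont in \<open>auto intro!: continuous_on_mult continuous_on_id\<close>)

lemma DD: "s \<in> {0..T} \<Longrightarrow> S \<subseteq> {0..T} \<Longrightarrow> (D has_real_derivative s * p s) (at s within S)"
  unfolding D_def[abs_def]
  by (rule DERIV_subset[of _ _ _ "{0..T}"], rule integral_has_real_derivative)
    (use cont in \<open>auto intro!: continuous_on_mult continuous_on_id\<close>)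

lemma zero_values: "\<Phi> 0 = 0" "B 0 = 0" "D 0 = 0" "Y h 0 = 0" by (simp_all add: \<Phi>_def B_def D_def Y_def)

lemma DY: "s \<in> {0..T} \<Longrightarrow> S \<subseteq> {0..T} \<Longrightarrow> (Y h has_real_derivative y h s) (at s within S)"
proof -
  assume s: "s \<in> {0..T}" "S \<subseteq> {0..T}"
  have "(Y h has_real_derivative - (s * g s) / h + s * n s + h * (s * p s)) (at s within S)"
    unfolding Y_def[abs_def]
    by (rule DERIV_add[OF DERIV_add[OF DERIV_cdivide[OF DERIV_minus[OF D\<Phi>[OF s]]] DB[OF s]] DERIV_cmult[OF DD[OF s]]])
  then show ?thesis by (simp add: y_def algebra_simps)
qed

lemma Y_cont: "continuous_on {0..T} (Y h)"
  by (rule DERIV_continuous_on[OF DY]) auto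

lemma D_square: "((\<lambda>s. c * s\<^sup>2 / 2) has_real_derivative c * s) (at s within S)" for c :: real
  by (auto intro!: derivative_eq_intros)

lemma BD_diff:
  assumes "0 \<le> t" "t \<le> s" "s \<le> T"
  shows "\<bar>B s - B t\<bar> \<le> K * (s\<^sup>2 - t\<^sup>2) / 2" "\<bar>D s - D t\<bar> \<le> K * (s\<^sup>2 - t\<^sup>2) / 2"
proof -
  have sub: "x \<in> {0..T}" "{t..s} \<subseteq> {0..T}" if "x \<in> {t..s}" for x using that assms by auto
  have b: "\<bar>x * n x\<bar> \<le> K * x" "\<bar>x * p x\<bar> \<le> K * x" if "x \<in> {t..s}" for x
    using n_le[OF sub(1)[OF that]] p_le[OF sub(1)[OF that]] that assms
    by (auto simp: abs_mult mult.commute[of K] intro!: mult_left_mono)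
  have "\<bar>B s - B t\<bar> \<le> K * s\<^sup>2 / 2 - K * t\<^sup>2 / 2"
    by (rule increment_bound[OF assms(2) DB[OF sub] D_square b(1)])
  then show "\<bar>B s - B t\<bar> \<le> K * (s\<^sup>2 - t\<^sup>2) / 2" by (simp add: right_diff_distrib diff_divide_distrib)
  have "\<bar>D s - D t\<bar> \<le> K * s\<^sup>2 / 2 - K * t\<^sup>2 / 2"
    by (rule increment_bound[OF assms(2) DD[OF sub] D_square b(2)])
  then show "\<bar>D s - D t\<bar> \<le> K * (s\<^sup>2 - t\<^sup>2) / 2" by (simp add: right_diff_distrib diff_divide_distrib)
qed

lemma \<Phi>_diff:
  assumes "0 \<le> t" "t \<le> s" "s \<le> T"
  shows "gm * (s\<^sup>2 - t\<^sup>2) / 2 \<le> \<Phi> s - \<Phi> t"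
proof -
  have sub: "x \<in> {0..T}" "{t..s} \<subseteq> {0..T}" if "x \<in> {t..s}" for x using that assms by auto
  have "\<bar>(\<lambda>_. 0::real) s - (\<lambda>_. 0) t\<bar> \<le> (\<Phi> s - gm * s\<^sup>2 / 2) - (\<Phi> t - gm * t\<^sup>2 / 2)"
  proof (rule increment_bound[OF assms(2), where f' = "\<lambda>_. 0"])
    fix x assume x: "x \<in> {t..s}"
    show "((\<lambda>_. 0::real) has_real_derivative 0) (at x within {t..s})" by simp
    show "((\<lambda>s. \<Phi> s - gm * s\<^sup>2 / 2) has_real_derivative x * g x - gm * x) (at x within {t..s})"
      by (rule DERIV_diff[OF D\<Phi>[OF sub[OF x]] D_square])
    show "\<bar>0\<bar> \<le> x * g x - gm * x" using g_ge[OF sub(1)[OF x]] x assms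
      by (simp add: mult.commute[of gm] mult_left_mono)
  qed
  then show ?thesis by (simp add: right_diff_distrib diff_divide_distrib)
qed

lemma \<Phi>_near: "s \<in> {0..T} \<Longrightarrow> \<bar>\<Phi> s - \<kappa> * s\<^sup>2 / 2\<bar> \<le> K * s ^ 4 / 4"
proof -
  assume s: "s \<in> {0..T}"
  have sub: "x \<in> {0..T}" "{0..s} \<subseteq> {0..T}" if "x \<in> {0..s}" for x using that s by auto
  have "\<bar>(\<Phi> s - \<kappa> * s\<^sup>2 / 2) - (\<Phi> 0 - \<kappa> * 0\<^sup>2 / 2)\<bar> \<le> K * s ^ 4 / 4 - K * 0 ^ 4 / 4"
  proof (rule increment_bound)
    show "0 \<le> s" using s by simp
    fix x assume x: "x \<in> {0..s}"
    show "((\<lambda>s. \<Phi> s - \<kappa> * s\<^sup>2 / 2) has_real_derivative x * g x - \<kappa> * x) (at x within {0..s})"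
      by (rule DERIV_diff[OF D\<Phi>[OF sub[OF x]] D_square])
    show "((\<lambda>s. K * s ^ 4 / 4) has_real_derivative K * x ^ 3) (at x within {0..s})"
      by (auto intro!: derivative_eq_intros)
    have "x * g x - \<kappa> * x = x * (g x - \<kappa>)" by (simp add: algebra_simps)
    then have "\<bar>x * g x - \<kappa> * x\<bar> = x * \<bar>g x - \<kappa>\<bar>" using x by (simp add: abs_mult)
    also have "\<dots> \<le> x * (K * x\<^sup>2)" using x g_near[OF sub(1)[OF x]] by (intro mult_left_mono) auto
    finally show "\<bar>x * g x - \<kappa> * x\<bar> \<le> K * x ^ 3" by (simp add: power2_eq_square power3_eq_cube mult_ac)
  qed
  then show ?thesis using zero_values by simp
qed

lemma \<Phi>_end: "s \<in> {0..T} \<Longrightarrow> \<bar>(\<Phi> T - \<Phi> s) - T * g T * (T - s)\<bar> \<le> K * (T - s)\<^sup>2 / 2"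
proof -
  assume s: "s \<in> {0..T}"
  have sub: "x \<in> {0..T}" "{s..T} \<subseteq> {0..T}" if "x \<in> {s..T}" for x using that s by auto
  have "\<bar>(\<Phi> T - T * g T * T) - (\<Phi> s - T * g T * s)\<bar> \<le> - (K * (T - T)\<^sup>2 / 2) - - (K * (T - s)\<^sup>2 / 2)"
  proof (rule increment_bound)
    show "s \<le> T" using s by simp
    fix x assume x: "x \<in> {s..T}"
    show "((\<lambda>s. \<Phi> s - T * g T * s) has_real_derivative x * g x - T * g T) (at x within {s..T})"
      by (rule DERIV_diff[OF D\<Phi>[OF sub[OF x]] DERIV_cmult_Id])
    show "((\<lambda>s. - (K * (T - s)\<^sup>2 / 2)) has_real_derivative K * (T - x)) (at x within {s..T})"
      by (auto intro!: derivative_eq_intros simp: field_simps)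
    show "\<bar>x * g x - T * g T\<bar> \<le> K * (T - x)" by (rule g_end[OF sub(1)[OF x]])
  qed
  then show ?thesis by (simp add: algebra_simps)
qed

text \<open>
  \<open>\<Phi>\<close> increases and \<open>B\<close>, \<open>D\<close> are bounded independently of \<open>h\<close>.
\<close>

lemma Y_quasi_decreasing:
  assumes h: "0 < h" "h \<le> 1" and st: "0 \<le> t" "t \<le> s" "s \<le> T"
  shows "exp (2 * Y h s) \<le> exp (2 * K * T\<^sup>2) * exp (2 * Y h t)"
proof -
  have "s\<^sup>2 \<le> T\<^sup>2" "t\<^sup>2 \<le> s\<^sup>2" using st by (auto intro: power_mono)
  have "s\<^sup>2 - t\<^sup>2 \<le> T\<^sup>2" using \<open>s\<^sup>2 \<le> T\<^sup>2\<close> zero_le_power2[of t] by linarith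
  then have k: "K * (s\<^sup>2 - t\<^sup>2) / 2 \<le> K * T\<^sup>2 / 2" using K by (simp add: mult_left_mono)
  have "\<bar>h * (D s - D t)\<bar> \<le> \<bar>D s - D t\<bar>" unfolding abs_mult using h by (intro mult_left_le_one_le) auto
  from abs_estimates(1)[OF this BD_diff(2)[OF st] k]
  have d: "h * D s - h * D t \<le> K * T\<^sup>2 / 2" by (simp only: right_diff_distrib)
  have "0 \<le> gm * (s\<^sup>2 - t\<^sup>2) / 2" using gm \<open>t\<^sup>2 \<le> s\<^sup>2\<close> by simp
  then have "0 \<le> (\<Phi> s - \<Phi> t) / h" using \<Phi>_diff[OF st] h by simp
  then have "- \<Phi> s / h \<le> - \<Phi> t / h" by (simp add: diff_divide_distrib)
  then have "Y h s \<le> Y h t + K * T\<^sup>2"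
    unfolding Y_def using BD_diff(1)[OF st] k d by linarith
  then have "2 * Y h s \<le> 2 * K * T\<^sup>2 + 2 * Y h t" by linarith
  then show ?thesis unfolding exp_add[symmetric] by (simp only: exp_le_cancel_iff)
qed

lemma Y_bracket:
  assumes h: "0 < h" "h \<le> 1" and st: "0 \<le> t" "t \<le> s" "s \<le> T"
  shows "\<bar>(Y h s - Y h t) + (\<Phi> s - \<Phi> t) / h\<bar> \<le> K * (s\<^sup>2 - t\<^sup>2)"
    "Y h s - Y h t \<le> - gm * (s\<^sup>2 - t\<^sup>2) / (2 * h) + K * (s\<^sup>2 - t\<^sup>2)"
proof -
  have e: "(Y h s - Y h t) + (\<Phi> s - \<Phi> t) / h = (B s - B t) + h * (D s - D t)"
    by (simp add: Y_def algebra_simps diff_divide_distrib)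
  have "\<bar>h * (D s - D t)\<bar> \<le> \<bar>D s - D t\<bar>" unfolding abs_mult using h by (intro mult_left_le_one_le) auto
  then show 1: "\<bar>(Y h s - Y h t) + (\<Phi> s - \<Phi> t) / h\<bar> \<le> K * (s\<^sup>2 - t\<^sup>2)"
    unfolding e using BD_diff[OF st] by (intro abs_estimates(2))
  have "gm * (s\<^sup>2 - t\<^sup>2) / 2 / h \<le> (\<Phi> s - \<Phi> t) / h"
    using \<Phi>_diff[OF st] h by (intro divide_right_mono) auto
  then show "Y h s - Y h t \<le> - gm * (s\<^sup>2 - t\<^sup>2) / (2 * h) + K * (s\<^sup>2 - t\<^sup>2)"
    using 1 by (simp add: abs_le_iff)
qed

lemma exp_linear_integral:
  fixes k :: real
  assumes "0 < k"
  shows "((\<lambda>t. exp (- k * (T - t))) has_integral (1 - exp (- k * T)) / k) {0..T}"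
proof -
  have "((\<lambda>t. exp (- k * (T - t))) has_integral exp (- k * (T - T)) / k - exp (- k * (T - 0)) / k) {0..T}"
  proof (rule fundamental_theorem_of_calculus)
    show "0 \<le> T" using T by simp
    show "((\<lambda>t. exp (- k * (T - t)) / k) has_vector_derivative exp (- k * (T - x))) (at x within {0..T})" for x
      unfolding has_real_derivative_iff_has_vector_derivative[symmetric]
      using assms by (auto intro!: derivative_eq_intros)
  qed
  then show ?thesis by (simp add: diff_divide_distrib)
qed

text \<open>
  Near \<open>T\<close> the exponent \<open>2 * (Y T - Y t)\<close> is close to the linear function \<open>- 2 * T * g T * (T - t) / h\<close>.
\<close>

lemma laplace_end:
  obtains M h0 where "0 < h0" "0 \<le> M"
    "\<And>h. 0 < h \<Longrightarrow> h < h0 \<Longrightarrow>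
      \<bar>integral {0..T} (\<lambda>t. exp (2 * (Y h T - Y h t))) - h / (2 * (T * g T))\<bar> \<le> M * h\<^sup>2"
proof -
  define \<beta> where "\<beta> = T * g T"
  \<comment> \<open>Both exponents are at most \<open>- c * (T - t) / h\<close> for small \<open>h\<close>.\<close>
  define c where "c = gm * T / 2"
  define M0 where "M0 = 16 * K / c\<^sup>2 + 2 * (4 * (K * T)) / c"
  define M where "M = M0 * (2 / c) + 1 / (4 * \<beta>\<^sup>2 * T)"
  define h0 where "h0 = min 1 (c / (4 * K * T + 1))"
  have c0: "0 < c" using gm T by (simp add: c_def)
  have gT: "gm \<le> g T" using g_ge[of T] T by simp
  have \<beta>0: "0 < \<beta>" using gT gm T by (simp add: \<beta>_def)
  have c\<beta>: "c \<le> 2 * \<beta>"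
  proof -
    have "gm * T \<le> g T * T" using gT T by (intro mult_right_mono) auto
    then show ?thesis using \<beta>0 by (simp add: c_def \<beta>_def mult.commute)
  qed
  have M00: "0 \<le> M0" using K T c0 by (simp add: M0_def)
  have KT: "0 \<le> 4 * K * T" using K T by simp
  have h00: "0 < h0" using c0 KT by (simp add: h0_def)
  have "\<bar>integral {0..T} (\<lambda>t. exp (2 * (Y h T - Y h t))) - h / (2 * \<beta>)\<bar> \<le> M * h\<^sup>2"
    if h: "0 < h" "h < h0" for h
  proof -
    have h1: "h \<le> 1" using h by (simp add: h0_def)
    have "h * (4 * K * T + 1) \<le> c" using h KT by (simp add: h0_def field_simps)
    then have hc: "4 * (K * T) * h \<le> c" using h by (simp add: algebra_simps)
    let ?a = "\<lambda>t. 2 * (Y h T - Y h t)" and ?b = "\<lambda>t. - (2 * \<beta> / h) * (T - t)"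
    have pt: "\<bar>exp (?a t) - exp (?b t)\<bar> \<le> M0 * h * exp (- (c / (2 * h)) * (T - t))" if t: "t \<in> {0..T}" for t
    proof -
      define x where "x = T - t"
      have x0: "0 \<le> x" using t by (simp add: x_def)
      have T2: "T\<^sup>2 - t\<^sup>2 = (T + t) * x" by (simp add: x_def power2_eq_square algebra_simps)
      have up: "K * (T\<^sup>2 - t\<^sup>2) \<le> K * (2 * T * x)" unfolding T2 using t x0 K by (intro mult_left_mono mult_right_mono) auto
      have lo: "T * x \<le> T\<^sup>2 - t\<^sup>2" unfolding T2 using t x0 by (intro mult_right_mono) auto
      have tT: "0 \<le> t" "t \<le> T" "T \<le> T" using t by auto
      have "\<bar>(\<Phi> T - \<Phi> t) / h - \<beta> * x / h\<bar> = \<bar>(\<Phi> T - \<Phi> t) - \<beta> * x\<bar> / h"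
        using h by (simp add: diff_divide_distrib[symmetric])
      also have "\<dots> \<le> (K * x\<^sup>2 / 2) / h"
        using \<Phi>_end[OF t] h unfolding \<beta>_def x_def by (intro divide_right_mono) auto
      finally have 1: "\<bar>(\<Phi> T - \<Phi> t) / h - \<beta> * x / h\<bar> \<le> K * x\<^sup>2 / h / 2" by simp
      have b: "?b t = - 2 * (\<beta> * x / h)" by (simp add: x_def)
      have d: "\<bar>?a t - ?b t\<bar> \<le> K * x\<^sup>2 / h + 4 * (K * T) * x"
        unfolding b using abs_estimates(3)[OF 1 Y_bracket(1)[OF h(1) h1 tT] up] by (simp add: mult_ac)
      have "c * x / h \<le> gm * (T\<^sup>2 - t\<^sup>2) / (2 * h)"
      proof -
        have "gm * (T * x) \<le> gm * (T\<^sup>2 - t\<^sup>2)" using lo gm by (intro mult_left_mono) auto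
        then show ?thesis using h by (simp add: c_def divide_right_mono field_simps)
      qed
      moreover have "Y h T - Y h t \<le> - (gm * (T\<^sup>2 - t\<^sup>2) / (2 * h)) + K * (T\<^sup>2 - t\<^sup>2)"
        using Y_bracket(2)[OF h(1) h1 tT] by simp
      ultimately have "?a t \<le> - 2 * (c * x / h) + 4 * (K * T) * x"
      proof -
        assume "c * x / h \<le> gm * (T\<^sup>2 - t\<^sup>2) / (2 * h)"
          "Y h T - Y h t \<le> - (gm * (T\<^sup>2 - t\<^sup>2) / (2 * h)) + K * (T\<^sup>2 - t\<^sup>2)"
        from abs_estimates(4)[OF this up] show ?thesis by simp
      qed
      moreover have "4 * (K * T) * x \<le> c * x / h"
      proof -
        have "4 * (K * T) \<le> c / h" using hc h by (simp add: pos_le_divide_eq)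
        then have "4 * (K * T) * x \<le> c / h * x" using x0 by (rule mult_right_mono)
        then show ?thesis by simp
      qed
      ultimately have am: "?a t \<le> - c * x / h" by simp
      have "c * x / h \<le> 2 * \<beta> * x / h" using c\<beta> x0 h by (intro divide_right_mono mult_right_mono) auto
      then have bm: "?b t \<le> - c * x / h" unfolding b by simp
      have "\<bar>exp (?a t) - exp (?b t)\<bar> \<le> (K * x\<^sup>2 / h + 4 * (K * T) * x) * exp (- c * x / h)"
        by (rule exp_difference_bound[OF am bm d])
      also have "\<dots> \<le> M0 * h * exp (- c * x / (2 * h))"
        unfolding M0_def by (rule poly_exp_bound) (use K T c0 h x0 in auto)
      finally show ?thesis by (simp add: x_def)
    qed
    have ia: "(\<lambda>t. exp (?a t)) integrable_on {0..T}"
      by (intro integrable_continuous_real continuous_on_exp continuous_on_mult continuous_on_diff continuous_on_const Y_cont)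
    have k0: "0 < 2 * \<beta> / h" "0 < c / (2 * h)" using \<beta>0 c0 h by auto
    note ib = exp_linear_integral[OF k0(1)] note ic = exp_linear_integral[OF k0(2)]
    have "\<bar>integral {0..T} (\<lambda>t. exp (?a t)) - integral {0..T} (\<lambda>t. exp (?b t))\<bar>
        = norm (integral {0..T} (\<lambda>t. exp (?a t) - exp (?b t)))"
      using Henstock_Kurzweil_Integration.integral_diff[OF ia has_integral_integrable[OF ib]] by simp
    also have "\<dots> \<le> integral {0..T} (\<lambda>t. M0 * h * exp (- (c / (2 * h)) * (T - t)))"
    proof (rule integral_norm_bound_integral)
      show "(\<lambda>t. exp (?a t) - exp (?b t)) integrable_on {0..T}"
        by (rule integrable_diff[OF ia has_integral_integrable[OF ib]])
      show "(\<lambda>t. M0 * h * exp (- (c / (2 * h)) * (T - t))) integrable_on {0..T}"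
        by (rule has_integral_integrable[OF has_integral_mult_right[OF ic]])
    qed (use pt in auto)
    also have "\<dots> = M0 * h * ((1 - exp (- (c / (2 * h)) * T)) / (c / (2 * h)))"
      by (rule integral_unique[OF has_integral_mult_right[OF ic]])
    also have "\<dots> \<le> M0 * h * (1 / (c / (2 * h)))"
      using M00 h c0 by (intro mult_left_mono divide_right_mono) auto
    also have "\<dots> = M0 * (2 / c) * h\<^sup>2" by (simp add: power2_eq_square)
    finally have A: "\<bar>integral {0..T} (\<lambda>t. exp (?a t)) - integral {0..T} (\<lambda>t. exp (?b t))\<bar> \<le> M0 * (2 / c) * h\<^sup>2" .
    have I: "integral {0..T} (\<lambda>t. exp (?b t)) = (1 - exp (- (2 * \<beta> / h) * T)) / (2 * \<beta> / h)"
      by (rule integral_unique[OF ib])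
    have "exp (- (2 * \<beta> / h * T)) \<le> 1 / (2 * \<beta> / h * T)"
      by (rule exp_minus_le_inverse[OF mult_pos_pos[OF k0(1) T]])
    then have "exp (- (2 * \<beta> / h) * T) / (2 * \<beta> / h) \<le> (1 / (2 * \<beta> / h * T)) / (2 * \<beta> / h)"
      using k0 by (intro divide_right_mono) auto
    also have "\<dots> = 1 / (4 * \<beta>\<^sup>2 * T) * h\<^sup>2" using h by (simp add: power2_eq_square)
    finally have E: "exp (- (2 * \<beta> / h) * T) / (2 * \<beta> / h) \<le> 1 / (4 * \<beta>\<^sup>2 * T) * h\<^sup>2" .
    have E0: "0 \<le> exp (- (2 * \<beta> / h) * T) / (2 * \<beta> / h)" using h \<beta>0 by simp
    have "integral {0..T} (\<lambda>t. exp (?b t)) - h / (2 * \<beta>) = - (exp (- (2 * \<beta> / h) * T) / (2 * \<beta> / h))"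
    proof -
      have hk: "h / (2 * \<beta>) = 1 / (2 * \<beta> / h)" by simp
      have gen: "(u - v) - u = - v" for u v :: real by simp
      show ?thesis unfolding I hk diff_divide_distrib by (rule gen)
    qed
    with A E E0 show ?thesis unfolding M_def distrib_right by linarith
  qed
  moreover have "0 \<le> M" using M00 c0 T by (simp add: M_def)
  ultimately show ?thesis using that[of h0 M] h00 unfolding \<beta>_def by blast
qed

text \<open>
  Near \<open>0\<close> the exponent \<open>2 * Y\<close> is close to the quadratic function \<open>- \<kappa> * s\<^sup>2 / h\<close>.
\<close>

lemma laplace_origin:
  obtains M h0 where "0 < h0" "0 \<le> M"
    "\<And>h. 0 < h \<Longrightarrow> h < h0 \<Longrightarrow>
      \<bar>integral {0..T} (\<lambda>s. exp (2 * Y h s)) - sqrt (pi * h / \<kappa>) / 2\<bar> \<le> M * (h * sqrt h)"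
proof -
  \<comment> \<open>Both exponents are at most \<open>- c * s\<^sup>2 / h\<close> for small \<open>h\<close>.\<close>
  define c where "c = gm / 2"
  define M0 where "M0 = 16 * (K / 2) / c\<^sup>2 + 2 * (2 * K) / c"
  define M where "M = M0 * (sqrt (2 * pi / c) / 2) + (2 / (\<kappa> * T\<^sup>2)) * (sqrt (2 * pi / \<kappa>) / 2)"
  define h0 where "h0 = min 1 (c / (2 * K + 1))"
  have c0: "0 < c" using gm by (simp add: c_def)
  have \<kappa>gm: "gm \<le> \<kappa>" using g_ge[of 0] g0 T by simp
  then have \<kappa>0: "0 < \<kappa>" using gm by simp
  have M00: "0 \<le> M0" using K c0 by (simp add: M0_def)
  have h00: "0 < h0" using c0 K by (simp add: h0_def)
  have "\<bar>integral {0..T} (\<lambda>s. exp (2 * Y h s)) - sqrt (pi * h / \<kappa>) / 2\<bar> \<le> M * (h * sqrt h)"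
    if h: "0 < h" "h < h0" for h
  proof -
    have h1: "h \<le> 1" using h by (simp add: h0_def)
    have "h * (2 * K + 1) \<le> c" using h K by (simp add: h0_def field_simps)
    then have hc: "2 * K * h \<le> c" using h by (simp add: algebra_simps)
    have pt: "\<bar>exp (2 * Y h s) - exp (- (\<kappa> / h) * s\<^sup>2)\<bar> \<le> M0 * h * exp (- (c / (2 * h)) * s\<^sup>2)" if s: "s \<in> {0..T}" for s
    proof -
      define x where "x = s\<^sup>2"
      have x0: "0 \<le> x" by (simp add: x_def)
      have s4: "s ^ 4 = x\<^sup>2" by (simp add: x_def power_mult[symmetric])
      have tT: "0 \<le> (0::real)" "0 \<le> s" "s \<le> T" using s by auto
      have b1: "\<bar>Y h s + \<Phi> s / h\<bar> \<le> K * x" "Y h s \<le> - gm * x / (2 * h) + K * x"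
        using Y_bracket[OF h(1) h1 tT] zero_values by (simp_all add: x_def)
      have "\<bar>\<Phi> s / h - \<kappa> * x / (2 * h)\<bar> = \<bar>\<Phi> s - \<kappa> * s\<^sup>2 / 2\<bar> / h"
        using h by (simp add: x_def diff_divide_distrib[symmetric] abs_divide[symmetric] field_simps)
      also have "\<dots> \<le> (K * s ^ 4 / 4) / h"
        using \<Phi>_near[OF s] h by (intro divide_right_mono) auto
      finally have 1: "\<bar>\<Phi> s / h - \<kappa> * x / (2 * h)\<bar> \<le> K / 2 * x\<^sup>2 / h / 2" unfolding s4 by simp
      have b: "- (\<kappa> / h) * s\<^sup>2 = - 2 * (\<kappa> * x / (2 * h))" using h by (simp add: x_def)
      have d: "\<bar>2 * Y h s - (- (\<kappa> / h) * s\<^sup>2)\<bar> \<le> K / 2 * x\<^sup>2 / h + (2 * K) * x"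
        unfolding b using abs_estimates(3)[OF 1 b1(1) order_refl] by (simp add: mult_ac)
      have "2 * K * x \<le> c * x / h"
      proof -
        have "2 * K \<le> c / h" using hc h by (simp add: pos_le_divide_eq)
        then have "2 * K * x \<le> c / h * x" using x0 by (rule mult_right_mono)
        then show ?thesis by simp
      qed
      moreover have "gm * x / (2 * h) = c * x / h" by (simp add: c_def)
      ultimately have am: "2 * Y h s \<le> - c * x / h" using b1(2) by simp
      have "c * x / h \<le> \<kappa> * x / h" using \<kappa>gm gm x0 h unfolding c_def by (intro divide_right_mono mult_right_mono) auto
      then have bm: "- (\<kappa> / h) * s\<^sup>2 \<le> - c * x / h" by (simp add: x_def)
      have "\<bar>exp (2 * Y h s) - exp (- (\<kappa> / h) * s\<^sup>2)\<bar> \<le> (K / 2 * x\<^sup>2 / h + (2 * K) * x) * exp (- c * x / h)"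
        by (rule exp_difference_bound[OF am bm d])
      also have "\<dots> \<le> M0 * h * exp (- c * x / (2 * h))"
        unfolding M0_def by (rule poly_exp_bound) (use K c0 h x0 in auto)
      finally show ?thesis by (simp add: x_def)
    qed
    have ia: "(\<lambda>s. exp (2 * Y h s)) integrable_on {0..T}"
      by (intro integrable_continuous_real continuous_on_exp continuous_on_mult continuous_on_const Y_cont)
    have ig: "(\<lambda>s::real. exp (- k * s\<^sup>2)) integrable_on {0..T}" for k
      by (intro integrable_continuous_real continuous_on_exp continuous_on_mult continuous_on_const continuous_on_power continuous_on_id)
    have k0: "0 < \<kappa> / h" "0 < c / (2 * h)" using \<kappa>0 c0 h by auto
    have "\<bar>integral {0..T} (\<lambda>s. exp (2 * Y h s)) - integral {0..T} (\<lambda>s. exp (- (\<kappa> / h) * s\<^sup>2))\<bar>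
        = norm (integral {0..T} (\<lambda>s. exp (2 * Y h s) - exp (- (\<kappa> / h) * s\<^sup>2)))"
      using Henstock_Kurzweil_Integration.integral_diff[OF ia ig, of "\<kappa> / h"] by (simp only: real_norm_def)
    also have "\<dots> \<le> integral {0..T} (\<lambda>s. M0 * h * exp (- (c / (2 * h)) * s\<^sup>2))"
    proof (rule integral_norm_bound_integral)
      show "(\<lambda>s. exp (2 * Y h s) - exp (- (\<kappa> / h) * s\<^sup>2)) integrable_on {0..T}" by (rule integrable_diff[OF ia ig])
      show "(\<lambda>s. M0 * h * exp (- (c / (2 * h)) * s\<^sup>2)) integrable_on {0..T}"
        by (rule integrable_on_mult_right[OF ig])
    qed (use pt in auto)
    also have "\<dots> = M0 * h * integral {0..T} (\<lambda>s. exp (- (c / (2 * h)) * s\<^sup>2))" by simp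
    also have "\<dots> \<le> M0 * h * (sqrt (pi / (c / (2 * h))) / 2)"
      using M00 h by (intro mult_left_mono gaussian_truncated(1)[OF k0(2) T]) auto
    also have "sqrt (pi / (c / (2 * h))) = sqrt (2 * pi / c) * sqrt h"
      unfolding real_sqrt_mult[symmetric] by (simp add: mult_ac)
    finally have A: "\<bar>integral {0..T} (\<lambda>s. exp (2 * Y h s)) - integral {0..T} (\<lambda>s. exp (- (\<kappa> / h) * s\<^sup>2))\<bar>
        \<le> M0 * (sqrt (2 * pi / c) / 2) * (h * sqrt h)" by (simp add: mult_ac)
    have q1: "sqrt (pi / (\<kappa> / h)) = sqrt (pi * h / \<kappa>)" by simp
    have q2: "sqrt (2 * pi / (\<kappa> / h)) = sqrt (2 * pi / \<kappa>) * sqrt h"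
      unfolding real_sqrt_mult[symmetric] by (simp add: mult_ac)
    have "exp (- (\<kappa> * T\<^sup>2 / (2 * h))) \<le> 1 / (\<kappa> * T\<^sup>2 / (2 * h))"
      by (rule exp_minus_le_inverse) (use \<kappa>0 h T in auto)
    moreover have "- (\<kappa> / h) * T\<^sup>2 / 2 = - (\<kappa> * T\<^sup>2 / (2 * h))" by simp
    ultimately have "exp (- (\<kappa> / h) * T\<^sup>2 / 2) \<le> 2 / (\<kappa> * T\<^sup>2) * h" by (simp add: mult.commute)
    then have "exp (- (\<kappa> / h) * T\<^sup>2 / 2) * (sqrt (2 * pi / \<kappa>) * sqrt h / 2) \<le> 2 / (\<kappa> * T\<^sup>2) * h * (sqrt (2 * pi / \<kappa>) * sqrt h / 2)"
      using h \<kappa>0 by (intro mult_right_mono) auto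
    also have "\<dots> = 2 / (\<kappa> * T\<^sup>2) * (sqrt (2 * pi / \<kappa>) / 2) * (h * sqrt h)" by simp
    finally have E: "exp (- (\<kappa> / h) * T\<^sup>2 / 2) * (sqrt (2 * pi / \<kappa>) * sqrt h / 2) \<le> 2 / (\<kappa> * T\<^sup>2) * (sqrt (2 * pi / \<kappa>) / 2) * (h * sqrt h)" .
    have E0: "0 \<le> exp (- (\<kappa> / h) * T\<^sup>2 / 2) * (sqrt (2 * pi / \<kappa>) * sqrt h / 2)" using h \<kappa>0 by simp
    from A E E0 gaussian_truncated[OF k0(1) T] show ?thesis
      unfolding M_def distrib_right q1 q2 by linarith
  qed
  moreover have "0 \<le> M" using M00 c0 \<kappa>0 by (simp add: M_def)
  ultimately show ?thesis using that[of h0 M] h00 by blast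
qed

end

section \<open>The discriminant near the bottom of the well\<close>

lemma green_identity:
  assumes u: "ode_solution q1 u u'" and v: "ode_solution q2 v v'" and T: "0 \<le> T"
    and q: "\<And>s. q1 s - q2 s = d" and z: "u' 0 * v 0 - u 0 * v' 0 = 0"
  shows "d * integral {0..T} (\<lambda>s. u s * v s) = u' T * v T - u T * v' T"
proof -
  have "((\<lambda>s. d * (u s * v s)) has_integral (u' T * v T - u T * v' T) - (u' 0 * v 0 - u 0 * v' 0)) {0..T}"
  proof (rule fundamental_theorem_of_calculus[OF T])
    fix s
    have "((\<lambda>s. u' s * v s - u s * v' s) has_real_derivative
        (q1 s * u s * v s + v' s * u' s) - (u' s * v' s + q2 s * v s * u s)) (at s)"
      by (rule DERIV_diff[OF DERIV_mult[OF ode_solution_D(2)[OF u] ode_solution_D(1)[OF v]]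
            DERIV_mult[OF ode_solution_D(1)[OF u] ode_solution_D(2)[OF v]]])
    moreover have "(q1 s * u s * v s + v' s * u' s) - (u' s * v' s + q2 s * v s * u s) = d * (u s * v s)"
      unfolding q[of s, symmetric] by (simp add: algebra_simps)
    ultimately show "((\<lambda>s. u' s * v s - u s * v' s) has_vector_derivative d * (u s * v s)) (at s within {0..T})"
      using has_field_derivative_at_within
      unfolding has_real_derivative_iff_has_vector_derivative[symmetric] by metis
  qed
  from integral_unique[OF this] show ?thesis using z by simp
qed

text \<open>
  Elementary steps of the proofs below, in atomic variables.
\<close>

lemma tunnel_estimates:
  fixes H A B C dl J e L m X Z u w N :: real
  shows "H \<noteq> 0 \<Longrightarrow> H * (A / H + B / H - C) = A + B - H * C"
    and "m \<noteq> 0 \<Longrightarrow> dl * (J + e * L / (4 * m)) * m = dl * J * m + e / 4 * (dl * L)"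
    and "B \<noteq> 0 \<Longrightarrow> C / B * (A * B) = C * A"
    and "- Z \<le> w \<Longrightarrow> w \<le> u + 9/16 * X \<Longrightarrow> u < N / 4 \<Longrightarrow> N \<le> X \<Longrightarrow> 0 \<le> X \<Longrightarrow> 0 < X + Z"
  by (simp_all add: field_simps)

text \<open>
  The WKB coefficients of a double well: \<open>I1\<close> and \<open>I2\<close> are the transport equations, and \<open>C1\<close> bounds the
  coefficients of the residual \<open>R\<close> below.
\<close>

locale tunnel = wkb_data "pi/2" K gm \<kappa> g n p for K gm \<kappa> g n p +
  fixes V g' n' p' :: "real \<Rightarrow> real" and C1 :: real
  assumes cV: "continuous_on UNIV V" and evenV: "\<And>s. V (- s) = V s" and perV: "\<And>s. V (s + pi) = V s"
    and Dg: "\<And>s. s \<in> {0..pi/2} \<Longrightarrow> (g has_real_derivative g' s) (at s within {0..pi/2})"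
    and Dn: "\<And>s. s \<in> {0..pi/2} \<Longrightarrow> (n has_real_derivative n' s) (at s within {0..pi/2})"
    and Dp: "\<And>s. s \<in> {0..pi/2} \<Longrightarrow> (p has_real_derivative p' s) (at s within {0..pi/2})"
    and Vg: "\<And>s. s \<in> {0..pi/2} \<Longrightarrow> V s = s\<^sup>2 * (g s)\<^sup>2"
    and I1: "\<And>s. s \<in> {0..pi/2} \<Longrightarrow> g s + s * g' s - \<kappa> = - 2 * s\<^sup>2 * g s * n s"
    and I2: "\<And>s. s \<in> {0..pi/2} \<Longrightarrow> n s + s * n' s + s\<^sup>2 * (n s)\<^sup>2 - n 0 = 2 * s\<^sup>2 * g s * p s"
    and C1: "\<And>s. s \<in> {0..pi/2} \<Longrightarrow> \<bar>p s + s * p' s + 2 * s\<^sup>2 * n s * p s\<bar> + \<bar>s\<^sup>2 * (p s)\<^sup>2\<bar> \<le> C1"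
begin

abbreviation "T \<equiv> pi / 2"
text \<open>
  \<open>l0\<close> is the approximate eigenvalue, and \<open>R\<close> the residual of \<open>exp Y\<close> in the equation
  \<open>h\<^sup>2 u'' = (V - l0) u\<close>. For another spectral parameter \<open>l\<close> the residual, divided by \<open>h\<^sup>2\<close>, is \<open>\<rho>\<close>.
\<close>

definition "l0 h = h * \<kappa> - h\<^sup>2 * n 0"
definition "R h s = h ^ 3 * (p s + s * p' s + 2 * s\<^sup>2 * n s * p s) + h ^ 4 * (s\<^sup>2 * (p s)\<^sup>2)"
definition "qq h l = (\<lambda>s. (V s - l) / h\<^sup>2)"
definition "\<rho> h l s = (R h s + (l - l0 h)) / h\<^sup>2"
definition "P h s = exp (2 * Y h s)"
definition "C2 = exp (2 * K * T\<^sup>2)"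
definition "C3 = 2 * C1 + 1"

lemma C1_nonneg: "0 \<le> C1" using C1[of 0] by simp

lemma R_bound:
  assumes "0 < h" "h \<le> 1" "s \<in> {0..T}"
  shows "\<bar>R h s\<bar> \<le> C1 * h ^ 3"
proof -
  let ?a = "p s + s * p' s + 2 * s\<^sup>2 * n s * p s" and ?b = "s\<^sup>2 * (p s)\<^sup>2"
  have "h ^ 4 \<le> h ^ 3" by (rule power_decreasing) (use assms in auto)
  then have "h ^ 4 * \<bar>?b\<bar> \<le> h ^ 3 * \<bar>?b\<bar>" by (rule mult_right_mono) simp
  moreover have "\<bar>R h s\<bar> \<le> h ^ 3 * \<bar>?a\<bar> + h ^ 4 * \<bar>?b\<bar>"
    unfolding R_def using assms abs_triangle_ineq[of "h ^ 3 * ?a" "h ^ 4 * ?b"] by (simp add: abs_mult)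
  ultimately have "\<bar>R h s\<bar> \<le> h ^ 3 * (\<bar>?a\<bar> + \<bar>?b\<bar>)" by (simp add: distrib_left)
  also have "\<dots> \<le> h ^ 3 * C1" using C1[OF assms(3)] assms(1) by (intro mult_left_mono) auto
  finally show ?thesis by (simp add: mult.commute)
qed

text \<open>
  The Riccati equation of the WKB function; this is where the transport equations enter.
\<close>

lemma Dy:
  assumes h: "h \<noteq> 0" and s: "s \<in> {0..T}" and S: "S \<subseteq> {0..T}"
  shows "(y h has_real_derivative qq h l s + \<rho> h l s - (y h s)\<^sup>2) (at s within S)"
proof -
  let ?w = "- g s / h + n s + h * p s" and ?w' = "- g' s / h + n' s + h * p' s"
  have D: "(y h has_real_derivative 1 * ?w + ?w' * s) (at s within S)"
    unfolding y_def[abs_def]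
    by (rule DERIV_mult[OF DERIV_ident DERIV_add[OF DERIV_add[OF DERIV_cdivide[OF DERIV_minus[OF DERIV_subset[OF Dg[OF s] S]]]
          DERIV_subset[OF Dn[OF s] S]] DERIV_cmult[OF DERIV_subset[OF Dp[OF s] S]]]])
  have "h\<^sup>2 * (1 * ?w + ?w' * s) = V s - l + (R h s + (l - l0 h)) - h\<^sup>2 * (y h s)\<^sup>2"
  proof -
    have yy: "h * y h s = s * (- g s + h * n s + h\<^sup>2 * p s)"
      using h by (simp add: y_def field_simps power2_eq_square)
    have y2: "h\<^sup>2 * (y h s)\<^sup>2 = s\<^sup>2 * (- g s + h * n s + h\<^sup>2 * p s)\<^sup>2"
      unfolding power_mult_distrib[symmetric] yy ..
    have w: "h\<^sup>2 * (1 * ?w + ?w' * s) = - h * (g s + s * g' s) + h\<^sup>2 * (n s + s * n' s) + h ^ 3 * (p s + s * p' s)"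
      using h by (simp add: field_simps power2_eq_square power3_eq_cube)
    have i1: "g s + s * g' s = \<kappa> - 2 * s\<^sup>2 * g s * n s" using I1[OF s] by simp
    have i2: "n s + s * n' s = n 0 + 2 * s\<^sup>2 * g s * p s - s\<^sup>2 * (n s)\<^sup>2" using I2[OF s] by simp
    show ?thesis
      unfolding y2 w i1 i2 Vg[OF s] R_def l0_def by algebra
  qed
  moreover have "h\<^sup>2 * (qq h l s + \<rho> h l s - (y h s)\<^sup>2) = V s - l + (R h s + (l - l0 h)) - h\<^sup>2 * (y h s)\<^sup>2"
    unfolding qq_def \<rho>_def by (rule tunnel_estimates(1)) (use h in simp)
  ultimately have "h\<^sup>2 * (1 * ?w + ?w' * s) = h\<^sup>2 * (qq h l s + \<rho> h l s - (y h s)\<^sup>2)" by (simp only:)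
  then have "1 * ?w + ?w' * s = qq h l s + \<rho> h l s - (y h s)\<^sup>2"
    using h by (simp only: mult_left_cancel power_not_zero not_False_eq_True)
  with D show ?thesis by (simp only:)
qed

lemma qq_cont: "continuous_on UNIV (qq h l)"
  unfolding qq_def divide_inverse by (intro continuous_intros cV)

lemma hill_qq: "hill (qq h l)"
proof
  show "continuous_on UNIV (qq h l)" by (rule qq_cont)
qed (simp_all add: qq_def evenV perV)

lemma weight_P: "0 < h \<Longrightarrow> h \<le> 1 \<Longrightarrow> weight T C2 (P h)"
proof
  assume h: "0 < h" "h \<le> 1"
  show "0 < T" by simp
  show "continuous_on {0..T} (P h)" unfolding P_def[abs_def]
    by (intro continuous_on_exp continuous_on_mult continuous_on_const Y_cont)
  show "0 < P h s" for s by (simp add: P_def)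
  show "P h s \<le> C2 * P h t" if "0 \<le> t" "t \<le> s" "s \<le> T" for s t
    unfolding P_def C2_def using Y_quasi_decreasing[OF h that] .
qed

end

locale tunnel_h = tunnel K gm \<kappa> g n p V g' n' p' C1 for K gm \<kappa> g n p V g' n' p' C1 +
  fixes h :: real
  assumes h0: "0 < h" and h1: "h \<le> 1"
begin

sublocale W: weight T C2 "P h" by (rule weight_P[OF h0 h1])

text \<open>
  \<open>\<theta>\<close> measures the perturbation \<open>\<rho>\<close> in the window, and \<open>Q\<close> is \<open>exp (Y h T)\<close> times the value at \<open>T\<close> of the
  unperturbed odd solution \<open>exp (Y h s) * G s\<close>. Outside the window \<open>R\<close> cannot change the sign of
  \<open>R + (l - l0)\<close>, so \<open>\<rho>\<close> has a definite sign there.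
\<close>

definition "\<theta> = C3 * h * C2 * T\<^sup>2"
definition "yT = y h T"
definition "Q = P h T * W.G T"
definition "\<psi>T = exp (Y h T)"
definition "window l \<longleftrightarrow> \<bar>l - l0 h\<bar> \<le> (C1 + 1) * h ^ 3"

abbreviation "a l \<equiv> ev_sol (qq h l)"
abbreviation "a' l \<equiv> ev_der (qq h l)"
abbreviation "b l \<equiv> od_sol (qq h l)"
abbreviation "b' l \<equiv> od_der (qq h l)"
abbreviation "disc l \<equiv> hill.mA (qq h l)"

lemma disc_def: "disc l = a l T * b' l T + a' l T * b l T"
  by (rule hill.mA_def[OF hill_qq])

lemma wronskian: "a l s * b' l s - a' l s * b l s = 1"
  by (rule wronskian_ev_od[OF qq_cont])

lemmas sol = ev_od_ode[OF qq_cont]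

lemma disc_products: "a l T * b' l T = (1 + disc l) / 2" "a' l T * b l T = (disc l - 1) / 2"
  using wronskian[of l T] disc_def[of l] by simp_all

text \<open>
  Substitution of \<open>u = exp Y * f\<close> into Hill's equation.
\<close>

lemma reduction:
  assumes u: "ode_solution (qq h l) u u'"
  shows "W.solves (\<rho> h l) (\<lambda>s. u s * exp (- Y h s)) (\<lambda>s. exp (Y h s) * (u' s - y h s * u s))"
  unfolding W.solves_def
proof (intro ballI conjI)
  fix s assume s: "s \<in> {0..T}"
  note du = has_field_derivative_at_within[OF ode_solution_D(1)[OF u, of s], of "{0..T}"]
  note du' = has_field_derivative_at_within[OF ode_solution_D(2)[OF u, of s], of "{0..T}"]
  note dY = DY[OF s order_refl, of h]
  have hne: "h \<noteq> 0" using h0 by simp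
  note dy = Dy[OF hne s order_refl, of l]
  have e1: "((\<lambda>s. exp (- Y h s)) has_real_derivative exp (- Y h s) * - y h s) (at s within {0..T})"
    by (rule DERIV_chain'[OF DERIV_minus[OF dY] DERIV_exp, THEN DERIV_cong]) simp
  have e2: "((\<lambda>s. exp (Y h s)) has_real_derivative exp (Y h s) * y h s) (at s within {0..T})"
    by (rule DERIV_chain'[OF dY DERIV_exp, THEN DERIV_cong]) simp
  have PP: "P h s = exp (Y h s) * exp (Y h s)" by (simp add: P_def exp_add[symmetric])
  have ee: "exp (- Y h s) = 1 / exp (Y h s)" by (simp add: exp_minus inverse_eq_divide)
  show "((\<lambda>s. u s * exp (- Y h s)) has_real_derivative exp (Y h s) * (u' s - y h s * u s) / P h s) (at s within {0..T})"
    by (rule DERIV_mult[OF du e1, THEN DERIV_cong]) (simp add: PP ee field_simps)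
  have "((\<lambda>s. exp (Y h s) * (u' s - y h s * u s)) has_real_derivative
      exp (Y h s) * y h s * (u' s - y h s * u s) +
      (qq h l s * u s - ((qq h l s + \<rho> h l s - (y h s)\<^sup>2) * u s + u' s * y h s)) * exp (Y h s)) (at s within {0..T})"
    by (rule DERIV_mult[OF e2 DERIV_diff[OF du' DERIV_mult[OF dy du]]])
  moreover have "exp (Y h s) * y h s * (u' s - y h s * u s) +
      (qq h l s * u s - ((qq h l s + \<rho> h l s - (y h s)\<^sup>2) * u s + u' s * y h s)) * exp (Y h s)
      = - \<rho> h l s * P h s * (u s * exp (- Y h s))"
    by (simp add: PP ee algebra_simps power2_eq_square)
  ultimately show "((\<lambda>s. exp (Y h s) * (u' s - y h s * u s)) has_real_derivative
      - \<rho> h l s * P h s * (u s * exp (- Y h s))) (at s within {0..T})" by simp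
qed

definition "fa l s = a l s * exp (- Y h s)"
definition "Xa l s = exp (Y h s) * (a' l s - y h s * a l s)"
definition "fb l s = b l s * exp (- Y h s)"
definition "Xb l s = exp (Y h s) * (b' l s - y h s * b l s)"

lemma solves_a: "W.solves (\<rho> h l) (fa l) (Xa l)" and solves_b: "W.solves (\<rho> h l) (fb l) (Xb l)"
  using reduction[OF sol(1)] reduction[OF sol(2)]
  unfolding fa_def[abs_def] Xa_def[abs_def] fb_def[abs_def] Xb_def[abs_def] .

lemma init: "fa l 0 = 1" "Xa l 0 = 0" "fb l 0 = 0" "Xb l 0 = 1"
  by (simp_all add: fa_def Xa_def fb_def Xb_def sol zero_values y_def)

lemma recover: "a l s = exp (Y h s) * fa l s" "b l s = exp (Y h s) * fb l s"
  "exp (Y h s) * a' l s = Xa l s + y h s * (P h s * fa l s)"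
  "exp (Y h s) * b' l s = Xb l s + y h s * (P h s * fb l s)"
proof -
  have ee: "exp (- Y h s) = 1 / exp (Y h s)" by (simp add: exp_minus inverse_eq_divide)
  have PP: "P h s = exp (Y h s) * exp (Y h s)" by (simp add: P_def exp_add[symmetric])
  show "a l s = exp (Y h s) * fa l s" "b l s = exp (Y h s) * fb l s"
    by (simp_all add: fa_def fb_def ee)
  show "exp (Y h s) * a' l s = Xa l s + y h s * (P h s * fa l s)"
    "exp (Y h s) * b' l s = Xb l s + y h s * (P h s * fb l s)"
    by (simp_all add: fa_def fb_def Xa_def Xb_def ee PP algebra_simps)
qed

lemma h2: "0 < h\<^sup>2" "h ^ 3 / h\<^sup>2 = h" using h0 by (simp_all add: power2_eq_square power3_eq_cube)

lemma rho_window: "window l \<Longrightarrow> s \<in> {0..T} \<Longrightarrow> \<bar>\<rho> h l s\<bar> \<le> C3 * h"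
proof -
  assume w: "window l" and s: "s \<in> {0..T}"
  have "\<bar>R h s + (l - l0 h)\<bar> \<le> C3 * h ^ 3"
    using R_bound[OF h0 h1 s] w unfolding window_def C3_def by (simp add: algebra_simps abs_le_iff)
  then have "\<bar>R h s + (l - l0 h)\<bar> / h\<^sup>2 \<le> C3 * h ^ 3 / h\<^sup>2" by (rule divide_right_mono) simp
  then show ?thesis unfolding \<rho>_def abs_divide abs_power2 times_divide_eq_right[symmetric] h2(2) .
qed

lemma rho_below: "l \<le> l0 h - (C1 + 1) * h ^ 3 \<Longrightarrow> s \<in> {0..T} \<Longrightarrow> \<rho> h l s \<le> - h"
proof -
  assume l: "l \<le> l0 h - (C1 + 1) * h ^ 3" and s: "s \<in> {0..T}"
  have "R h s + (l - l0 h) \<le> - (h ^ 3)"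
    using R_bound[OF h0 h1 s] l by (simp add: algebra_simps abs_le_iff)
  then have "(R h s + (l - l0 h)) / h\<^sup>2 \<le> - (h ^ 3) / h\<^sup>2" by (rule divide_right_mono) simp
  then show ?thesis unfolding \<rho>_def using h2 by (simp add: power3_eq_cube power2_eq_square)
qed

lemma rho_above: "l0 h + (C1 + 1) * h ^ 3 \<le> l \<Longrightarrow> s \<in> {0..T} \<Longrightarrow> h \<le> \<rho> h l s"
proof -
  assume l: "l0 h + (C1 + 1) * h ^ 3 \<le> l" and s: "s \<in> {0..T}"
  have "h ^ 3 \<le> R h s + (l - l0 h)"
    using R_bound[OF h0 h1 s] l by (simp add: algebra_simps abs_le_iff)
  then have "h ^ 3 / h\<^sup>2 \<le> (R h s + (l - l0 h)) / h\<^sup>2" by (rule divide_right_mono) simp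
  then show ?thesis unfolding \<rho>_def using h2 by simp
qed

lemma TT: "T \<in> {0..T}" by simp

lemma Q_nonneg: "0 \<le> Q" unfolding Q_def using W.G_nonneg[OF TT] by (simp add: P_def)

lemma P_psi: "P h T = \<psi>T * \<psi>T" by (simp add: P_def \<psi>T_def exp_add[symmetric])

lemma psi_pos: "0 < \<psi>T" by (simp add: \<psi>T_def)

end

text \<open>
  As \<open>h\<close> tends to \<open>0\<close>, \<open>\<theta>\<close> tends to \<open>0\<close>, \<open>\<bar>yT\<bar> * Q\<close> tends to \<open>1/2\<close>, the weight at \<open>T\<close> is exponentially
  small, and the right-hand side of \<open>high\<close> tends to infinity (\<open>eventually_tunnel_small\<close>). The bounds
  \<open>1/32\<close> and \<open>9/16\<close> ensure \<open>1 + yT * Q - 4 * \<theta> \<ge> 1/4\<close>, a lower bound for \<open>exp (Y h T) * b' l T\<close>.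
\<close>

locale tunnel_small = tunnel_h +
  assumes th: "\<theta> \<le> 1/32" and yQ: "\<bar>yT\<bar> * Q \<le> 9/16"
    and low: "\<bar>yT\<bar> * P h T < h * W.N T / 4"
    and high: "1 < h * W.N (T / 2) * (W.G T - W.G (T / 2))"
begin

lemma theta_nonneg: "0 \<le> \<theta>"
  unfolding \<theta>_def C3_def using C1_nonneg h0 W.C_ge_1 by simp

lemma th_half: "C3 * h * C2 * T\<^sup>2 \<le> 1/2" using th unfolding \<theta>_def by simp

lemma b_window:
  assumes w: "window l" and s: "s \<in> {0..T}"
  shows "\<bar>Xb l s - 1\<bar> \<le> 2 * \<theta>" "\<bar>fb l s - W.G s\<bar> \<le> 2 * \<theta> * W.G s" "0 \<le> fb l s" "fb l s \<le> 2 * W.G s"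
proof -
  have g: "\<bar>Xb l s - 1\<bar> \<le> 2 * \<theta>" "\<bar>fb l s - W.G s\<bar> \<le> 2 * \<theta> * W.G s"
    unfolding \<theta>_def
    by (rule W.growing_solution(1)[OF solves_b init(3,4) rho_window[OF w] th_half s], assumption)
       (rule W.growing_solution(2)[OF solves_b init(3,4) rho_window[OF w] th_half s], assumption)
  show "\<bar>Xb l s - 1\<bar> \<le> 2 * \<theta>" "\<bar>fb l s - W.G s\<bar> \<le> 2 * \<theta> * W.G s" by (rule g)+
  have "2 * \<theta> * W.G s \<le> 1 * W.G s" using th W.G_nonneg[OF s] by (intro mult_right_mono) auto
  then show "0 \<le> fb l s" "fb l s \<le> 2 * W.G s" using g(2) W.G_nonneg[OF s] by (auto simp: abs_le_iff)
qed

lemma Q_pos: "0 < Q"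
proof -
  have "0 < W.G T - W.G (T/2)"
  proof (rule ccontr)
    assume "\<not> 0 < W.G T - W.G (T/2)"
    moreover have "W.G (T/2) \<le> W.G T" by (rule W.G_mono) auto
    ultimately have "W.G T - W.G (T/2) = 0" by simp
    then show False using high by simp
  qed
  then have "0 < W.G T" using W.G_nonneg[of "T/2"] by simp
  then show ?thesis by (simp add: Q_def P_def)
qed

lemma psi_b: "\<psi>T * b l T = P h T * fb l T" "\<psi>T * b' l T = Xb l T + yT * (P h T * fb l T)"
  using recover(2)[where l = l and s = T] recover(4)[where l = l and s = T] by (simp_all add: \<psi>T_def yT_def P_def mult.assoc[symmetric] exp_add[symmetric])

lemma b_end:
  assumes w: "window l"
  shows "\<bar>\<psi>T * b l T - Q\<bar> \<le> 2 * \<theta> * Q" "\<bar>\<psi>T * b' l T - (1 + yT * Q)\<bar> \<le> 4 * \<theta>"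
    "Q / 2 \<le> \<psi>T * b l T" "1/4 \<le> \<psi>T * b' l T" "0 < b l T" "0 < b' l T"
proof -
  note bw = b_window[OF w TT]
  have "\<bar>P h T * fb l T - P h T * W.G T\<bar> = P h T * \<bar>fb l T - W.G T\<bar>"
    unfolding right_diff_distrib[symmetric] abs_mult by (simp add: P_def)
  also have "\<dots> \<le> P h T * (2 * \<theta> * W.G T)" by (rule mult_left_mono[OF bw(2)]) (simp add: P_def)
  finally show 1: "\<bar>\<psi>T * b l T - Q\<bar> \<le> 2 * \<theta> * Q" unfolding psi_b Q_def by (simp add: mult_ac)
  have "\<bar>yT * (\<psi>T * b l T - Q)\<bar> \<le> \<bar>yT\<bar> * (2 * \<theta> * Q)" unfolding abs_mult using 1 by (rule mult_left_mono) simp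
  also have "\<dots> = 2 * \<theta> * (\<bar>yT\<bar> * Q)" by simp
  also have "\<dots> \<le> 2 * \<theta> * (9/16)" using yQ theta_nonneg by (intro mult_left_mono) auto
  finally have 2: "\<bar>yT * (\<psi>T * b l T) - yT * Q\<bar> \<le> 2 * \<theta>" using theta_nonneg by (simp add: right_diff_distrib)
  have e: "\<psi>T * b' l T = Xb l T + yT * (\<psi>T * b l T)" unfolding psi_b ..
  show 3: "\<bar>\<psi>T * b' l T - (1 + yT * Q)\<bar> \<le> 4 * \<theta>" unfolding e using 2 bw(1) by linarith
  have "2 * \<theta> * Q \<le> 1/2 * Q" using th Q_nonneg by (intro mult_right_mono) auto
  then show 4: "Q / 2 \<le> \<psi>T * b l T" using 1 by linarith
  have "- (yT * Q) \<le> 9/16" using yQ abs_mult[of yT Q] Q_nonneg by (simp add: abs_le_iff)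
  then show 5: "1/4 \<le> \<psi>T * b' l T" using 3 th by linarith
  show "0 < b l T" using 4 Q_pos psi_pos by (smt (verit) half_gt_zero zero_less_mult_pos)
  show "0 < b' l T" using 5 psi_pos by (smt (verit) zero_less_divide_1_iff zero_less_mult_pos)
qed

lemma b_positive:
  assumes w: "window l" and s: "0 < s" "s \<le> T"
  shows "0 < b l s"
proof -
  have sT: "s \<in> {0..T}" using s by simp
  have "W.G 0 < W.G s"
  proof (rule DERIV_pos_imp_increasing_open[OF s(1)])
    fix x assume x: "0 < x" "x < s"
    then have "(W.G has_real_derivative 1 / P h x) (at x within {0..s})" by (intro W.DG) (use s in auto)
    then have "(W.G has_real_derivative 1 / P h x) (at x)" using x by (simp add: at_within_Icc_at)
    then show "\<exists>y. DERIV W.G x :> y \<and> 0 < y" by (intro exI conjI) (auto simp: P_def)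
  next
    show "continuous_on {0..s} W.G"
      by (rule DERIV_continuous_on[OF W.DG]) (use s in auto)
  qed
  then have Gp: "0 < W.G s" using W.G0 by simp
  have "2 * \<theta> * W.G s \<le> 1/2 * W.G s" using th Gp by (intro mult_right_mono) auto
  then have "0 < fb l s" using b_window(2)[OF w sT] Gp by linarith
  then show ?thesis unfolding recover(2)[where l = l and s = s] by simp
qed

text \<open>
  The quotient \<open>a / b\<close> is decreasing, since its derivative is \<open>- 1 / b\<^sup>2\<close> by the Wronskian identity.
\<close>

lemma a_positive:
  assumes w: "window l" and aT: "0 \<le> a l T" and s: "0 \<le> s" "s < T"
  shows "0 < a l s"
proof (cases "s = 0")
  case True then show ?thesis using sol by simp
next
  case False
  then have s0: "0 < s" using s by simp
  have "a l T / b l T < a l s / b l s"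
  proof (rule DERIV_neg_imp_decreasing[OF s(2)])
    fix x assume x: "s \<le> x" "x \<le> T"
    have bx: "0 < b l x" by (rule b_positive[OF w]) (use x s0 in auto)
    have "((\<lambda>x. a l x / b l x) has_real_derivative (a' l x * b l x - a l x * b' l x) / (b l x * b l x)) (at x)"
      by (rule DERIV_divide[OF ode_solution_D(1)[OF sol(1)] ode_solution_D(1)[OF sol(2)]]) (use bx in simp)
    moreover have "a' l x * b l x - a l x * b' l x = - 1" using wronskian[of l x] by simp
    ultimately have "((\<lambda>x. a l x / b l x) has_real_derivative - 1 / (b l x * b l x)) (at x)" by simp
    moreover have "- 1 / (b l x * b l x) < 0" using bx by simp
    ultimately show "\<exists>y. ((\<lambda>x. a l x / b l x) has_real_derivative y) (at x) \<and> y < 0" by blast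
  qed
  moreover have "0 \<le> a l T / b l T" using aT b_end(5)[OF w] by simp
  ultimately have "0 < a l s / b l s" by linarith
  moreover have "0 < b l s" by (rule b_positive[OF w]) (use s0 s in auto)
  ultimately show ?thesis by (simp add: zero_less_divide_iff)
qed

text \<open>
  Here \<open>X\<close> grows by at least \<open>h * N T\<close>, which dominates the negative term \<open>yT * P * f\<close>; so \<open>a'\<close> and \<open>b\<close> are
  positive at \<open>T\<close>, and \<open>disc l = 1 + 2 * a' * b\<close>.
\<close>

lemma disc_below:
  assumes l: "l \<le> l0 h - (C1 + 1) * h ^ 3"
  shows "1 < disc l"
proof -
  note rb = rho_below[OF l]
  have r0: "\<rho> h l s \<le> 0" if "s \<in> {0..T}" for s using rb[OF that] h0 by simp
  have Gp: "0 < W.G T" using Q_pos by (simp add: Q_def P_def zero_less_mult_iff)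
  have "W.G T \<le> fb l T" by (rule W.growing_solution_sign(2)[OF solves_b init(3,4) r0 TT])
  then have bT: "0 < b l T" unfolding recover(2)[where l = l and s = T] using Gp by simp
  have X1: "h * W.N T \<le> Xa l T" and f1: "fa l T \<le> 1 + Xa l T * W.G T"
    using W.even_solution_sign[OF solves_a init(1,2) rb less_imp_le[OF h0]] by auto
  have X0: "0 \<le> Xa l T"
  proof -
    have "0 \<le> W.N T" using low h0 by (smt (verit) P_def abs_ge_zero exp_gt_zero mult_nonneg_nonneg zero_le_mult_iff divide_less_0_iff zero_less_mult_pos)
    then show ?thesis using X1 h0 by (smt (verit) mult_nonneg_nonneg)
  qed
  have f1': "1 \<le> (fa l T)\<^sup>2" using W.squares_nondecreasing(1)[OF solves_a r0 _ TT] init by simp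
  have "\<bar>yT\<bar> * (P h T * fa l T) \<le> \<bar>yT\<bar> * (P h T * (1 + Xa l T * W.G T))"
    using f1 by (intro mult_left_mono) (auto simp: P_def)
  also have "\<dots> = \<bar>yT\<bar> * P h T + (\<bar>yT\<bar> * Q) * Xa l T" by (simp add: Q_def algebra_simps)
  also have "\<dots> \<le> \<bar>yT\<bar> * P h T + 9/16 * Xa l T" using yQ X0 by (intro add_left_mono mult_right_mono)
  finally have 1: "\<bar>yT\<bar> * (P h T * fa l T) \<le> \<bar>yT\<bar> * P h T + 9/16 * Xa l T" .
  have "0 \<le> fa l T"
    by (rule order_trans[OF zero_le_one W.ge_one_of_square_ge_one[OF W.solves_continuous(1)[OF solves_a] init(1) _ TT]])
      (use W.squares_nondecreasing(1)[OF solves_a r0] init in force)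
  then have "- (yT * (P h T * fa l T)) \<le> \<bar>yT\<bar> * (P h T * fa l T)"
    using mult_right_mono[of "- yT" "\<bar>yT\<bar>" "P h T * fa l T"] by (simp add: P_def)
  then have "0 < Xa l T + yT * (P h T * fa l T)" by (rule tunnel_estimates(4)[OF _ 1 low X1 X0])
  then have "0 < exp (Y h T) * a' l T" using recover(3)[where l = l and s = T] by (simp add: yT_def)
  then have "0 < a' l T" by (simp add: zero_less_mult_iff)
  then have "0 < a' l T * b l T" using bT by simp
  then show ?thesis using disc_products(2)[of l] by simp
qed

lemma window_top: "window (l0 h + (C1 + 1) * h ^ 3)" and window_bottom: "window (l0 h - (C1 + 1) * h ^ 3)"
  using C1_nonneg h0 by (simp_all add: window_def)

text \<open>
  If \<open>a\<close> were nonnegative at \<open>T\<close>, it would be positive before, contradicting the oscillation above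
  the window. Hence \<open>a < 0 < b'\<close> at \<open>T\<close>, and \<open>disc l = 2 * a * b' - 1\<close>.
\<close>

lemma disc_top: "disc (l0 h + (C1 + 1) * h ^ 3) < - 1"
proof -
  let ?l = "l0 h + (C1 + 1) * h ^ 3"
  have "a ?l T < 0"
  proof (rule ccontr)
    assume "\<not> a ?l T < 0"
    then have aT: "0 \<le> a ?l T" by simp
    show False
    proof (rule W.even_solution_oscillates[OF solves_a init(2) rho_above[OF order_refl] less_imp_le[OF h0] _ _ high])
      show "0 < fa ?l s" if "0 \<le> s" "s < T" for s
        using a_positive[OF window_top aT that] by (simp add: fa_def)
      show "0 \<le> fa ?l T" using aT by (simp add: fa_def)
    qed auto
  qed
  then have "a ?l T * b' ?l T < 0" using b_end(6)[OF window_top] by (simp add: mult_neg_pos)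
  then show ?thesis using disc_products(1)[of ?l] by simp
qed

definition "Ja l1 l2 = integral {0..T} (\<lambda>s. a l1 s * a l2 s)"
definition "Jb l1 l2 = integral {0..T} (\<lambda>s. b l1 s * b l2 s)"

lemma qq_diff: "qq h l1 s - qq h l2 s = (l2 - l1) / h\<^sup>2"
  by (simp add: qq_def diff_divide_distrib[symmetric])

lemma green_a: "(l2 - l1) / h\<^sup>2 * Ja l1 l2 = a' l1 T * a l2 T - a l1 T * a' l2 T"
  unfolding Ja_def by (rule green_identity[OF sol(1) sol(1) _ qq_diff]) (simp_all add: sol)

lemma green_b: "(l2 - l1) / h\<^sup>2 * Jb l1 l2 = b' l1 T * b l2 T - b l1 T * b' l2 T"
  unfolding Jb_def by (rule green_identity[OF sol(2) sol(2) _ qq_diff]) (simp_all add: sol)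

lemma cont_sol: "continuous_on S (a l)" "continuous_on S (b l)"
  by (rule continuous_at_imp_continuous_on, rule ballI, rule DERIV_isCont[OF ode_solution_D(1)[OF sol(1)]])
     (rule continuous_at_imp_continuous_on, rule ballI, rule DERIV_isCont[OF ode_solution_D(1)[OF sol(2)]])

lemma a_end_nonneg:
  assumes w: "window l" and d: "-1 \<le> disc l"
  shows "0 \<le> a l T"
proof -
  have "0 \<le> a l T * b' l T" using disc_products(1)[of l] d by simp
  then show ?thesis using b_end(6)[OF w] by (simp add: zero_le_mult_iff)
qed

lemma Jb_nonneg: "window l1 \<Longrightarrow> window l2 \<Longrightarrow> 0 \<le> Jb l1 l2"
  unfolding Jb_def
proof (rule integral_nonneg)
  show "(\<lambda>s. b l1 s * b l2 s) integrable_on {0..T}"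
    by (intro integrable_continuous_real continuous_on_mult cont_sol)
  fix s assume w: "window l1" "window l2" and s: "s \<in> {0..T}"
  show "0 \<le> b l1 s * b l2 s" unfolding recover(2) using b_window(3)[OF w(1) s] b_window(3)[OF w(2) s] by simp
qed

lemma Ja_pos:
  assumes w: "window l1" "window l2" and d: "-1 \<le> disc l1" "-1 \<le> disc l2"
  shows "0 < Ja l1 l2"
proof -
  have i: "(\<lambda>s. a l1 s * a l2 s) integrable_on {0..T}"
    by (intro integrable_continuous_real continuous_on_mult cont_sol)
  have pos: "0 < a l1 s * a l2 s" if "0 \<le> s" "s < T" for s
    using a_positive[OF w(1) a_end_nonneg[OF w(1) d(1)] that] a_positive[OF w(2) a_end_nonneg[OF w(2) d(2)] that] by simp
  have nn: "0 \<le> a l1 s * a l2 s" if s: "s \<in> {0..T}" for s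
  proof (cases "s = T")
    case True
    show ?thesis unfolding True
      by (rule mult_nonneg_nonneg[OF a_end_nonneg[OF w(1) d(1)] a_end_nonneg[OF w(2) d(2)]])
  next
    case False
    then show ?thesis using pos[of s] s by simp
  qed
  have "0 \<le> Ja l1 l2" unfolding Ja_def by (rule integral_nonneg[OF i nn])
  moreover have "Ja l1 l2 \<noteq> 0"
  proof
    assume "Ja l1 l2 = 0"
    then have "\<forall>s\<in>{0..T}. a l1 s * a l2 s = 0"
      unfolding Ja_def using integral_eq_0_iff[of 0 T "\<lambda>s. a l1 s * a l2 s"] nn
      by (simp add: continuous_on_mult cont_sol)
    then have "a l1 0 * a l2 0 = 0" by (rule bspec) simp
    then show False by (simp add: sol)
  qed
  ultimately show ?thesis by simp
qed

text \<open>
  Two different parameters with the same value of the discriminant are impossible, since Green's identities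
  for \<open>a\<close> and for \<open>b\<close> would have opposite signs.
\<close>

lemma disc_injective:
  assumes w: "window l1" "window l2" and d: "disc l1 = d" "disc l2 = d" "-1 \<le> d" "d \<le> 1"
  shows "l1 = l2"
proof -
  have no: False if w: "window l1" "window l2" and d: "disc l1 = d" "disc l2 = d" "-1 \<le> d" "d \<le> 1" and lt: "l1 < l2" for l1 l2
  proof -
    define Pd where "Pd = (1 + d) / 2"
    have Pd: "0 \<le> Pd" "0 \<le> 1 - Pd" using d by (simp_all add: Pd_def)
    note bp = b_end(5,6)[OF w(1)] b_end(5,6)[OF w(2)]
    have pr: "a l1 T * b' l1 T = Pd" "a' l1 T * b l1 T = Pd - 1" "a l2 T * b' l2 T = Pd" "a' l2 T * b l2 T = Pd - 1"
      using disc_products[of l1] disc_products[of l2] d by (simp_all add: Pd_def)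
    have dl: "0 < (l2 - l1) / h\<^sup>2" using lt h0 by simp
    have "0 < Ja l1 l2" by (rule Ja_pos[OF w]) (use d in auto)
    with dl have "0 < (l2 - l1) / h\<^sup>2 * Ja l1 l2" by (rule mult_pos_pos)
    then have 1: "0 < a' l1 T * a l2 T - a l1 T * a' l2 T" unfolding green_a .
    have "0 \<le> (l2 - l1) / h\<^sup>2 * Jb l1 l2" by (rule mult_nonneg_nonneg[OF less_imp_le[OF dl] Jb_nonneg[OF w]])
    then have 2: "0 \<le> b' l1 T * b l2 T - b l1 T * b' l2 T" unfolding green_b .
    have "0 < (a' l1 T * a l2 T - a l1 T * a' l2 T) * (b l1 T * b' l2 T * (b' l1 T * b l2 T))"
      using 1 bp by simp
    also have "\<dots> = (a' l1 T * b l1 T) * (a l2 T * b' l2 T) * (b' l1 T * b l2 T) - (a l1 T * b' l1 T) * (a' l2 T * b l2 T) * (b l1 T * b' l2 T)"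
      by (simp add: algebra_simps)
    also have "\<dots> = - (Pd * (1 - Pd)) * (b' l1 T * b l2 T - b l1 T * b' l2 T)"
      unfolding pr by (simp add: algebra_simps)
    also have "\<dots> \<le> 0" using Pd 2 by (simp add: mult_nonneg_nonneg)
    finally show False by simp
  qed
  show ?thesis
  proof (rule ccontr)
    assume "l1 \<noteq> l2"
    then consider "l1 < l2" | "l2 < l1" by linarith
    then show False
    proof cases
      case 1 then show False using no[OF w d] by simp
    next
      case 2 then show False using no[OF w(2,1) d(2,1) d(3,4)] by simp
    qed
  qed
qed

text \<open>
  An exact formula for the gap. Green's identity for \<open>a\<close> is multiplied by the values of \<open>b\<close> and \<open>b'\<close> at \<open>T\<close>, so
  that only the products known from the discriminant remain; Green's identity for \<open>b\<close> turns the
  remaining Wronskian of the odd solutions into an integral.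
\<close>

lemma gap_identity:
  assumes w: "window l1" "window l2" and d: "disc l1 = c" "disc l2 = - c"
  shows "(l2 - l1) / h\<^sup>2 * (Ja l1 l2 + (1 - c)\<^sup>2 * Jb l1 l2 / (4 * (b l1 T * b' l2 T * (b' l1 T * b l2 T))))
     = c / (b' l1 T * b l2 T)"
proof -
  note bp = b_end(5,6)[OF w(1)] b_end(5,6)[OF w(2)]
  let ?m = "b l1 T * b' l2 T * (b' l1 T * b l2 T)"
  have m: "?m \<noteq> 0" using bp by simp
  have pr: "a l1 T * b' l1 T = (1 + c) / 2" "a' l1 T * b l1 T = (c - 1) / 2" "a l2 T * b' l2 T = (1 - c) / 2" "a' l2 T * b l2 T = (- c - 1) / 2"
    using disc_products[of l1] disc_products[of l2] d by simp_all
  have "(l2 - l1) / h\<^sup>2 * Ja l1 l2 * ?m = (a' l1 T * b l1 T) * (a l2 T * b' l2 T) * (b' l1 T * b l2 T) - (a l1 T * b' l1 T) * (a' l2 T * b l2 T) * (b l1 T * b' l2 T)"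
    unfolding green_a by (simp add: algebra_simps)
  also have "\<dots> = c * (b l1 T * b' l2 T) - (1 - c)\<^sup>2 / 4 * (b' l1 T * b l2 T - b l1 T * b' l2 T)"
    unfolding pr by (simp add: field_simps power2_eq_square)
  also have "b' l1 T * b l2 T - b l1 T * b' l2 T = (l2 - l1) / h\<^sup>2 * Jb l1 l2" by (rule green_b[symmetric])
  finally have "(l2 - l1) / h\<^sup>2 * Ja l1 l2 * ?m + (1 - c)\<^sup>2 / 4 * ((l2 - l1) / h\<^sup>2 * Jb l1 l2) = c * (b l1 T * b' l2 T)" by simp
  then have "((l2 - l1) / h\<^sup>2 * (Ja l1 l2 + (1 - c)\<^sup>2 * Jb l1 l2 / (4 * ?m))) * ?m = (c / (b' l1 T * b l2 T)) * ?m"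
    unfolding tunnel_estimates(2)[OF m] using bp by (subst tunnel_estimates(3)) auto
  then show ?thesis using m by (simp only: mult_cancel_right) simp
qed

end

section \<open>The gap for one value of the semiclassical parameter\<close>

context tunnel_small
begin

lemma disc_continuous: "continuous_on S disc"
proof (rule continuous_at_imp_continuous_on, rule ballI)
  fix l
  have c: "isCont (\<lambda>l. fst (fund_sol (qq h l) x y) T) l" "isCont (\<lambda>l. snd (fund_sol (qq h l) x y) T) l" for x y
    using fund_sol_isCont[OF cV, of T] unfolding qq_def by auto
  have "isCont (\<lambda>l. a l T * b' l T + a' l T * b l T) l"
    unfolding ev_sol_def ev_der_def od_sol_def od_der_def by (intro isCont_add isCont_mult c)
  moreover have "(\<lambda>l. a l T * b' l T + a' l T * b l T) = disc" by (rule ext) (rule disc_def[symmetric])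
  ultimately show "isCont disc l" by simp
qed

abbreviation "lo \<equiv> l0 h - (C1 + 1) * h ^ 3"
abbreviation "hi \<equiv> l0 h + (C1 + 1) * h ^ 3"

lemma window_iff: "window l \<longleftrightarrow> lo \<le> l \<and> l \<le> hi"
  unfolding window_def by (auto simp: abs_le_iff)

lemma disc_crossing:
  assumes "lo \<le> u" "u \<le> hi" "disc u \<le> d" "d \<le> 1"
  obtains l where "lo \<le> l" "l \<le> u" "disc l = d"
proof -
  have "d \<le> disc lo" using disc_below[OF order_refl] assms(4) by linarith
  then have "\<exists>x\<ge>lo. x \<le> u \<and> disc x = d"
    by (rule IVT2'[OF assms(3) _ assms(1) disc_continuous])
  then show ?thesis using that by blast
qed

lemma magnetic_hill_l: "magnetic_hill V l h"
  by (rule magnetic_hill.intro[OF hill_qq[unfolded qq_def] magnetic_hill_axioms.intro[OF h0 cV]])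

lemma multiplicity_off:
  assumes "(disc l)\<^sup>2 \<noteq> (cos (\<xi> * pi / h))\<^sup>2"
  shows "multiplicity_at H2_circle (magnetic_schrodinger V \<xi> h) l = 0"
  using magnetic_hill.multiplicity_zero_off_band[OF magnetic_hill_l, of l \<xi>] assms
  unfolding qq_def magnetic_hill.k_def[OF magnetic_hill_l] by simp

lemma multiplicity_on:
  assumes "(disc l)\<^sup>2 = (cos (\<xi> * pi / h))\<^sup>2" "disc l \<noteq> 0" "window l"
  shows "multiplicity_at H2_circle (magnetic_schrodinger V \<xi> h) l = 1"
proof -
  have "hill.mB (qq h l) \<noteq> 0"
    unfolding hill.mB_def[OF hill_qq] using b_end(5,6)[OF assms(3)] by simp
  then show ?thesis
    using magnetic_hill.multiplicity_one_on_band[OF magnetic_hill_l, of l \<xi>] assms(1,2)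
    unfolding qq_def magnetic_hill.k_def[OF magnetic_hill_l] by simp
qed

lemma multiplicity_double:
  assumes "disc l = 0" "cos (\<xi> * pi / h) = 0"
  shows "2 \<le> multiplicity_at H2_circle (magnetic_schrodinger V \<xi> h) l"
  using magnetic_hill.multiplicity_two[OF magnetic_hill_l, of l \<xi>] assms
  unfolding qq_def magnetic_hill.k_def[OF magnetic_hill_l] by simp

text \<open>
  The discriminant exceeds \<open>1\<close> below the window and drops below \<open>- 1\<close> inside it, and in the window it
  takes each value in \<open>[-1, 1]\<close> exactly once. For \<open>c = 0\<close> the two crossings merge into one
  eigenvalue of multiplicity two.
\<close>

lemma first_two_eigenvalues:
  fixes \<xi> :: real
  defines "c \<equiv> \<bar>cos (\<xi> * pi / h)\<bar>"
  obtains l1 l2 where "window l1" "window l2" "disc l1 = c" "disc l2 = - c"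
    "magnetic_eigenvalue V \<xi> 1 h = l1" "magnetic_eigenvalue V \<xi> 2 h = l2"
proof -
  let ?M = "multiplicity_at H2_circle (magnetic_schrodinger V \<xi> h)"
  have c: "0 \<le> c" "c \<le> 1" unfolding c_def by auto
  have c2: "c\<^sup>2 = (cos (\<xi> * pi / h))\<^sup>2" unfolding c_def by simp
  have lohi: "lo \<le> hi" using C1_nonneg h0 by simp
  have top: "disc hi \<le> d" if "-1 \<le> d" for d using disc_top that by linarith
  have cm: "-1 \<le> c" "-1 \<le> - c" "- c \<le> 1" using c by auto
  obtain l1 where l1: "lo \<le> l1" "l1 \<le> hi" "disc l1 = c"
    by (rule disc_crossing[OF lohi order_refl top[OF cm(1)] c(2)]) (rule that)
  obtain l2 where l2: "lo \<le> l2" "l2 \<le> hi" "disc l2 = - c"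
    by (rule disc_crossing[OF lohi order_refl top[OF cm(2)] cm(3)]) (rule that)
  have w1: "window l1" and w2: "window l2" using l1 l2 by (simp_all add: window_iff)
  have off: "?M \<nu> = 0" if nu: "\<nu> \<le> hi" "\<nu> \<noteq> l1" "\<nu> \<noteq> l2" for \<nu>
  proof (rule multiplicity_off)
    show "(disc \<nu>)\<^sup>2 \<noteq> (cos (\<xi> * pi / h))\<^sup>2"
    proof
      assume "(disc \<nu>)\<^sup>2 = (cos (\<xi> * pi / h))\<^sup>2"
      then have d: "disc \<nu> = c \<or> disc \<nu> = - c" unfolding c2[symmetric] power2_eq_iff .
      have "lo \<le> \<nu>"
      proof (rule ccontr)
        assume "\<not> lo \<le> \<nu>"
        then have "1 < disc \<nu>" by (intro disc_below) simp
        then show False using d c by auto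
      qed
      then have w: "window \<nu>" using nu by (simp add: window_iff)
      from d show False
      proof
        assume "disc \<nu> = c"
        then have "\<nu> = l1" using disc_injective[OF w w1, of c] l1 c by auto
        then show False using nu by simp
      next
        assume "disc \<nu> = - c"
        then have "\<nu> = l2" using disc_injective[OF w w2, of "- c"] l2 c by auto
        then show False using nu by simp
      qed
    qed
  qed
  show ?thesis
  proof (cases "c = 0")
    case True
    have eq: "l2 = l1" using disc_injective[OF w2 w1, of 0] l1 l2 True by auto
    have cos0: "cos (\<xi> * pi / h) = 0" using True by (simp add: c_def)
    have m2: "2 \<le> ?M l1" by (rule multiplicity_double[OF _ cos0]) (use l1 True in simp)
    have m1: "1 \<le> ?M l1" using m2 by (rule order_trans[rotated]) simp
    have lt: "?M \<nu> = 0" if "\<nu> < l1" for \<nu> by (rule off) (use that eq l1 in auto)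
    have e1: "magnetic_eigenvalue V \<xi> 1 h = l1"
      unfolding magnetic_eigenvalue_def by (rule nth_eigenvalue_lowest[OF _ _ lt]) (use m1 in \<open>simp_all add: one_enat_def\<close>)
    have e2: "magnetic_eigenvalue V \<xi> 2 h = l2"
      unfolding magnetic_eigenvalue_def eq
      by (rule nth_eigenvalue_lowest[OF _ _ lt]) (use m2 in \<open>simp_all add: numeral_eq_enat\<close>)
    show ?thesis by (rule that[OF w1 w2 l1(3) l2(3) e1 e2])
  next
    case False
    then have cp: "0 < c" using c by simp
    have m1: "?M l1 = 1" by (rule multiplicity_on[OF _ _ w1]) (use l1 cp c2 in auto)
    have m2: "?M l2 = 1" by (rule multiplicity_on[OF _ _ w2]) (use l2 cp c2 in auto)
    have less: "l1 < l2"
    proof (rule ccontr)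
      assume "\<not> l1 < l2"
      then have le: "l2 \<le> l1" by simp
      have dc: "disc l2 \<le> c" using l2(3) c by simp
      obtain l where l: "lo \<le> l" "l \<le> l2" "disc l = c"
        by (rule disc_crossing[OF l2(1,2) dc c(2)]) (rule that)
      have "window l" using l l2 by (simp add: window_iff)
      then have "l = l1" using disc_injective[OF _ w1, of l c] l l1 c by auto
      then have "l1 = l2" using l le by simp
      then show False using l1 l2 cp by simp
    qed
    have lt1: "?M \<nu> = 0" if "\<nu> < l1" for \<nu> by (rule off) (use that less l1 in auto)
    have lt2: "?M \<nu> = 0" if "\<nu> < l2" "\<nu> \<noteq> l1" for \<nu> by (rule off) (use that l2 in auto)
    have e1: "magnetic_eigenvalue V \<xi> 1 h = l1"
      unfolding magnetic_eigenvalue_def by (rule nth_eigenvalue_lowest[OF _ _ lt1]) (simp_all add: m1 one_enat_def)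
    have e2: "magnetic_eigenvalue V \<xi> 2 h = l2"
      unfolding magnetic_eigenvalue_def by (rule nth_eigenvalue_second_simple[OF less m1 _ lt2]) (simp add: m2)
    show ?thesis by (rule that[OF w1 w2 l1(3) l2(3) e1 e2])
  qed
qed

text \<open>
  A bound for \<open>X\<close> of the even solution at \<open>T\<close> when the discriminant lies in \<open>[-1, 1]\<close>.
\<close>

definition "\<zeta> = P h T * (2 / Q + 4 * \<bar>yT\<bar>)"

lemma zeta_nonneg: "0 \<le> \<zeta>"
  unfolding \<zeta>_def using Q_pos by (simp add: P_def)

lemma zeta_G: "\<zeta> * W.G T \<le> 5"
proof -
  have "\<zeta> * W.G T = Q * (2 / Q + 4 * \<bar>yT\<bar>)" by (simp add: \<zeta>_def Q_def)
  also have "\<dots> = 2 + 4 * (\<bar>yT\<bar> * Q)" using Q_pos by (simp add: field_simps)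
  finally show ?thesis using yQ by simp
qed

text \<open>
  In the band, \<open>0 \<le> a * b' \<le> 1\<close> and \<open>-1 \<le> a' * b \<le> 0\<close> at \<open>T\<close>, so the lower bounds on \<open>b\<close> and \<open>b'\<close>
  make \<open>a\<close> and \<open>a'\<close> small at \<open>T\<close>.
\<close>

lemma a_band:
  assumes w: "window l" and d: "-1 \<le> disc l" "disc l \<le> 1" and s: "s \<in> {0..T}"
  shows "\<bar>fa l s\<bar> \<le> 12" "\<bar>fa l s - 1\<bar> \<le> \<zeta> * W.G s + 12 * \<theta>"
proof -
  note bp = b_end(3-6)[OF w]
  have pr: "a l T = (1 + disc l) / 2 / b' l T" "a' l T = (disc l - 1) / 2 / b l T"
    using disc_products[of l] bp by (simp_all add: field_simps)
  have "\<bar>(1 + disc l) / 2\<bar> \<le> 1" using d by (simp add: abs_le_iff)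
  then have "\<bar>(1 + disc l) / 2\<bar> / b' l T \<le> 1 / b' l T" by (rule divide_right_mono) (use bp in simp)
  moreover have "\<bar>a l T\<bar> = \<bar>(1 + disc l) / 2\<bar> / b' l T" unfolding pr using bp by (simp only: abs_divide abs_of_pos)
  ultimately have "\<bar>a l T\<bar> \<le> 1 / b' l T" by (simp only:)
  then have "\<psi>T * \<bar>a l T\<bar> \<le> \<psi>T * (1 / b' l T)" using psi_pos by (intro mult_left_mono) auto
  also have "\<dots> = P h T / (\<psi>T * b' l T)" using psi_pos by (simp add: P_psi)
  also have "\<dots> \<le> P h T / (1/4)" by (rule divide_left_mono[OF bp(2)]) (use bp psi_pos in \<open>auto simp: P_def\<close>)
  finally have A: "\<psi>T * \<bar>a l T\<bar> \<le> 4 * P h T" by simp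
  have "\<bar>(disc l - 1) / 2\<bar> \<le> 1" using d by (simp add: abs_le_iff)
  then have "\<bar>(disc l - 1) / 2\<bar> / b l T \<le> 1 / b l T" by (rule divide_right_mono) (use bp in simp)
  moreover have "\<bar>a' l T\<bar> = \<bar>(disc l - 1) / 2\<bar> / b l T" unfolding pr using bp by (simp only: abs_divide abs_of_pos)
  ultimately have "\<bar>a' l T\<bar> \<le> 1 / b l T" by (simp only:)
  then have "\<psi>T * \<bar>a' l T\<bar> \<le> \<psi>T * (1 / b l T)" using psi_pos by (intro mult_left_mono) auto
  also have "\<dots> = P h T / (\<psi>T * b l T)" using psi_pos by (simp add: P_psi)
  also have "\<dots> \<le> P h T / (Q / 2)" by (rule divide_left_mono[OF bp(1)]) (use bp psi_pos Q_pos in \<open>auto simp: P_def\<close>)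
  finally have A': "\<psi>T * \<bar>a' l T\<bar> \<le> P h T * (2 / Q)" by simp
  have "\<bar>Xa l T\<bar> = \<psi>T * \<bar>a' l T - yT * a l T\<bar>" by (simp add: Xa_def \<psi>T_def yT_def abs_mult)
  also have "\<dots> \<le> \<psi>T * (\<bar>a' l T\<bar> + \<bar>yT\<bar> * \<bar>a l T\<bar>)"
    using psi_pos abs_triangle_ineq4[of "a' l T" "yT * a l T"] by (intro mult_left_mono) (auto simp: abs_mult)
  also have "\<dots> = \<psi>T * \<bar>a' l T\<bar> + \<bar>yT\<bar> * (\<psi>T * \<bar>a l T\<bar>)" by (simp add: algebra_simps)
  also have "\<dots> \<le> P h T * (2 / Q) + \<bar>yT\<bar> * (4 * P h T)" using A A' by (intro add_mono mult_left_mono) auto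
  also have "\<dots> = \<zeta>" by (simp add: \<zeta>_def algebra_simps)
  finally have XT: "\<bar>Xa l T\<bar> \<le> \<zeta>" .
  have "\<bar>fa l s\<bar> \<le> 2 * (1 + \<zeta> * W.G T)"
    by (rule W.band_solution(1)[OF solves_a init(1) XT rho_window[OF w] th_half s])
  also have "2 * (1 + \<zeta> * W.G T) \<le> 12" using zeta_G by simp
  finally show "\<bar>fa l s\<bar> \<le> 12" .
  have 1: "\<bar>fa l s - 1\<bar> \<le> \<zeta> * W.G s + 2 * \<theta> * (1 + \<zeta> * W.G T)"
    unfolding \<theta>_def by (rule W.band_solution(2)[OF solves_a init(1) XT rho_window[OF w] th_half s])
  have "2 * \<theta> * (1 + \<zeta> * W.G T) \<le> 2 * \<theta> * 6" using zeta_G theta_nonneg by (intro mult_left_mono) auto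
  then show "\<bar>fa l s - 1\<bar> \<le> \<zeta> * W.G s + 12 * \<theta>" using 1 by linarith
qed

text \<open>
  Both even solutions are close to \<open>exp Y\<close>, so their product is close to the weight.
\<close>

lemma Ja_estimate:
  assumes w: "window l1" "window l2" and d: "-1 \<le> disc l1" "disc l1 \<le> 1" "-1 \<le> disc l2" "disc l2 \<le> 1"
  shows "\<bar>Ja l1 l2 - W.N T\<bar> \<le> 13 * (\<zeta> * C2 * T\<^sup>2 + 12 * \<theta> * W.N T)"
proof -
  have iJ: "(\<lambda>s. a l1 s * a l2 s) integrable_on {0..T}"
    by (intro integrable_continuous_real continuous_on_mult cont_sol)
  have iP: "P h integrable_on {0..T}" by (rule integrable_continuous_real[OF W.cP])
  have pt: "\<bar>a l1 s * a l2 s - P h s\<bar> \<le> 13 * (\<zeta> * C2 * T + 12 * \<theta> * P h s)" if s: "s \<in> {0..T}" for s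
  proof -
    have P0: "0 \<le> P h s" by (simp add: P_def)
    note f1 = a_band[OF w(1) d(1,2) s] note f2 = a_band[OF w(2) d(3,4) s]
    have "P h s = exp (Y h s) * exp (Y h s)" by (simp add: P_def exp_add[symmetric])
    then have e: "a l1 s * a l2 s - P h s = P h s * (fa l1 s * fa l2 s - 1)"
      unfolding recover(1)[where l = l1 and s = s] recover(1)[where l = l2 and s = s] by (simp add: algebra_simps)
    have "fa l1 s * fa l2 s - 1 = (fa l1 s - 1) * fa l2 s + (fa l2 s - 1)" by (simp add: algebra_simps)
    then have "\<bar>fa l1 s * fa l2 s - 1\<bar> \<le> \<bar>fa l1 s - 1\<bar> * \<bar>fa l2 s\<bar> + \<bar>fa l2 s - 1\<bar>"
      using abs_triangle_ineq[of "(fa l1 s - 1) * fa l2 s" "fa l2 s - 1"] by (simp add: abs_mult)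
    also have "\<dots> \<le> (\<zeta> * W.G s + 12 * \<theta>) * 12 + (\<zeta> * W.G s + 12 * \<theta>)"
      using f1 f2 by (intro add_mono mult_mono) auto
    finally have "\<bar>fa l1 s * fa l2 s - 1\<bar> \<le> 13 * (\<zeta> * W.G s + 12 * \<theta>)" by simp
    then have "P h s * \<bar>fa l1 s * fa l2 s - 1\<bar> \<le> P h s * (13 * (\<zeta> * W.G s + 12 * \<theta>))"
      using P0 by (rule mult_left_mono)
    also have "\<dots> = 13 * (\<zeta> * (P h s * W.G s) + 12 * \<theta> * P h s)" by (simp add: algebra_simps)
    also have "\<dots> \<le> 13 * (\<zeta> * (C2 * T) + 12 * \<theta> * P h s)"
    proof -
      have "C2 * s \<le> C2 * T" using s W.C_ge_1 by (intro mult_left_mono) auto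
      then have "P h s * W.G s \<le> C2 * T" using W.P_times_G_le[OF s] by linarith
      then have "\<zeta> * (P h s * W.G s) \<le> \<zeta> * (C2 * T)" using zeta_nonneg by (rule mult_left_mono)
      then show ?thesis by (rule mult_left_mono[OF add_right_mono]) simp
    qed
    finally show ?thesis unfolding e abs_mult using P0 by (simp add: mult_ac)
  qed
  have h1: "((\<lambda>s. \<zeta> * C2 * T) has_integral measure lborel {0..T} *\<^sub>R (\<zeta> * C2 * T)) {0..T}"
    by (rule has_integral_const_real)
  have h2: "((\<lambda>s. 12 * \<theta> * P h s) has_integral 12 * \<theta> * W.N T) {0..T}"
    unfolding W.N_def by (rule has_integral_mult_right[OF integrable_integral[OF iP]])
  have e1: "Ja l1 l2 - W.N T = integral {0..T} (\<lambda>s. a l1 s * a l2 s - P h s)"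
    unfolding Ja_def W.N_def by (rule Henstock_Kurzweil_Integration.integral_diff[OF iJ iP, symmetric])
  have e2: "norm (integral {0..T} (\<lambda>s. a l1 s * a l2 s - P h s))
      \<le> integral {0..T} (\<lambda>s. 13 * (\<zeta> * C2 * T + 12 * \<theta> * P h s))"
  proof (rule integral_norm_bound_integral)
    show "(\<lambda>s. a l1 s * a l2 s - P h s) integrable_on {0..T}" by (rule integrable_diff[OF iJ iP])
    show "(\<lambda>s. 13 * (\<zeta> * C2 * T + 12 * \<theta> * P h s)) integrable_on {0..T}"
      by (intro integrable_continuous_real continuous_on_mult continuous_on_add continuous_on_const W.cP)
    show "norm (a l1 s * a l2 s - P h s) \<le> 13 * (\<zeta> * C2 * T + 12 * \<theta> * P h s)" if "s \<in> {0..T}" for s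
      unfolding real_norm_def by (rule pt[OF that])
  qed
  have e3: "integral {0..T} (\<lambda>s. 13 * (\<zeta> * C2 * T + 12 * \<theta> * P h s))
      = 13 * (measure lborel {0..T} *\<^sub>R (\<zeta> * C2 * T) + 12 * \<theta> * W.N T)"
    by (rule integral_unique[OF has_integral_mult_right[OF has_integral_add[OF h1 h2]]])
  have e4: "measure lborel {0..T} *\<^sub>R (\<zeta> * C2 * T) = \<zeta> * C2 * T\<^sup>2"
  proof -
    have m: "measure lborel {0..T} = T" by simp
    have "t *\<^sub>R (u * v * t) = u * v * t\<^sup>2" for t u v :: real by (simp add: power2_eq_square)
    then show ?thesis unfolding m .
  qed
  show ?thesis using e2 unfolding e1[symmetric] e3 e4 real_norm_def .
qed

lemma Jb_estimate:
  assumes w: "window l1" "window l2"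
  shows "Jb l1 l2 / (4 * (b l1 T * b' l2 T * (b' l1 T * b l2 T))) \<le> 64 * C2 * T\<^sup>2 * P h T / Q"
    "0 \<le> Jb l1 l2 / (4 * (b l1 T * b' l2 T * (b' l1 T * b l2 T)))"
proof -
  have ib: "(\<lambda>s. b l1 s * b l2 s) integrable_on {0..T}"
    by (intro integrable_continuous_real continuous_on_mult cont_sol)
  have pt: "b l1 s * b l2 s \<le> 4 * C2 * T * W.G T" if s: "s \<in> {0..T}" for s
  proof -
    have P0: "0 \<le> P h s" by (simp add: P_def)
    have PP: "P h s = exp (Y h s) * exp (Y h s)" by (simp add: P_def exp_add[symmetric])
    have e: "b l1 s * b l2 s = P h s * (fb l1 s * fb l2 s)"
      unfolding recover(2)[where l = l1 and s = s] recover(2)[where l = l2 and s = s] PP by simp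
    also have "\<dots> \<le> P h s * ((2 * W.G s) * (2 * W.G s))"
      using b_window(3,4)[OF w(1) s] b_window(3,4)[OF w(2) s] P0 W.G_nonneg[OF s]
      by (intro mult_left_mono mult_mono) auto
    also have "\<dots> = 4 * (P h s * W.G s) * W.G s" by simp
    also have "\<dots> \<le> 4 * (C2 * T) * W.G T"
    proof -
      have "C2 * s \<le> C2 * T" using s W.C_ge_1 by (intro mult_left_mono) auto
      then have "P h s * W.G s \<le> C2 * T" using W.P_times_G_le[OF s] by linarith
      moreover have "W.G s \<le> W.G T" using W.G_mono[of s T] s by simp
      moreover have "0 \<le> 4 * (C2 * T)" using W.C_ge_1 by simp
      ultimately show ?thesis using W.G_nonneg[OF s]
        by (intro mult_mono[OF mult_left_mono]) simp_all
    qed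
    finally show ?thesis by simp
  qed
  have "Jb l1 l2 \<le> integral {0..T} (\<lambda>s. 4 * C2 * T * W.G T)"
    unfolding Jb_def by (rule integral_le[OF ib]) (use pt in auto)
  also have "\<dots> = 4 * C2 * T\<^sup>2 * W.G T" by (simp add: power2_eq_square)
  also have "\<dots> = 4 * C2 * T\<^sup>2 * Q / P h T" by (simp add: Q_def P_def)
  finally have J: "Jb l1 l2 \<le> 4 * C2 * T\<^sup>2 * Q / P h T" .
  let ?m = "b l1 T * b' l2 T * (b' l1 T * b l2 T)"
  note b1 = b_end(3-6)[OF w(1)] note b2 = b_end(3-6)[OF w(2)]
  have "(Q / 2 * (1/4)) * ((1/4) * (Q / 2)) \<le> (\<psi>T * b l1 T * (\<psi>T * b' l2 T)) * ((\<psi>T * b' l1 T) * (\<psi>T * b l2 T))"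
    using b1 b2 Q_nonneg by (intro mult_mono) auto
  also have "\<dots> = P h T * P h T * ?m" unfolding P_psi by (simp add: mult_ac)
  finally have m: "Q * Q / (64 * (P h T * P h T)) \<le> ?m"
    by (simp add: P_def field_simps)
  have m0: "0 < ?m" using b1 b2 by simp
  have PT: "0 < P h T" by (simp add: P_def)
  have "Jb l1 l2 / (4 * ?m) \<le> (4 * C2 * T\<^sup>2 * Q / P h T) / (4 * (Q * Q / (64 * (P h T * P h T))))"
    using J m m0 Jb_nonneg[OF w] Q_pos PT W.C_ge_1 by (intro frac_le) auto
  also have "\<dots> = 64 * C2 * T\<^sup>2 * P h T / Q" using Q_pos PT by (simp add: field_simps)
  finally show "Jb l1 l2 / (4 * ?m) \<le> 64 * C2 * T\<^sup>2 * P h T / Q" .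
  show "0 \<le> Jb l1 l2 / (4 * ?m)" using m0 Jb_nonneg[OF w] by simp
qed

text \<open>
  The factors are \<open>b1 = exp (Y h T) * b' l1 T\<close> and \<open>b2 = exp (Y h T) * b l2 T\<close>, normalised so that they
  have at most algebraic size in \<open>h\<close>.
\<close>

lemma gap_estimate:
  fixes \<xi> :: real
  defines "c \<equiv> \<bar>cos (\<xi> * pi / h)\<bar>"
  obtains b1 b2 J where
    "(magnetic_eigenvalue V \<xi> 2 h - magnetic_eigenvalue V \<xi> 1 h) * (b1 * b2 * J) = h\<^sup>2 * c * P h T"
    "\<bar>b1 - (1 + yT * Q)\<bar> \<le> 4 * \<theta>" "\<bar>b2 - Q\<bar> \<le> 2 * \<theta> * Q"
    "\<bar>J - W.N T\<bar> \<le> 13 * (\<zeta> * C2 * T\<^sup>2 + 12 * \<theta> * W.N T) + 64 * C2 * T\<^sup>2 * P h T / Q"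
proof -
  have c: "0 \<le> c" "c \<le> 1" unfolding c_def by auto
  obtain l1 l2 where w: "window l1" "window l2" and d: "disc l1 = c" "disc l2 = - c"
    and ev: "magnetic_eigenvalue V \<xi> 1 h = l1" "magnetic_eigenvalue V \<xi> 2 h = l2"
    unfolding c_def by (rule first_two_eigenvalues)
  let ?m = "b l1 T * b' l2 T * (b' l1 T * b l2 T)"
  let ?E = "Jb l1 l2 / (4 * ?m)"
  define J where "J = Ja l1 l2 + (1 - c)\<^sup>2 * Jb l1 l2 / (4 * ?m)"
  have dd: "-1 \<le> disc l1" "disc l1 \<le> 1" "-1 \<le> disc l2" "disc l2 \<le> 1" using d c by auto
  have c1: "(1 - c)\<^sup>2 \<le> 1" using c by (simp add: power_le_one)
  have "(1 - c)\<^sup>2 * ?E \<le> 1 * ?E" by (rule mult_right_mono[OF c1 Jb_estimate(2)[OF w]])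
  then have E1: "(1 - c)\<^sup>2 * Jb l1 l2 / (4 * ?m) \<le> 64 * C2 * T\<^sup>2 * P h T / Q"
    using Jb_estimate(1)[OF w] by simp
  have E0: "0 \<le> (1 - c)\<^sup>2 * Jb l1 l2 / (4 * ?m)"
    using mult_nonneg_nonneg[OF zero_le_power2[of "1 - c"] Jb_estimate(2)[OF w]] by simp
  have J: "\<bar>J - W.N T\<bar> \<le> 13 * (\<zeta> * C2 * T\<^sup>2 + 12 * \<theta> * W.N T) + 64 * C2 * T\<^sup>2 * P h T / Q"
    unfolding J_def using Ja_estimate[OF w dd] E0 E1 by linarith
  note bp = b_end(5,6)[OF w(1)] b_end(5,6)[OF w(2)]
  have "(l2 - l1) / h\<^sup>2 * J = c / (b' l1 T * b l2 T)" unfolding J_def by (rule gap_identity[OF w d])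
  then have "(l2 - l1) * J * (b' l1 T * b l2 T) = h\<^sup>2 * c" using h0 bp by (simp add: field_simps)
  then have "(l2 - l1) * ((\<psi>T * b' l1 T) * (\<psi>T * b l2 T) * J) = h\<^sup>2 * c * P h T"
    unfolding P_psi by algebra
  then show ?thesis using that[of "\<psi>T * b' l1 T" "\<psi>T * b l2 T" J] b_end(2)[OF w(1)] b_end(1)[OF w(2)] J
    unfolding ev by blast
qed

end

section \<open>Asymptotics of the factors of the gap\<close>

lemma eventually_scaled_less:
  fixes C d :: real
  assumes "0 < d"
  shows "\<forall>\<^sub>F h in at_right 0. C * h < d" "\<forall>\<^sub>F h in at_right 0. C * sqrt h < d"
proof -
  have "((\<lambda>h. C * h) \<longlongrightarrow> C * 0) (at_right 0)" by (intro tendsto_intros)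
  then show "\<forall>\<^sub>F h in at_right 0. C * h < d" using assms by (intro order_tendstoD(2)[of _ "C * 0"]) auto
  have "((\<lambda>h. C * sqrt h) \<longlongrightarrow> C * sqrt 0) (at_right 0)" by (intro tendsto_intros)
  then show "\<forall>\<^sub>F h in at_right 0. C * sqrt h < d" using assms by (intro order_tendstoD(2)[of _ "C * sqrt 0"]) auto
qed

lemma inverse_product_near_one:
  fixes x y z e :: real
  assumes "\<bar>x - 1\<bar> \<le> e" "\<bar>y - 1\<bar> \<le> e" "\<bar>z - 1\<bar> \<le> e" "e \<le> 1/8"
  shows "x * y * z \<noteq> 0" "\<bar>1 / (x * y * z) - 1\<bar> \<le> 8 * e" "1 / (x * y * z) \<le> 2" "0 \<le> 1 / (x * y * z)"
proof -
  have e0: "0 \<le> e" using assms(1) by linarith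
  have mul: "\<bar>u * v - 1\<bar> \<le> d + f + d * f" if "\<bar>u - 1\<bar> \<le> d" "\<bar>v - 1\<bar> \<le> f" for u v d f :: real
  proof -
    have "u * v - 1 = (u - 1) * (v - 1) + (u - 1) + (v - 1)" by (simp add: algebra_simps)
    moreover have "\<bar>(u - 1) * (v - 1)\<bar> \<le> d * f" unfolding abs_mult using that by (intro mult_mono) auto
    ultimately show ?thesis using that by linarith
  qed
  have ee: "e * e \<le> 1/8 * e" using assms(4) e0 by (rule mult_right_mono)
  have 1: "\<bar>x * y - 1\<bar> \<le> 17/8 * e" using mul[OF assms(1,2)] ee by linarith
  have "\<bar>x * y * z - 1\<bar> \<le> 17/8 * e + e + 17/8 * e * e" by (rule mul[OF 1 assms(3)])
  then have 2: "\<bar>x * y * z - 1\<bar> \<le> 4 * e" using ee by linarith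
  then have 3: "1/2 \<le> x * y * z" using assms(4) by linarith
  then show "x * y * z \<noteq> 0" "0 \<le> 1 / (x * y * z)" by auto
  show "1 / (x * y * z) \<le> 2" using 3 by (simp add: field_simps)
  have "1 / r - 1 = - (r - 1) / r" if "r \<noteq> 0" for r :: real using that by (simp add: field_simps)
  then have "1 / (x * y * z) - 1 = - (x * y * z - 1) / (x * y * z)" using \<open>x * y * z \<noteq> 0\<close> by blast
  then have "\<bar>1 / (x * y * z) - 1\<bar> = \<bar>x * y * z - 1\<bar> / (x * y * z)"
    using 3 by (simp only: abs_divide abs_minus_cancel abs_of_pos)
  also have "\<dots> \<le> 4 * e / (1/2)" using 2 3 by (intro frac_le) auto
  finally show "\<bar>1 / (x * y * z) - 1\<bar> \<le> 8 * e" by simp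
qed

lemma exp_minus_le_power:
  fixes z :: real
  assumes "0 < z"
  shows "exp (- z) \<le> (2 / z)\<^sup>2" "exp (- z) \<le> (3 / z) ^ 3"
proof -
  have "exp (- (z / 2)) \<le> 2 / z" using exp_minus_le_inverse[of "z / 2"] assms by simp
  then have "exp (- (z / 2)) ^ 2 \<le> (2 / z) ^ 2" by (rule power_mono) simp
  then show "exp (- z) \<le> (2 / z)\<^sup>2" by (simp add: exp_of_nat_mult[symmetric])
  have "exp (- (z / 3)) \<le> 3 / z" using exp_minus_le_inverse[of "z / 3"] assms by simp
  then have "exp (- (z / 3)) ^ 3 \<le> (3 / z) ^ 3" by (rule power_mono) simp
  then show "exp (- z) \<le> (3 / z) ^ 3" by (simp add: exp_of_nat_mult[symmetric])
qed

lemma double_half_quotient: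
  fixes A X h Z :: real
  assumes "A - A0 \<le> - X / (2 * h) + Z"
  shows "2 * A \<le> 2 * A0 + (2 * Z + - (X / h))"
  using assms by simp

lemma product_split:
  fixes y b h Q :: real
  assumes "b \<noteq> 0" "h \<noteq> 0"
  shows "y * Q + 1/2 = (y + b / h) * Q - b / h * (Q - h / (2 * b))"
  using assms by (simp add: field_simps)

context tunnel
begin

abbreviation "\<beta> \<equiv> T * g T"
text \<open>
  The quantities \<open>Q\<close> and \<open>N T\<close> of the previous section as functions of \<open>h\<close>.
\<close>

definition "QT h = P h T * integral {0..T} (\<lambda>t. 1 / P h t)"
definition "NT h = integral {0..T} (P h)"
definition "N0 h = sqrt (pi * h / \<kappa>) / 2"

lemma kappa_pos: "0 < \<kappa>" using g_ge[of 0] g0 gm by simp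

lemma beta_pos: "0 < \<beta>" using g_ge[of T] gm by simp

lemma P_pos: "0 < P h s" by (simp add: P_def)

lemma C2_pos: "1 \<le> C2" unfolding C2_def using K by simp

lemma Q_asymp: "\<exists>C. \<forall>\<^sub>F h in at_right 0. \<bar>QT h - h / (2 * \<beta>)\<bar> \<le> C * h\<^sup>2"
proof -
  obtain M hh where hh: "0 < hh" and M: "\<And>h. 0 < h \<Longrightarrow> h < hh \<Longrightarrow>
      \<bar>integral {0..T} (\<lambda>t. exp (2 * (Y h T - Y h t))) - h / (2 * \<beta>)\<bar> \<le> M * h\<^sup>2"
    by (rule laplace_end) (rule that)
  have "QT h = integral {0..T} (\<lambda>t. exp (2 * (Y h T - Y h t)))" for h
  proof -
    have "P h T * (1 / P h t) = exp (2 * (Y h T - Y h t))" for t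
      by (simp add: P_def exp_diff[symmetric] right_diff_distrib)
    then show ?thesis unfolding QT_def integral_mult_right[symmetric] by simp
  qed
  moreover have "\<forall>\<^sub>F h in at_right 0. 0 < h \<and> h < hh"
    using hh eventually_at_right_real by fastforce
  ultimately have "\<forall>\<^sub>F h in at_right 0. \<bar>QT h - h / (2 * \<beta>)\<bar> \<le> M * h\<^sup>2"
    using M by (auto elim!: eventually_mono)
  then show ?thesis by blast
qed

lemma N_asymp: "\<exists>C. \<forall>\<^sub>F h in at_right 0. \<bar>NT h - N0 h\<bar> \<le> C * (h * sqrt h)"
proof -
  obtain M hh where hh: "0 < hh" and M: "\<And>h. 0 < h \<Longrightarrow> h < hh \<Longrightarrow>
      \<bar>integral {0..T} (\<lambda>s. exp (2 * Y h s)) - sqrt (pi * h / \<kappa>) / 2\<bar> \<le> M * (h * sqrt h)"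
    by (rule laplace_origin) (rule that)
  have "\<forall>\<^sub>F h in at_right 0. 0 < h \<and> h < hh"
    using hh eventually_at_right_real by fastforce
  then have "\<forall>\<^sub>F h in at_right 0. \<bar>NT h - N0 h\<bar> \<le> M * (h * sqrt h)"
    using M by (auto elim!: eventually_mono simp: NT_def N0_def P_def[abs_def])
  then show ?thesis by blast
qed

text \<open>
  The decay is exponential; the third power is the one needed to compensate the factor \<open>y h T\<close> of order
  \<open>1 / h\<close> and still leave order \<open>h\<^sup>2\<close>.
\<close>

lemma P_end_small:
  obtains C where "\<And>h. 0 < h \<Longrightarrow> h \<le> 1 \<Longrightarrow> P h T \<le> C * h ^ 3"
proof -
  define C where "C = exp (2 * K * T\<^sup>2) * (3 / (gm * T\<^sup>2)) ^ 3"
  have "P h T \<le> C * h ^ 3" if h: "0 < h" "h \<le> 1" for h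
  proof -
    have "Y h T - Y h 0 \<le> - gm * (T\<^sup>2 - 0\<^sup>2) / (2 * h) + K * (T\<^sup>2 - 0\<^sup>2)"
      by (rule Y_bracket(2)[OF h]) auto
    then have "Y h T - 0 \<le> - (gm * T\<^sup>2) / (2 * h) + K * T\<^sup>2" by (simp add: zero_values)
    from double_half_quotient[OF this] have "2 * Y h T \<le> 2 * K * T\<^sup>2 + - (gm * T\<^sup>2 / h)" by (simp only: mult.assoc mult_zero_right add_0_left)
    then have "P h T \<le> exp (2 * K * T\<^sup>2) * exp (- (gm * T\<^sup>2 / h))"
      unfolding P_def exp_add[symmetric] by (simp only: exp_le_cancel_iff)
    also have "\<dots> \<le> exp (2 * K * T\<^sup>2) * (3 / (gm * T\<^sup>2 / h)) ^ 3"
      by (intro mult_left_mono exp_minus_le_power(2)) (use gm h in auto)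
    also have "3 / (gm * T\<^sup>2 / h) = 3 / (gm * T\<^sup>2) * h" by simp
    finally show ?thesis unfolding C_def power_mult_distrib by (simp add: mult.assoc)
  qed
  then show ?thesis by (rule that)
qed

lemma y_end: "0 < h \<Longrightarrow> h \<le> 1 \<Longrightarrow> \<bar>y h T + \<beta> / h\<bar> \<le> 2 * K * T"
proof -
  assume h: "0 < h" "h \<le> 1"
  have TT: "T \<in> {0..T}" by simp
  have "y h T + \<beta> / h = T * (n T + h * p T)" by (simp add: y_def algebra_simps)
  moreover have "\<bar>h * p T\<bar> \<le> 1 * K" unfolding abs_mult using h p_le[OF TT] by (intro mult_mono) auto
  then have "\<bar>n T + h * p T\<bar> \<le> 2 * K" using n_le[OF TT] by linarith
  then have "\<bar>T * (n T + h * p T)\<bar> \<le> T * (2 * K)" unfolding abs_mult by (intro mult_mono) auto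
  ultimately show ?thesis by (simp add: mult_ac)
qed

text \<open>
  Since \<open>y h T\<close> is \<open>- \<beta> / h\<close> up to a bounded error, its product with \<open>h / (2 * \<beta>)\<close> tends to \<open>- 1/2\<close>.
\<close>

lemma yQ_asymp: "\<exists>C. \<forall>\<^sub>F h in at_right 0. \<bar>y h T * QT h + 1/2\<bar> \<le> C * h \<and> \<bar>QT h - h / (2 * \<beta>)\<bar> \<le> C * h\<^sup>2"
proof -
  obtain C where C: "\<forall>\<^sub>F h in at_right 0. \<bar>QT h - h / (2 * \<beta>)\<bar> \<le> C * h\<^sup>2" using Q_asymp by blast
  define Ca where "Ca = \<bar>C\<bar>"
  define C' where "C' = \<beta> * Ca + 2 * K * T * (1 / (2 * \<beta>) + Ca) + Ca"
  have "\<forall>\<^sub>F h in at_right 0. 0 < h \<and> h < (1::real)" using eventually_at_right_real[of 0 1] by simp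
  with C have "\<forall>\<^sub>F h in at_right 0. \<bar>y h T * QT h + 1/2\<bar> \<le> C' * h \<and> \<bar>QT h - h / (2 * \<beta>)\<bar> \<le> C' * h\<^sup>2"
  proof eventually_elim
    case (elim h)
    then have h: "0 < h" "h \<le> 1" by auto
    have hh: "h\<^sup>2 \<le> h" using h by (simp add: power2_eq_square mult_left_le)
    have q: "\<bar>QT h - h / (2 * \<beta>)\<bar> \<le> Ca * h\<^sup>2"
      using elim(1) mult_right_mono[OF abs_ge_self[of C], of "h\<^sup>2"] unfolding Ca_def by simp
    have e: "y h T * QT h + 1/2 = (y h T + \<beta> / h) * QT h - \<beta> / h * (QT h - h / (2 * \<beta>))"
      by (rule product_split) (use h beta_pos in linarith)+
    have "Ca * h\<^sup>2 \<le> Ca * h" using hh by (rule mult_left_mono) (simp add: Ca_def)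
    moreover have "0 \<le> h / (2 * \<beta>)" using beta_pos h by (intro divide_nonneg_pos) linarith+
    ultimately have "\<bar>QT h\<bar> \<le> h / (2 * \<beta>) + Ca * h" using q by linarith
    then have Qb: "\<bar>QT h\<bar> \<le> (1 / (2 * \<beta>) + Ca) * h" by (simp add: distrib_right)
    have "\<bar>(y h T + \<beta> / h) * QT h\<bar> \<le> (2 * K * T) * ((1 / (2 * \<beta>) + Ca) * h)"
      unfolding abs_mult using y_end[OF h] Qb K by (intro mult_mono) auto
    moreover have "\<bar>\<beta> / h * (QT h - h / (2 * \<beta>))\<bar> \<le> \<beta> / h * (Ca * h\<^sup>2)"
      unfolding abs_mult using q beta_pos h by (intro mult_mono) auto
    moreover have "\<beta> / h * (Ca * h\<^sup>2) = \<beta> * Ca * h" using h by (simp add: power2_eq_square)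
    ultimately have "\<bar>y h T * QT h + 1/2\<bar> \<le> \<beta> * Ca * h + (2 * K * T) * ((1 / (2 * \<beta>) + Ca) * h)"
      unfolding e by linarith
    also have "\<dots> = (\<beta> * Ca + 2 * K * T * (1 / (2 * \<beta>) + Ca)) * h" by (simp only: distrib_right mult.assoc)
    also have "\<dots> \<le> C' * h" unfolding C'_def using h by (intro mult_right_mono) (auto simp: Ca_def)
    finally have 1: "\<bar>y h T * QT h + 1/2\<bar> \<le> C' * h" .
    have "Ca \<le> C'" unfolding C'_def using beta_pos K by (simp add: Ca_def)
    then have "Ca * h\<^sup>2 \<le> C' * h\<^sup>2" by (rule mult_right_mono) simp
    with 1 q show ?case by linarith
  qed
  then show ?thesis by blast
qed

text \<open>
  The weight on \<open>[0, T / 2]\<close> is exponentially larger than on \<open>[3 * T / 4, T]\<close>, which makes the product of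
  the integrals of \<open>P\<close> and \<open>1 / P\<close> over these intervals large.
\<close>

lemma barrier_large:
  "\<exists>c>0. \<forall>h. 0 < h \<longrightarrow> h \<le> 1 \<longrightarrow>
     c / h \<le> h * integral {0..T/2} (P h) * (integral {0..T} (\<lambda>t. 1 / P h t) - integral {0..T/2} (\<lambda>t. 1 / P h t))"
proof -
  \<comment> \<open>This is \<open>(3 * T / 4)\<^sup>2 - (T / 2)\<^sup>2\<close>, the increment of \<open>s\<^sup>2\<close> in \<open>Y_bracket\<close> between these points.\<close>
  define L where "L = 5 * T\<^sup>2 / 16"
  define Cr where "Cr = exp (2 * K * L) * (2 / (gm * L))\<^sup>2"
  define c where "c = (T / 2) * (T / 4) / (C2\<^sup>2 * Cr)"
  have L: "0 < L" by (simp add: L_def)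
  have Cr: "0 < Cr" using gm L by (simp add: Cr_def)
  have c0: "0 < c" using Cr C2_pos by (simp add: c_def)
  have "c / h \<le> h * integral {0..T/2} (P h) * (integral {0..T} (\<lambda>t. 1 / P h t) - integral {0..T/2} (\<lambda>t. 1 / P h t))"
    if h: "0 < h" "h \<le> 1" for h
  proof -
    let ?p = "P h (T/2)" and ?r = "P h (3 * T / 4)"
    have p0: "0 < ?p" "0 < ?r" by (auto simp: P_pos)
    interpret W: weight T C2 "P h" by (rule weight_P[OF h])
    have cI: "continuous_on {0..T} (\<lambda>t. 1 / P h t)"
      by (intro continuous_on_divide continuous_on_const W.cP) (use P_pos[of h] in \<open>auto simp: less_le\<close>)
    have iP: "P h integrable_on {u..v}" and iI: "(\<lambda>t. 1 / P h t) integrable_on {u..v}" if "0 \<le> u" "v \<le> T" for u v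
      by (intro integrable_continuous_real continuous_on_subset[OF W.cP] continuous_on_subset[OF cI]; use that in auto)+
    have A: "(T / 2) * (?p / C2) \<le> integral {0..T/2} (P h)"
    proof -
      have "integral {0..T/2} (\<lambda>t. ?p / C2) \<le> integral {0..T/2} (P h)"
      proof (rule integral_le)
        show "(\<lambda>t. ?p / C2) integrable_on {0..T/2}" by (rule integrable_const_ivl)
        show "P h integrable_on {0..T/2}" by (rule iP) auto
        fix t assume t: "t \<in> {0..T/2}"
        have "?p \<le> C2 * P h t" by (rule W.decr) (use t in auto)
        then show "?p / C2 \<le> P h t" using C2_pos by (simp add: field_simps)
      qed
      then show ?thesis by simp
    qed
    have B: "(T / 4) * (1 / (C2 * ?r)) \<le> integral {0..T} (\<lambda>t. 1 / P h t) - integral {0..T/2} (\<lambda>t. 1 / P h t)"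
    proof -
      have s1: "integral {0..T/2} (\<lambda>t. 1 / P h t) + integral {T/2..T} (\<lambda>t. 1 / P h t) = integral {0..T} (\<lambda>t. 1 / P h t)"
        by (rule Henstock_Kurzweil_Integration.integral_combine) (auto intro: iI)
      have "integral {3*T/4..T} (\<lambda>t. 1 / (C2 * ?r)) \<le> integral {3*T/4..T} (\<lambda>t. 1 / P h t)"
      proof (rule integral_le)
        show "(\<lambda>t. 1 / (C2 * ?r)) integrable_on {3*T/4..T}" by (rule integrable_const_ivl)
        show "(\<lambda>t. 1 / P h t) integrable_on {3*T/4..T}" by (rule iI) auto
        fix t assume t: "t \<in> {3*T/4..T}"
        have "P h t \<le> C2 * ?r" by (rule W.decr) (use t in auto)
        then show "1 / (C2 * ?r) \<le> 1 / P h t" using P_pos[of h t] by (intro divide_left_mono) (auto intro: mult_pos_pos)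
      qed
      moreover have "integral {3*T/4..T} (\<lambda>t. 1 / P h t) \<le> integral {T/2..T} (\<lambda>t. 1 / P h t)"
        by (rule integral_subset_le) (auto intro: iI simp: P_pos less_imp_le)
      moreover have "integral {3*T/4..T} (\<lambda>t. 1 / (C2 * ?r)) = (T / 4) * (1 / (C2 * ?r))" by simp
      ultimately show ?thesis using s1 by linarith
    qed
    have ratio: "?r \<le> ?p * (Cr * h\<^sup>2)"
    proof -
      have L': "(3 * T / 4)\<^sup>2 - (T / 2)\<^sup>2 = L" by (simp add: L_def power2_eq_square)
      have "Y h (3 * T / 4) - Y h (T / 2) \<le> - gm * L / (2 * h) + K * L"
        unfolding L'[symmetric] by (rule Y_bracket(2)[OF h]) auto
      then have "Y h (3 * T / 4) - Y h (T / 2) \<le> - (gm * L) / (2 * h) + K * L" by (simp only: minus_mult_left)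
      from double_half_quotient[OF this]
      have "2 * Y h (3 * T / 4) \<le> 2 * Y h (T / 2) + (2 * K * L + - (gm * L / h))" by (simp only: mult.assoc)
      then have "?r \<le> ?p * (exp (2 * K * L) * exp (- (gm * L / h)))"
        unfolding P_def exp_add[symmetric] by (simp only: exp_le_cancel_iff)
      also have "\<dots> \<le> ?p * (exp (2 * K * L) * (2 / (gm * L / h))\<^sup>2)"
        by (intro mult_left_mono exp_minus_le_power(1)) (use gm h L P_pos[of h "T/2"] in \<open>auto simp: less_imp_le\<close>)
      also have "2 / (gm * L / h) = 2 / (gm * L) * h" by simp
      finally show ?thesis unfolding Cr_def power_mult_distrib by (simp add: mult.assoc)
    qed
    have "c / h = h * ((T / 2) * (?p / C2)) * ((T / 4) * (1 / (C2 * (?p * (Cr * h\<^sup>2)))))"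
      using h p0 Cr C2_pos unfolding c_def by (simp add: field_simps power2_eq_square)
    also have "\<dots> \<le> h * ((T / 2) * (?p / C2)) * ((T / 4) * (1 / (C2 * ?r)))"
    proof -
      have "1 / (C2 * (?p * (Cr * h\<^sup>2))) \<le> 1 / (C2 * ?r)"
        using ratio C2_pos p0 Cr h by (intro divide_left_mono mult_left_mono mult_pos_pos) auto
      then show ?thesis using h p0 C2_pos by (intro mult_left_mono) auto
    qed
    also have "\<dots> \<le> h * integral {0..T/2} (P h) * (integral {0..T} (\<lambda>t. 1 / P h t) - integral {0..T/2} (\<lambda>t. 1 / P h t))"
    proof (rule mult_mono)
      show "h * ((T / 2) * (?p / C2)) \<le> h * integral {0..T/2} (P h)" using A h by (intro mult_left_mono) auto
      show "0 \<le> h * integral {0..T/2} (P h)" using A h p0 C2_pos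
        by (intro mult_nonneg_nonneg order_trans[OF _ A]) auto
    qed (use B p0 C2_pos in auto)
    finally show ?thesis .
  qed
  then show ?thesis using c0 by blast
qed

end

section \<open>Asymptotics of the gap\<close>

lemma first_ratio:
  fixes b1 q t C h :: real
  assumes "\<bar>b1 - (1 + q)\<bar> \<le> 4 * (t * h)" "\<bar>q + 1/2\<bar> \<le> C * h"
  shows "\<bar>2 * b1 - 1\<bar> \<le> (8 * t + 2 * C) * h"
  unfolding distrib_right mult.assoc using assms by linarith

lemma second_ratio:
  fixes b2 Q t C h \<beta> :: real
  assumes "\<bar>b2 - Q\<bar> \<le> 2 * (t * h) * Q" "\<bar>Q - h / (2 * \<beta>)\<bar> \<le> C * h\<^sup>2" "0 < h" "h \<le> 1" "0 < \<beta>" "0 \<le> t" "0 \<le> C"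
  shows "\<bar>b2 * (2 * \<beta> / h) - 1\<bar> \<le> 2 * \<beta> * (2 * t * (1 / (2 * \<beta>) + C) + C) * h"
proof -
  have "C * h\<^sup>2 \<le> C * h" using assms by (intro mult_left_mono) (auto simp: power2_eq_square mult_left_le)
  then have "Q \<le> 1 / (2 * \<beta>) * h + C * h" using assms(2) by simp
  then have Q: "Q \<le> (1 / (2 * \<beta>) + C) * h" by (simp only: distrib_right)
  have "2 * (t * h) * Q \<le> 2 * (t * h) * ((1 / (2 * \<beta>) + C) * h)"
    using Q by (rule mult_left_mono) (use assms in auto)
  then have "\<bar>b2 - h / (2 * \<beta>)\<bar> \<le> 2 * (t * h) * ((1 / (2 * \<beta>) + C) * h) + C * h\<^sup>2"
    using assms(1,2) by linarith
  also have "\<dots> = (2 * t * (1 / (2 * \<beta>) + C) + C) * h * h" by (simp add: algebra_simps power2_eq_square)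
  finally have *: "\<bar>b2 - h / (2 * \<beta>)\<bar> \<le> (2 * t * (1 / (2 * \<beta>) + C) + C) * h * h" .
  have "\<bar>b2 * (2 * \<beta> / h) - 1\<bar> = (2 * \<beta> / h) * \<bar>b2 - h / (2 * \<beta>)\<bar>"
  proof -
    have "b2 * (2 * \<beta> / h) - 1 = (2 * \<beta> / h) * (b2 - h / (2 * \<beta>))"
      using assms by (simp add: field_simps)
    then show ?thesis using assms by (simp only: abs_mult) simp
  qed
  also have "\<dots> \<le> (2 * \<beta> / h) * ((2 * t * (1 / (2 * \<beta>) + C) + C) * h * h)"
    using * by (rule mult_left_mono) (use assms in auto)
  also have "\<dots> = 2 * \<beta> * (2 * t * (1 / (2 * \<beta>) + C) + C) * h" using assms by simp
  finally show ?thesis .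
qed

lemma barrier_product_bound:
  fixes p C h y \<beta> m :: real
  assumes "0 \<le> p" "p \<le> C * h ^ 3" "y \<le> \<beta> / h + m" "0 < h" "h \<le> 1" "0 \<le> C" "0 \<le> m" "0 < \<beta>"
  shows "p * y \<le> C * (\<beta> + m) * h\<^sup>2"
proof -
  have "p * y \<le> p * (\<beta> / h + m)" using assms by (intro mult_left_mono) auto
  also have "\<dots> \<le> C * h ^ 3 * (\<beta> / h + m)" using assms by (intro mult_right_mono) auto
  also have "\<dots> = C * \<beta> * h\<^sup>2 + C * m * h\<^sup>2 * h" using assms by (simp add: field_simps power2_eq_square power3_eq_cube)
  also have "\<dots> \<le> C * \<beta> * h\<^sup>2 + C * m * h\<^sup>2 * 1" using assms by (intro add_left_mono mult_left_mono) auto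
  finally show ?thesis by (simp add: algebra_simps)
qed

lemma perturbation_chain:
  fixes J N r :: real
  assumes "\<bar>J - N\<bar> \<le> 13 * (a + b) + d" "\<bar>N - r\<bar> \<le> e" "a \<le> a'" "b \<le> b'" "d \<le> d'"
  shows "\<bar>J - r\<bar> \<le> 13 * (a' + b') + d' + e"
proof -
  have "13 * (a + b) + d \<le> 13 * (a' + b') + d'"
    using assms(3-5) by (intro add_mono mult_left_mono) auto
  then show ?thesis using assms(1,2) by arith
qed

text \<open>
  The terms with the factor \<open>p\<close> have order \<open>h\<^sup>2\<close>, the others order \<open>h * sqrt h\<close>, to be compared with the
  main term of order \<open>sqrt h\<close>.
\<close>

lemma third_ratio:
  fixes J N z A t C h p Q y c0 \<beta> m :: real
  defines "Z \<equiv> 8 * \<beta> * C + 4 * (C * (\<beta> + m))"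
  defines "M \<equiv> 13 * (Z * A + 12 * t * (c0 + C)) + 64 * A * (4 * \<beta> * C) + C"
  assumes J: "\<bar>J - N\<bar> \<le> 13 * (p * (2 / Q + 4 * y) * A + 12 * (t * h) * N) + 64 * A * p / Q"
    and N: "\<bar>N - c0 * sqrt h\<bar> \<le> C * (h * sqrt h)" and p: "0 \<le> p" "p \<le> C * h ^ 3"
    and Q: "h / (4 * \<beta>) \<le> Q" and y: "y \<le> \<beta> / h + m"
    and h: "0 < h" "h \<le> 1" and nn: "0 \<le> C" "0 \<le> A" "0 \<le> t" "0 \<le> m" "0 < \<beta>" "0 < c0"
  shows "\<bar>J / (c0 * sqrt h) - 1\<bar> \<le> M / c0 * h"
proof -
  let ?s = "sqrt h"
  have s: "0 < ?s" "?s \<le> 1" "?s * ?s = h" using h by auto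
  have hs: "h * ?s \<le> ?s" using h s by (simp add: mult_left_le_one_le)
  have h2: "h\<^sup>2 \<le> h * ?s"
  proof -
    have "h \<le> ?s" using mult_left_le[OF s(2), of ?s] s by simp
    then show ?thesis unfolding power2_eq_square using h by (intro mult_left_mono) auto
  qed
  have Q0: "0 < Q" using Q h nn by (intro order_less_le_trans[OF _ Q]) simp
  have pQ: "p / Q \<le> 4 * \<beta> * C * h\<^sup>2"
  proof -
    have "p / Q \<le> C * h ^ 3 / (h / (4 * \<beta>))" using p Q h nn by (intro frac_le) auto
    also have "\<dots> = 4 * \<beta> * C * h\<^sup>2" using h nn by (simp add: power2_eq_square power3_eq_cube)
    finally show ?thesis .
  qed
  have py: "p * y \<le> C * (\<beta> + m) * h\<^sup>2" by (rule barrier_product_bound[OF p y h]) (use nn in auto)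
  have "p * (2 / Q + 4 * y) = 2 * (p / Q) + 4 * (p * y)" by (simp add: algebra_simps)
  also have "\<dots> \<le> 2 * (4 * \<beta> * C * h\<^sup>2) + 4 * (C * (\<beta> + m) * h\<^sup>2)" using pQ py by linarith
  also have "\<dots> = Z * h\<^sup>2" by (simp add: Z_def algebra_simps)
  finally have z: "p * (2 / Q + 4 * y) \<le> Z * h\<^sup>2" .
  have Z0: "0 \<le> Z" using nn by (simp add: Z_def)
  have zA: "p * (2 / Q + 4 * y) * A \<le> Z * A * (h * ?s)"
  proof -
    have "Z * h\<^sup>2 \<le> Z * (h * ?s)" by (rule mult_left_mono[OF h2 Z0])
    then have "p * (2 / Q + 4 * y) * A \<le> Z * (h * ?s) * A" using z nn by (intro mult_right_mono) auto
    then show ?thesis by (simp only: mult_ac)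
  qed
  have "C * (h * ?s) \<le> C * ?s" using hs nn by (intro mult_left_mono) auto
  then have "N \<le> (c0 + C) * ?s" using N by (simp add: distrib_right)
  then have "12 * (t * h) * N \<le> 12 * (t * h) * ((c0 + C) * ?s)" by (rule mult_left_mono) (use nn h in auto)
  then have tN: "12 * (t * h) * N \<le> 12 * t * (c0 + C) * (h * ?s)" by (simp only: mult_ac)
  have "64 * A * (p / Q) \<le> 64 * A * (4 * \<beta> * C * (h * ?s))"
    using order_trans[OF pQ mult_left_mono[OF h2, of "4 * \<beta> * C"]] nn by (intro mult_left_mono) auto
  then have AQ: "64 * A * p / Q \<le> 64 * A * (4 * \<beta> * C) * (h * ?s)" by (simp only: mult.assoc times_divide_eq_right)
  have *: "\<bar>J - c0 * ?s\<bar> \<le> M * (h * ?s)"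
  proof -
    have "\<bar>J - c0 * ?s\<bar> \<le> 13 * (Z * A * (h * ?s) + 12 * t * (c0 + C) * (h * ?s)) + 64 * A * (4 * \<beta> * C) * (h * ?s) + C * (h * ?s)"
      by (rule perturbation_chain[OF J N zA tN AQ])
    also have "\<dots> = M * (h * ?s)" unfolding M_def by (simp only: distrib_right distrib_left mult.assoc)
    finally show ?thesis .
  qed
  have cs: "0 < c0 * ?s" using nn s by simp
  have "J / r - 1 = (J - r) / r" if "r \<noteq> 0" for r using that by (simp add: field_simps)
  then have "\<bar>J / (c0 * ?s) - 1\<bar> = \<bar>J - c0 * ?s\<bar> / (c0 * ?s)"
    using cs by (simp only: abs_divide abs_of_pos less_irrefl not_False_eq_True order_less_imp_not_eq2)
  also have "\<dots> \<le> M * (h * ?s) / (c0 * ?s)" using * cs by (intro divide_right_mono) auto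
  also have "\<dots> = M / c0 * h" using s by simp
  finally show ?thesis .
qed

context tunnel
begin

definition "c0 = sqrt (pi / \<kappa>) / 2"
definition "t0 = C3 * C2 * T\<^sup>2"

lemma c0_pos: "0 < c0" unfolding c0_def using kappa_pos by simp

lemma N0_eq: "0 \<le> h \<Longrightarrow> N0 h = c0 * sqrt h"
  by (simp add: N0_def c0_def real_sqrt_mult real_sqrt_divide)

lemma t0_nonneg: "0 \<le> t0" unfolding t0_def C3_def using C1_nonneg C2_pos by simp

lemma laplace_data:
  obtains C where "0 \<le> C" "\<forall>\<^sub>F h in at_right 0. 0 < h \<and> h \<le> 1 \<and> \<bar>y h T * QT h + 1/2\<bar> \<le> C * h \<and>
    \<bar>QT h - h / (2 * \<beta>)\<bar> \<le> C * h\<^sup>2 \<and> \<bar>NT h - c0 * sqrt h\<bar> \<le> C * (h * sqrt h) \<and> P h T \<le> C * h ^ 3"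
proof -
  obtain Ca where Ca: "\<forall>\<^sub>F h in at_right 0. \<bar>y h T * QT h + 1/2\<bar> \<le> Ca * h \<and> \<bar>QT h - h / (2 * \<beta>)\<bar> \<le> Ca * h\<^sup>2"
    using yQ_asymp by blast
  obtain Cb where Cb: "\<forall>\<^sub>F h in at_right 0. \<bar>NT h - N0 h\<bar> \<le> Cb * (h * sqrt h)" using N_asymp by blast
  obtain Cc where Cc: "\<And>h. 0 < h \<Longrightarrow> h \<le> 1 \<Longrightarrow> P h T \<le> Cc * h ^ 3" by (rule P_end_small) (rule that)
  define C where "C = \<bar>Ca\<bar> + \<bar>Cb\<bar> + \<bar>Cc\<bar>"
  have C: "0 \<le> C" "Ca \<le> C" "Cb \<le> C" "Cc \<le> C" unfolding C_def by linarith+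
  have "\<forall>\<^sub>F h in at_right 0. 0 < h \<and> h < (1::real)" using eventually_at_right_real[of 0 1] by simp
  with Ca Cb have "\<forall>\<^sub>F h in at_right 0. 0 < h \<and> h \<le> 1 \<and> \<bar>y h T * QT h + 1/2\<bar> \<le> C * h \<and>
    \<bar>QT h - h / (2 * \<beta>)\<bar> \<le> C * h\<^sup>2 \<and> \<bar>NT h - c0 * sqrt h\<bar> \<le> C * (h * sqrt h) \<and> P h T \<le> C * h ^ 3"
  proof eventually_elim
    case (elim h)
    then have h: "0 < h" "h \<le> 1" by auto
    have "Ca * h \<le> C * h" "Ca * h\<^sup>2 \<le> C * h\<^sup>2" "Cb * (h * sqrt h) \<le> C * (h * sqrt h)" "Cc * h ^ 3 \<le> C * h ^ 3"
      by (intro mult_right_mono C; use h in simp)+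
    moreover have "\<bar>NT h - c0 * sqrt h\<bar> \<le> Cb * (h * sqrt h)" using elim(2) N0_eq[of h] h by simp
    ultimately show ?case using elim(1) h Cc[OF h] by linarith
  qed
  with C(1) show ?thesis by (rule that)
qed

text \<open>
  Each smallness condition compares powers of \<open>h\<close> with the limits in \<open>laplace_data\<close>; the last one is
  \<open>barrier_large\<close>.
\<close>

lemma eventually_tunnel_small: "\<forall>\<^sub>F h in at_right 0. tunnel_small K gm \<kappa> g n p V g' n' p' C1 h"
proof -
  obtain C where C: "0 \<le> C" and data: "\<forall>\<^sub>F h in at_right 0. 0 < h \<and> h \<le> 1 \<and> \<bar>y h T * QT h + 1/2\<bar> \<le> C * h \<and>
    \<bar>QT h - h / (2 * \<beta>)\<bar> \<le> C * h\<^sup>2 \<and> \<bar>NT h - c0 * sqrt h\<bar> \<le> C * (h * sqrt h) \<and> P h T \<le> C * h ^ 3"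
    by (rule laplace_data)
  obtain c where c: "0 < c" and barrier: "\<And>h. 0 < h \<Longrightarrow> h \<le> 1 \<Longrightarrow>
     c / h \<le> h * integral {0..T/2} (P h) * (integral {0..T} (\<lambda>t. 1 / P h t) - integral {0..T/2} (\<lambda>t. 1 / P h t))"
    using barrier_large by blast
  have ev: "\<forall>\<^sub>F h in at_right 0. t0 * h < 1/32" "\<forall>\<^sub>F h in at_right 0. C * h < 1/16"
    "\<forall>\<^sub>F h in at_right 0. C * h < c0 / 2" "\<forall>\<^sub>F h in at_right 0. 1 * h < c"
    "\<forall>\<^sub>F h in at_right 0. C * (\<beta> + 2 * K * T) * sqrt h < c0 / 8"
    using c0_pos c by (intro eventually_scaled_less; simp)+
  from data ev show ?thesis
  proof eventually_elim
    case (elim h)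
    then have h: "0 < h" "h \<le> 1" by auto
    interpret H: tunnel_h K gm \<kappa> g n p V g' n' p' C1 h by unfold_locales (rule h)+
    have G: "H.W.G T = integral {0..T} (\<lambda>t. 1 / P h t)" "H.W.N T = NT h"
      "H.W.N (T/2) = integral {0..T/2} (P h)" "H.W.G (T/2) = integral {0..T/2} (\<lambda>t. 1 / P h t)"
      by (simp_all only: H.W.G_def H.W.N_def NT_def)
    have QH: "H.Q = QT h" by (simp only: H.Q_def G QT_def)
    show ?case
    proof
      show "H.\<theta> \<le> 1/32" using elim(2) unfolding H.\<theta>_def t0_def by (simp add: mult_ac)
      have "\<bar>H.yT * H.Q\<bar> \<le> 9/16" unfolding H.yT_def QH using elim(1,3) by linarith
      then show "\<bar>H.yT\<bar> * H.Q \<le> 9/16" using H.W.G_nonneg[of T] P_pos[of h T]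
        by (simp add: abs_mult H.Q_def)
      have y: "\<bar>H.yT\<bar> \<le> \<beta> / h + 2 * K * T"
      proof -
        have "0 < \<beta> / h" by (rule divide_pos_pos[OF beta_pos h(1)])
        then show ?thesis using y_end[OF h] unfolding H.yT_def by linarith
      qed
      have "P h T * \<bar>H.yT\<bar> \<le> C * (\<beta> + 2 * K * T) * h\<^sup>2"
        by (rule barrier_product_bound[OF _ _ y h C _ beta_pos]) (use elim(1) P_pos[of h T] K in auto)
      also have "\<dots> = C * (\<beta> + 2 * K * T) * sqrt h * (h * sqrt h)"
        using h by (simp add: power2_eq_square)
      also have "\<dots> < c0 / 8 * (h * sqrt h)" using elim(6) h by (intro mult_strict_right_mono) auto
      finally have 1: "P h T * \<bar>H.yT\<bar> < c0 / 8 * (h * sqrt h)" .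
      have "C * h * sqrt h \<le> c0 / 2 * sqrt h" using elim(4) h by (intro mult_right_mono) auto
      moreover have "\<bar>NT h - c0 * sqrt h\<bar> \<le> C * h * sqrt h" using elim(1) by (simp only: mult.assoc)
      moreover have "c0 * sqrt h = c0 / 2 * sqrt h + c0 / 2 * sqrt h" by simp
      ultimately have "c0 / 2 * sqrt h \<le> NT h" by linarith
      then have "h * (c0 / 2 * sqrt h) \<le> h * NT h" using h by (intro mult_left_mono) auto
      then show "\<bar>H.yT\<bar> * P h T < h * H.W.N T / 4" using 1 unfolding G by (simp add: mult_ac)
      have "1 < c / h" using elim(5) h by simp
      also note barrier[OF h]
      finally show "1 < h * H.W.N (T / 2) * (H.W.G T - H.W.G (T / 2))" unfolding G .
    qed
  qed
qed

lemma P_end_eq: "P h T = exp (- (2 * \<Phi> T) / h) * exp (2 * B T) * exp (2 * h * D T)"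
  unfolding P_def Y_def exp_add[symmetric] by (simp add: algebra_simps)

lemma prefactor_eq: "0 < h \<Longrightarrow> 4 * \<beta> * h / (c0 * sqrt h) = 8 * \<beta> * sqrt h * sqrt (\<kappa> / pi)"
proof -
  assume h: "0 < h"
  have "sqrt (\<kappa> / pi) * sqrt (pi / \<kappa>) = 1" unfolding real_sqrt_mult[symmetric] using kappa_pos by simp
  then have "8 * \<beta> * sqrt h * sqrt (\<kappa> / pi) * (c0 * sqrt h) = 4 * \<beta> * (sqrt h * sqrt h)" unfolding c0_def by algebra
  also have "sqrt h * sqrt h = h" using h by simp
  finally have "8 * \<beta> * sqrt h * sqrt (\<kappa> / pi) * (c0 * sqrt h) = 4 * \<beta> * h" .
  moreover have "c0 * sqrt h \<noteq> 0" using c0_pos h by simp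
  ultimately show ?thesis using nonzero_divide_eq_eq by metis
qed

text \<open>
  Each factor of \<open>gap_estimate\<close>, divided by its limiting value \<open>1/2\<close>, \<open>h / (2 * \<beta>)\<close> or
  \<open>c0 * sqrt h\<close>, is \<open>1\<close> up to an error of order \<open>h\<close>, and so is the part \<open>exp (2 * h * D T)\<close> of the weight.
  The limiting values combine to the prefactor by \<open>prefactor_eq\<close>.
\<close>

theorem gap_asymptotics:
  fixes \<xi> :: real
  shows "(\<lambda>h. (magnetic_eigenvalue V \<xi> 2 h - magnetic_eigenvalue V \<xi> 1 h)
      - 8 * h powr (1/2) * exp (2 * B T) * \<beta> * sqrt (\<kappa> / pi) * \<bar>cos (\<xi> * pi / h)\<bar> * exp (- (2 * \<Phi> T) / h))
    \<in> O[at_right 0](\<lambda>h. h powr (3/2) * exp (- (2 * \<Phi> T) / h))"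
proof -
  obtain C where C: "0 \<le> C" and data: "\<forall>\<^sub>F h in at_right 0. 0 < h \<and> h \<le> 1 \<and> \<bar>y h T * QT h + 1/2\<bar> \<le> C * h \<and>
    \<bar>QT h - h / (2 * \<beta>)\<bar> \<le> C * h\<^sup>2 \<and> \<bar>NT h - c0 * sqrt h\<bar> \<le> C * (h * sqrt h) \<and> P h T \<le> C * h ^ 3"
    by (rule laplace_data)
  define m where "m = 2 * K * T"
  define A where "A = C2 * T\<^sup>2"
  define E1 where "E1 = 8 * t0 + 2 * C"
  define E2 where "E2 = 2 * \<beta> * (2 * t0 * (1 / (2 * \<beta>) + C) + C)"
  define E3 where "E3 = (13 * ((8 * \<beta> * C + 4 * (C * (\<beta> + m))) * A + 12 * t0 * (c0 + C)) + 64 * A * (4 * \<beta> * C) + C) / c0"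
  define E where "E = \<bar>E1\<bar> + \<bar>E2\<bar> + \<bar>E3\<bar>"
  define Dm where "Dm = 2 * \<bar>D T\<bar>"
  define M where "M = 2 * (Dm * exp Dm) + 8 * E"
  define L where "L = 8 * \<beta> * sqrt (\<kappa> / pi) * exp (2 * B T)"
  have nn: "0 \<le> A" "0 \<le> m" unfolding A_def m_def using C2_pos K by auto
  have E_ge: "E1 \<le> E" "E2 \<le> E" "E3 \<le> E" unfolding E_def by linarith+
  have L0: "0 \<le> L" unfolding L_def
    by (rule mult_nonneg_nonneg, rule mult_nonneg_nonneg) (use beta_pos kappa_pos in linarith, use kappa_pos in simp, simp)
  have ev: "\<forall>\<^sub>F h in at_right 0. E * h < 1/8" "\<forall>\<^sub>F h in at_right 0. C * h < 1 / (4 * \<beta>)"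
    using beta_pos by (intro eventually_scaled_less divide_pos_pos; simp)+
  show ?thesis
  proof (rule bigoI[of _ "L * M"])
    from data ev eventually_tunnel_small
    show "\<forall>\<^sub>F h in at_right 0. norm ((magnetic_eigenvalue V \<xi> 2 h - magnetic_eigenvalue V \<xi> 1 h)
      - 8 * h powr (1/2) * exp (2 * B T) * \<beta> * sqrt (\<kappa> / pi) * \<bar>cos (\<xi> * pi / h)\<bar> * exp (- (2 * \<Phi> T) / h))
      \<le> L * M * norm (h powr (3/2) * exp (- (2 * \<Phi> T) / h))"
    proof eventually_elim
      case (elim h)
      then have h: "0 < h" "h \<le> 1" by auto
      interpret H: tunnel_small K gm \<kappa> g n p V g' n' p' C1 h by (rule elim)
      have QH: "H.Q = QT h" by (simp only: H.Q_def H.W.G_def QT_def)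
      have NH: "H.W.N T = NT h" by (simp only: H.W.N_def NT_def)
      have tH: "H.\<theta> = t0 * h" unfolding H.\<theta>_def t0_def by (simp only: mult_ac)
      define \<Delta> where "\<Delta> = magnetic_eigenvalue V \<xi> 2 h - magnetic_eigenvalue V \<xi> 1 h"
      define c where "c = \<bar>cos (\<xi> * pi / h)\<bar>"
      have c: "0 \<le> c" "c \<le> 1" unfolding c_def by auto
      obtain b1 b2 J where gap: "\<Delta> * (b1 * b2 * J) = h\<^sup>2 * c * P h T"
        and b1: "\<bar>b1 - (1 + y h T * QT h)\<bar> \<le> 4 * (t0 * h)" and b2: "\<bar>b2 - QT h\<bar> \<le> 2 * (t0 * h) * QT h"
        and J: "\<bar>J - NT h\<bar> \<le> 13 * (P h T * (2 / QT h + 4 * \<bar>y h T\<bar>) * A + 12 * (t0 * h) * NT h) + 64 * A * P h T / QT h"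
        using H.gap_estimate[of \<xi> thesis] unfolding H.\<zeta>_def H.yT_def QH NH tH \<Delta>_def c_def A_def
        by (simp only: mult.assoc)
      have q: "\<bar>QT h - h / (2 * \<beta>)\<bar> \<le> C * h\<^sup>2" using elim(1) by blast
      define r1 where "r1 = 2 * b1"
      define r2 where "r2 = b2 * (2 * \<beta> / h)"
      define r3 where "r3 = J / (c0 * sqrt h)"
      have R: "\<bar>r1 - 1\<bar> \<le> E * h" "\<bar>r2 - 1\<bar> \<le> E * h" "\<bar>r3 - 1\<bar> \<le> E * h"
      proof -
        have "\<bar>r1 - 1\<bar> \<le> E1 * h" unfolding r1_def E1_def
          by (rule first_ratio[OF b1]) (use elim(1) in blast)
        also have "\<dots> \<le> E * h" using E_ge h by (intro mult_right_mono) auto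
        finally show "\<bar>r1 - 1\<bar> \<le> E * h" .
        have "\<bar>r2 - 1\<bar> \<le> E2 * h" unfolding r2_def E2_def
          by (rule second_ratio[OF b2 q h beta_pos t0_nonneg C])
        also have "\<dots> \<le> E * h" using E_ge h by (intro mult_right_mono) auto
        finally show "\<bar>r2 - 1\<bar> \<le> E * h" .
        have Q: "h / (4 * \<beta>) \<le> QT h"
        proof -
          have "C * h\<^sup>2 \<le> 1 / (4 * \<beta>) * h" unfolding power2_eq_square mult.assoc[symmetric]
            using elim(3) h by (intro mult_right_mono) auto
          moreover have "h / (2 * \<beta>) = h / (4 * \<beta>) + 1 / (4 * \<beta>) * h" using beta_pos by (simp add: field_simps)
          ultimately show ?thesis using q by linarith
        qed
        have yb: "\<bar>y h T\<bar> \<le> \<beta> / h + m"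
        proof -
          have "0 < \<beta> / h" by (rule divide_pos_pos[OF beta_pos h(1)])
          then show ?thesis using y_end[OF h] unfolding m_def by linarith
        qed
        have "\<bar>r3 - 1\<bar> \<le> E3 * h" unfolding r3_def E3_def
          by (rule third_ratio[OF J _ _ _ Q yb h C nn(1) t0_nonneg nn(2) beta_pos c0_pos])
            (use elim(1) P_pos[of h T] in auto)
        also have "\<dots> \<le> E * h" using E_ge h by (intro mult_right_mono) auto
        finally show "\<bar>r3 - 1\<bar> \<le> E * h" .
      qed
      define r where "r = r1 * r2 * r3"
      have r: "r \<noteq> 0" "\<bar>1 / r - 1\<bar> \<le> 8 * (E * h)" "1 / r \<le> 2" "0 \<le> 1 / r"
        unfolding r_def using inverse_product_near_one[OF R] elim(2) by auto
      define e where "e = exp (2 * h * D T)"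
      have e: "\<bar>e - 1\<bar> \<le> (Dm * exp Dm) * h"
      proof -
        have d: "\<bar>2 * h * D T - 0\<bar> \<le> Dm * h" unfolding Dm_def using h by (simp add: abs_mult)
        have "Dm * h \<le> Dm" unfolding Dm_def using h by (intro mult_left_le) auto
        with d have "\<bar>exp (2 * h * D T) - exp 0\<bar> \<le> Dm * h * exp Dm"
          by (intro exp_difference_bound) (auto simp: Dm_def)
        then show ?thesis by (simp add: e_def mult_ac)
      qed
      have er: "\<bar>e / r - 1\<bar> \<le> M * h"
      proof -
        have "\<bar>(e - 1) * (1 / r)\<bar> \<le> (Dm * exp Dm) * h * 2" unfolding abs_mult
          using e r by (intro mult_mono) auto
        moreover have "e / r - 1 = (e - 1) * (1 / r) + (1 / r - 1)" by (simp add: diff_divide_distrib)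
        ultimately have "\<bar>e / r - 1\<bar> \<le> (Dm * exp Dm) * h * 2 + 8 * (E * h)" using r(2) by linarith
        also have "\<dots> = M * h" unfolding M_def by (simp add: algebra_simps)
        finally show ?thesis .
      qed
      define X where "X = exp (- (2 * \<Phi> T) / h)"
      have X0: "0 \<le> X" by (simp add: X_def)
      define F where "F = L * sqrt h * X"
      have F0: "0 \<le> F" unfolding F_def using L0 X0 h by (intro mult_nonneg_nonneg) auto
      have "\<Delta> = c * F * (e / r)"
      proof -
        have "r = 4 * \<beta> / (h * (c0 * sqrt h)) * (b1 * b2 * J)"
          unfolding r_def r1_def r2_def r3_def by simp
        then have "\<Delta> * r = 4 * \<beta> / (h * (c0 * sqrt h)) * (\<Delta> * (b1 * b2 * J))" by (simp only: mult_ac)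
        also have "\<dots> = c * (4 * \<beta> * h / (c0 * sqrt h)) * P h T"
          unfolding gap using h by (simp add: power2_eq_square)
        also have "\<dots> = c * F * e" unfolding prefactor_eq[OF h(1)] P_end_eq F_def L_def X_def e_def by (simp only: mult_ac)
        finally show ?thesis using r(1) by (simp add: eq_divide_eq)
      qed
      then have "\<Delta> - c * F = c * F * (e / r - 1)" by (simp only: right_diff_distrib mult_1_right)
      then have "\<bar>\<Delta> - c * F\<bar> = c * F * \<bar>e / r - 1\<bar>" using c F0 by (simp only: abs_mult abs_of_nonneg)
      also have "\<dots> \<le> 1 * F * (M * h)" using er c F0 by (intro mult_mono mult_nonneg_nonneg) auto
      finally have main: "\<bar>\<Delta> - c * F\<bar> \<le> L * M * (h * sqrt h * X)" unfolding F_def by (simp only: mult_ac mult_1_left)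
      have p1: "h powr (1/2) = sqrt h" using h by (simp add: powr_half_sqrt)
      have "h powr (1 + 1/2) = h powr 1 * h powr (1/2)" by (rule powr_add)
      then have p2: "h powr (3/2) = h * sqrt h" using h p1 by simp
      have "8 * sqrt h * exp (2 * B T) * \<beta> * sqrt (\<kappa> / pi) * c * X = c * F" unfolding F_def L_def by (simp only: mult_ac)
      moreover have "norm (h * sqrt h * X) = h * sqrt h * X" using X0 h by simp
      ultimately show ?case unfolding p1 p2 using main
        unfolding \<Delta>_def c_def[symmetric] X_def[symmetric] by (simp only: real_norm_def)
    qed
  qed
qed

end

section \<open>Double wells on the circle\<close>

lemma compact_interval_bound:
  fixes f :: "real \<Rightarrow> real"
  assumes "continuous_on {a..b} f"
  obtains C where "0 \<le> C" "\<And>s. s \<in> {a..b} \<Longrightarrow> \<bar>f s\<bar> \<le> C"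
proof -
  have "bounded (f ` {a..b})" using assms by (intro compact_imp_bounded compact_continuous_image) auto
  then obtain C where "\<forall>x\<in>f ` {a..b}. norm x \<le> C" unfolding bounded_iff by blast
  then show ?thesis by (intro that[of "\<bar>C\<bar>"]) force+
qed

lemma deriv_sqrt_square:
  fixes V g g' :: "real \<Rightarrow> real"
  assumes V: "\<And>x. x \<in> {0<..<b} \<Longrightarrow> V x = x\<^sup>2 * (g x)\<^sup>2" and g: "\<And>x. x \<in> {0<..<b} \<Longrightarrow> 0 < g x"
    and s: "s \<in> {0<..<b}" and D: "(g has_real_derivative g' s) (at s)"
  shows "deriv (\<lambda>x. sqrt (V x)) s = g s + s * g' s"
proof (rule DERIV_imp_deriv)
  have "((\<lambda>x. x * g x) has_real_derivative 1 * g s + g' s * s) (at s)"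
    by (rule DERIV_mult[OF DERIV_ident D])
  then have "((\<lambda>x. x * g x) has_real_derivative g s + s * g' s) (at s)" by (simp add: mult.commute)
  then show "((\<lambda>x. sqrt (V x)) has_real_derivative g s + s * g' s) (at s)"
  proof (rule has_field_derivative_transform_within_open)
    show "x * g x = sqrt (V x)" if "x \<in> {0<..<b}" for x
      using V[OF that] g[OF that] that by (simp add: power_mult_distrib[symmetric] real_sqrt_abs abs_mult)
  qed (use s in auto)
qed

lemma integral_pi_symmetric:
  fixes f :: "real \<Rightarrow> real"
  assumes sym: "\<And>s. f (pi - s) = f s" and f: "f integrable_on {0..pi}"
  shows "integral {0..pi} f = 2 * integral {0..pi/2} f"
proof -
  have "integral {0 - pi..pi/2 - pi} (\<lambda>x. f (x + pi)) = integral {0..pi/2} f" by (rule integral_shift_real_ivl)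
  moreover have "integral {- pi..- (pi/2)} (\<lambda>x. f (- x)) = integral {pi/2..pi} f"
    using Henstock_Kurzweil_Integration.integral_reflect_real[of pi "pi/2" f] .
  moreover have "f (x + pi) = f (- x)" for x using sym[of "- x"] by (simp add: add.commute)
  ultimately have "integral {pi/2..pi} f = integral {0..pi/2} f" by simp
  moreover have "integral {0..pi/2} f + integral {pi/2..pi} f = integral {0..pi} f"
    by (rule Henstock_Kurzweil_Integration.integral_combine) (use f in auto)
  ultimately show ?thesis by simp
qed

text \<open>
  The coefficients are smooth on \<open>(- pi, pi)\<close>, so all constants exist by compactness of \<open>[0, pi / 2]\<close>; the
  estimate at the midpoint is the mean value theorem for \<open>s * g s\<close>.
\<close>

lemma double_well_tunnel:
  fixes V :: "real \<Rightarrow> real" and \<kappa> :: real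
  assumes V: "double_well_potential V" and ev: "\<And>s. V (- s) = V s" and \<kappa>: "\<kappa> = sqrt (deriv (deriv V) 0 / 2)"
  obtains K gm g n p g' n' p' C1 where "tunnel K gm \<kappa> g n p V g' n' p' C1"
    "\<And>x. x \<in> {0<..<pi} \<Longrightarrow> V x = x\<^sup>2 * (g x)\<^sup>2" "\<And>x. x \<in> {0<..<pi} \<Longrightarrow> 0 < g x"
    "\<And>x. x \<in> {0<..<pi} \<Longrightarrow> (g has_real_derivative g' x) (at x)"
proof -
  obtain g g' m n n' p p' where
    D: "\<And>x. x \<in> {-pi<..<pi} \<Longrightarrow> (g has_real_derivative g' x) (at x)"
    "\<And>x. x \<in> {-pi<..<pi} \<Longrightarrow> (n has_real_derivative n' x) (at x)"
    "\<And>x. x \<in> {-pi<..<pi} \<Longrightarrow> (p has_real_derivative p' x) (at x)"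
    and cd: "continuous_on {-pi<..<pi} g'" "continuous_on {-pi<..<pi} p'" "continuous_on {-pi<..<pi} m"
    and Vg: "\<And>x. x \<in> {-pi<..<pi} \<Longrightarrow> V x = x\<^sup>2 * (g x)\<^sup>2"
    and g0: "\<And>x. x \<in> {-pi<..<pi} \<Longrightarrow> g x > 0"
    and gm: "\<And>x. x \<in> {-pi<..<pi} \<Longrightarrow> g x = \<kappa> + x\<^sup>2 * m x"
    and I: "\<And>x. x \<in> {-pi<..<pi} \<Longrightarrow> g x + x * g' x - \<kappa> = - 2 * x\<^sup>2 * g x * n x"
      "\<And>x. x \<in> {-pi<..<pi} \<Longrightarrow> n x + x * n' x + x\<^sup>2 * (n x)\<^sup>2 - n 0 = 2 * x\<^sup>2 * g x * p x"
    by (rule wkb_functions[OF V ev \<kappa>]) (rule that)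
  let ?I = "{0..pi/2}"
  have sub: "x \<in> {-pi<..<pi}" if "x \<in> ?I" for x using that pi_gt_zero by (simp only: atLeastAtMost_iff greaterThanLessThan_iff) linarith
  then have subs: "?I \<subseteq> {-pi<..<pi}" by blast
  note Dw = D[OF sub, THEN has_field_derivative_at_within, of _ ?I]
  have c: "continuous_on ?I g" "continuous_on ?I n" "continuous_on ?I p"
    by (rule DERIV_continuous_on[OF Dw(1)] DERIV_continuous_on[OF Dw(2)] DERIV_continuous_on[OF Dw(3)]; assumption)+
  note cd' = cd[THEN continuous_on_subset, OF subs]
  obtain s0 where s0: "s0 \<in> ?I" "\<And>s. s \<in> ?I \<Longrightarrow> g s0 \<le> g s"
    using continuous_attains_inf[of ?I g] c(1) by auto
  obtain Km where Km: "0 \<le> Km" "\<And>s. s \<in> ?I \<Longrightarrow> \<bar>m s\<bar> \<le> Km" by (rule compact_interval_bound[OF cd'(3)]) (rule that)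
  obtain Kn where Kn: "0 \<le> Kn" "\<And>s. s \<in> ?I \<Longrightarrow> \<bar>n s\<bar> \<le> Kn" by (rule compact_interval_bound[OF c(2)]) (rule that)
  obtain Kp where Kp: "0 \<le> Kp" "\<And>s. s \<in> ?I \<Longrightarrow> \<bar>p s\<bar> \<le> Kp" by (rule compact_interval_bound[OF c(3)]) (rule that)
  have "continuous_on ?I (\<lambda>s. g s + s * g' s)" by (intro continuous_intros c cd')
  then obtain Kd where Kd: "0 \<le> Kd" "\<And>s. s \<in> ?I \<Longrightarrow> \<bar>g s + s * g' s\<bar> \<le> Kd" by (rule compact_interval_bound) (rule that)
  have "continuous_on ?I (\<lambda>s. p s + s * p' s + 2 * s\<^sup>2 * n s * p s)" by (intro continuous_intros c cd')
  then obtain Ka where Ka: "\<And>s. s \<in> ?I \<Longrightarrow> \<bar>p s + s * p' s + 2 * s\<^sup>2 * n s * p s\<bar> \<le> Ka" by (rule compact_interval_bound) (rule that)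
  have "continuous_on ?I (\<lambda>s. s\<^sup>2 * (p s)\<^sup>2)" by (intro continuous_intros c)
  then obtain Kb where Kb: "\<And>s. s \<in> ?I \<Longrightarrow> \<bar>s\<^sup>2 * (p s)\<^sup>2\<bar> \<le> Kb" by (rule compact_interval_bound) (rule that)
  define K where "K = Km + Kn + Kp + Kd"
  have K: "Km \<le> K" "Kn \<le> K" "Kp \<le> K" "Kd \<le> K" "0 \<le> K" unfolding K_def using Km(1) Kn(1) Kp(1) Kd(1) by linarith+
  have "tunnel K (g s0) \<kappa> g n p V g' n' p' (Ka + Kb)"
  proof
    show "0 < pi / 2" "0 \<le> K" using K by auto
    show "0 < g s0" by (rule g0[OF sub[OF s0(1)]])
    show "continuous_on ?I g" "continuous_on ?I n" "continuous_on ?I p" by (rule c)+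
    show "g s0 \<le> g s" if "s \<in> ?I" for s by (rule s0(2)[OF that])
    show "g 0 = \<kappa>" using gm[of 0] by simp
    show "\<bar>g s - \<kappa>\<bar> \<le> K * s\<^sup>2" if s: "s \<in> ?I" for s
    proof -
      have "\<bar>m s\<bar> * s\<^sup>2 \<le> K * s\<^sup>2" using Km(2)[OF s] K(1) by (intro mult_right_mono) auto
      then show ?thesis using gm[OF sub[OF s]] by (simp add: abs_mult mult.commute)
    qed
    show "\<bar>s * g s - pi / 2 * g (pi / 2)\<bar> \<le> K * (pi / 2 - s)" if s: "s \<in> ?I" for s
    proof -
      have d: "((\<lambda>x. x * g x) has_real_derivative g x + x * g' x) (at x within ?I)" if "x \<in> ?I" for x
        using DERIV_mult[OF DERIV_ident Dw(1)[OF that]] by (simp add: mult.commute)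
      have "norm (s * g s - pi / 2 * g (pi / 2)) \<le> K * norm (s - pi / 2)"
        by (rule field_differentiable_bound[OF _ d]) (use s Kd(2) K(4) order_trans in \<open>auto simp: convex_real_interval\<close>)
      then show ?thesis using s by simp
    qed
    show "\<bar>n s\<bar> \<le> K" "\<bar>p s\<bar> \<le> K" if "s \<in> ?I" for s using Kn(2)[OF that] Kp(2)[OF that] K by linarith+
    have "smooth_real V" using V unfolding double_well_potential_def by blast
    then have "V differentiable (at x)" for x
      unfolding smooth_real_def by (metis funpow_0)
    then show "continuous_on UNIV V" by (simp add: continuous_at_imp_continuous_on differentiable_imp_continuous_within)
    show "V (- s) = V s" for s by (rule ev)
    show "V (s + pi) = V s" for s by (rule double_well_periodic_pi[OF V ev])
    fix s assume s: "s \<in> ?I"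
    show "(g has_real_derivative g' s) (at s within ?I)" "(n has_real_derivative n' s) (at s within ?I)"
      "(p has_real_derivative p' s) (at s within ?I)" by (rule Dw[OF s])+
    show "V s = s\<^sup>2 * (g s)\<^sup>2" by (rule Vg[OF sub[OF s]])
    show "g s + s * g' s - \<kappa> = - 2 * s\<^sup>2 * g s * n s" by (rule I(1)[OF sub[OF s]])
    show "n s + s * n' s + s\<^sup>2 * (n s)\<^sup>2 - n 0 = 2 * s\<^sup>2 * g s * p s" by (rule I(2)[OF sub[OF s]])
    show "\<bar>p s + s * p' s + 2 * s\<^sup>2 * n s * p s\<bar> + \<bar>s\<^sup>2 * (p s)\<^sup>2\<bar> \<le> Ka + Kb" by (rule add_mono[OF Ka[OF s] Kb[OF s]])
  qed
  moreover have "x \<in> {-pi<..<pi}" if "x \<in> {0<..<pi}" for x using that by auto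
  ultimately show ?thesis using D(1) Vg g0 by (intro that) blast+
qed

theorem theorem1p4:
  fixes V :: "real \<Rightarrow> real" and \<xi>\<^sub>0 \<kappa> S A :: real
  assumes "double_well_potential V"
    and even: "\<And>s. V (- s) = V s"
    and \<kappa>: "\<kappa> = sqrt (deriv (deriv V) 0 / 2)"
    and S: "S = integral {0..pi} (\<lambda>\<sigma>. sqrt (V \<sigma>))"
    and A: "A = exp (- integral {0..pi/2}
              (\<lambda>\<sigma>. (deriv (\<lambda>x. sqrt (V x)) \<sigma> - \<kappa>) / sqrt (V \<sigma>)))"
  shows "(\<lambda>h. (magnetic_eigenvalue V \<xi>\<^sub>0 2 h - magnetic_eigenvalue V \<xi>\<^sub>0 1 h)
            - 8 * h powr (1/2) * A * sqrt (V (pi/2)) * sqrt (\<kappa> / pi)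
                * \<bar>cos (\<xi>\<^sub>0 * pi / h)\<bar> * exp (- S / h))
         \<in> O[at_right 0](\<lambda>h. h powr (3/2) * exp (- S / h))"
proof -
  obtain K gm g n p g' n' p' C1 where tun: "tunnel K gm \<kappa> g n p V g' n' p' C1"
    and Vx: "\<And>x. x \<in> {0<..<pi} \<Longrightarrow> V x = x\<^sup>2 * (g x)\<^sup>2" and gx: "\<And>x. x \<in> {0<..<pi} \<Longrightarrow> 0 < g x"
    and Dx: "\<And>x. x \<in> {0<..<pi} \<Longrightarrow> (g has_real_derivative g' x) (at x)"
    by (rule double_well_tunnel[OF assms(1) even \<kappa>]) (rule that)
  interpret X: tunnel K gm \<kappa> g n p V g' n' p' C1 by (rule tun)
  have root: "sqrt (V s) = s * g s" if "s \<in> {0..pi/2}" for s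
  proof -
    have "0 \<le> g s" using X.g_ge[OF that] X.gm by linarith
    then show ?thesis using X.Vg[OF that] that by (simp add: power_mult_distrib[symmetric] real_sqrt_abs abs_mult)
  qed
  have V': "V (pi - s) = V s" for s using assms(1) unfolding double_well_potential_def by blast
  \<comment> \<open>The potential is symmetric about \<open>pi / 2\<close>.\<close>
  have S2: "S = 2 * X.\<Phi> (pi/2)"
  proof -
    have "(\<lambda>\<sigma>. sqrt (V \<sigma>)) integrable_on {0..pi}"
      by (intro integrable_continuous_real continuous_on_real_sqrt continuous_on_subset[OF X.cV]) auto
    then have "S = 2 * integral {0..pi/2} (\<lambda>\<sigma>. sqrt (V \<sigma>))"
      unfolding S by (intro integral_pi_symmetric) (simp_all only: V')
    also have "integral {0..pi/2} (\<lambda>\<sigma>. sqrt (V \<sigma>)) = X.\<Phi> (pi/2)"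
      unfolding X.\<Phi>_def by (rule Henstock_Kurzweil_Integration.integral_cong) (rule root)
    finally show ?thesis .
  qed
  \<comment> \<open>By the first transport equation the integrand is \<open>- 2 * \<sigma> * n \<sigma>\<close>, except at \<open>0\<close>, where
  \<open>sqrt V\<close> has a kink.\<close>
  have A2: "A = exp (2 * X.B (pi/2))"
  proof -
    have "integral {0..pi/2} (\<lambda>\<sigma>. (deriv (\<lambda>x. sqrt (V x)) \<sigma> - \<kappa>) / sqrt (V \<sigma>)) = integral {0..pi/2} (\<lambda>\<sigma>. (- 2) * (\<sigma> * n \<sigma>))"
    proof (rule integral_spike[of "{0}"])
      fix s assume s: "s \<in> {0..pi/2} - {0::real}"
      then have sI: "s \<in> {0..pi/2}" and s0: "s \<in> {0<..<pi}" by auto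
      have "deriv (\<lambda>x. sqrt (V x)) s - \<kappa> = g s + s * g' s - \<kappa>"
        by (simp only: deriv_sqrt_square[where b = pi and V = V and g = g and g' = g' and s = s, OF Vx gx s0 Dx[OF s0]])
      also have "\<dots> = - 2 * s\<^sup>2 * g s * n s" by (rule X.I1[OF sI])
      finally have "(deriv (\<lambda>x. sqrt (V x)) s - \<kappa>) / sqrt (V s) = - 2 * s\<^sup>2 * g s * n s / (s * g s)" by (simp only: root[OF sI])
      also have "\<dots> = (- 2) * (s * n s)" using gx[OF s0] s0 by (simp add: field_simps power2_eq_square)
      finally show "(- 2) * (s * n s) = (deriv (\<lambda>x. sqrt (V x)) s - \<kappa>) / sqrt (V s)" ..
    qed simp
    then show ?thesis unfolding A X.B_def integral_mult_right by simp
  qed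
  have "sqrt (V (pi/2)) = pi/2 * g (pi/2)" by (rule root) simp
  then show ?thesis unfolding S2 A2 using X.gap_asymptotics[of \<xi>\<^sub>0] by (simp only:)
qed

end
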